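(* Let $\mathbf m=(m_1,m_2,m_1',m_2',m_1'',m_2'')$ be positive integers such that the multiplicity $d=d_{\mathbf m}$ of $[m_1'',m_2'']$ in $[m_1,m_2]\otimes[m_1',m_2']$ is non-zero. Put $$\ell=\tfrac13(m_1+2m_2+m_1'+2m_2'-m_1''-2m_2''),\qquad n=\tfrac13(2m_1+m_2+2m_1'+m_2'-2m_1''-m_2''),$$ $$(\xi_1,\xi_2,\xi_3)=\begin{cases}(\ell,\ m_2,\ m_1'+\ell-n)&\text{if }\ell\le n,\\ (n,\ m_1',\ m_2+n-\ell)&\text{if }n\le \ell,\end{cases}\qquad (\xi_4,\xi_5,\xi_6)=(\ell-m_2',\ n-m_1,\ 0),$$ $$\Lambda=\sum_{i=1}^3\xi_i-\sum_{i=4}^6\xi_i+2|\ell-n|,\qquad \lambda_\pm=\pm\tfrac12\Lambda+\tfrac16\sum_{i=1}^6\xi_i,\qquad \xi_a=\min\{\xi_1,\xi_2,\xi_3\},\quad \xi_b=\max\{\xi_4,\xi_5,\xi_6\},$$ so that $d=\xi_a-\xi_b$. Then there is a basis of the multiplicity space $M_{\mathbf m}$ in which the operators $X_{\mathbf m}$ and $Y_{\mathbf m}$ are simultaneously given by the $d\times d$ tridiagonal matrices $(a_{ij})_{1\le i,j\le d}$ and $(b_{ij})_{1\le i,j\le d}$ respectively, whose off-diagonal non-zero entries are, for $1\le j\le d-1$, $$a_{j,j+1}=(j+\xi_b-\xi_1)(j+\xi_b-\xi_2)(j+\xi_b-\xi_3),\qquad b_{j,j+1}=a_{j,j+1}\,(j+\xi_b-\lambda_-),$$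 $$a_{j+1,j}=(j+\xi_b-\xi_4)(j+\xi_b-\xi_5)(j+\xi_b-\xi_6),\qquad b_{j+1,j}=a_{j+1,j}\,(j+\xi_b-\lambda_+),$$ and whose diagonal entries are, with $E_{j,k}=\sum_{i=1}^6\bigl(\xi_i-j-\xi_b+\tfrac12\bigr)^k$, for $1\le j\le d$, $$a_{jj}=-\tfrac1{108}\Bigl(\tfrac72E_{j,1}^3-18E_{j,1}E_{j,2}+18E_{j,3}\Bigr)-\tfrac1{24}E_{j,1}(\Lambda^2+2),$$ $$b_{jj}=\tfrac1{288}\Bigl(\tfrac52E_{j,1}^4+32E_{j,1}E_{j,3}+6\bigl(E_{j,2}^2-3E_{j,1}^2E_{j,2}-4E_{j,4}\bigr)+6E_{j,2}(\Lambda^2+2)-3E_{j,1}^2(\Lambda^2-2)-\tfrac32\Lambda^4+6\Lambda^2-36\Bigr).$$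
   Context: The complexified Lie algebra $\mathfrak{su}_3$ is generated by $e_{pq}$, $1\le p,q\le 3$, with $[e_{pq},e_{rs}]=\delta_{qr}e_{ps}-\delta_{sp}e_{rq}$ and $\sum_{i=1}^3e_{ii}=0$. Set $h_1=e_{11}-e_{22}$, $h_2=e_{22}-e_{33}$. For positive integers $m_1,m_2$, $[m_1,m_2]$ is the irreducible finite-dimensional representation with highest weight vector $v$ satisfying $h_pv=(m_p-1)v$ for $p=1,2$ and $e_{pq}v=0$ for $p<q$ (note the shift by one); such a $v$ is said to have weight $(m_1,m_2)$. The multiplicity $d_{\mathbf m}$ is the number of copies of $[m_1'',m_2'']$ in the decomposition of $[m_1,m_2]\otimes[m_1',m_2']$. The multiplicity space $M_{\mathbf m}$, of dimension $d_{\mathbf m}$, is the subspace of $[m_1,m_2]\otimes[m_1',m_2']$ consisting of the highest-weight vectors (for the diagonal action) of weight $(m_1'',m_2'')$. In $U(\mathfrak{su}_3)^{\otimes2}$ put $e^{(1)}_{pq}=e_{pq}\otimes1$, $e^{(2)}_{pq}=1\otimes e_{pq}$. Polarised traces, with sums from 1 to 3 over repeated indices understood, for $a_1,\dots,a_\mu\in\{1,2\}$: $$T^{(a_1,\dots,a_\mu)}=e^{(a_1)}_{i_2i_1}e^{(a_2)}_{i_3i_2}\cdots e^{(a_\mu)}_{i_1i_\mu},\qquad \overline T^{(a_1,\dots,a_\mu)}=e^{(a_1)}_{i_1i_2}e^{(a_2)}_{i_2i_3}\cdots e^{(a_\mu)}_{i_\mu i_1}.$$ Let $L=\tfrac12(e_{i_1i_2}e_{i_2i_3}e_{i_3i_1}+e_{i_2i_1}e_{i_3i_2}e_{i_1i_3})$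 (a Casimir element), $l_1=L\otimes1$, $l_2=1\otimes L$. Define $$X=\tfrac12\bigl(T^{(1,1,2)}-T^{(1,2,2)}\bigr)+\tfrac13(l_1-l_2),$$ $$Y=\tfrac12\bigl(T^{(1,1,2,2)}+\overline T^{(1,1,2,2)}\bigr)-\tfrac1{12}\bigl(T^{(1,2)}\bigr)^2-\tfrac5{12}T^{(1,1)}T^{(2,2)}-2T^{(1,2)}.$$ These elements commute with the diagonal action of $\mathfrak{su}_3$ (i.e. with all $e_{pq}^{(1)}+e_{pq}^{(2)}$), hence act on $M_{\mathbf m}$; the resulting operators are denoted $X_{\mathbf m}$ and $Y_{\mathbf m}$. *)

theory Defs
  imports "HOL-Analysis.Analysis"
begin

text \<open>
  Finite-dimensional representations of the complexified Lie algebra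
  \<open>\<ss>\<uu>\<^sub>3\<close> are given in coordinates, by the matrices of the
  generators \<open>e\<^sub>p\<^sub>q\<close>, \<open>1 \<le> p, q \<le> 3\<close>.  The indices are natural numbers; values of
  \<open>\<rho>\<close> outside \<open>{1..3}\<close> are irrelevant.  Products of operators are matrix products
  \<open>**\<close> (on this type \<open>*\<close> is the entrywise product), and \<open>*s\<close> is scaling by a
  complex number, so that \<open>vec.subspace\<close>, \<open>vec.span\<close> and \<open>vec.independent\<close> are
  over the complex numbers.
\<close>

type_synonym 'n rep = "nat \<Rightarrow> nat \<Rightarrow> complex ^ 'n ^ 'n"

definition sl3_rep :: "'n::finite rep \<Rightarrow> bool" where
  "sl3_rep \<rho> \<longleftrightarrow>
     (\<forall>p\<in>{1..3}. \<forall>q\<in>{1..3}. \<forall>r\<in>{1..3}. \<forall>s\<in>{1..3}.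
        \<rho> p q ** \<rho> r s - \<rho> r s ** \<rho> p q =
          (if q = r then \<rho> p s else 0) - (if s = p then \<rho> r q else 0)) \<and>
     (\<Sum>i\<in>{1..3}. \<rho> i i) = 0"

definition invariant_subspace :: "'n::finite rep \<Rightarrow> (complex ^ 'n) set \<Rightarrow> bool" where
  "invariant_subspace \<rho> U \<longleftrightarrow>
     vec.subspace U \<and> (\<forall>p\<in>{1..3}. \<forall>q\<in>{1..3}. \<forall>u\<in>U. \<rho> p q *v u \<in> U)"

definition irreducible_subrep :: "'n::finite rep \<Rightarrow> (complex ^ 'n) set \<Rightarrow> bool" where
  "irreducible_subrep \<rho> U \<longleftrightarrow>
     invariant_subspace \<rho> U \<and> U \<noteq> {0} \<and>
     (\<forall>W. invariant_subspace \<rho> W \<and> W \<subseteq> U \<longrightarrow> W = {0} \<or> W = U)"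

text \<open>Weights are shifted by one; the zero vector is included.\<close>

definition highest_weight_space :: "'n::finite rep \<Rightarrow> nat \<Rightarrow> nat \<Rightarrow> (complex ^ 'n) set" where
  "highest_weight_space \<rho> m\<^sub>1 m\<^sub>2 =
     {v. (\<rho> 1 1 - \<rho> 2 2) *v v = (of_nat m\<^sub>1 - 1) *s v \<and>
         (\<rho> 2 2 - \<rho> 3 3) *v v = (of_nat m\<^sub>2 - 1) *s v \<and>
         (\<forall>p\<in>{1..3}. \<forall>q\<in>{1..3}. p < q \<longrightarrow> \<rho> p q *v v = 0)}"

text \<open>The subrepresentation of \<open>\<rho>\<close> on \<open>U\<close> is a copy of \<open>[m\<^sub>1, m\<^sub>2]\<close>.\<close>

definition irrep_on :: "'n::finite rep \<Rightarrow> (complex ^ 'n) set \<Rightarrow> nat \<Rightarrow> nat \<Rightarrow> bool" where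
  "irrep_on \<rho> U m\<^sub>1 m\<^sub>2 \<longleftrightarrow>
     irreducible_subrep \<rho> U \<and> (\<exists>v\<in>U. v \<noteq> 0 \<and> v \<in> highest_weight_space \<rho> m\<^sub>1 m\<^sub>2)"

definition irrep :: "'n::finite rep \<Rightarrow> nat \<Rightarrow> nat \<Rightarrow> bool" where
  "irrep \<rho> m\<^sub>1 m\<^sub>2 \<longleftrightarrow> sl3_rep \<rho> \<and> irrep_on \<rho> UNIV m\<^sub>1 m\<^sub>2"

text \<open>The whole space is the internal direct sum of the members of \<open>S\<close>.\<close>

definition irreducible_decomposition :: "'n::finite rep \<Rightarrow> (complex ^ 'n) set set \<Rightarrow> bool" where
  "irreducible_decomposition \<rho> S \<longleftrightarrow>
     finite S \<and> (\<forall>U\<in>S. irreducible_subrep \<rho> U) \<and>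
     (\<forall>w. \<exists>!f. f \<in> (\<Pi>\<^sub>E U\<in>S. U) \<and> w = (\<Sum>U\<in>S. f U))"

text \<open>
  By complete reducibility a decomposition exists, and the number of copies does not
  depend on it; so for each \<open>\<rho>\<close>, \<open>m\<^sub>1\<close>, \<open>m\<^sub>2\<close> exactly one \<open>d\<close> satisfies the following.
\<close>

definition has_multiplicity :: "'n::finite rep \<Rightarrow> nat \<Rightarrow> nat \<Rightarrow> nat \<Rightarrow> bool" where
  "has_multiplicity \<rho> m\<^sub>1 m\<^sub>2 d \<longleftrightarrow>
     (\<exists>S. irreducible_decomposition \<rho> S \<and> d = card {U\<in>S. irrep_on \<rho> U m\<^sub>1 m\<^sub>2})"

text \<open>
  The tensor product of \<open>complex ^ 'n\<close> and \<open>complex ^ 'm\<close> is \<open>complex ^ ('n \<times> 'm)\<close>,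
  and the tensor product of operators is the Kronecker product of matrices.
\<close>

definition kron ::
  "complex ^ 'n ^ 'n \<Rightarrow> complex ^ 'm ^ 'm \<Rightarrow> complex ^ ('n::finite \<times> 'm::finite) ^ ('n \<times> 'm)" where
  "kron A B = (\<chi> i j. A $ fst i $ fst j * B $ snd i $ snd j)"

text \<open>\<open>tensor_gen \<rho> \<rho>' a p q\<close> is the action of \<open>e\<^sup>(\<^sup>a\<^sup>)\<^sub>p\<^sub>q\<close>, where \<open>a\<close> is 1 or 2.\<close>

definition tensor_gen :: "'n::finite rep \<Rightarrow> 'm::finite rep \<Rightarrow> nat \<Rightarrow> ('n \<times> 'm) rep" where
  "tensor_gen \<rho> \<rho>' a p q = (if a = 1 then kron (\<rho> p q) (mat 1) else kron (mat 1) (\<rho>' p q))"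

definition tensor_rep :: "'n::finite rep \<Rightarrow> 'm::finite rep \<Rightarrow> ('n \<times> 'm) rep" where
  "tensor_rep \<rho> \<rho>' p q = tensor_gen \<rho> \<rho>' 1 p q + tensor_gen \<rho> \<rho>' 2 p q"

text \<open>
  For a list \<open>[a\<^sub>1, \<dots>, a\<^sub>\<mu>]\<close>, the index \<open>i\<^sub>k\<^sub>+\<^sub>1\<close> is represented by \<open>i k\<close>, with
  \<open>k\<close> counted modulo \<open>\<mu>\<close>; the factors are multiplied in the order of the list.
\<close>

definition pol_trace :: "(nat \<Rightarrow> 'k::finite rep) \<Rightarrow> nat list \<Rightarrow> complex ^ 'k ^ 'k" where
  "pol_trace e as =
     (\<Sum>i \<in> {0..<length as} \<rightarrow>\<^sub>E {1..3}.
        foldr (\<lambda>k A. e (as ! k) (i (Suc k mod length as)) (i k) ** A) [0..<length as] (mat 1))"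

definition pol_trace_bar :: "(nat \<Rightarrow> 'k::finite rep) \<Rightarrow> nat list \<Rightarrow> complex ^ 'k ^ 'k" where
  "pol_trace_bar e as =
     (\<Sum>i \<in> {0..<length as} \<rightarrow>\<^sub>E {1..3}.
        foldr (\<lambda>k A. e (as ! k) (i k) (i (Suc k mod length as)) ** A) [0..<length as] (mat 1))"

definition casimir_L :: "'n::finite rep \<Rightarrow> complex ^ 'n ^ 'n" where
  "casimir_L \<rho> = (1/2) *\<^sub>R
     (\<Sum>i\<in>{1..3}. \<Sum>j\<in>{1..3}. \<Sum>k\<in>{1..3}.
        \<rho> i j ** \<rho> j k ** \<rho> k i + \<rho> j i ** \<rho> k j ** \<rho> i k)"

definition op_X :: "'n::finite rep \<Rightarrow> 'm::finite rep \<Rightarrow> complex ^ ('n \<times> 'm) ^ ('n \<times> 'm)" where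
  "op_X \<rho> \<rho>' =
     (let T = pol_trace (tensor_gen \<rho> \<rho>') in
        (1/2) *\<^sub>R (T [1,1,2] - T [1,2,2])
        + (1/3) *\<^sub>R (kron (casimir_L \<rho>) (mat 1) - kron (mat 1) (casimir_L \<rho>')))"

definition op_Y :: "'n::finite rep \<Rightarrow> 'm::finite rep \<Rightarrow> complex ^ ('n \<times> 'm) ^ ('n \<times> 'm)" where
  "op_Y \<rho> \<rho>' =
     (let T = pol_trace (tensor_gen \<rho> \<rho>'); T' = pol_trace_bar (tensor_gen \<rho> \<rho>') in
        (1/2) *\<^sub>R (T [1,1,2,2] + T' [1,1,2,2])
        - (1/12) *\<^sub>R (T [1,2] ** T [1,2])
        - (5/12) *\<^sub>R (T [1,1] ** T [2,2])
        - 2 *\<^sub>R T [1,2])"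

text \<open>
  The tridiagonal matrices, with row index \<open>i\<close> and column index \<open>j\<close> starting at 1;
  \<open>\<xi> 1, \<dots>, \<xi> 6\<close> are the parameters, \<open>\<beta>\<close> stands for \<open>\<xi>\<^sub>b\<close>, and \<open>lm\<close>, \<open>lp\<close> for
  \<open>\<lambda>\<^sub>-\<close>, \<open>\<lambda>\<^sub>+\<close>.
\<close>

definition E_sum :: "(nat \<Rightarrow> real) \<Rightarrow> real \<Rightarrow> nat \<Rightarrow> nat \<Rightarrow> real" where
  "E_sum \<xi> \<beta> j k = (\<Sum>i\<in>{1..6}. (\<xi> i - real j - \<beta> + 1/2) ^ k)"

definition mat_a :: "(nat \<Rightarrow> real) \<Rightarrow> real \<Rightarrow> real \<Rightarrow> nat \<Rightarrow> nat \<Rightarrow> real" where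
  "mat_a \<xi> \<beta> \<Lambda> i j =
     (let E = E_sum \<xi> \<beta> in
      if j = i + 1 then (real i + \<beta> - \<xi> 1) * (real i + \<beta> - \<xi> 2) * (real i + \<beta> - \<xi> 3)
      else if i = j + 1 then (real j + \<beta> - \<xi> 4) * (real j + \<beta> - \<xi> 5) * (real j + \<beta> - \<xi> 6)
      else if i = j then
        - (1/108) * (7/2 * E j 1 ^ 3 - 18 * E j 1 * E j 2 + 18 * E j 3)
        - 1/24 * E j 1 * (\<Lambda>\<^sup>2 + 2)
      else 0)"

definition mat_b :: "(nat \<Rightarrow> real) \<Rightarrow> real \<Rightarrow> real \<Rightarrow> real \<Rightarrow> real \<Rightarrow> nat \<Rightarrow> nat \<Rightarrow> real" where
  "mat_b \<xi> \<beta> \<Lambda> lm lp i j =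
     (let E = E_sum \<xi> \<beta> in
      if j = i + 1 then mat_a \<xi> \<beta> \<Lambda> i j * (real i + \<beta> - lm)
      else if i = j + 1 then mat_a \<xi> \<beta> \<Lambda> i j * (real j + \<beta> - lp)
      else if i = j then
        1/288 * (5/2 * E j 1 ^ 4 + 32 * E j 1 * E j 3
                 + 6 * ((E j 2)\<^sup>2 - 3 * (E j 1)\<^sup>2 * E j 2 - 4 * E j 4)
                 + 6 * E j 2 * (\<Lambda>\<^sup>2 + 2) - 3 * (E j 1)\<^sup>2 * (\<Lambda>\<^sup>2 - 2)
                 - 3/2 * \<Lambda> ^ 4 + 6 * \<Lambda>\<^sup>2 - 36)
      else 0)"

text \<open>
  \<open>v 1, \<dots>, v d\<close> is a basis of the subspace \<open>M\<close>, and the operator \<open>A\<close> acts in it by the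
  matrix \<open>c\<close>; as usual, column \<open>j\<close> of \<open>c\<close> holds the coordinates of the image of \<open>v j\<close>.
\<close>

definition basis_of :: "(complex ^ 'k::finite) set \<Rightarrow> nat \<Rightarrow> (nat \<Rightarrow> complex ^ 'k) \<Rightarrow> bool" where
  "basis_of M d v \<longleftrightarrow>
     inj_on v {1..d} \<and> vec.independent (v ` {1..d}) \<and> vec.span (v ` {1..d}) = M"

definition acts_by ::
  "complex ^ 'k ^ 'k::finite \<Rightarrow> nat \<Rightarrow> (nat \<Rightarrow> complex ^ 'k) \<Rightarrow> (nat \<Rightarrow> nat \<Rightarrow> real) \<Rightarrow> bool" where
  "acts_by A d v c \<longleftrightarrow> (\<forall>j\<in>{1..d}. A *v v j = (\<Sum>i\<in>{1..d}. complex_of_real (c i j) *s v i))"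

end

theory Submission
  imports Defs
begin

text \<open>Let \<open>V\<close> and \<open>W\<close> be the two irreducible representations.  A highest-weight vector of \<open>V \<otimes> W\<close> is
  determined by its coefficient in \<open>W\<close> along the highest-weight vector of \<open>V\<close>.  Realise \<open>W\<close> by the
  monomials of bidegree \<open>(a, b)\<close> in a vector \<open>y\<close> and a covector \<open>\<beta>\<close>, modulo \<open>\<Sum>\<^sub>k y\<^sub>k \<beta>\<^sub>k\<close>.  The monomials of
  the relevant weight without the factor \<open>y\<^sub>2 \<beta>\<^sub>2\<close> form a chain \<open>C t\<close>; the coefficients that occur are spanned by
  the \<open>C t\<close> with \<open>\<xi>\<^sub>b < t \<le> \<xi>\<^sub>a\<close>, since raising operators kill highest-weight vectors, and each of these occurs,
  by a construction with invariants.  Along the chain, \<open>X\<close> and \<open>Y\<close> act by tridiagonal matrices, which are the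
  transposes of those of the theorem.  Hence this is applied to the transposed representations, for which \<open>X\<close> and
  \<open>Y\<close> are the transposed operators, and the required basis is the dual one; that the two multiplicity spaces are
  in duality, and that their dimension is \<open>d\<close>, follows from a decomposition into irreducible representations.\<close>

section \<open>Linear algebra\<close>

text \<open>The passage to transposes is forced. Along the chain the ratio of the entries of
  \<open>Y\<close> and \<open>X\<close> is j + \<xi>_b - \<lambda>_+ above the diagonal and j +
  \<xi>_b - \<lambda>_- below it, the opposite of what is claimed. Rescaling the basis vectors
  leaves these ratios unchanged, and \<Lambda> > 0, so the two can only be exchanged by going to a
  dual basis.

  The given representations consist of arbitrary matrices, so the monomials have to be found inside
  them. Each one is the vector with prescribed matrix coefficients against the highest-weight
  covector. It exists by induction on the distance from the top: the quadratic Casimir element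
  expresses a positive multiple of a monomial through lowering generators applied to monomials
  closer to the top.

  The number \<open>d\<close> is known only through some decomposition. Its summands yield
  biorthogonal families of highest-weight vectors and covectors, which make the two multiplicity
  spaces dual to each other; the chain, used for both, counts their common dimension.\<close>

lemma matrix_vector_mult_smult [simp]:
  fixes A :: "'a::comm_semiring_1 ^ 'n ^ 'm"
  shows "A *v (c *s x) = c *s (A *v x)"
  by (simp add: matrix_vector_mult_def vec_eq_iff sum_distrib_left mult_ac)

lemma matrix_vector_mult_sum:
  fixes A :: "'a::comm_ring_1 ^ 'n ^ 'm"
  shows "A *v (\<Sum>i\<in>I. f i) = (\<Sum>i\<in>I. A *v f i)"
  by (induction I rule: infinite_finite_induct) (auto simp: matrix_vector_right_distrib)

lemma matrix_sum_vector_mult: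
  fixes f :: "'i \<Rightarrow> 'a::comm_ring_1 ^ 'n ^ 'm"
  shows "(\<Sum>i\<in>I. f i) *v x = (\<Sum>i\<in>I. f i *v x)"
  by (induction I rule: infinite_finite_induct) (auto simp: matrix_vector_mult_add_rdistrib)

lemma scaleR_matrix_vector_mult:
  fixes A :: "complex ^ 'n ^ 'm"
  shows "(r *\<^sub>R A) *v x = complex_of_real r *s (A *v x)"
  unfolding matrix_vector_mult_def vec_eq_iff vector_smult_component vec_lambda_beta vector_scaleR_component
    sum_distrib_left scaleR_conv_of_real[where 'a=complex] mult.assoc by simp

lemma scalar_product_add_right: "scalar_product r (x + y) = scalar_product r x + scalar_product (r::'a::comm_ring_1^'n) y"
  and scalar_product_add_left: "scalar_product (r + s) x = scalar_product r x + scalar_product s x"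
  and scalar_product_smult_right: "scalar_product r (c *s x) = c * scalar_product r x"
  and scalar_product_smult_left: "scalar_product (c *s r) x = c * scalar_product r x"
  and scalar_product_zero_right [simp]: "scalar_product r 0 = 0"
  and scalar_product_zero_left [simp]: "scalar_product 0 x = 0"
  and scalar_product_diff_right: "scalar_product r (x - y) = scalar_product r x - scalar_product r y"
  and scalar_product_commute: "scalar_product r x = scalar_product x r"
  by (simp_all add: scalar_product_def algebra_simps sum.distrib sum_distrib_left sum_subtractf)

lemma scalar_product_sum_right:
  "scalar_product (r::'a::comm_ring_1^'n) (\<Sum>i\<in>I. f i) = (\<Sum>i\<in>I. scalar_product r (f i))"
  by (induction I rule: infinite_finite_induct) (auto simp: scalar_product_add_right)

lemma scalar_product_matrix:
  fixes A :: "'a::comm_ring_1^'n^'m"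
  shows "scalar_product r (A *v x) = scalar_product (transpose A *v r) x"
  unfolding scalar_product_def matrix_vector_mult_def transpose_def
  by (simp add: sum_distrib_left sum_distrib_right) (subst sum.swap, simp add: mult_ac)

lemma scalar_product_eq_0_all:
  fixes x :: "'a::comm_ring_1^'n"
  assumes "\<And>r. scalar_product r x = 0"
  shows "x = 0"
proof -
  have "x $ i = 0" for i
    using assms[of "axis i 1"] by (simp add: scalar_product_def axis_def if_distrib[of "\<lambda>z. z * _"] cong: if_cong)
  then show ?thesis by (simp add: vec_eq_iff)
qed

lemma subspace_separation:
  fixes U :: "(complex^'n) set"
  assumes U: "vec.subspace U" and x: "x \<notin> U"
  obtains r where "\<And>u. u \<in> U \<Longrightarrow> scalar_product r u = 0" "scalar_product r x = 1"
proof -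
  obtain C where C: "C \<subseteq> U" "vec.independent C" "U \<subseteq> vec.span C"
    using vec.maximal_independent_subset[of U] by blast
  have spC: "vec.span C = U"
    using C U by (metis subset_antisym vec.span_minimal)
  have xC: "x \<notin> vec.span C" using x spC by simp
  then have ind: "vec.independent (insert x C)"
    using C(2) by (simp add: vec.independent_insert)
  obtain g where g: "Vector_Spaces.linear (*s) (*s) g" "\<forall>b\<in>insert x C. g b = (if b = x then x else 0)"
    using vec.linear_independent_extend[OF ind, of "\<lambda>b. if b = x then x else 0"] by blast
  have gU: "g u = 0" if "u \<in> U" for u
  proof -
    have "\<forall>b\<in>C. g b = 0" using g(2) xC by (metis insert_iff vec.span_base)
    then show ?thesis
      using vec.linear_eq_0_on_span[OF g(1), of C u] that spC by auto
  qed
  have "x \<noteq> 0" using x U by (metis vec.subspace_0)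
  then obtain i where i: "x $ i \<noteq> 0" by (auto simp: vec_eq_iff)
  define r where "r = (1 / (x $ i)) *s (matrix g $ i)"
  have r: "scalar_product r u = g u $ i / x $ i" for u
    using matrix_works[OF g(1), of u, symmetric]
    by (simp add: r_def scalar_product_def matrix_vector_mult_def sum_divide_distrib)
  show ?thesis
    by (rule that[of r]) (use r gU g(2) i in auto)
qed

text \<open>The polynomial in \<open>H\<close> with roots \<open>ks\<close>, applied to
  \<open>w\<close>. Keeping the list of roots explicit lets a further root be added for each new
  summand of a span.\<close>

primrec eigen_kill :: "complex^'n^'n \<Rightarrow> complex list \<Rightarrow> complex^'n \<Rightarrow> complex^'n" where
  "eigen_kill H [] w = w"
| "eigen_kill H (k # ks) w = eigen_kill H ks (H *v w - k *s w)"

lemma eigen_kill_add: "eigen_kill H ks (x + y) = eigen_kill H ks x + eigen_kill H ks y"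
proof (induction ks arbitrary: x y)
  case (Cons k ks)
  have "H *v (x + y) - k *s (x + y) = (H *v x - k *s x) + (H *v y - k *s y)"
    by (simp add: matrix_vector_right_distrib vec.scale_right_distrib)
  then show ?case using Cons[of "H *v x - k *s x" "H *v y - k *s y"] by (simp only: eigen_kill.simps)
qed simp

lemma eigen_kill_smult: "eigen_kill H ks (c *s x) = c *s eigen_kill H ks x"
proof (induction ks arbitrary: x)
  case (Cons k ks)
  have "H *v (c *s x) - k *s (c *s x) = c *s (H *v x - k *s x)"
    by (simp add: vec.scale_right_diff_distrib vector_smult_assoc mult.commute)
  then show ?case using Cons[of "H *v x - k *s x"] by (simp only: eigen_kill.simps)
qed simp

lemmas eigen_kill_linear = eigen_kill_add eigen_kill_smult

lemma eigen_kill_zero [simp]: "eigen_kill H ks 0 = 0"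
  using eigen_kill_linear(2)[of H ks 0 0] by simp

lemma eigen_kill_step:
  "eigen_kill H ks (H *v w - k *s w) = H *v eigen_kill H ks w - k *s eigen_kill H ks w"
proof (induction ks arbitrary: w)
  case (Cons l ks)
  have "H *v (H *v w - k *s w) - l *s (H *v w - k *s w) = H *v (H *v w - l *s w) - k *s (H *v w - l *s w)"
    by (simp add: matrix_vector_mult_diff_distrib vec.scale_right_diff_distrib vector_smult_assoc mult.commute)
  then show ?case using Cons[of "H *v w - l *s w"] by (simp only: eigen_kill.simps)
qed simp

lemma eigen_kill_commute: "eigen_kill H ks (eigen_kill H ls w) = eigen_kill H ls (eigen_kill H ks w)"
  by (induction ks arbitrary: w) (auto simp: eigen_kill_step[symmetric])

lemma eigen_kill_eigenvector:
  assumes "H *v w = h *s w"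
  shows "eigen_kill H ks w = (\<Prod>k\<leftarrow>ks. h - k) *s w"
proof (induction ks)
  case (Cons k ks)
  have "H *v w - k *s w = (h - k) *s w" unfolding assms by (simp add: vec.scale_left_diff_distrib)
  then show ?case
    by (simp only: eigen_kill.simps eigen_kill_smult Cons vector_smult_assoc list.map prod_list.Cons)
qed simp

text \<open>A product of factors \<open>H - k\<close> kills the given span element, but multiplies \<open>w\<close> by a non-zero number.\<close>

lemma eigenvector_in_span_others:
  assumes H: "H *v w = h *s w"
    and w: "w \<in> vec.span {z. \<exists>k. k \<noteq> h \<and> H *v z = k *s z}"
  shows "w = (0::complex^'n)"
proof -
  have "\<exists>ks. h \<notin> set ks \<and> eigen_kill H ks w = 0"
    using w
  proof (induction rule: vec.span_induct_alt)
    case base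
    show ?case by (rule exI[of _ "[]"]) simp
  next
    case (step c x y)
    then obtain ks k where ks: "h \<notin> set ks" "eigen_kill H ks y = 0" and k: "k \<noteq> h" "H *v x = k *s x" by blast
    have "eigen_kill H (k # ks) (c *s x) = 0"
      using k(2) by (simp add: vector_smult_assoc mult.commute)
    moreover have "eigen_kill H (k # ks) y = 0"
      using eigen_kill_commute[of H "[k]" ks y] ks(2) by (simp add: eigen_kill_commute eigen_kill_step)
    ultimately have "eigen_kill H (k # ks) (c *s x + y) = 0"
      by (metis add_0 eigen_kill_linear(1))
    then show ?case using ks(1) k(1) by (intro exI[of _ "k # ks"]) auto
  qed
  then obtain ks where ks: "h \<notin> set ks" "eigen_kill H ks w = 0" by blast
  have "(\<Prod>k\<leftarrow>ks. h - k) \<noteq> 0" using ks(1) by (auto simp: prod_list_zero_iff)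
  then show ?thesis using ks(2) eigen_kill_eigenvector[OF H, of ks] by (simp add: vec.scale_eq_0_iff)
qed

section \<open>Words in the generators\<close>

definition gens :: "(nat \<times> nat) set" where
  "gens = {1..3} \<times> {1..3}"

definition lows :: "(nat \<times> nat) set" where
  "lows = {(p, q) \<in> gens. q < p}"

lemma lows_gens: "lows \<subseteq> gens" by (auto simp: lows_def)

lemma range3: "p \<in> {1..3::nat} \<longleftrightarrow> p = 1 \<or> p = 2 \<or> p = 3" by auto

text \<open>The head of the word acts first.\<close>

primrec wact :: "'n::finite rep \<Rightarrow> (nat \<times> nat) list \<Rightarrow> complex ^ 'n \<Rightarrow> complex ^ 'n" where
  "wact \<rho> [] w = w"
| "wact \<rho> (g # ws) w = wact \<rho> ws (\<rho> (fst g) (snd g) *v w)"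

lemma wact_append [simp]: "wact \<rho> (ws @ vs) w = wact \<rho> vs (wact \<rho> ws w)"
  by (induction ws arbitrary: w) auto

lemma wact_add: "wact \<rho> ws (x + y) = wact \<rho> ws x + wact \<rho> ws y"
  by (induction ws arbitrary: x y) (auto simp: matrix_vector_right_distrib)

lemma wact_smult: "wact \<rho> ws (c *s x) = c *s wact \<rho> ws x"
  by (induction ws arbitrary: x) auto

lemma wact_zero [simp]: "wact \<rho> ws 0 = 0"
  by (induction ws) auto

lemma wact_diff: "wact \<rho> ws (x - y) = wact \<rho> ws x - wact \<rho> ws y"
  by (induction ws arbitrary: x y) (auto simp: matrix_vector_mult_diff_distrib)

lemma sl3_rep_commute:
  assumes "sl3_rep \<rho>" "p \<in> {1..3}" "q \<in> {1..3}" "r \<in> {1..3}" "s \<in> {1..3}"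
  shows "\<rho> p q *v (\<rho> r s *v x) =
    \<rho> r s *v (\<rho> p q *v x) + (if q = r then \<rho> p s *v x else 0) - (if s = p then \<rho> r q *v x else 0)"
proof -
  have "\<rho> p q ** \<rho> r s - \<rho> r s ** \<rho> p q = (if q = r then \<rho> p s else 0) - (if s = p then \<rho> r q else 0)"
    using assms unfolding sl3_rep_def by blast
  then have "(\<rho> p q ** \<rho> r s) *v x - (\<rho> r s ** \<rho> p q) *v x
      = (if q = r then \<rho> p s else 0) *v x - (if s = p then \<rho> r q else 0) *v x"
    by (metis matrix_vector_mult_diff_rdistrib)
  then have "(\<rho> p q ** \<rho> r s) *v x = (\<rho> r s ** \<rho> p q) *v x
      + ((if q = r then \<rho> p s *v x else 0) - (if s = p then \<rho> r q *v x else 0))"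
    by (simp add: diff_eq_eq algebra_simps split: if_splits)
  then show ?thesis by (simp add: matrix_vector_mul_assoc add_diff_eq)
qed

lemma sl3_rep_trace:
  assumes "sl3_rep \<rho>"
  shows "\<rho> 1 1 *v x + \<rho> 2 2 *v x + \<rho> 3 3 *v x = 0"
proof -
  have "{1..3::nat} = {1,2,3}" by auto
  then have "\<rho> 1 1 + \<rho> 2 2 + \<rho> 3 3 = 0"
    using assms unfolding sl3_rep_def by (simp add: algebra_simps)
  then show ?thesis by (metis matrix_vector_mult_0 matrix_vector_mult_add_rdistrib)
qed

text \<open>Normal ordering in the style of Poincare-Birkhoff-Witt. A leading lowering letter is
  carried to the end of the word, where \<open>low\<close> disposes of it; each exchange costs
  commutator words shorter by one letter, which the induction on the length covers. Any other
  leading letter is stripped by \<open>up\<close>.\<close>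

lemma word_vanish:
  fixes \<delta> :: "(nat \<times> nat) list \<Rightarrow> 'a::ab_group_add"
  assumes swap: "\<And>pre post p q r s. set (pre @ (r,s) # (p,q) # post) \<subseteq> gens \<Longrightarrow>
      \<delta> (pre @ (r,s) # (p,q) # post) = \<delta> (pre @ (p,q) # (r,s) # post)
        + (if q = r then \<delta> (pre @ (p,s) # post) else 0) - (if s = p then \<delta> (pre @ (r,q) # post) else 0)"
    and low: "\<And>pre p q. set pre \<subseteq> gens \<Longrightarrow> (p,q) \<in> lows \<Longrightarrow> \<delta> (pre @ [(p,q)]) = 0"
    and up: "\<And>p q ws. (p,q) \<in> gens \<Longrightarrow> p \<le> q \<Longrightarrow> set ws \<subseteq> gens \<Longrightarrow> \<delta> ws = 0 \<Longrightarrow> \<delta> ((p,q) # ws) = 0"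
    and nil: "\<delta> [] = 0"
    and ws: "set ws \<subseteq> gens"
  shows "\<delta> ws = 0"
  using ws
proof (induction "length ws" arbitrary: ws rule: less_induct)
  case less
  \<comment> \<open>The bound says that \<open>pre @ (r,s) # post\<close> is no longer than
    \<open>ws\<close>; the commutator words are then shorter than \<open>ws\<close> and fall under
    the outer hypothesis.\<close>
  have move: "\<delta> (pre @ (r,s) # post) = 0"
    if "length pre + length post < length ws" "set pre \<subseteq> gens" "set post \<subseteq> gens" "(r,s) \<in> lows" for pre post r s
    using that
  proof (induction post arbitrary: pre)
    case Nil
    then show ?case using low[of pre r s] by simp
  next
    case (Cons g post)
    obtain p q where g: "g = (p,q)" by (cases g)
    have in_gens: "(p,q) \<in> gens" "(r,s) \<in> gens" "(p,s) \<in> gens" "(r,q) \<in> gens"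
      using Cons.prems g lows_gens by (auto simp: gens_def)
    have 1: "\<delta> (pre @ (p,q) # (r,s) # post) = 0"
      using Cons.IH[of "pre @ [(p,q)]"] Cons.prems g in_gens by simp
    have 2: "\<delta> (pre @ (p,s) # post) = 0" "\<delta> (pre @ (r,q) # post) = 0"
      by (rule less.hyps; use Cons.prems g in_gens in auto)+
    have "\<delta> (pre @ (r,s) # (p,q) # post) = 0"
      using swap[of pre r s p q post] 1 2 Cons.prems g in_gens by simp
    then show ?case using g by simp
  qed
  show ?case
  proof (cases ws)
    case Nil
    then show ?thesis using nil by simp
  next
    case (Cons g ws')
    obtain p q where g: "g = (p,q)" by (cases g)
    show ?thesis
    proof (cases "q < p")
      case True
      then show ?thesis using move[of "[]" ws' p q] less.prems Cons g by (auto simp: lows_def)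
    next
      case False
      have "\<delta> ws' = 0" using less Cons by auto
      then show ?thesis using up[of p q ws'] False less.prems Cons g by simp
    qed
  qed
qed

section \<open>Highest-weight vectors\<close>

text \<open>The eigenvalue of \<open>e\<^sub>p\<^sub>p\<close> on the highest-weight vector of \<open>[a + 1, b + 1]\<close>.\<close>

definition hwt :: "complex \<Rightarrow> complex \<Rightarrow> nat \<Rightarrow> complex" where
  "hwt a b p = (if p = 1 then (2 * a + b) / 3 else if p = 2 then (b - a) / 3 else - (a + 2 * b) / 3)"

definition hwv :: "'n::finite rep \<Rightarrow> complex \<Rightarrow> complex \<Rightarrow> complex ^ 'n \<Rightarrow> bool" where
  "hwv \<rho> a b x \<longleftrightarrow> (\<forall>p\<in>{1..3}. \<rho> p p *v x = hwt a b p *s x) \<and>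
     (\<forall>p\<in>{1..3}. \<forall>q\<in>{1..3}. p < q \<longrightarrow> \<rho> p q *v x = 0)"

lemma hwvD:
  assumes "hwv \<rho> a b x"
  shows "p \<in> {1..3} \<Longrightarrow> \<rho> p p *v x = hwt a b p *s x"
    "p \<in> {1..3} \<Longrightarrow> q \<in> {1..3} \<Longrightarrow> p < q \<Longrightarrow> \<rho> p q *v x = 0"
  using assms unfolding hwv_def by blast+

text \<open>The trace relation recovers the eigenvalues of the three diagonal generators from those
  of their two differences.\<close>

lemma highest_weight_space_iff:
  assumes rep: "sl3_rep \<rho>"
  shows "x \<in> highest_weight_space \<rho> m\<^sub>1 m\<^sub>2 \<longleftrightarrow> hwv \<rho> (of_nat m\<^sub>1 - 1) (of_nat m\<^sub>2 - 1) x"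
proof -
  define a b :: complex where "a = of_nat m\<^sub>1 - 1" and "b = of_nat m\<^sub>2 - 1"
  have tr: "(\<rho> 1 1 *v x) $ i + (\<rho> 2 2 *v x) $ i + (\<rho> 3 3 *v x) $ i = 0" for i
    using sl3_rep_trace[OF rep, of x] by (metis vector_add_component zero_index)
  have "(\<rho> 1 1 - \<rho> 2 2) *v x = a *s x \<and> (\<rho> 2 2 - \<rho> 3 3) *v x = b *s x \<longleftrightarrow>
      (\<forall>i. (\<rho> 1 1 *v x) $ i - (\<rho> 2 2 *v x) $ i = a * x $ i \<and> (\<rho> 2 2 *v x) $ i - (\<rho> 3 3 *v x) $ i = b * x $ i)"
    by (auto simp: vec_eq_iff matrix_vector_mult_diff_rdistrib)
  also have "\<dots> \<longleftrightarrow> (\<forall>i. (\<rho> 1 1 *v x) $ i = (2 * a + b) / 3 * x $ i \<and> (\<rho> 2 2 *v x) $ i = (b - a) / 3 * x $ i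
      \<and> (\<rho> 3 3 *v x) $ i = - (a + 2 * b) / 3 * x $ i)"
  proof (intro all_cong1 iffI conjI)
    fix i assume h: "(\<rho> 1 1 *v x) $ i - (\<rho> 2 2 *v x) $ i = a * x $ i \<and> (\<rho> 2 2 *v x) $ i - (\<rho> 3 3 *v x) $ i = b * x $ i"
    have e: "(\<rho> 2 2 *v x) $ i = (\<rho> 3 3 *v x) $ i + b * x $ i" "(\<rho> 1 1 *v x) $ i = (\<rho> 3 3 *v x) $ i + b * x $ i + a * x $ i"
      using h by (auto simp: algebra_simps)
    have "3 * (\<rho> 3 3 *v x) $ i = - (a + 2 * b) * x $ i"
      using tr[of i] unfolding e by (simp add: algebra_simps) (metis add_eq_0_iff add.commute add.assoc)
    then show 3: "(\<rho> 3 3 *v x) $ i = - (a + 2 * b) / 3 * x $ i" by (simp add: field_simps)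
    show "(\<rho> 1 1 *v x) $ i = (2 * a + b) / 3 * x $ i" "(\<rho> 2 2 *v x) $ i = (b - a) / 3 * x $ i"
      unfolding e 3 by (simp_all add: field_simps)
  next
    fix i assume h: "(\<rho> 1 1 *v x) $ i = (2 * a + b) / 3 * x $ i \<and> (\<rho> 2 2 *v x) $ i = (b - a) / 3 * x $ i
      \<and> (\<rho> 3 3 *v x) $ i = - (a + 2 * b) / 3 * x $ i"
    show "(\<rho> 1 1 *v x) $ i - (\<rho> 2 2 *v x) $ i = a * x $ i" "(\<rho> 2 2 *v x) $ i - (\<rho> 3 3 *v x) $ i = b * x $ i"
      unfolding h[THEN conjunct1] h[THEN conjunct2, THEN conjunct1] h[THEN conjunct2, THEN conjunct2]
      by (simp_all add: field_simps)
  qed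
  also have "\<dots> \<longleftrightarrow> (\<forall>p\<in>{1..3}. \<rho> p p *v x = hwt a b p *s x)"
    unfolding range3 Ball_def hwt_def by (auto simp: vec_eq_iff)
  finally show ?thesis
    unfolding highest_weight_space_def hwv_def a_def b_def by auto
qed

lemma irreducible_subrepD:
  assumes "irreducible_subrep \<rho> U"
  shows "vec.subspace U" "\<And>p q u. p \<in> {1..3} \<Longrightarrow> q \<in> {1..3} \<Longrightarrow> u \<in> U \<Longrightarrow> \<rho> p q *v u \<in> U"
    "\<And>W. invariant_subspace \<rho> W \<Longrightarrow> W \<subseteq> U \<Longrightarrow> W \<noteq> {0} \<Longrightarrow> W = U"
  using assms unfolding irreducible_subrep_def invariant_subspace_def by blast+

section \<open>The submodule generated by a highest-weight vector\<close>

locale hw_vector =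
  fixes \<rho> :: "'n::finite rep" and a b :: complex and x :: "complex ^ 'n"
  assumes rep: "sl3_rep \<rho>" and hw: "hwv \<rho> a b x"
begin

text \<open>\<open>F\<close> is the submodule generated by \<open>x\<close> (invariance is shown in
  \<open>F_invariant\<close>), and \<open>Low\<close> is its part strictly below the highest
  weight.\<close>

definition F where "F = vec.span {wact \<rho> ws x | ws. set ws \<subseteq> lows}"
definition Low where "Low = vec.span {wact \<rho> ws x | ws. set ws \<subseteq> lows \<and> ws \<noteq> []}"

lemma lowering_F:
  assumes "(p,q) \<in> lows" "u \<in> F"
  shows "\<rho> p q *v u \<in> Low"
  using assms(2) unfolding F_def
proof (induction rule: vec.span_induct_alt)
  case base
  show ?case by (simp add: Low_def vec.span_zero)
next
  case (step c y z)
  then obtain ws where ws: "y = wact \<rho> ws x" "set ws \<subseteq> lows" by blast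
  have "\<rho> p q *v y = wact \<rho> (ws @ [(p,q)]) x" using ws by simp
  then have "\<rho> p q *v y \<in> Low" unfolding Low_def
    using ws(2) assms(1) by (intro vec.span_base) (auto intro!: exI[of _ "ws @ [(p,q)]"])
  then show ?case using step(2) unfolding Low_def
    by (simp add: matrix_vector_right_distrib vec.span_add vec.span_scale)
qed

lemma Low_F: "Low \<subseteq> F" unfolding Low_def F_def by (rule vec.span_mono) auto

text \<open>Induction on the last letter: the generator is moved past it, and the commutator is
  again a generator acting on the shorter word.\<close>

lemma word_F:
  assumes "set ws \<subseteq> lows" "p \<in> {1..3}" "q \<in> {1..3}"
  shows "\<rho> p q *v wact \<rho> ws x \<in> F"
  using assms
proof (induction ws arbitrary: p q rule: rev_induct)
  case Nil
  have x: "x \<in> F" unfolding F_def by (rule vec.span_base) (auto intro!: exI[of _ "[]"])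
  show ?case
  proof (cases "q < p")
    case True
    then have "(p,q) \<in> lows" using Nil by (auto simp: lows_def gens_def)
    then show ?thesis using lowering_F[of p q x] x Low_F by auto
  next
    case False
    then show ?thesis using hwvD[OF hw, of p] hwvD(2)[OF hw, of p q] Nil x
      by (cases "p = q") (auto simp: F_def vec.span_scale vec.span_zero)
  qed
next
  case (snoc g ws)
  obtain r s where g: "g = (r,s)" by (cases g)
  have rs: "r \<in> {1..3}" "s \<in> {1..3}" "(r,s) \<in> lows" using snoc.prems g by (auto simp: lows_def gens_def)
  have IH: "\<rho> p q *v wact \<rho> ws x \<in> F" if "p \<in> {1..3}" "q \<in> {1..3}" for p q
    using snoc that by auto
  have "\<rho> r s *v (\<rho> p q *v wact \<rho> ws x) \<in> F" using lowering_F[OF rs(3) IH] Low_F snoc.prems by auto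
  moreover have "(if q = r then \<rho> p s *v wact \<rho> ws x else 0) \<in> F" "(if s = p then \<rho> r q *v wact \<rho> ws x else 0) \<in> F"
    using IH snoc.prems rs by (auto simp: F_def vec.span_zero)
  ultimately show ?case using sl3_rep_commute[OF rep snoc.prems(2,3) rs(1,2), of "wact \<rho> ws x"] g
    by (simp add: F_def vec.span_add vec.span_diff)
qed

lemma F_invariant: "invariant_subspace \<rho> F"
  unfolding invariant_subspace_def
proof (intro conjI ballI)
  show "vec.subspace F" by (simp add: F_def)
  fix p q :: nat and u assume pq: "p \<in> {1..3}" "q \<in> {1..3}" and u: "u \<in> F"
  from u show "\<rho> p q *v u \<in> F"
    unfolding F_def
  proof (induction rule: vec.span_induct_alt)
    case base
    show ?case by (simp add: vec.span_zero)
  next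
    case (step c y z)
    then have "\<rho> p q *v y \<in> F" using word_F[of _ p q] pq by auto
    then show ?case using step(2)
      by (simp add: matrix_vector_right_distrib vec.span_add vec.span_scale F_def)
  qed
qed

lemma x_F: "x \<in> F"
  unfolding F_def by (rule vec.span_base) (auto intro!: exI[of _ "[]"])

lemma word_diag:
  assumes "set ws \<subseteq> lows" "p \<in> {1..3}"
  shows "\<exists>k. \<rho> p p *v wact \<rho> ws x = k *s wact \<rho> ws x"
  using assms
proof (induction ws rule: rev_induct)
  case Nil
  then show ?case using hwvD(1)[OF hw] by auto
next
  case (snoc g ws)
  obtain r s where g: "g = (r,s)" by (cases g)
  have rs: "r \<in> {1..3}" "s \<in> {1..3}" using snoc.prems g by (auto simp: lows_def gens_def)
  obtain k where k: "\<rho> p p *v wact \<rho> ws x = k *s wact \<rho> ws x" using snoc by auto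
  have "\<rho> p p *v (\<rho> r s *v wact \<rho> ws x) = (k + (if p = r then 1 else 0) - (if s = p then 1 else 0)) *s (\<rho> r s *v wact \<rho> ws x)"
    unfolding sl3_rep_commute[OF rep snoc.prems(2,2) rs] k
    by (auto simp: vec.scale_left_distrib vec.scale_left_diff_distrib)
  then show ?case unfolding g wact_append wact.simps fst_conv snd_conv by blast
qed

text \<open>\<open>\<rho> 1 1 - \<rho> 3 3\<close> defines the principal grading: a generator with
  indices \<open>r > s\<close> lowers its eigenvalue by \<open>r - s\<close>. So this single
  operator separates \<open>x\<close> from all non-empty lowering words.\<close>

lemma word_height:
  assumes "set ws \<subseteq> lows"
  shows "\<exists>N::nat. N \<ge> length ws \<and>
    (\<rho> 1 1 - \<rho> 3 3) *v wact \<rho> ws x = (hwt a b 1 - hwt a b 3 - of_nat N) *s wact \<rho> ws x"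
  using assms
proof (induction ws rule: rev_induct)
  case Nil
  then show ?case using hwvD(1)[OF hw, of 1] hwvD(1)[OF hw, of 3]
    by (auto simp: matrix_vector_mult_diff_rdistrib vec.scale_left_diff_distrib intro!: exI[of _ 0])
next
  case (snoc g ws)
  obtain r s where g: "g = (r,s)" by (cases g)
  have rs: "r \<in> {1..3}" "s \<in> {1..3}" "s < r" using snoc.prems g by (auto simp: lows_def gens_def)
  obtain N where N: "N \<ge> length ws" "(\<rho> 1 1 - \<rho> 3 3) *v wact \<rho> ws x = (hwt a b 1 - hwt a b 3 - of_nat N) *s wact \<rho> ws x"
    using snoc by auto
  have "(\<rho> 1 1 - \<rho> 3 3) *v (\<rho> r s *v wact \<rho> ws x) =
     \<rho> r s *v ((\<rho> 1 1 - \<rho> 3 3) *v wact \<rho> ws x) - of_nat (r - s) *s (\<rho> r s *v wact \<rho> ws x)"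
    using rs sl3_rep_commute[OF rep, of 1 1 r s "wact \<rho> ws x"] sl3_rep_commute[OF rep, of 3 3 r s "wact \<rho> ws x"]
    unfolding range3 by (auto simp: matrix_vector_mult_diff_rdistrib matrix_vector_mult_diff_distrib vec_eq_iff)
  also have "\<dots> = (hwt a b 1 - hwt a b 3 - of_nat (N + (r - s))) *s (\<rho> r s *v wact \<rho> ws x)"
    unfolding N(2) matrix_vector_mult_smult by (simp add: vec_eq_iff algebra_simps)
  finally show ?case using g N(1) rs(3) by (intro exI[of _ "N + (r - s)"]) auto
qed

lemma Low_top_weight:
  assumes z: "z \<in> Low" and top: "(\<rho> 1 1 - \<rho> 3 3) *v z = (hwt a b 1 - hwt a b 3) *s z"
  shows "z = 0"
proof (rule eigenvector_in_span_others[OF top])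
  have "{wact \<rho> ws x | ws. set ws \<subseteq> lows \<and> ws \<noteq> []}
      \<subseteq> {z. \<exists>k. k \<noteq> hwt a b 1 - hwt a b 3 \<and> (\<rho> 1 1 - \<rho> 3 3) *v z = k *s z}"
  proof safe
    fix ws assume "set ws \<subseteq> lows" "ws \<noteq> []"
    then obtain N :: nat where "N > 0" "(\<rho> 1 1 - \<rho> 3 3) *v wact \<rho> ws x = (hwt a b 1 - hwt a b 3 - of_nat N) *s wact \<rho> ws x"
      using word_height[of ws] by (metis length_greater_0_conv less_le_trans)
    then show "\<exists>k. k \<noteq> hwt a b 1 - hwt a b 3 \<and> (\<rho> 1 1 - \<rho> 3 3) *v wact \<rho> ws x = k *s wact \<rho> ws x"
      by (intro exI[of _ "hwt a b 1 - hwt a b 3 - of_nat N"]) auto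
  qed
  then show "z \<in> vec.span {z. \<exists>k. k \<noteq> hwt a b 1 - hwt a b 3 \<and> (\<rho> 1 1 - \<rho> 3 3) *v z = k *s z}"
    using z vec.span_mono unfolding Low_def by blast
qed

lemma hwv_height: "hwv \<rho> a b y \<Longrightarrow> (\<rho> 1 1 - \<rho> 3 3) *v y = (hwt a b 1 - hwt a b 3) *s y"
  using hwvD(1)[of \<rho> a b y 1] hwvD(1)[of \<rho> a b y 3]
  by (simp add: matrix_vector_mult_diff_rdistrib vec.scale_left_diff_distrib)

lemma F_decompose: "u \<in> F \<Longrightarrow> \<exists>c. u - c *s x \<in> Low"
  unfolding F_def
proof (induction rule: vec.span_induct_alt)
  case base
  show ?case by (intro exI[of _ 0]) (simp add: Low_def vec.span_zero)
next
  case (step k y z)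
  then obtain ws c where ws: "y = wact \<rho> ws x" "set ws \<subseteq> lows" and c: "z - c *s x \<in> Low" by blast
  show ?case
  proof (cases "ws = []")
    case True
    have "k *s y + z - (k + c) *s x = z - c *s x" using True ws by (simp add: vec.scale_left_distrib)
    then show ?thesis using c by metis
  next
    case False
    then have "y \<in> Low" using ws unfolding Low_def by (intro vec.span_base) auto
    then have "k *s y + (z - c *s x) \<in> Low" using c unfolding Low_def by (intro vec.span_add vec.span_scale)
    then show ?thesis by (intro exI[of _ c]) (simp add: algebra_simps)
  qed
qed

lemma F_irreducible:
  assumes "irreducible_subrep \<rho> U" "x \<in> U" "x \<noteq> 0"
  shows "F = U"
proof (rule irreducible_subrepD(3)[OF assms(1) F_invariant])
  show "F \<noteq> {0}" using x_F assms by auto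
  have "wact \<rho> ws u \<in> U" if "set ws \<subseteq> lows" "u \<in> U" for ws u
    using that
  proof (induction ws arbitrary: u)
    case (Cons g ws)
    then show ?case using irreducible_subrepD(2)[OF assms(1), of "fst g" "snd g" u]
      by (auto simp: lows_def gens_def)
  qed simp
  then show "F \<subseteq> U" unfolding F_def
    using assms(2) irreducible_subrepD(1)[OF assms(1)] by (intro vec.span_minimal) auto
qed

text \<open>Subtracting a multiple of \<open>x\<close> from \<open>y\<close> leaves an element of
  \<open>Low\<close> with the top eigenvalue of the grading, which must be 0.\<close>

lemma highest_weight_unique:
  assumes "irreducible_subrep \<rho> U" "x \<in> U" "x \<noteq> 0" "y \<in> U" "hwv \<rho> a b y"
  shows "\<exists>c. y = c *s x"
proof -
  have "y \<in> F" using F_irreducible assms by simp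
  then obtain c where c: "y - c *s x \<in> Low" using F_decompose by blast
  have "(\<rho> 1 1 - \<rho> 3 3) *v (y - c *s x) = (hwt a b 1 - hwt a b 3) *s (y - c *s x)"
    unfolding matrix_vector_mult_diff_distrib matrix_vector_mult_smult hwv_height[OF assms(5)] hwv_height[OF hw]
    by (simp add: vec_eq_iff algebra_simps)
  then have "y - c *s x = 0" using Low_top_weight[OF c] by blast
  then show ?thesis by auto
qed

text \<open>The functional is 1 on \<open>x\<close> and 0 on \<open>Low\<close>. Since
  \<open>x\<close> generates \<open>U\<close>, lowering generators map \<open>U\<close> into
  \<open>Low\<close>, and diagonal ones rescale each spanning word; so \<open>r\<close> behaves like
  a highest-weight vector for the transposed action.\<close>

lemma highest_weight_functional:
  assumes "irreducible_subrep \<rho> U" "x \<in> U" "x \<noteq> 0"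
  obtains r where "scalar_product r x = 1"
    "\<And>p q u. (p,q) \<in> lows \<Longrightarrow> u \<in> U \<Longrightarrow> scalar_product r (\<rho> p q *v u) = 0"
    "\<And>p u. p \<in> {1..3} \<Longrightarrow> u \<in> U \<Longrightarrow> scalar_product r (\<rho> p p *v u) = hwt a b p * scalar_product r u"
proof -
  have "x \<notin> Low" using Low_top_weight[OF _ hwv_height[OF hw]] assms(3) by blast
  moreover have "vec.subspace Low" by (simp add: Low_def)
  ultimately obtain r where r: "\<And>u. u \<in> Low \<Longrightarrow> scalar_product r u = 0" "scalar_product r x = 1"
    using subspace_separation by blast
  have UF: "U = F" using F_irreducible[OF assms] by simp
  have diag: "scalar_product r (\<rho> p p *v u) = hwt a b p * scalar_product r u" if p: "p \<in> {1..3}" and u: "u \<in> F" for p u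
    using u unfolding F_def
  proof (induction rule: vec.span_induct_alt)
    case base
    show ?case by simp
  next
    case (step c y z)
    then obtain ws where ws: "y = wact \<rho> ws x" "set ws \<subseteq> lows" by blast
    have "scalar_product r (\<rho> p p *v y) = hwt a b p * scalar_product r y"
    proof (cases "ws = []")
      case True
      then show ?thesis using ws hwvD(1)[OF hw p] by (simp add: scalar_product_smult_right)
    next
      case False
      then have "y \<in> Low" using ws unfolding Low_def by (intro vec.span_base) auto
      moreover obtain k where "\<rho> p p *v y = k *s y" using word_diag[OF ws(2) p] ws by auto
      ultimately show ?thesis using r(1) by (simp add: scalar_product_smult_right)
    qed
    then show ?case using step(2)
      by (simp add: matrix_vector_right_distrib scalar_product_add_right scalar_product_smult_right algebra_simps)
  qed
  show ?thesis
    by (rule that[of r]) (use r diag UF lowering_F in auto)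
qed

end

section \<open>The monomial family of an irreducible representation\<close>

text \<open>A family indexed by the exponents of
  \<open>y\<^sub>1\<^bsup>i1\<^esup> y\<^sub>2\<^bsup>i2\<^esup> y\<^sub>3\<^bsup>i3\<^esup> \<beta>\<^sub>1\<^bsup>j1\<^esup> \<beta>\<^sub>2\<^bsup>j2\<^esup> \<beta>\<^sub>3\<^bsup>j3\<^esup>\<close>, each divided by
  the factorials of its exponents, where \<open>y\<close> is a vector and \<open>\<beta>\<close> a covector.  With divided powers,
  extending by 0 to negative exponents is consistent with the action of the derivations
  \<open>y\<^sub>p \<partial>/\<partial>y\<^sub>q - \<beta>\<^sub>q \<partial>/\<partial>\<beta>\<^sub>p\<close>.\<close>

type_synonym 'c family = "int \<Rightarrow> int \<Rightarrow> int \<Rightarrow> int \<Rightarrow> int \<Rightarrow> int \<Rightarrow> 'c"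

text \<open>\<open>der s p q F\<close> is the transpose of the action of \<open>e\<^sub>p\<^sub>q\<close>, shifted on the diagonal by \<open>s\<close>.\<close>

definition der :: "complex \<Rightarrow> nat \<Rightarrow> nat \<Rightarrow> complex family \<Rightarrow> complex family" where
  "der s p q F i1 i2 i3 j1 j2 j3 =
    (if p = 1 \<and> q = 1 then (of_int (i1 - j1) - s) * F i1 i2 i3 j1 j2 j3
     else if p = 2 \<and> q = 2 then (of_int (i2 - j2) - s) * F i1 i2 i3 j1 j2 j3
     else if p = 3 \<and> q = 3 then (of_int (i3 - j3) - s) * F i1 i2 i3 j1 j2 j3
     else if p = 1 \<and> q = 2 then of_int (i1 + 1) * F (i1 + 1) (i2 - 1) i3 j1 j2 j3 - of_int (j2 + 1) * F i1 i2 i3 (j1 - 1) (j2 + 1) j3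
     else if p = 1 \<and> q = 3 then of_int (i1 + 1) * F (i1 + 1) i2 (i3 - 1) j1 j2 j3 - of_int (j3 + 1) * F i1 i2 i3 (j1 - 1) j2 (j3 + 1)
     else if p = 2 \<and> q = 3 then of_int (i2 + 1) * F i1 (i2 + 1) (i3 - 1) j1 j2 j3 - of_int (j3 + 1) * F i1 i2 i3 j1 (j2 - 1) (j3 + 1)
     else if p = 2 \<and> q = 1 then of_int (i2 + 1) * F (i1 - 1) (i2 + 1) i3 j1 j2 j3 - of_int (j1 + 1) * F i1 i2 i3 (j1 + 1) (j2 - 1) j3
     else if p = 3 \<and> q = 1 then of_int (i3 + 1) * F (i1 - 1) i2 (i3 + 1) j1 j2 j3 - of_int (j1 + 1) * F i1 i2 i3 (j1 + 1) j2 (j3 - 1)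
     else of_int (i3 + 1) * F i1 (i2 - 1) (i3 + 1) j1 j2 j3 - of_int (j2 + 1) * F i1 i2 i3 j1 (j2 + 1) (j3 - 1))"

lemma der_simps:
  "der s 1 1 F i1 i2 i3 j1 j2 j3 = (of_int (i1 - j1) - s) * F i1 i2 i3 j1 j2 j3"
  "der s 2 2 F i1 i2 i3 j1 j2 j3 = (of_int (i2 - j2) - s) * F i1 i2 i3 j1 j2 j3"
  "der s 3 3 F i1 i2 i3 j1 j2 j3 = (of_int (i3 - j3) - s) * F i1 i2 i3 j1 j2 j3"
  "der s 1 2 F i1 i2 i3 j1 j2 j3 = of_int (i1 + 1) * F (i1 + 1) (i2 - 1) i3 j1 j2 j3 - of_int (j2 + 1) * F i1 i2 i3 (j1 - 1) (j2 + 1) j3"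
  "der s 1 3 F i1 i2 i3 j1 j2 j3 = of_int (i1 + 1) * F (i1 + 1) i2 (i3 - 1) j1 j2 j3 - of_int (j3 + 1) * F i1 i2 i3 (j1 - 1) j2 (j3 + 1)"
  "der s 2 3 F i1 i2 i3 j1 j2 j3 = of_int (i2 + 1) * F i1 (i2 + 1) (i3 - 1) j1 j2 j3 - of_int (j3 + 1) * F i1 i2 i3 j1 (j2 - 1) (j3 + 1)"
  "der s 2 1 F i1 i2 i3 j1 j2 j3 = of_int (i2 + 1) * F (i1 - 1) (i2 + 1) i3 j1 j2 j3 - of_int (j1 + 1) * F i1 i2 i3 (j1 + 1) (j2 - 1) j3"
  "der s 3 1 F i1 i2 i3 j1 j2 j3 = of_int (i3 + 1) * F (i1 - 1) i2 (i3 + 1) j1 j2 j3 - of_int (j1 + 1) * F i1 i2 i3 (j1 + 1) j2 (j3 - 1)"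
  "der s 3 2 F i1 i2 i3 j1 j2 j3 = of_int (i3 + 1) * F i1 (i2 - 1) (i3 + 1) j1 j2 j3 - of_int (j2 + 1) * F i1 i2 i3 j1 (j2 + 1) (j3 - 1)"
  by (simp_all add: der_def)

text \<open>The products are in the opposite order to \<open>sl3_rep_commute\<close>, as
  transposition requires.\<close>

lemma der_commute:
  assumes "p \<in> {1..3}" "q \<in> {1..3}" "r \<in> {1..3}" "s \<in> {1..3}"
  shows "der t r s (der t p q F) i1 i2 i3 j1 j2 j3 = der t p q (der t r s F) i1 i2 i3 j1 j2 j3
    + (if q = r then der t p s F i1 i2 i3 j1 j2 j3 else 0) - (if s = p then der t r q F i1 i2 i3 j1 j2 j3 else 0)"
  using assms unfolding range3
  by (elim disjE; simp only:; simp add: der_simps[unfolded One_nat_def] algebra_simps)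

text \<open>The head acts last here and first in \<open>wact\<close>, since the derivations are
  transposes of the generators.\<close>

primrec der_word :: "complex \<Rightarrow> complex family \<Rightarrow> (nat \<times> nat) list \<Rightarrow> complex family" where
  "der_word s F [] = F"
| "der_word s F (g # ws) = der s (fst g) (snd g) (der_word s F ws)"

lemma der_word_append: "der_word s F (ws @ vs) = der_word s (der_word s F vs) ws"
  by (induction ws) auto

lemma der_linear:
  "der s p q (\<lambda>i1 i2 i3 j1 j2 j3. F i1 i2 i3 j1 j2 j3 + c * G i1 i2 i3 j1 j2 j3) i1 i2 i3 j1 j2 j3 =
   der s p q F i1 i2 i3 j1 j2 j3 + c * der s p q G i1 i2 i3 j1 j2 j3"
  unfolding der_def by (simp add: algebra_simps)

lemma der_word_linear:
  "der_word s (\<lambda>i1 i2 i3 j1 j2 j3. F i1 i2 i3 j1 j2 j3 + c * G i1 i2 i3 j1 j2 j3) ws =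
   (\<lambda>i1 i2 i3 j1 j2 j3. der_word s F ws i1 i2 i3 j1 j2 j3 + c * der_word s G ws i1 i2 i3 j1 j2 j3)"
proof (induction ws)
  case (Cons g ws)
  show ?case unfolding der_word.simps Cons by (intro ext) (rule der_linear)
qed simp

lemma der_zero: "der s p q (\<lambda>i1 i2 i3 j1 j2 j3. 0) = (\<lambda>i1 i2 i3 j1 j2 j3. 0)"
  by (simp add: der_def fun_eq_iff)

lemma der_word_zero: "der_word s (\<lambda>i1 i2 i3 j1 j2 j3. 0) ws = (\<lambda>i1 i2 i3 j1 j2 j3. 0)"
  by (induction ws) (auto simp: der_zero)

lemma der_word_swap:
  assumes "p \<in> {1..3}" "q \<in> {1..3}" "r \<in> {1..3}" "s \<in> {1..3}"
  shows "der_word t F (pre @ (r,s) # (p,q) # post) i1 i2 i3 j1 j2 j3 =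
     der_word t F (pre @ (p,q) # (r,s) # post) i1 i2 i3 j1 j2 j3
     + (if q = r then der_word t F (pre @ (p,s) # post) i1 i2 i3 j1 j2 j3 else 0)
     - (if s = p then der_word t F (pre @ (r,q) # post) i1 i2 i3 j1 j2 j3 else 0)"
proof -
  let ?G = "der_word t F post"
  define c1 c2 :: complex where "c1 = (if q = r then 1 else 0)" and "c2 = (if s = p then -1 else 0)"
  have "der t r s (der t p q ?G) = (\<lambda>i1 i2 i3 j1 j2 j3.
      (der t p q (der t r s ?G) i1 i2 i3 j1 j2 j3 + c1 * der t p s ?G i1 i2 i3 j1 j2 j3) + c2 * der t r q ?G i1 i2 i3 j1 j2 j3)"
    using der_commute[OF assms, of t ?G] by (auto simp: fun_eq_iff c1_def c2_def)
  then show ?thesis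
    by (simp add: der_word_append der_word_linear c1_def c2_def)
qed

section \<open>Support, bidegree and trace relation of families\<close>

definition vanish_neg :: "complex family \<Rightarrow> bool" where
  "vanish_neg F \<longleftrightarrow> (\<forall>i1 i2 i3 j1 j2 j3. i1 < 0 \<or> i2 < 0 \<or> i3 < 0 \<or> j1 < 0 \<or> j2 < 0 \<or> j3 < 0
     \<longrightarrow> F i1 i2 i3 j1 j2 j3 = 0)"

text \<open>The divided-power monomial with these exponents, multiplied by the invariant y_1
  \<beta>_1 + y_2 \<beta>_2 + y_3 \<beta>_3; the integer factors come from the divided powers. Its
  vanishing is the relation that cuts out the irreducible quotient.\<close>

definition trace_of :: "complex family \<Rightarrow> complex family" where
  "trace_of F i1 i2 i3 j1 j2 j3 =
     of_int (i1 + 1) * of_int (j1 + 1) * F (i1 + 1) i2 i3 (j1 + 1) j2 j3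
   + of_int (i2 + 1) * of_int (j2 + 1) * F i1 (i2 + 1) i3 j1 (j2 + 1) j3
   + of_int (i3 + 1) * of_int (j3 + 1) * F i1 i2 (i3 + 1) j1 j2 (j3 + 1)"

definition trace_zero :: "complex family \<Rightarrow> bool" where
  "trace_zero F \<longleftrightarrow> trace_of F = (\<lambda>i1 i2 i3 j1 j2 j3. 0)"

definition bidegree :: "int \<Rightarrow> int \<Rightarrow> complex family \<Rightarrow> bool" where
  "bidegree a b F \<longleftrightarrow> (\<forall>i1 i2 i3 j1 j2 j3. i1 + i2 + i3 \<noteq> a \<or> j1 + j2 + j3 \<noteq> b \<longrightarrow> F i1 i2 i3 j1 j2 j3 = 0)"

text \<open>An exponent leaves the negative range only from -1, and there its factor
  \<open>k + 1\<close> is 0; all other terms keep a negative exponent.\<close>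

lemma vanish_neg_der:
  assumes "vanish_neg F" shows "vanish_neg (der s p q F)"
proof -
  have F: "F i1 i2 i3 j1 j2 j3 = 0" if "i1 < 0 \<or> i2 < 0 \<or> i3 < 0 \<or> j1 < 0 \<or> j2 < 0 \<or> j3 < 0" for i1 i2 i3 j1 j2 j3
    using assms that unfolding vanish_neg_def by blast
  have G: "of_int (k + 1) * c = (0::complex)" if "c = 0 \<or> k + 1 = 0" for k c using that by (auto simp flip: of_int_add)
  show ?thesis
    unfolding vanish_neg_def
  proof (intro allI impI)
    fix i1 i2 i3 j1 j2 j3 :: int
    assume neg: "i1 < 0 \<or> i2 < 0 \<or> i3 < 0 \<or> j1 < 0 \<or> j2 < 0 \<or> j3 < 0"
    have diag: "F i1 i2 i3 j1 j2 j3 = 0" using F neg by blast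
    have up: "of_int (i1 + 1) * F (i1 + 1) (i2 - 1) i3 j1 j2 j3 = 0"
      "of_int (i1 + 1) * F (i1 + 1) i2 (i3 - 1) j1 j2 j3 = 0"
      "of_int (i2 + 1) * F i1 (i2 + 1) (i3 - 1) j1 j2 j3 = 0"
      "of_int (i2 + 1) * F (i1 - 1) (i2 + 1) i3 j1 j2 j3 = 0"
      "of_int (i3 + 1) * F (i1 - 1) i2 (i3 + 1) j1 j2 j3 = 0"
      "of_int (i3 + 1) * F i1 (i2 - 1) (i3 + 1) j1 j2 j3 = 0"
      "of_int (j2 + 1) * F i1 i2 i3 (j1 - 1) (j2 + 1) j3 = 0"
      "of_int (j3 + 1) * F i1 i2 i3 (j1 - 1) j2 (j3 + 1) = 0"
      "of_int (j3 + 1) * F i1 i2 i3 j1 (j2 - 1) (j3 + 1) = 0"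
      "of_int (j1 + 1) * F i1 i2 i3 (j1 + 1) (j2 - 1) j3 = 0"
      "of_int (j1 + 1) * F i1 i2 i3 (j1 + 1) j2 (j3 - 1) = 0"
      "of_int (j2 + 1) * F i1 i2 i3 j1 (j2 + 1) (j3 - 1) = 0"
      by (rule G, rule disjCI, rule F, use neg in presburger)+
    show "der s p q F i1 i2 i3 j1 j2 j3 = 0"
      unfolding der_def diag up by simp
  qed
qed

text \<open>The last branch of \<open>der\<close> also catches indices outside the range, so an
  identity checked for the nine genuine index pairs holds for all \<open>p\<close> and
  \<open>q\<close>.\<close>

lemma der_cases:
  obtains "p = 1" "q = 1" | "p = 2" "q = 2" | "p = 3" "q = 3" | "p = 1" "q = 2" | "p = 1" "q = 3" | "p = 2" "q = 3"
    | "p = 2" "q = 1" | "p = 3" "q = 1" | "p = 3" "q = 2" | "\<And>F. der s p q F = der s 3 2 F"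
proof -
  have "der s p q F = der s 3 2 F" if c: "\<not> (p = 1 \<and> q = 1)" "\<not> (p = 2 \<and> q = 2)" "\<not> (p = 3 \<and> q = 3)"
    "\<not> (p = 1 \<and> q = 2)" "\<not> (p = 1 \<and> q = 3)" "\<not> (p = 2 \<and> q = 3)" "\<not> (p = 2 \<and> q = 1)" "\<not> (p = 3 \<and> q = 1)" for F
    unfolding fun_eq_iff by (subst der_def, simp only: c if_False) (simp add: der_def)
  then show ?thesis using that by metis
qed

lemma trace_of_der: "trace_of (der s p q F) = der s p q (trace_of F)"
proof -
  have cases: "trace_of (der s 1 1 F) i1 i2 i3 j1 j2 j3 = der s 1 1 (trace_of F) i1 i2 i3 j1 j2 j3"
    "trace_of (der s 1 2 F) i1 i2 i3 j1 j2 j3 = der s 1 2 (trace_of F) i1 i2 i3 j1 j2 j3"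
    "trace_of (der s 1 3 F) i1 i2 i3 j1 j2 j3 = der s 1 3 (trace_of F) i1 i2 i3 j1 j2 j3"
    "trace_of (der s 2 1 F) i1 i2 i3 j1 j2 j3 = der s 2 1 (trace_of F) i1 i2 i3 j1 j2 j3"
    "trace_of (der s 2 2 F) i1 i2 i3 j1 j2 j3 = der s 2 2 (trace_of F) i1 i2 i3 j1 j2 j3"
    "trace_of (der s 2 3 F) i1 i2 i3 j1 j2 j3 = der s 2 3 (trace_of F) i1 i2 i3 j1 j2 j3"
    "trace_of (der s 3 1 F) i1 i2 i3 j1 j2 j3 = der s 3 1 (trace_of F) i1 i2 i3 j1 j2 j3"
    "trace_of (der s 3 2 F) i1 i2 i3 j1 j2 j3 = der s 3 2 (trace_of F) i1 i2 i3 j1 j2 j3"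
    "trace_of (der s 3 3 F) i1 i2 i3 j1 j2 j3 = der s 3 3 (trace_of F) i1 i2 i3 j1 j2 j3" for i1 i2 i3 j1 j2 j3
    unfolding trace_of_def der_simps by (simp_all add: algebra_simps)
  show ?thesis
    unfolding fun_eq_iff by (rule der_cases[where p = p and q = q and s = s]; simp only: cases simp_thms)
qed

lemma trace_zero_der: "trace_zero F \<Longrightarrow> trace_zero (der s p q F)"
  by (simp add: trace_zero_def trace_of_der der_zero)

lemma bidegree_der:
  assumes "bidegree a b F" shows "bidegree a b (der s p q F)"
proof -
  have F: "F i1 i2 i3 j1 j2 j3 = 0" if "i1 + i2 + i3 \<noteq> a \<or> j1 + j2 + j3 \<noteq> b" for i1 i2 i3 j1 j2 j3
    using assms that unfolding bidegree_def by blast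
  show ?thesis
    unfolding bidegree_def
  proof (intro allI impI)
    fix i1 i2 i3 j1 j2 j3 :: int
    assume h: "i1 + i2 + i3 \<noteq> a \<or> j1 + j2 + j3 \<noteq> b"
    have z: "F i1 i2 i3 j1 j2 j3 = 0"
      "F (i1 + 1) (i2 - 1) i3 j1 j2 j3 = 0" "F (i1 + 1) i2 (i3 - 1) j1 j2 j3 = 0"
      "F i1 (i2 + 1) (i3 - 1) j1 j2 j3 = 0" "F (i1 - 1) (i2 + 1) i3 j1 j2 j3 = 0"
      "F (i1 - 1) i2 (i3 + 1) j1 j2 j3 = 0" "F i1 (i2 - 1) (i3 + 1) j1 j2 j3 = 0"
      "F i1 i2 i3 (j1 - 1) (j2 + 1) j3 = 0" "F i1 i2 i3 (j1 - 1) j2 (j3 + 1) = 0"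
      "F i1 i2 i3 j1 (j2 - 1) (j3 + 1) = 0" "F i1 i2 i3 (j1 + 1) (j2 - 1) j3 = 0"
      "F i1 i2 i3 (j1 + 1) j2 (j3 - 1) = 0" "F i1 i2 i3 j1 (j2 + 1) (j3 - 1) = 0"
      by (rule F, use h in presburger)+
    show "der s p q F i1 i2 i3 j1 j2 j3 = 0"
      unfolding der_def z by simp
  qed
qed

lemma der_word_invariants:
  "vanish_neg F \<Longrightarrow> vanish_neg (der_word s F ws)"
  "trace_zero F \<Longrightarrow> trace_zero (der_word s F ws)"
  "bidegree a b F \<Longrightarrow> bidegree a b (der_word s F ws)"
  by (induction ws) (auto simp: vanish_neg_der trace_zero_der bidegree_der)

text \<open>The quadratic Casimir element acts by a scalar modulo multiples of \<open>\<Sum>\<^sub>k y\<^sub>k \<beta>\<^sub>k\<close>.\<close>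

definition casimir_gap :: "int \<Rightarrow> int \<Rightarrow> int \<Rightarrow> int \<Rightarrow> int \<Rightarrow> int \<Rightarrow> int" where
  "casimir_gap i1 i2 i3 j1 j2 j3 = i1 * i2 + i1 * i3 + i2 * i3 + j1 * j2 + j1 * j3 + j2 * j3
     + i1 * j1 + i2 * j2 + i3 * j3 + i2 + 2 * i3 + 2 * j1 + j2"

lemma casimir_identity:
  assumes "trace_zero F"
  shows "der s 1 2 (der s 2 1 F) i1 i2 i3 j1 j2 j3 + der s 2 3 (der s 3 2 F) i1 i2 i3 j1 j2 j3
    + der s 1 3 (der s 3 1 F) i1 i2 i3 j1 j2 j3 = of_int (casimir_gap i1 i2 i3 j1 j2 j3) * F i1 i2 i3 j1 j2 j3"
proof -
  define tr where "tr = trace_of F"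
  have tr0: "tr i1 i2 i3 j1 j2 j3 = 0" for i1 i2 i3 j1 j2 j3
    using assms unfolding tr_def trace_zero_def by simp
  \<comment> \<open>An exact identity for every family: the three error terms are trace relations at
    exponents lowered by one.\<close>
  have "der s 1 2 (der s 2 1 F) i1 i2 i3 j1 j2 j3 + der s 2 3 (der s 3 2 F) i1 i2 i3 j1 j2 j3
    + der s 1 3 (der s 3 1 F) i1 i2 i3 j1 j2 j3 = of_int (casimir_gap i1 i2 i3 j1 j2 j3) * F i1 i2 i3 j1 j2 j3
    - tr (i1 - 1) i2 i3 (j1 - 1) j2 j3 - tr i1 (i2 - 1) i3 j1 (j2 - 1) j3 - tr i1 i2 (i3 - 1) j1 j2 (j3 - 1)"
    unfolding der_simps tr_def trace_of_def casimir_gap_def by (simp add: algebra_simps)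
  then show ?thesis unfolding tr0 by simp
qed

text \<open>The last hypothesis says that the height of the monomial below y_1^a \<beta>_3^b is
  positive. The gap can then be divided out in \<open>represents_ex\<close>.\<close>

lemma casimir_gap_pos:
  assumes "i1 \<ge> 0" "i2 \<ge> 0" "i3 \<ge> 0" "j1 \<ge> 0" "j2 \<ge> 0" "j3 \<ge> 0" "i2 + 2 * i3 + 2 * j1 + j2 > 0"
  shows "casimir_gap i1 i2 i3 j1 j2 j3 > 0"
proof -
  have "i1 * i2 \<ge> 0" "i1 * i3 \<ge> 0" "i2 * i3 \<ge> 0" "j1 * j2 \<ge> 0" "j1 * j3 \<ge> 0" "j2 * j3 \<ge> 0"
    "i1 * j1 \<ge> 0" "i2 * j2 \<ge> 0" "i3 * j3 \<ge> 0"
    using assms by simp_all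
  then show ?thesis using assms(7) unfolding casimir_gap_def by linarith
qed

definition top_family :: "nat \<Rightarrow> nat \<Rightarrow> complex family" where
  "top_family a b i1 i2 i3 j1 j2 j3 =
     (if i1 = int a \<and> i2 = 0 \<and> i3 = 0 \<and> j1 = 0 \<and> j2 = 0 \<and> j3 = int b then 1 else 0)"

lemma top_family_invariants:
  "vanish_neg (top_family a b)" "trace_zero (top_family a b)" "bidegree (int a) (int b) (top_family a b)"
proof -
  show "vanish_neg (top_family a b)" "bidegree (int a) (int b) (top_family a b)"
    by (auto simp: vanish_neg_def bidegree_def top_family_def)
  have z: "of_int (k + 1) * of_int (l + 1) * c = (0::complex)" if "k + 1 = 0 \<or> l + 1 = 0 \<or> c = 0" for k l c
    using that by (auto simp flip: of_int_add)
  have "trace_of (top_family a b) i1 i2 i3 j1 j2 j3 = 0 + 0 + 0" for i1 i2 i3 j1 j2 j3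
    unfolding trace_of_def by (intro arg_cong2[where f = "(+)"] z) (auto simp: top_family_def)
  then show "trace_zero (top_family a b)" by (simp add: trace_zero_def fun_eq_iff)
qed

lemma top_family_lowering:
  assumes "(p, q) \<in> lows"
  shows "der s p q (top_family a b) = (\<lambda>i1 i2 i3 j1 j2 j3. 0)"
proof -
  have c: "of_int (k + 1) * (if P then 1 else 0) = (0::complex)" if "P \<longrightarrow> k + 1 = 0" for k P
    using that by (auto simp flip: of_int_add)
  have "p = 2 \<and> q = 1 \<or> p = 3 \<and> q = 1 \<or> p = 3 \<and> q = 2"
    using assms unfolding lows_def gens_def by auto
  then show ?thesis
    by (elim disjE) (simp_all add: fun_eq_iff der_def top_family_def c del: of_int_add)
qed

text \<open>\<open>\<xi>\<close> is the highest-weight covector: the coordinate along \<open>v\<close> which vanishes on the other weight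
  spaces.  Irreducibility is expressed by \<open>sep\<close> and \<open>cyc\<close>, which are exchanged by transposition.\<close>

locale hw_triple =
  fixes \<rho> :: "'n::finite rep" and a b :: nat and v \<xi> :: "complex ^ 'n"
  assumes rep: "sl3_rep \<rho>"
    and hw: "hwv \<rho> (of_nat a) (of_nat b) v"
    and xi_low: "(p, q) \<in> lows \<Longrightarrow> scalar_product \<xi> (\<rho> p q *v w) = 0"
    and xi_diag: "p \<in> {1..3} \<Longrightarrow> scalar_product \<xi> (\<rho> p p *v w) = hwt (of_nat a) (of_nat b) p * scalar_product \<xi> w"
    and norm: "scalar_product \<xi> v = 1"
    and sep: "(\<And>ws. set ws \<subseteq> gens \<Longrightarrow> scalar_product \<xi> (wact \<rho> ws w) = 0) \<Longrightarrow> w = 0"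
    and cyc: "(\<And>ws. set ws \<subseteq> gens \<Longrightarrow> scalar_product r (wact \<rho> ws v) = 0) \<Longrightarrow> r = 0"
begin

text \<open>In bidegree (a, b) the differences i_p - j_p add up to a - b; subtracting a third of
  this from each makes the generators traceless.\<close>

definition shift :: complex where "shift = (of_nat a - of_nat b) / 3"

definition coef :: "(nat \<times> nat) list \<Rightarrow> complex family" where
  "coef ws = der_word shift (top_family a b) ws"

definition represents :: "complex ^ 'n \<Rightarrow> ((nat \<times> nat) list \<Rightarrow> complex) \<Rightarrow> bool" where
  "represents w \<phi> \<longleftrightarrow> (\<forall>ws. set ws \<subseteq> gens \<longrightarrow> scalar_product \<xi> (wact \<rho> ws w) = \<phi> ws)"

lemma represents_unique: "represents w \<phi> \<Longrightarrow> represents w' \<phi> \<Longrightarrow> w = w'"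
  using sep[of "w - w'"] unfolding represents_def by (simp add: wact_diff scalar_product_diff_right)

lemma represents_add: "represents w \<phi> \<Longrightarrow> represents w' \<psi> \<Longrightarrow> represents (w + w') (\<lambda>ws. \<phi> ws + \<psi> ws)"
  and represents_diff: "represents w \<phi> \<Longrightarrow> represents w' \<psi> \<Longrightarrow> represents (w - w') (\<lambda>ws. \<phi> ws - \<psi> ws)"
  and represents_smult: "represents w \<phi> \<Longrightarrow> represents (c *s w) (\<lambda>ws. c * \<phi> ws)"
  unfolding represents_def
  by (simp_all add: wact_add wact_diff wact_smult scalar_product_add_right scalar_product_diff_right scalar_product_smult_right)

lemma represents_act: "represents w \<phi> \<Longrightarrow> (p,q) \<in> gens \<Longrightarrow> represents (\<rho> p q *v w) (\<lambda>ws. \<phi> ((p,q) # ws))"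
  unfolding represents_def
proof (intro allI impI)
  fix ws assume "\<forall>ws. set ws \<subseteq> gens \<longrightarrow> scalar_product \<xi> (wact \<rho> ws w) = \<phi> ws" "(p,q) \<in> gens" "set ws \<subseteq> gens"
  then have "scalar_product \<xi> (wact \<rho> ((p,q) # ws) w) = \<phi> ((p,q) # ws)" by (metis insert_subset list.simps(15))
  then show "scalar_product \<xi> (wact \<rho> ws (\<rho> p q *v w)) = \<phi> ((p,q) # ws)" by simp
qed

lemma coef_Cons: "coef ((p,q) # ws) = der shift p q (coef ws)"
  by (simp add: coef_def)

lemma coef_invariants: "vanish_neg (coef ws)" "trace_zero (coef ws)" "bidegree (int a) (int b) (coef ws)"
  unfolding coef_def by (intro der_word_invariants top_family_invariants)+

lemma scalar_product_swap:
  assumes "set (pre @ (r,s) # (p,q) # post) \<subseteq> gens"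
  shows "scalar_product \<xi> (wact \<rho> (pre @ (r,s) # (p,q) # post) w) = scalar_product \<xi> (wact \<rho> (pre @ (p,q) # (r,s) # post) w)
        + (if q = r then scalar_product \<xi> (wact \<rho> (pre @ (p,s) # post) w) else 0)
        - (if s = p then scalar_product \<xi> (wact \<rho> (pre @ (r,q) # post) w) else 0)"
proof -
  have pq: "p \<in> {1..3}" "q \<in> {1..3}" "r \<in> {1..3}" "s \<in> {1..3}" using assms by (auto simp: gens_def)
  show ?thesis
    using sl3_rep_commute[OF rep pq, of "wact \<rho> pre w"]
    by (simp add: wact_add wact_diff scalar_product_add_right scalar_product_diff_right)
qed

text \<open>Both sides are determined by the highest weight: move a lowering generator to the end.\<close>

lemma represents_top: "represents v (\<lambda>ws. coef ws (int a) 0 0 0 0 (int b))"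
  unfolding represents_def
proof (intro allI impI)
  fix ws :: "(nat \<times> nat) list" assume ws: "set ws \<subseteq> gens"
  define \<delta> where "\<delta> ws = scalar_product \<xi> (wact \<rho> ws v) - coef ws (int a) 0 0 0 0 (int b)" for ws
  have "\<delta> ws = 0"
  proof (rule word_vanish[OF _ _ _ _ ws])
    fix pre post :: "(nat \<times> nat) list" and p q r s
    assume g: "set (pre @ (r,s) # (p,q) # post) \<subseteq> gens"
    have pq: "p \<in> {1..3}" "q \<in> {1..3}" "r \<in> {1..3}" "s \<in> {1..3}" using g by (auto simp: gens_def)
    show "\<delta> (pre @ (r,s) # (p,q) # post) = \<delta> (pre @ (p,q) # (r,s) # post)
        + (if q = r then \<delta> (pre @ (p,s) # post) else 0) - (if s = p then \<delta> (pre @ (r,q) # post) else 0)"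
      unfolding \<delta>_def scalar_product_swap[OF g] coef_def der_word_swap[OF pq] by simp
  next
    fix pre :: "(nat \<times> nat) list" and p q assume "(p,q) \<in> lows"
    then show "\<delta> (pre @ [(p,q)]) = 0"
      unfolding \<delta>_def coef_def by (simp add: xi_low der_word_append top_family_lowering der_word_zero)
  next
    fix p q and ws :: "(nat \<times> nat) list" assume g: "(p,q) \<in> gens" "p \<le> q" "set ws \<subseteq> gens" "\<delta> ws = 0"
    have pq: "p \<in> {1..3}" "q \<in> {1..3}" using g by (auto simp: gens_def)
    have z: "coef ws (int a + 1) (0 - 1) 0 0 0 (int b) = 0" "coef ws (int a + 1) 0 (0 - 1) 0 0 (int b) = 0"
      "coef ws (int a) (0 + 1) (0 - 1) 0 0 (int b) = 0" "coef ws (int a) 0 0 (0 - 1) (0 + 1) (int b) = 0"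
      "coef ws (int a) 0 0 (0 - 1) 0 (int b + 1) = 0" "coef ws (int a) 0 0 0 (0 - 1) (int b + 1) = 0"
      using coef_invariants(1)[of ws] unfolding vanish_neg_def by auto
    show "\<delta> ((p,q) # ws) = 0"
    proof (cases "p = q")
      case True
      have "der shift p p (coef ws) (int a) 0 0 0 0 (int b) = hwt (of_nat a) (of_nat b) p * coef ws (int a) 0 0 0 0 (int b)"
        using pq unfolding range3 by (auto simp: der_simps[unfolded One_nat_def] hwt_def shift_def field_simps)
      then show ?thesis using True g(4) hwvD(1)[OF hw pq(1)]
        unfolding \<delta>_def by (simp add: coef_Cons wact_smult scalar_product_smult_right)
    next
      case False
      have "der shift p q (coef ws) (int a) 0 0 0 0 (int b) = 0"
        using pq False g(2) unfolding range3 der_def z by auto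
      then show ?thesis using False g(2) hwvD(2)[OF hw pq]
        unfolding \<delta>_def by (simp add: coef_Cons)
    qed
  next
    show "\<delta> [] = 0" by (simp add: \<delta>_def coef_def norm top_family_def)
  qed
  then show "scalar_product \<xi> (wact \<rho> ws v) = coef ws (int a) 0 0 0 0 (int b)" by (simp add: \<delta>_def)
qed

section \<open>Existence of the monomials inside the representation\<close>

lemma represents_zero: "represents 0 (\<lambda>ws. 0)"
  by (simp add: represents_def)

lemma represents_ex_neg:
  assumes "i1 < 0 \<or> i2 < 0 \<or> i3 < 0 \<or> j1 < 0 \<or> j2 < 0 \<or> j3 < 0"
  shows "represents 0 (\<lambda>ws. coef ws i1 i2 i3 j1 j2 j3)"
proof -
  have "coef ws i1 i2 i3 j1 j2 j3 = 0" for ws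
    using assms coef_invariants(1)[of ws] unfolding vanish_neg_def by blast
  then show ?thesis using represents_zero by simp
qed

text \<open>Induction on the height. By \<open>casimir_identity\<close>, the gap times the wanted
  monomial is a sum over the three positive roots of a lowering generator applied to a raised
  monomial; the raised monomials have smaller height and are therefore already vectors.\<close>

lemma represents_ex: "\<exists>w. represents w (\<lambda>ws. coef ws i1 i2 i3 j1 j2 j3)"
proof (induction "nat (i2 + 2 * i3 + 2 * j1 + j2)" arbitrary: i1 i2 i3 j1 j2 j3 rule: less_induct)
  case less
  show ?case
  proof (cases "i1 < 0 \<or> i2 < 0 \<or> i3 < 0 \<or> j1 < 0 \<or> j2 < 0 \<or> j3 < 0")
    case True
    then show ?thesis using represents_ex_neg by blast
  next
    case False
    then have nn: "i1 \<ge> 0" "i2 \<ge> 0" "i3 \<ge> 0" "j1 \<ge> 0" "j2 \<ge> 0" "j3 \<ge> 0" by auto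
    show ?thesis
    proof (cases "i2 + 2 * i3 + 2 * j1 + j2 > 0")
      case pos: True
      define g where "g = casimir_gap i1 i2 i3 j1 j2 j3"
      have g: "g > 0" unfolding g_def using casimir_gap_pos[OF nn pos] .
      have IH: "\<exists>w. represents w (\<lambda>ws. coef ws k1 k2 k3 l1 l2 l3)"
        if "k2 + 2 * k3 + 2 * l1 + l2 < i2 + 2 * i3 + 2 * j1 + j2" for k1 k2 k3 l1 l2 l3
        by (rule less) (use that pos in auto)
      obtain w1 w2 w3 w4 w5 w6 where w:
        "represents w1 (\<lambda>ws. coef ws (i1 + 1) (i2 - 1) i3 j1 j2 j3)"
        "represents w2 (\<lambda>ws. coef ws i1 i2 i3 (j1 - 1) (j2 + 1) j3)"
        "represents w3 (\<lambda>ws. coef ws i1 (i2 + 1) (i3 - 1) j1 j2 j3)"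
        "represents w4 (\<lambda>ws. coef ws i1 i2 i3 j1 (j2 - 1) (j3 + 1))"
        "represents w5 (\<lambda>ws. coef ws (i1 + 1) i2 (i3 - 1) j1 j2 j3)"
        "represents w6 (\<lambda>ws. coef ws i1 i2 i3 (j1 - 1) j2 (j3 + 1))"
        using IH[of "i2 - 1" i3 j1 j2 "i1 + 1" j3] IH[of i2 i3 "j1 - 1" "j2 + 1" i1 j3]
          IH[of "i2 + 1" "i3 - 1" j1 j2 i1 j3] IH[of i2 i3 j1 "j2 - 1" i1 "j3 + 1"]
          IH[of i2 "i3 - 1" j1 j2 "i1 + 1" j3] IH[of i2 i3 "j1 - 1" j2 i1 "j3 + 1"] by auto
      have e12: "represents (of_int (i1 + 1) *s w1 - of_int (j2 + 1) *s w2) (\<lambda>ws. der shift 1 2 (coef ws) i1 i2 i3 j1 j2 j3)"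
        and e23: "represents (of_int (i2 + 1) *s w3 - of_int (j3 + 1) *s w4) (\<lambda>ws. der shift 2 3 (coef ws) i1 i2 i3 j1 j2 j3)"
        and e13: "represents (of_int (i1 + 1) *s w5 - of_int (j3 + 1) *s w6) (\<lambda>ws. der shift 1 3 (coef ws) i1 i2 i3 j1 j2 j3)"
        unfolding der_simps using w by (simp_all only: represents_diff represents_smult)
      have "represents (\<rho> 2 1 *v (of_int (i1 + 1) *s w1 - of_int (j2 + 1) *s w2)
          + \<rho> 3 2 *v (of_int (i2 + 1) *s w3 - of_int (j3 + 1) *s w4)
          + \<rho> 3 1 *v (of_int (i1 + 1) *s w5 - of_int (j3 + 1) *s w6))
         (\<lambda>ws. der shift 1 2 (coef ((2,1) # ws)) i1 i2 i3 j1 j2 j3 + der shift 2 3 (coef ((3,2) # ws)) i1 i2 i3 j1 j2 j3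
          + der shift 1 3 (coef ((3,1) # ws)) i1 i2 i3 j1 j2 j3)"
        (is "represents ?w _")
        by (intro represents_add represents_act e12 e23 e13) (auto simp: gens_def)
      then have "represents ?w (\<lambda>ws. of_int g * coef ws i1 i2 i3 j1 j2 j3)"
        unfolding coef_Cons casimir_identity[OF coef_invariants(2)] g_def .
      then have "represents ((1 / of_int g) *s ?w) (\<lambda>ws. (1 / of_int g) * (of_int g * coef ws i1 i2 i3 j1 j2 j3))"
        by (rule represents_smult)
      then show ?thesis using g by auto
    next
      case top: False
      \<comment> \<open>Height 0 and non-negative exponents leave only powers of y_1 and
        \<beta>_3.\<close>
      then have z: "i2 = 0" "i3 = 0" "j1 = 0" "j2 = 0" using nn by auto
      show ?thesis
      proof (cases "i1 = int a \<and> j3 = int b")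
        case True
        then show ?thesis using represents_top z by blast
      next
        case False
        then have "coef ws i1 i2 i3 j1 j2 j3 = 0" for ws
          using coef_invariants(3)[of ws] z unfolding bidegree_def by auto
        then show ?thesis using represents_zero by auto
      qed
    qed
  qed
qed

definition B :: "(complex ^ 'n) family" where
  "B i1 i2 i3 j1 j2 j3 = (SOME w. represents w (\<lambda>ws. coef ws i1 i2 i3 j1 j2 j3))"

lemma represents_B: "represents (B i1 i2 i3 j1 j2 j3) (\<lambda>ws. coef ws i1 i2 i3 j1 j2 j3)"
  unfolding B_def by (rule someI_ex[OF represents_ex])

lemma B_top: "B (int a) 0 0 0 0 (int b) = v"
  by (rule represents_unique[OF represents_B represents_top])

lemma B_neg: "i1 < 0 \<or> i2 < 0 \<or> i3 < 0 \<or> j1 < 0 \<or> j2 < 0 \<or> j3 < 0 \<Longrightarrow> B i1 i2 i3 j1 j2 j3 = 0"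
  by (rule represents_unique[OF represents_B represents_ex_neg])

lemma B_bidegree:
  assumes "i1 + i2 + i3 \<noteq> int a \<or> j1 + j2 + j3 \<noteq> int b"
  shows "B i1 i2 i3 j1 j2 j3 = 0"
proof (rule represents_unique[OF represents_B])
  have "coef ws i1 i2 i3 j1 j2 j3 = 0" for ws
    using coef_invariants(3)[of ws] assms unfolding bidegree_def by blast
  then show "represents 0 (\<lambda>ws. coef ws i1 i2 i3 j1 j2 j3)" using represents_zero by simp
qed

lemma B_trace:
  "of_int ((i1 + 1) * (j1 + 1)) *s B (i1 + 1) i2 i3 (j1 + 1) j2 j3
   + of_int ((i2 + 1) * (j2 + 1)) *s B i1 (i2 + 1) i3 j1 (j2 + 1) j3
   + of_int ((i3 + 1) * (j3 + 1)) *s B i1 i2 (i3 + 1) j1 j2 (j3 + 1) = 0" (is "?w = 0")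
proof (rule represents_unique[OF _ represents_zero])
  have "represents ?w (\<lambda>ws. of_int ((i1 + 1) * (j1 + 1)) * coef ws (i1 + 1) i2 i3 (j1 + 1) j2 j3
   + of_int ((i2 + 1) * (j2 + 1)) * coef ws i1 (i2 + 1) i3 j1 (j2 + 1) j3
   + of_int ((i3 + 1) * (j3 + 1)) * coef ws i1 i2 (i3 + 1) j1 j2 (j3 + 1))" (is "represents _ ?\<phi>")
    by (intro represents_add represents_smult represents_B)
  moreover have "?\<phi> ws = 0" for ws
    using coef_invariants(2)[of ws] unfolding trace_zero_def trace_of_def fun_eq_iff of_int_mult by blast
  ultimately show "represents ?w (\<lambda>ws. 0)" by simp
qed

lemma B_actionI:
  assumes "p \<in> {1..3}" "q \<in> {1..3}" "represents w (\<lambda>ws. der shift p q (coef ws) i1 i2 i3 j1 j2 j3)"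
  shows "\<rho> p q *v B i1 i2 i3 j1 j2 j3 = w"
  using represents_unique[OF represents_act[OF represents_B] assms(3)[folded coef_Cons]] assms(1,2) by (auto simp: gens_def)

lemma B_action:
  "\<rho> 1 2 *v B i1 i2 i3 j1 j2 j3 = of_int (i1 + 1) *s B (i1 + 1) (i2 - 1) i3 j1 j2 j3 - of_int (j2 + 1) *s B i1 i2 i3 (j1 - 1) (j2 + 1) j3"
  "\<rho> 1 3 *v B i1 i2 i3 j1 j2 j3 = of_int (i1 + 1) *s B (i1 + 1) i2 (i3 - 1) j1 j2 j3 - of_int (j3 + 1) *s B i1 i2 i3 (j1 - 1) j2 (j3 + 1)"
  "\<rho> 2 3 *v B i1 i2 i3 j1 j2 j3 = of_int (i2 + 1) *s B i1 (i2 + 1) (i3 - 1) j1 j2 j3 - of_int (j3 + 1) *s B i1 i2 i3 j1 (j2 - 1) (j3 + 1)"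
  "\<rho> 2 1 *v B i1 i2 i3 j1 j2 j3 = of_int (i2 + 1) *s B (i1 - 1) (i2 + 1) i3 j1 j2 j3 - of_int (j1 + 1) *s B i1 i2 i3 (j1 + 1) (j2 - 1) j3"
  "\<rho> 3 1 *v B i1 i2 i3 j1 j2 j3 = of_int (i3 + 1) *s B (i1 - 1) i2 (i3 + 1) j1 j2 j3 - of_int (j1 + 1) *s B i1 i2 i3 (j1 + 1) j2 (j3 - 1)"
  "\<rho> 3 2 *v B i1 i2 i3 j1 j2 j3 = of_int (i3 + 1) *s B i1 (i2 - 1) (i3 + 1) j1 j2 j3 - of_int (j2 + 1) *s B i1 i2 i3 j1 (j2 + 1) (j3 - 1)"
  "\<rho> 1 1 *v B i1 i2 i3 j1 j2 j3 = (of_int (i1 - j1) - shift) *s B i1 i2 i3 j1 j2 j3"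
  "\<rho> 2 2 *v B i1 i2 i3 j1 j2 j3 = (of_int (i2 - j2) - shift) *s B i1 i2 i3 j1 j2 j3"
  "\<rho> 3 3 *v B i1 i2 i3 j1 j2 j3 = (of_int (i3 - j3) - shift) *s B i1 i2 i3 j1 j2 j3"
  by (rule B_actionI, simp, simp, unfold der_simps, intro represents_diff represents_smult represents_B)+

lemma xi_B: "scalar_product \<xi> (B i1 i2 i3 j1 j2 j3) = top_family a b i1 i2 i3 j1 j2 j3"
  using represents_B[of i1 i2 i3 j1 j2 j3] unfolding represents_def
  by (metis coef_def der_word.simps(1) empty_subsetI list.set(1) wact.simps(1))

end

text \<open>For any covector \<open>r\<close>, the vectors whose images under all words are killed
  by \<open>r\<close> form an invariant subspace, which is 0 or everything. For
  \<open>r = \<xi>\<close> it does not contain \<open>v\<close>, which gives \<open>sep\<close>; if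
  it contains \<open>v\<close> it is everything and \<open>r\<close> is 0, which gives
  \<open>cyc\<close>.\<close>

lemma irrep_hw_triple:
  assumes irr: "irrep \<rho> m\<^sub>1 m\<^sub>2" and pos: "m\<^sub>1 > 0" "m\<^sub>2 > 0"
  shows "\<exists>v \<xi>. hw_triple \<rho> (m\<^sub>1 - 1) (m\<^sub>2 - 1) v \<xi>"
proof -
  have rep: "sl3_rep \<rho>" and U: "irreducible_subrep \<rho> UNIV" using irr unfolding irrep_def irrep_on_def by auto
  obtain v where v: "v \<noteq> 0" "v \<in> highest_weight_space \<rho> m\<^sub>1 m\<^sub>2" using irr unfolding irrep_def irrep_on_def by auto
  have hw: "hwv \<rho> (of_nat (m\<^sub>1 - 1)) (of_nat (m\<^sub>2 - 1)) v"
    using v(2) pos highest_weight_space_iff[OF rep] by (simp add: of_nat_diff)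
  interpret hw_vector \<rho> "of_nat (m\<^sub>1 - 1)" "of_nat (m\<^sub>2 - 1)" v by unfold_locales (fact rep, fact hw)
  obtain \<xi> where xi: "scalar_product \<xi> v = 1"
    "\<And>p q u. (p,q) \<in> lows \<Longrightarrow> scalar_product \<xi> (\<rho> p q *v u) = 0"
    "\<And>p u. p \<in> {1..3} \<Longrightarrow> scalar_product \<xi> (\<rho> p p *v u) = hwt (of_nat (m\<^sub>1 - 1)) (of_nat (m\<^sub>2 - 1)) p * scalar_product \<xi> u"
    by (rule highest_weight_functional[OF U UNIV_I v(1)]) (rule that, auto)
  have annihilator: "invariant_subspace \<rho> {w. \<forall>ws. set ws \<subseteq> gens \<longrightarrow> scalar_product r (wact \<rho> ws w) = 0}" for r
    unfolding invariant_subspace_def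
  proof (intro conjI ballI)
    show "vec.subspace {w. \<forall>ws. set ws \<subseteq> gens \<longrightarrow> scalar_product r (wact \<rho> ws w) = 0}"
      by (auto simp: vec.subspace_def wact_add wact_smult scalar_product_add_right scalar_product_smult_right)
    fix p q :: nat and w assume pq: "p \<in> {1..3}" "q \<in> {1..3}" and w: "w \<in> {w. \<forall>ws. set ws \<subseteq> gens \<longrightarrow> scalar_product r (wact \<rho> ws w) = 0}"
    show "\<rho> p q *v w \<in> {w. \<forall>ws. set ws \<subseteq> gens \<longrightarrow> scalar_product r (wact \<rho> ws w) = 0}"
    proof (clarify)
      fix ws :: "(nat \<times> nat) list" assume "set ws \<subseteq> gens"
      then have "set ((p,q) # ws) \<subseteq> gens" using pq by (auto simp: gens_def)
      then have "scalar_product r (wact \<rho> ((p,q) # ws) w) = 0" using w by blast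
      then show "scalar_product r (wact \<rho> ws (\<rho> p q *v w)) = 0" by simp
    qed
  qed
  have dich: "{w. \<forall>ws. set ws \<subseteq> gens \<longrightarrow> scalar_product r (wact \<rho> ws w) = 0} \<noteq> {0} \<Longrightarrow>
      {w. \<forall>ws. set ws \<subseteq> gens \<longrightarrow> scalar_product r (wact \<rho> ws w) = 0} = UNIV" for r
    using irreducible_subrepD(3)[OF U annihilator[of r] subset_UNIV] .
  have "hw_triple \<rho> (m\<^sub>1 - 1) (m\<^sub>2 - 1) v \<xi>"
  proof
    fix w assume w: "\<And>ws. set ws \<subseteq> gens \<Longrightarrow> scalar_product \<xi> (wact \<rho> ws w) = 0"
    show "w = 0"
    proof (rule ccontr)
      assume "w \<noteq> 0"
      then have "{w. \<forall>ws. set ws \<subseteq> gens \<longrightarrow> scalar_product \<xi> (wact \<rho> ws w) = 0} = UNIV"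
        using dich[of \<xi>] w by blast
      then have "scalar_product \<xi> (wact \<rho> [] v) = 0" by (metis (mono_tags, lifting) UNIV_I empty_subsetI list.set(1) mem_Collect_eq)
      then show False using xi(1) by simp
    qed
  next
    fix r assume r: "\<And>ws. set ws \<subseteq> gens \<Longrightarrow> scalar_product r (wact \<rho> ws v) = 0"
    have "{w. \<forall>ws. set ws \<subseteq> gens \<longrightarrow> scalar_product r (wact \<rho> ws w) = 0} = UNIV"
      using dich[of r] r v(1) by blast
    then have "scalar_product r (wact \<rho> [] w) = 0" for w by (metis (mono_tags, lifting) UNIV_I empty_subsetI list.set(1) mem_Collect_eq)
    then show "r = 0" by (intro scalar_product_eq_0_all) (simp add: scalar_product_commute)
  qed (use xi rep hw in auto)
  then show ?thesis by blast
qed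

subsection \<open>Transposed representations\<close>

definition transp :: "'n::finite rep \<Rightarrow> 'n rep" where
  "transp \<rho> p q = transpose (\<rho> q p)"

lemma transpose_diff: "transpose (A - B) = transpose A - transpose (B :: 'a::ab_group_add ^'n^'m)"
  and transpose_add: "transpose (A + B) = transpose A + transpose B"
  and transpose_zero [simp]: "transpose (0 :: 'a ^'n^'m) = 0"
  and transpose_smult: "transpose (r *\<^sub>R C) = r *\<^sub>R transpose (C :: 'b::real_vector^'n^'m)"
  by (simp_all add: transpose_def vec_eq_iff)

lemma transpose_sum: "transpose (\<Sum>i\<in>I. f i) = (\<Sum>i\<in>I. transpose (f i :: 'a::ab_group_add ^'n^'m))"
  by (induction I rule: infinite_finite_induct) (auto simp: transpose_add)

lemma sl3_rep_transp:
  assumes rep: "sl3_rep \<rho>" shows "sl3_rep (transp \<rho>)"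
  unfolding sl3_rep_def
proof (intro conjI ballI)
  fix p q r s :: nat assume h: "p \<in> {1..3}" "q \<in> {1..3}" "r \<in> {1..3}" "s \<in> {1..3}"
  have "\<rho> s r ** \<rho> q p - \<rho> q p ** \<rho> s r = (if r = q then \<rho> s p else 0) - (if p = s then \<rho> q r else 0)"
    using rep h unfolding sl3_rep_def by blast
  then have "transpose (\<rho> s r ** \<rho> q p - \<rho> q p ** \<rho> s r) = transpose ((if r = q then \<rho> s p else 0) - (if p = s then \<rho> q r else 0))"
    by simp
  then show "transp \<rho> p q ** transp \<rho> r s - transp \<rho> r s ** transp \<rho> p q =
     (if q = r then transp \<rho> p s else 0) - (if s = p then transp \<rho> r q else 0)"
    unfolding transp_def transpose_diff matrix_transpose_mul by auto
next
  show "(\<Sum>i\<in>{1..3}. transp \<rho> i i) = 0"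
    using rep unfolding sl3_rep_def transp_def transpose_sum[symmetric] by simp
qed

lemma scalar_product_transp:
  "scalar_product r (transp \<rho> p q *v w) = scalar_product (\<rho> q p *v r) w"
  by (simp only: transp_def scalar_product_matrix transpose_transpose)

lemma scalar_product_wact_transp:
  "scalar_product r (wact (transp \<rho>) ws w) = scalar_product (wact \<rho> (rev (map prod.swap ws)) r) w"
  by (induction ws arbitrary: w) (auto simp: scalar_product_transp)

lemma scalar_product_eqI:
  assumes "\<And>w. scalar_product r w = scalar_product s (w :: 'a::comm_ring_1 ^'n)"
  shows "r = s"
proof -
  have "r - s = 0"
    by (rule scalar_product_eq_0_all) (simp add: scalar_product_diff_right assms scalar_product_commute[of _ r] scalar_product_commute[of _ s])
  then show ?thesis by simp
qed

text \<open>\<open>v\<close> and \<open>\<xi>\<close> exchange roles; words are reversed and their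
  index pairs swapped, while the highest weight stays the same.\<close>

lemma hw_triple_transp:
  assumes "hw_triple \<rho> a b v \<xi>"
  shows "hw_triple (transp \<rho>) a b \<xi> v"
proof -
  interpret hw_triple \<rho> a b v \<xi> by fact
  have words: "set (rev (map prod.swap ws)) \<subseteq> gens \<longleftrightarrow> set ws \<subseteq> gens" for ws
    by (auto simp: gens_def)
  have rev_rev: "rev (map prod.swap (rev (map prod.swap ws))) = ws" for ws :: "(nat \<times> nat) list"
    by (simp add: rev_map o_def)
  show ?thesis
  proof
    show "sl3_rep (transp \<rho>)" using rep by (rule sl3_rep_transp)
    show "hwv (transp \<rho>) (of_nat a) (of_nat b) \<xi>"
      unfolding hwv_def
    proof (intro conjI ballI impI)
      fix p q :: nat assume p: "p \<in> {1..3}"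
      show "transp \<rho> p p *v \<xi> = hwt (of_nat a) (of_nat b) p *s \<xi>"
        by (rule scalar_product_eqI) (simp add: scalar_product_commute[of "transp \<rho> p p *v \<xi>"] scalar_product_transp
           scalar_product_smult_left xi_diag[OF p] scalar_product_commute[of "\<rho> p p *v _"])
      assume q: "q \<in> {1..3}" "p < q"
      show "transp \<rho> p q *v \<xi> = 0"
        by (rule scalar_product_eqI) (use p q in \<open>simp add: scalar_product_commute[of "transp \<rho> p q *v \<xi>"] scalar_product_transp
           xi_low scalar_product_commute[of "\<rho> q p *v _"] lows_def gens_def\<close>)
    qed
    show "scalar_product v (transp \<rho> p q *v w) = 0" if "(p,q) \<in> lows" for p q w
      using that hwvD(2)[OF hw, of q p] by (simp add: scalar_product_transp lows_def gens_def)
    show "scalar_product v (transp \<rho> p p *v w) = hwt (of_nat a) (of_nat b) p * scalar_product v w" if "p \<in> {1..3}" for p w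
      using that hwvD(1)[OF hw, of p] by (simp add: scalar_product_transp scalar_product_smult_left)
    show "scalar_product v \<xi> = 1" using norm by (simp add: scalar_product_commute)
    show "w = 0" if h: "\<And>ws. set ws \<subseteq> gens \<Longrightarrow> scalar_product v (wact (transp \<rho>) ws w) = 0" for w
    proof (rule cyc)
      fix ws :: "(nat \<times> nat) list" assume "set ws \<subseteq> gens"
      then show "scalar_product w (wact \<rho> ws v) = 0"
        using h[of "rev (map prod.swap ws)"] words[of ws] rev_rev[of ws]
        unfolding scalar_product_wact_transp by (simp add: scalar_product_commute)
    qed
    show "r = 0" if h: "\<And>ws. set ws \<subseteq> gens \<Longrightarrow> scalar_product r (wact (transp \<rho>) ws \<xi>) = 0" for r
    proof (rule sep)
      fix ws :: "(nat \<times> nat) list" assume "set ws \<subseteq> gens"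
      then show "scalar_product \<xi> (wact \<rho> ws r) = 0"
        using h[of "rev (map prod.swap ws)"] words[of ws] rev_rev[of ws]
        unfolding scalar_product_wact_transp by (simp add: scalar_product_commute)
    qed
  qed
qed

subsection \<open>Weight spaces\<close>

text \<open>Split \<open>w\<close> according to the eigenvalues of the spanning vectors: the part
  from the other eigenvalues is itself an eigenvector for \<open>\<kappa>\<close>, hence 0.\<close>

lemma span_eigenspace:
  assumes A: "\<And>z. z \<in> A \<Longrightarrow> \<exists>k. H *v z = k *s z"
    and w: "w \<in> vec.span A" "H *v w = \<kappa> *s w"
  shows "w \<in> vec.span {z \<in> A. H *v z = \<kappa> *s (z :: complex ^'n)}"
proof -
  define A1 A2 where "A1 = {z \<in> A. H *v z = \<kappa> *s z}" and "A2 = {z \<in> A. H *v z \<noteq> \<kappa> *s z}"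
  have "A = A1 \<union> A2" by (auto simp: A1_def A2_def)
  then have "w \<in> vec.span (A1 \<union> A2)" using w by simp
  then obtain x y where xy: "w = x + y" "x \<in> vec.span A1" "y \<in> vec.span A2"
    unfolding vec.span_Un by blast
  have "H *v x = \<kappa> *s x"
    using xy(2)
  proof (induction rule: vec.span_induct_alt)
    case (step c x y)
    then show ?case by (simp add: A1_def matrix_vector_right_distrib vec.scale_right_distrib vector_smult_assoc mult.commute)
  qed simp
  then have "H *v y = \<kappa> *s y"
    using w(2) unfolding xy(1) by (simp add: matrix_vector_right_distrib vec.scale_right_distrib)
  moreover have "y \<in> vec.span {z. \<exists>k. k \<noteq> \<kappa> \<and> H *v z = k *s z}"
  proof (rule subsetD[OF vec.span_mono xy(3)], rule subsetI)
    fix z assume "z \<in> A2"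
    then show "z \<in> {z. \<exists>k. k \<noteq> \<kappa> \<and> H *v z = k *s z}" using A[of z] by (auto simp: A2_def)
  qed
  ultimately have "y = 0" by (rule eigenvector_in_span_others)
  then show ?thesis using xy by (simp add: A1_def)
qed

section \<open>Powers of raising operators and triangularity\<close>

lemma funpow_mult_add: "((*v) (A :: complex^'n^'n) ^^ k) (x + y) = ((*v) A ^^ k) x + ((*v) A ^^ k) (y :: complex^'n)"
  and funpow_mult_smult: "((*v) A ^^ k) (c *s x) = c *s ((*v) A ^^ k) x"
  and funpow_mult_diff: "((*v) A ^^ k) (x - y) = ((*v) A ^^ k) x - ((*v) A ^^ k) y"
  and funpow_mult_zero [simp]: "((*v) A ^^ k) 0 = (0 :: complex^'n)"
  by (induction k) (simp_all add: matrix_vector_right_distrib matrix_vector_mult_diff_distrib)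

lemma funpow_mult_sum: "((*v) (A :: complex^'n^'n) ^^ k) (\<Sum>i\<in>I. f i) = (\<Sum>i\<in>I. ((*v) A ^^ k) (f i :: complex^'n))"
  by (induction I rule: infinite_finite_induct) (simp_all add: funpow_mult_add)

text \<open>Among the terms with non-zero coefficient take the one of largest degree: the power of
  \<open>E\<close> given by this degree isolates it. With \<open>m = 0\<close> this is linear
  independence; with larger \<open>m\<close> it bounds the degrees that occur in a vector killed by
  \<open>E^m\<close>.\<close>

lemma triangular_coefficients:
  fixes C :: "'i \<Rightarrow> complex^'n" and E :: "complex^'n^'n"
  assumes fin: "finite T" and inj: "inj_on deg T"
    and nz: "\<And>t. t \<in> T \<Longrightarrow> ((*v) E ^^ deg t) (C t) \<noteq> 0"
    and kill: "\<And>t k. t \<in> T \<Longrightarrow> k > deg t \<Longrightarrow> ((*v) E ^^ k) (C t) = 0"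
    and w: "((*v) E ^^ m) (\<Sum>t\<in>T. c t *s C t) = 0"
    and t: "t \<in> T" "deg t \<ge> m"
  shows "c t = 0"
proof (rule ccontr)
  assume "c t \<noteq> 0"
  define S where "S = {s \<in> T. c s \<noteq> 0}"
  have "finite S" "t \<in> S" using fin t \<open>c t \<noteq> 0\<close> by (auto simp: S_def)
  then have "Max (deg ` S) \<in> deg ` S" by (intro Max_in) auto
  then obtain s where "s \<in> S" "deg s = Max (deg ` S)" by force
  then have s: "s \<in> S" "\<And>r. r \<in> S \<Longrightarrow> deg r \<le> deg s"
    using \<open>finite S\<close> by auto
  have sm: "deg s \<ge> m" using s(2)[OF \<open>t \<in> S\<close>] t(2) by simp
  have "((*v) E ^^ deg s) (\<Sum>t\<in>T. c t *s C t) = ((*v) E ^^ (deg s - m)) (((*v) E ^^ m) (\<Sum>t\<in>T. c t *s C t))"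
    using sm funpow_add[of "deg s - m" m "(*v) E"] by simp
  then have 0: "(\<Sum>r\<in>T. c r *s ((*v) E ^^ deg s) (C r)) = 0"
    unfolding w by (simp add: funpow_mult_sum funpow_mult_smult)
  have "c r *s ((*v) E ^^ deg s) (C r) = 0" if "r \<in> T - {s}" for r
  proof (cases "c r = 0")
    case False
    then have "deg r \<le> deg s" "deg r \<noteq> deg s" using that s inj by (auto simp: S_def inj_on_def)
    then show ?thesis using kill[of r "deg s"] that by simp
  qed simp
  then have "(\<Sum>r\<in>T - {s}. c r *s ((*v) E ^^ deg s) (C r)) = 0" by (rule sum.neutral[rule_format])
  then have "(\<Sum>r\<in>T. c r *s ((*v) E ^^ deg s) (C r)) = c s *s ((*v) E ^^ deg s) (C s)"
    using s fin sum.remove[of T s "\<lambda>r. c r *s ((*v) E ^^ deg s) (C r)"] by (simp add: S_def)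
  then show False using 0 s nz[of s] by (simp add: S_def vec.scale_eq_0_iff)
qed

context hw_triple
begin

definition Bset :: "(complex^'n) set" where
  "Bset = {B i1 i2 i3 j1 j2 j3 | i1 i2 i3 j1 j2 j3. True}"

lemma B_in_Bset [simp]: "B i1 i2 i3 j1 j2 j3 \<in> Bset"
  unfolding Bset_def by blast

text \<open>The span is invariant and contains \<open>v\<close>, so a covector vanishing on it is 0
  by \<open>cyc\<close>.\<close>

lemma B_span: "vec.span Bset = UNIV"
proof -
  have B: "B i1 i2 i3 j1 j2 j3 \<in> vec.span Bset" for i1 i2 i3 j1 j2 j3
    by (rule vec.span_base) simp
  have act: "\<rho> p q *v w \<in> vec.span Bset" if "p \<in> {1..3}" "q \<in> {1..3}" "w \<in> vec.span Bset" for p q w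
    using that(3)
  proof (induction rule: vec.span_induct_alt)
    case (step c x y)
    have "\<rho> p q *v x \<in> vec.span Bset"
      using step(1) that(1,2) unfolding range3 Bset_def
      by (elim CollectE exE conjE disjE; simp only: B_action; intro vec.span_diff vec.span_scale B[unfolded Bset_def])
    then show ?case using step(2) by (simp add: matrix_vector_right_distrib vec.span_add vec.span_scale)
  qed (simp add: vec.span_zero)
  have words: "wact \<rho> ws w \<in> vec.span Bset" if "set ws \<subseteq> gens" "w \<in> vec.span Bset" for ws w
    using that
  proof (induction ws arbitrary: w)
    case (Cons g ws)
    then show ?case using act[of "fst g" "snd g" w] by (auto simp: gens_def)
  qed simp
  have v: "v \<in> vec.span Bset" using B[of "int a" 0 0 0 0 "int b"] B_top by simp
  have "x \<in> vec.span Bset" for x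
  proof (rule ccontr)
    assume "x \<notin> vec.span Bset"
    then obtain r where r: "\<And>u. u \<in> vec.span Bset \<Longrightarrow> scalar_product r u = 0" "scalar_product r x = 1"
      using subspace_separation[OF vec.subspace_span] by blast
    have "r = 0" by (rule cyc) (use r words v in blast)
    then show False using r(2) by simp
  qed
  then show ?thesis by blast
qed

lemma B_eigen:
  "p \<in> {1..3} \<Longrightarrow> \<exists>k. \<rho> p p *v B i1 i2 i3 j1 j2 j3 = k *s B i1 i2 i3 j1 j2 j3"
  unfolding range3 by (elim disjE; simp only: B_action; blast)

text \<open>The trace relation is solved for the term containing y_2 \<beta>_2. The other two terms
  have the same weight and a smaller exponent of y_2.\<close>

lemma B_reduce:
  "B i1 i2 i3 j1 j2 j3 \<in> vec.span {B k1 k2 k3 l1 l2 l3 | k1 k2 k3 l1 l2 l3.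
     k1 - l1 = i1 - j1 \<and> k2 - l2 = i2 - j2 \<and> k3 - l3 = i3 - j3 \<and> (k2 = 0 \<or> l2 = 0)}"
proof (induction "nat i2" arbitrary: i1 i2 i3 j1 j2 j3 rule: less_induct)
  case less
  let ?S = "\<lambda>n1 n2 n3. {B k1 k2 k3 l1 l2 l3 | k1 k2 k3 l1 l2 l3.
     k1 - l1 = n1 \<and> k2 - l2 = n2 \<and> k3 - l3 = n3 \<and> (k2 = 0 \<or> l2 = 0)}"
  show ?case
  proof (cases "i2 > 0 \<and> j2 > 0")
    case False
    show ?thesis
    proof (cases "i2 < 0 \<or> j2 < 0")
      case True
      then have "B i1 i2 i3 j1 j2 j3 = 0" by (intro B_neg) blast
      then show ?thesis by (simp only: vec.span_zero)
    next
      case nn: False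
      then have "i2 = 0 \<or> j2 = 0" using False by auto
      then show ?thesis by (intro vec.span_base) blast
    qed
  next
    case True
    have IH: "B (i1 + 1) (i2 - 1) i3 (j1 + 1) (j2 - 1) j3 \<in> vec.span (?S (i1 - j1) (i2 - j2) (i3 - j3))"
      "B i1 (i2 - 1) (i3 + 1) j1 (j2 - 1) (j3 + 1) \<in> vec.span (?S (i1 - j1) (i2 - j2) (i3 - j3))"
      using less[of "i2 - 1" "i1 + 1" i3 "j1 + 1" "j2 - 1" j3] less[of "i2 - 1" i1 "i3 + 1" j1 "j2 - 1" "j3 + 1"] True by simp_all
    define x where "x = of_int ((i1 + 1) * (j1 + 1)) *s B (i1 + 1) (i2 - 1) i3 (j1 + 1) (j2 - 1) j3
      + of_int ((i3 + 1) * (j3 + 1)) *s B i1 (i2 - 1) (i3 + 1) j1 (j2 - 1) (j3 + 1)"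
    have x: "x \<in> vec.span (?S (i1 - j1) (i2 - j2) (i3 - j3))"
      unfolding x_def by (intro vec.span_add vec.span_scale IH)
    have "of_int (i2 * j2) *s B i1 i2 i3 j1 j2 j3 = - x"
      using B_trace[of i1 j1 "i2 - 1" i3 "j2 - 1" j3] unfolding x_def by (simp add: eq_neg_iff_add_eq_0 algebra_simps)
    then have "(1 / of_int (i2 * j2)) *s (of_int (i2 * j2) *s B i1 i2 i3 j1 j2 j3) = (- (1 / of_int (i2 * j2))) *s x"
      by simp
    then have "B i1 i2 i3 j1 j2 j3 = (- (1 / of_int (i2 * j2))) *s x"
      using True by (simp add: vector_smult_assoc)
    then show ?thesis using x by (simp only: vec.span_scale)
  qed
qed

text \<open>One application of \<open>span_eigenspace\<close> per diagonal generator, followed by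
  the reduction modulo the trace relation.\<close>

lemma weight_space_span:
  assumes "\<And>p. p \<in> {1..3} \<Longrightarrow> \<rho> p p *v w = \<kappa> p *s w"
  shows "w \<in> vec.span {B k1 k2 k3 l1 l2 l3 | k1 k2 k3 l1 l2 l3.
     of_int (k1 - l1) - shift = \<kappa> 1 \<and> of_int (k2 - l2) - shift = \<kappa> 2 \<and> of_int (k3 - l3) - shift = \<kappa> 3 \<and> (k2 = 0 \<or> l2 = 0)}"
    (is "_ \<in> vec.span ?S")
proof -
  let ?A1 = "{z \<in> Bset. \<rho> 1 1 *v z = \<kappa> 1 *s z}"
  let ?A2 = "{z \<in> ?A1. \<rho> 2 2 *v z = \<kappa> 2 *s z}"
  let ?A3 = "{z \<in> ?A2. \<rho> 3 3 *v z = \<kappa> 3 *s z}"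
  have eig: "\<exists>k. \<rho> p p *v z = k *s z" if "p \<in> {1..3}" "z \<in> Bset" for p z
    using that B_eigen unfolding Bset_def by blast
  have "w \<in> vec.span ?A1" by (rule span_eigenspace) (use eig assms B_span in auto)
  then have "w \<in> vec.span ?A2" by (rule span_eigenspace[rotated]) (use eig assms in auto)
  then have "w \<in> vec.span ?A3" by (rule span_eigenspace[rotated]) (use eig assms in auto)
  moreover have "?A3 \<subseteq> vec.span ?S"
  proof
    fix z assume z: "z \<in> ?A3"
    then obtain i1 i2 i3 j1 j2 j3 where zB: "z = B i1 i2 i3 j1 j2 j3" by (auto simp: Bset_def)
    show "z \<in> vec.span ?S"
    proof (cases "z = 0")
      case False
      have e: "of_int (i1 - j1) - shift = \<kappa> 1" "of_int (i2 - j2) - shift = \<kappa> 2" "of_int (i3 - j3) - shift = \<kappa> 3"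
        using z False unfolding zB mem_Collect_eq B_action vec.scale_cancel_right by blast+
      have "of_int k - shift = of_int l - shift \<longleftrightarrow> k = l" for k l by simp
      then show ?thesis unfolding zB e[symmetric] using B_reduce by presburger
    qed (simp add: vec.span_zero)
  qed
  ultimately show ?thesis by (metis (no_types, lifting) subsetD vec.span_minimal vec.subspace_span)
qed

end

text \<open>The highest power of a raising operator that does not kill a monomial yields a single monomial,
  since all contributions have the same sign.\<close>

lemma raise_extremal:
  fixes G :: "int \<Rightarrow> int \<Rightarrow> int \<Rightarrow> int \<Rightarrow> complex^'n"
  assumes E: "\<And>x y s t. E *v G x y s t = of_int (x + 1) *s G (x + 1) (y - 1) s t - of_int (t + 1) *s G x y (s - 1) (t + 1)"
    and neg: "\<And>x y s t. y < 0 \<or> s < 0 \<Longrightarrow> G x y s t = 0"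
    and "x \<ge> 0" "t \<ge> 0"
  shows "\<exists>c::real>0. ((*v) E ^^ (i + j)) (G x (int i) (int j) t) = complex_of_real ((-1)^j * c) *s G (x + int i) 0 0 (t + int j)"
  using assms(3,4)
proof (induction "i + j" arbitrary: x i j t)
  case 0
  then show ?case by (intro exI[of _ 1]) auto
next
  case (Suc k)
  have step: "((*v) E ^^ (i + j)) (G x (int i) (int j) t) =
      of_int (x + 1) *s ((*v) E ^^ k) (G (x + 1) (int i - 1) (int j) t)
      - of_int (t + 1) *s ((*v) E ^^ k) (G x (int i) (int j - 1) (t + 1))"
    unfolding Suc(2)[symmetric] funpow_Suc_right o_apply E
    by (simp only: funpow_mult_diff funpow_mult_smult)
  have 1: "\<exists>c::real\<ge>0. (i > 0 \<longrightarrow> c > 0) \<and> ((*v) E ^^ k) (G (x + 1) (int i - 1) (int j) t)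
      = complex_of_real ((-1)^j * c) *s G (x + int i) 0 0 (t + int j)"
  proof (cases i)
    case 0
    then show ?thesis by (intro exI[of _ 0]) (simp add: neg)
  next
    case (Suc i')
    have ii: "int i - 1 = int i'" "x + 1 + int i' = x + int i" using Suc by auto
    obtain c :: real where "c > 0" "((*v) E ^^ k) (G (x + 1) (int i') (int j) t)
        = complex_of_real ((-1)^j * c) *s G (x + 1 + int i') 0 0 (t + int j)"
      using Suc.hyps(1)[of i' j "x + 1" t] Suc.hyps(2) Suc.prems Suc by auto
    then show ?thesis unfolding ii by (intro exI[of _ c]) auto
  qed
  have 2: "\<exists>c::real\<ge>0. (j > 0 \<longrightarrow> c > 0) \<and> ((*v) E ^^ k) (G x (int i) (int j - 1) (t + 1))
      = complex_of_real (- ((-1)^j * c)) *s G (x + int i) 0 0 (t + int j)"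
  proof (cases j)
    case 0
    then show ?thesis by (intro exI[of _ 0]) (simp add: neg)
  next
    case (Suc j')
    have jj: "int j - 1 = int j'" "t + 1 + int j' = t + int j" "(-1::real)^j = - ((-1)^j')" using Suc by auto
    obtain c :: real where "c > 0" "((*v) E ^^ k) (G x (int i) (int j') (t + 1))
        = complex_of_real ((-1)^j' * c) *s G (x + int i) 0 0 (t + 1 + int j')"
      using Suc.hyps(1)[of i j' x "t + 1"] Suc.hyps(2) Suc.prems Suc by auto
    then show ?thesis unfolding jj by (intro exI[of _ c]) auto
  qed
  obtain c1 c2 :: real where c: "c1 \<ge> 0" "i > 0 \<longrightarrow> c1 > 0" "c2 \<ge> 0" "j > 0 \<longrightarrow> c2 > 0"
    and c': "((*v) E ^^ k) (G (x + 1) (int i - 1) (int j) t) = complex_of_real ((-1)^j * c1) *s G (x + int i) 0 0 (t + int j)"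
    "((*v) E ^^ k) (G x (int i) (int j - 1) (t + 1)) = complex_of_real (- ((-1)^j * c2)) *s G (x + int i) 0 0 (t + int j)"
    using 1 2 by blast
  have "i > 0 \<or> j > 0" using Suc.hyps(2) by auto
  then have pos: "real_of_int (x + 1) * c1 + real_of_int (t + 1) * c2 > 0"
    using c Suc.prems
    by (elim disjE) (simp_all add: add_pos_nonneg add_nonneg_pos)
  show ?case
    unfolding step c'
    by (rule exI[of _ "real_of_int (x + 1) * c1 + real_of_int (t + 1) * c2"])
       (use pos in \<open>simp add: vec_eq_iff algebra_simps\<close>)
qed

text \<open>Each application of \<open>E\<close> lowers the total degree \<open>i + j\<close> by
  one.\<close>

lemma raise_vanish:
  fixes G :: "int \<Rightarrow> int \<Rightarrow> int \<Rightarrow> int \<Rightarrow> complex^'n"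
  assumes E: "\<And>x y s t. E *v G x y s t = of_int (x + 1) *s G (x + 1) (y - 1) s t - of_int (t + 1) *s G x y (s - 1) (t + 1)"
    and neg: "\<And>x y s t. y < 0 \<or> s < 0 \<Longrightarrow> G x y s t = 0"
    and k: "int k > i + j"
  shows "((*v) E ^^ k) (G x i j t) = 0"
  using k
proof (induction k arbitrary: x i j t)
  case 0
  then have "i < 0 \<or> j < 0" by auto
  then show ?case by (simp add: neg)
next
  case (Suc k)
  show ?case
    unfolding funpow_Suc_right o_apply E funpow_mult_diff funpow_mult_smult
    using Suc by simp
qed

context hw_triple
begin

text \<open>A raising generator touches four of the six exponents; the other two are the parameters
  \<open>m\<close> and \<open>m'\<close>.\<close>

lemmas raise12 = raise_extremal[where G = "\<lambda>x y s t. B x y m s t m'" for m m', OF B_action(1) B_neg]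
lemmas raise23 = raise_extremal[where G = "\<lambda>x y s t. B m x y m' s t" for m m', OF B_action(3) B_neg]
lemmas raise13 = raise_extremal[where G = "\<lambda>x y s t. B x m y s m' t" for m m', OF B_action(2) B_neg]
lemmas raise12_vanish = raise_vanish[where G = "\<lambda>x y s t. B x y m s t m'" for m m', OF B_action(1) B_neg]
lemmas raise23_vanish = raise_vanish[where G = "\<lambda>x y s t. B m x y m' s t" for m m', OF B_action(3) B_neg]

lemma v_nonzero: "v \<noteq> 0"
  using norm by auto

text \<open>Raising leads to the top monomial \<open>v\<close>: \<open>\<rho> 1 3\<close> empties
  \<beta>_1, then \<open>\<rho> 1 2\<close> empties y_2, and each time the result is a non-zero
  multiple of one monomial.\<close>

lemma B_nonzero1:
  assumes "i1 \<ge> 0" "i2 \<ge> 0" "j1 \<ge> 0" "j3 \<ge> 0" "i1 + i2 = int a" "j1 + j3 = int b"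
  shows "B i1 i2 0 j1 0 j3 \<noteq> 0"
proof
  assume 0: "B i1 i2 0 j1 0 j3 = 0"
  obtain c :: real where c: "c > 0" "((*v) (\<rho> 1 3) ^^ (0 + nat j1)) (B i1 i2 (int 0) (int (nat j1)) 0 j3)
     = complex_of_real ((-1)^nat j1 * c) *s B (i1 + int 0) i2 0 0 0 (j3 + int (nat j1))"
    using raise13[where x = i1 and i = 0 and j = "nat j1" and t = j3 and m = i2 and m' = 0] assms by auto
  then have 1: "B i1 i2 0 0 0 (int b) = 0" using 0 assms by (auto simp: vec.scale_eq_0_iff add.commute)
  obtain d :: real where d: "d > 0" "((*v) (\<rho> 1 2) ^^ (nat i2 + 0)) (B i1 (int (nat i2)) 0 (int 0) 0 (int b))
     = complex_of_real ((-1)^0 * d) *s B (i1 + int (nat i2)) 0 0 0 (0 + int 0) (int b)"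
    using raise12[where x = i1 and i = "nat i2" and j = 0 and t = 0 and m = 0 and m' = "int b"] assms by auto
  then have "B (int a) 0 0 0 0 (int b) = 0" using 1 assms by (auto simp: vec.scale_eq_0_iff)
  then show False using B_top v_nonzero by simp
qed

text \<open>The mirror case: \<open>\<rho> 1 3\<close> empties y_3, then \<open>\<rho> 2 3\<close>
  empties \<beta>_2.\<close>

lemma B_nonzero2:
  assumes "i1 \<ge> 0" "i3 \<ge> 0" "j2 \<ge> 0" "j3 \<ge> 0" "i1 + i3 = int a" "j2 + j3 = int b"
  shows "B i1 0 i3 0 j2 j3 \<noteq> 0"
proof
  assume 0: "B i1 0 i3 0 j2 j3 = 0"
  obtain c :: real where c: "c > 0" "((*v) (\<rho> 1 3) ^^ (nat i3 + 0)) (B i1 0 (int (nat i3)) (int 0) j2 j3)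
     = complex_of_real ((-1)^0 * c) *s B (i1 + int (nat i3)) 0 0 0 j2 (j3 + int 0)"
    using raise13[where x = i1 and i = "nat i3" and j = 0 and t = j3 and m = 0 and m' = j2] assms by auto
  then have 1: "B (int a) 0 0 0 j2 j3 = 0" using 0 assms by (auto simp: vec.scale_eq_0_iff)
  obtain d :: real where d: "d > 0" "((*v) (\<rho> 2 3) ^^ (0 + nat j2)) (B (int a) 0 (int 0) 0 (int (nat j2)) j3)
     = complex_of_real ((-1)^nat j2 * d) *s B (int a) (0 + int 0) 0 0 0 (j3 + int (nat j2))"
    using raise23[where x = 0 and i = 0 and j = "nat j2" and t = j3 and m = "int a" and m' = 0] assms by auto
  then have "B (int a) 0 0 0 0 (int b) = 0" using 1 assms by (auto simp: vec.scale_eq_0_iff add.commute)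
  then show False using B_top v_nonzero by simp
qed

lemma funpow_diag:
  assumes "p \<in> {1..3}" "r \<in> {1..3}" "s \<in> {1..3}" "\<rho> p p *v w = \<kappa> *s w"
  shows "\<rho> p p *v (((*v) (\<rho> r s) ^^ k) w) =
    (\<kappa> + of_nat k * ((if p = r then 1 else 0) - (if s = p then 1 else 0))) *s (((*v) (\<rho> r s) ^^ k) w)"
proof (induction k)
  case 0
  then show ?case using assms by simp
next
  case (Suc k)
  show ?case
    unfolding funpow.simps o_apply sl3_rep_commute[OF rep assms(1,1,2,3)] Suc matrix_vector_mult_smult
    by (auto simp: vec_eq_iff algebra_simps)
qed

lemma xi_weight:
  assumes "p \<in> {1..3}" "\<rho> p p *v w = \<kappa> *s w" "scalar_product \<xi> w \<noteq> 0"
  shows "\<kappa> = hwt (of_nat a) (of_nat b) p"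
  using xi_diag[OF assms(1), of w] assms(2,3) by (simp add: scalar_product_smult_right)

text \<open>The vector \<open>e\<^sub>1\<^sub>2\<^bsup>a+1\<^esup> w\<close> has no component of highest weight, since \<open>y\<^sub>1\<^sup>a \<beta>\<^sub>3\<^sup>b\<close> can only be
  reached from a monomial of degree \<open>a + 1\<close> in \<open>y\<^sub>2\<close>.\<close>

lemma xi_raise:
  assumes "r = 1 \<and> s = 2 \<and> k = Suc a \<or> r = 2 \<and> s = 3 \<and> k = Suc b"
  shows "scalar_product \<xi> (((*v) (\<rho> r s) ^^ k) w) = 0"
proof -
  have hwt2: "hwt (of_nat a) (of_nat b) 2 = - shift" by (simp add: hwt_def shift_def field_simps)
  have cancel: "x - shift + y = - shift \<longleftrightarrow> x + y = 0" for x y by (auto simp: algebra_simps)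
  have "w \<in> vec.span Bset" using B_span by simp
  then show ?thesis
  proof (induction rule: vec.span_induct_alt)
    case (step c x y)
    then obtain i1 i2 i3 j1 j2 j3 where x: "x = B i1 i2 i3 j1 j2 j3" unfolding Bset_def by blast
    have "scalar_product \<xi> (((*v) (\<rho> r s) ^^ k) x) = 0"
    proof (rule ccontr)
      assume n0: "scalar_product \<xi> (((*v) (\<rho> r s) ^^ k) x) \<noteq> 0"
      then have "x \<noteq> 0" by auto
      then have bounds: "i1 \<ge> 0" "i2 \<ge> 0" "i3 \<ge> 0" "j1 \<ge> 0" "j2 \<ge> 0" "j3 \<ge> 0" "i1 + i2 + i3 = int a" "j1 + j2 + j3 = int b"
        using B_neg[of i1 i2 i3 j1 j2 j3] B_bidegree[of i1 i2 i3 j1 j2 j3] x by force+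
      have rs: "r \<in> {1..3}" "s \<in> {1..3}" using assms by auto
      have "\<rho> 2 2 *v (((*v) (\<rho> r s) ^^ k) x) = ((of_int (i2 - j2) - shift) +
          of_nat k * ((if 2 = r then 1 else 0) - (if s = 2 then 1 else 0))) *s (((*v) (\<rho> r s) ^^ k) x)"
        by (rule funpow_diag) (use rs in \<open>auto simp: x B_action(8) simp del: of_int_diff\<close>)
      then have "(of_int (i2 - j2) - shift) + of_nat k * ((if 2 = r then 1 else 0) - (if s = 2 then 1 else 0))
          = hwt (of_nat a) (of_nat b) 2"
        using xi_weight[of 2] n0 by auto
      then have "(of_int (i2 - j2) :: complex) + of_nat k * ((if 2 = r then 1 else 0) - (if s = 2 then 1 else 0)) = 0"
        using hwt2 by (simp only: cancel)
      then have "(of_int (i2 - j2 + int k * ((if 2 = r then 1 else 0) - (if s = 2 then 1 else 0))) :: complex) = of_int 0"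
        by (cases "r = 2"; cases "s = 2"; simp)
      then have "i2 - j2 + int k * ((if 2 = r then 1 else 0) - (if s = 2 then 1 else 0)) = 0"
        unfolding of_int_eq_iff .
      then show False using assms bounds by auto
    qed
    then show ?case using step(2) by (simp add: funpow_mult_add funpow_mult_smult scalar_product_add_right scalar_product_smult_right)
  qed simp
qed

end

section \<open>Tensor products\<close>

lemma kron_vector:
  "(kron A B *v z) $ (i, j) = (\<Sum>k\<in>UNIV. \<Sum>l\<in>UNIV. A $ i $ k * B $ j $ l * z $ (k, l))"
  unfolding matrix_vector_mult_def kron_def UNIV_Times_UNIV[symmetric] sum.cartesian_product
  by (simp add: case_prod_unfold)

lemma kron_left_vector: "(kron A (mat 1) *v z) $ (i, j) = (\<Sum>k\<in>UNIV. A $ i $ k * z $ (k, j))"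
  unfolding kron_vector mat_def by (simp add: if_distrib[of "\<lambda>x. _ * x * _"] if_distrib[of "\<lambda>x. _ * x"] if_distrib[of "\<lambda>x. x * _"] cong: if_cong)

lemma kron_right_vector: "(kron (mat 1) B *v z) $ (i, j) = (\<Sum>l\<in>UNIV. B $ j $ l * z $ (i, l))"
  unfolding kron_vector mat_def
  by (subst sum.swap) (simp add: if_distrib[of "\<lambda>x. _ * x * _"] if_distrib[of "\<lambda>x. _ * x"] if_distrib[of "\<lambda>x. x * _"] cong: if_cong)

lemma pair_vec_eqI: "(\<And>i j. x $ (i, j) = y $ (i, j)) \<Longrightarrow> x = y"
  by (auto simp: vec_eq_iff)

lemma kron_left_right_commute:
  "kron A (mat 1) *v (kron (mat 1) B *v z) = kron (mat 1) B *v (kron A (mat 1) *v z)"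
  by (rule pair_vec_eqI, unfold kron_left_vector kron_right_vector sum_distrib_left, subst sum.swap)
    (simp only: mult.left_commute)

definition slice :: "'m \<Rightarrow> complex ^ ('n::finite \<times> 'm::finite) \<Rightarrow> complex ^ 'n" where
  "slice j z = (\<chi> i. z $ (i, j))"

text \<open>The covector \<open>r\<close> applied to the first tensor factor, that is,
  \<open>r\<close> tensored with the identity.\<close>

definition contr :: "complex ^ 'n \<Rightarrow> complex ^ ('n::finite \<times> 'm::finite) \<Rightarrow> complex ^ 'm" where
  "contr r z = (\<chi> j. scalar_product r (slice j z))"

lemma slice_linear: "slice j (x + y) = slice j x + slice j y" "slice j (c *s x) = c *s slice j x"
  "slice j (x - y) = slice j x - slice j y" "slice j 0 = 0"
  by (simp_all add: slice_def vec_eq_iff)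

lemma contr_add: "contr r (x + y) = contr r x + contr r y"
  and contr_smult: "contr r (c *s x) = c *s contr r x"
  and contr_diff: "contr r (x - y) = contr r x - contr r y"
  and contr_zero [simp]: "contr r 0 = 0"
  by (simp_all add: contr_def slice_linear scalar_product_add_right scalar_product_smult_right scalar_product_diff_right vec_eq_iff)

lemma contr_sum: "contr r (\<Sum>i\<in>I. f i) = (\<Sum>i\<in>I. contr r (f i))"
  by (induction I rule: infinite_finite_induct) (auto simp: contr_add)

lemma contr_uminus: "contr r (- x) = - contr r x"
  using contr_diff[of r 0 x] by simp

lemma slice_left: "slice j (kron A (mat 1) *v z) = A *v slice j z"
  unfolding slice_def vec_eq_iff vec_lambda_beta kron_left_vector by (simp add: matrix_vector_mult_def)

lemma contr_smult_left: "contr (c *s r) z = c *s contr r z" and contr_zero_left: "contr 0 z = 0"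
  by (simp_all add: contr_def scalar_product_smult_left vec_eq_iff)

lemma contr_left: "contr r (kron A (mat 1) *v z) = contr (transpose A *v r) z"
  by (simp only: contr_def slice_left scalar_product_matrix)

lemma contr_right: "contr r (kron (mat 1) B *v z) = B *v contr r z"
proof -
  have "contr r (kron (mat 1) B *v z) $ j = (B *v contr r z) $ j" for j
  proof -
    have "contr r (kron (mat 1) B *v z) $ j = (\<Sum>i\<in>UNIV. r $ i * (\<Sum>l\<in>UNIV. B $ j $ l * z $ (i, l)))"
      by (simp only: contr_def vec_lambda_beta scalar_product_def slice_def kron_right_vector)
    also have "\<dots> = (\<Sum>l\<in>UNIV. B $ j $ l * (\<Sum>i\<in>UNIV. r $ i * z $ (i, l)))"
      by (unfold sum_distrib_left, subst sum.swap) (simp only: mult.left_commute)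
    also have "\<dots> = (B *v contr r z) $ j"
      by (simp only: contr_def vec_lambda_beta scalar_product_def slice_def matrix_vector_mult_def)
    finally show ?thesis .
  qed
  then show ?thesis by (simp only: vec_eq_iff simp_thms)
qed

lemma sl3_repI:
  assumes "\<And>p q r s x. p \<in> {1..3} \<Longrightarrow> q \<in> {1..3} \<Longrightarrow> r \<in> {1..3} \<Longrightarrow> s \<in> {1..3} \<Longrightarrow>
      \<rho> p q *v (\<rho> r s *v x) =
      \<rho> r s *v (\<rho> p q *v x) + (if q = r then \<rho> p s *v x else 0) - (if s = p then \<rho> r q *v x else 0)"
    and "\<And>x. \<rho> 1 1 *v x + \<rho> 2 2 *v x + \<rho> 3 3 *v x = 0"
  shows "sl3_rep \<rho>"
  unfolding sl3_rep_def
proof (intro conjI ballI)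
  fix p q r s :: nat assume h: "p \<in> {1..3}" "q \<in> {1..3}" "r \<in> {1..3}" "s \<in> {1..3}"
  show "\<rho> p q ** \<rho> r s - \<rho> r s ** \<rho> p q = (if q = r then \<rho> p s else 0) - (if s = p then \<rho> r q else 0)"
    unfolding matrix_eq matrix_vector_mult_diff_rdistrib matrix_vector_mul_assoc[symmetric] assms(1)[OF h]
    by simp
next
  have "{1..3::nat} = {1,2,3}" by auto
  then show "(\<Sum>i\<in>{1..3}. \<rho> i i) = 0"
    unfolding matrix_eq using assms(2) by (simp add: matrix_vector_mult_add_rdistrib add.assoc)
qed

lemma tensor_gen_simps:
  "tensor_gen \<rho> \<rho>' 1 p q = kron (\<rho> p q) (mat 1)" "tensor_gen \<rho> \<rho>' 2 p q = kron (mat 1) (\<rho>' p q)"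
  by (simp_all add: tensor_gen_def)

lemma kron_linear:
  "kron (A + B) C = kron A C + kron B C" "kron (A - B) C = kron A C - kron B C" "kron 0 C = 0"
  "kron A (C + D) = kron A C + kron A D" "kron A (C - D) = kron A C - kron A D" "kron A 0 = 0"
  by (simp_all add: kron_def vec_eq_iff algebra_simps)

lemma kron_left_mult: "kron A (mat 1) *v (kron C (mat 1) *v z) = kron (A ** C) (mat 1) *v z"
proof (rule pair_vec_eqI)
  fix i j
  have "slice j (kron A (mat 1) *v (kron C (mat 1) *v z)) = slice j (kron (A ** C) (mat 1) *v z)"
    unfolding slice_left by (rule matrix_vector_mul_assoc)
  then show "(kron A (mat 1) *v (kron C (mat 1) *v z)) $ (i,j) = (kron (A ** C) (mat 1) *v z) $ (i,j)"
    by (simp add: slice_def vec_eq_iff)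
qed

lemma kron_right_mult:
  fixes z :: "complex ^ ('n::finite \<times> 'm::finite)"
  shows "kron (mat 1) A *v (kron (mat 1) C *v z) = kron (mat 1) (A ** C) *v z"
proof (rule pair_vec_eqI)
  fix i :: 'n and j :: 'm
  let ?s = "\<lambda>z :: complex ^ ('n \<times> 'm). \<chi> l. z $ (i, l)"
  have s: "?s (kron (mat 1) B *v z) = B *v ?s z" for B z
    unfolding vec_eq_iff vec_lambda_beta kron_right_vector by (simp add: matrix_vector_mult_def)
  have "?s (kron (mat 1) A *v (kron (mat 1) C *v z)) = ?s (kron (mat 1) (A ** C) *v z)"
    unfolding s by (rule matrix_vector_mul_assoc)
  then show "(kron (mat 1) A *v (kron (mat 1) C *v z)) $ (i,j) = (kron (mat 1) (A ** C) *v z) $ (i,j)"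
    by (simp add: vec_eq_iff)
qed

lemma sl3_rep_tensor_gen:
  assumes "sl3_rep \<rho>" "sl3_rep \<rho>'"
  shows "sl3_rep (tensor_gen \<rho> \<rho>' 1)" "sl3_rep (tensor_gen \<rho> \<rho>' 2)"
proof -
  have e: "{1..3::nat} = {1,2,3}" by auto
  have rel: "\<rho> p q ** \<rho> r s = \<rho> r s ** \<rho> p q + (if q = r then \<rho> p s else 0) - (if s = p then \<rho> r q else 0)"
    if "sl3_rep \<rho>" "p \<in> {1..3}" "q \<in> {1..3}" "r \<in> {1..3}" "s \<in> {1..3}" for \<rho> :: "'c::finite rep" and p q r s
  proof -
    have "\<rho> p q ** \<rho> r s - \<rho> r s ** \<rho> p q = (if q = r then \<rho> p s else 0) - (if s = p then \<rho> r q else 0)"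
      using that unfolding sl3_rep_def by blast
    then show ?thesis by (simp only: diff_eq_eq) (simp only: add_diff_eq add.commute)
  qed
  have tr: "\<rho> 1 1 + \<rho> 2 2 + \<rho> 3 3 = 0" if "sl3_rep \<rho>" for \<rho> :: "'c::finite rep"
    using that unfolding sl3_rep_def e by (simp add: algebra_simps)
  show "sl3_rep (tensor_gen \<rho> \<rho>' 1)"
  proof (rule sl3_repI; unfold tensor_gen_simps kron_left_mult)
    fix p q r s :: nat and x assume h: "p \<in> {1..3}" "q \<in> {1..3}" "r \<in> {1..3}" "s \<in> {1..3}"
    show "kron (\<rho> p q ** \<rho> r s) (mat 1) *v x = kron (\<rho> r s ** \<rho> p q) (mat 1) *v x +
       (if q = r then kron (\<rho> p s) (mat 1) *v x else 0) - (if s = p then kron (\<rho> r q) (mat 1) *v x else 0)"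
      unfolding rel[OF assms(1) h]
      by (simp add: kron_linear matrix_vector_mult_add_rdistrib matrix_vector_mult_diff_rdistrib)
  next
    fix x
    have "kron (\<rho> 1 1 + \<rho> 2 2 + \<rho> 3 3) (mat 1) *v x = 0" unfolding tr[OF assms(1)] by (simp add: kron_linear)
    then show "kron (\<rho> 1 1) (mat 1) *v x + kron (\<rho> 2 2) (mat 1) *v x + kron (\<rho> 3 3) (mat 1) *v x = 0"
      by (simp add: kron_linear matrix_vector_mult_add_rdistrib)
  qed
  show "sl3_rep (tensor_gen \<rho> \<rho>' 2)"
  proof (rule sl3_repI; unfold tensor_gen_simps kron_right_mult)
    fix p q r s :: nat and x assume h: "p \<in> {1..3}" "q \<in> {1..3}" "r \<in> {1..3}" "s \<in> {1..3}"
    show "kron (mat 1) (\<rho>' p q ** \<rho>' r s) *v x = kron (mat 1) (\<rho>' r s ** \<rho>' p q) *v x +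
       (if q = r then kron (mat 1) (\<rho>' p s) *v x else 0) - (if s = p then kron (mat 1) (\<rho>' r q) *v x else 0)"
      unfolding rel[OF assms(2) h]
      by (simp add: kron_linear matrix_vector_mult_add_rdistrib matrix_vector_mult_diff_rdistrib)
  next
    fix x
    have "kron (mat 1) (\<rho>' 1 1 + \<rho>' 2 2 + \<rho>' 3 3) *v x = 0" unfolding tr[OF assms(2)] by (simp add: kron_linear)
    then show "kron (mat 1) (\<rho>' 1 1) *v x + kron (mat 1) (\<rho>' 2 2) *v x + kron (mat 1) (\<rho>' 3 3) *v x = 0"
      by (simp add: kron_linear matrix_vector_mult_add_rdistrib)
  qed
qed

lemma tensor_gen_commute:
  "tensor_gen \<rho> \<rho>' 1 p q *v (tensor_gen \<rho> \<rho>' 2 r s *v z) = tensor_gen \<rho> \<rho>' 2 r s *v (tensor_gen \<rho> \<rho>' 1 p q *v z)"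
  unfolding tensor_gen_simps by (rule kron_left_right_commute)

lemma tensor_rep_vector:
  "tensor_rep \<rho> \<rho>' p q *v z = tensor_gen \<rho> \<rho>' 1 p q *v z + tensor_gen \<rho> \<rho>' 2 p q *v z"
  by (simp add: tensor_rep_def matrix_vector_mult_add_rdistrib)

lemma sl3_rep_tensor:
  assumes "sl3_rep \<rho>" "sl3_rep \<rho>'"
  shows "sl3_rep (tensor_rep \<rho> \<rho>')"
proof (rule sl3_repI)
  fix p q r s :: nat and x assume h: "p \<in> {1..3}" "q \<in> {1..3}" "r \<in> {1..3}" "s \<in> {1..3}"
  show "tensor_rep \<rho> \<rho>' p q *v (tensor_rep \<rho> \<rho>' r s *v x) = tensor_rep \<rho> \<rho>' r s *v (tensor_rep \<rho> \<rho>' p q *v x)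
     + (if q = r then tensor_rep \<rho> \<rho>' p s *v x else 0) - (if s = p then tensor_rep \<rho> \<rho>' r q *v x else 0)"
    unfolding tensor_rep_vector matrix_vector_right_distrib tensor_gen_commute
      sl3_rep_commute[OF sl3_rep_tensor_gen(1)[OF assms] h] sl3_rep_commute[OF sl3_rep_tensor_gen(2)[OF assms] h]
    by (simp add: algebra_simps)
next
  fix x
  show "tensor_rep \<rho> \<rho>' 1 1 *v x + tensor_rep \<rho> \<rho>' 2 2 *v x + tensor_rep \<rho> \<rho>' 3 3 *v x = 0"
    using sl3_rep_trace[OF sl3_rep_tensor_gen(1)[OF assms], of x] sl3_rep_trace[OF sl3_rep_tensor_gen(2)[OF assms], of x]
    unfolding tensor_rep_vector by (metis (no_types, lifting) add.commute add.left_commute add.right_neutral)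
qed

section \<open>Highest-weight vectors of the tensor product, seen through their top
  coefficient\<close>

locale hw_pair = V: hw_triple \<rho> a b v \<xi> + W: hw_triple \<rho>' a' b' v' \<xi>'
  for \<rho> :: "'n::finite rep" and a b v \<xi> and \<rho>' :: "'m::finite rep" and a' b' v' \<xi>'
begin

abbreviation X1 :: "('n \<times> 'm) rep" where "X1 \<equiv> tensor_gen \<rho> \<rho>' 1"
abbreviation X2 :: "('n \<times> 'm) rep" where "X2 \<equiv> tensor_gen \<rho> \<rho>' 2"

text \<open>The coefficient of the highest-weight vector of the first factor.\<close>

definition top :: "complex ^ ('n \<times> 'm) \<Rightarrow> complex ^ 'm" where
  "top z = contr \<xi> z"

lemma top_linear: "top (x + y) = top x + top y" "top (x - y) = top x - top y" "top (c *s x) = c *s top x"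
  "top 0 = 0" "top (- x) = - top x"
  by (simp_all add: top_def contr_add contr_diff contr_smult contr_uminus)

lemma top_sum: "top (\<Sum>i\<in>I. f i) = (\<Sum>i\<in>I. top (f i))"
  unfolding top_def by (rule contr_sum)

lemma top_X2: "top (X2 p q *v z) = \<rho>' p q *v top z"
  unfolding top_def tensor_gen_simps contr_right ..

lemma top_X1_low: "(p,q) \<in> lows \<Longrightarrow> top (X1 p q *v z) = 0"
proof -
  assume "(p,q) \<in> lows"
  then have "transpose (\<rho> p q) *v \<xi> = 0"
    by (intro scalar_product_eqI) (simp only: scalar_product_matrix[symmetric] V.xi_low scalar_product_zero_left)
  then show ?thesis unfolding top_def tensor_gen_simps contr_left by (simp only: contr_zero_left)
qed

lemma top_X1_diag: "p \<in> {1..3} \<Longrightarrow> top (X1 p p *v z) = hwt (of_nat a) (of_nat b) p *s top z"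
proof -
  assume "p \<in> {1..3}"
  then have "transpose (\<rho> p p) *v \<xi> = hwt (of_nat a) (of_nat b) p *s \<xi>"
    by (intro scalar_product_eqI) (simp only: scalar_product_matrix[symmetric] V.xi_diag scalar_product_smult_left)
  then show ?thesis unfolding top_def tensor_gen_simps contr_left by (simp only: contr_smult_left)
qed

lemma wact_X1_slice: "slice j (wact X1 ws z) = wact \<rho> ws (slice j z)"
  by (induction ws arbitrary: z) (auto simp: tensor_gen_simps[unfolded One_nat_def] slice_left)

lemma wact_X1_X2: "wact X1 ws (X2 p q *v z) = X2 p q *v wact X1 ws z"
  by (induction ws arbitrary: z) (simp_all only: wact.simps tensor_gen_commute)

lemmas rep1 = sl3_rep_tensor_gen(1)[OF V.rep W.rep]
lemmas rep12 = sl3_rep_tensor[OF V.rep W.rep]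

text \<open>The \<open>\<xi>\<close>-component of any word in the generators of the first factor applied to \<open>u\<close> reduces to
  \<open>top u\<close>: on the right, a raising generator can be moved to the second factor, and on the left, a
  lowering generator gives 0.\<close>

lemma top_injective:
  assumes u: "hwv (tensor_rep \<rho> \<rho>') \<alpha> \<beta> u" and top: "top u = 0"
  shows "u = 0"
proof -
  have words: "top (wact X1 ws u) = 0" if "set ws \<subseteq> gens" for ws
  proof (rule word_vanish[OF _ _ _ _ that])
    fix pre post :: "(nat \<times> nat) list" and p q r s
    assume g: "set (pre @ (r,s) # (p,q) # post) \<subseteq> gens"
    have pq: "p \<in> {1..3}" "q \<in> {1..3}" "r \<in> {1..3}" "s \<in> {1..3}" using g by (auto simp: gens_def)
    show "top (wact X1 (pre @ (r,s) # (p,q) # post) u) = top (wact X1 (pre @ (p,q) # (r,s) # post) u)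
        + (if q = r then top (wact X1 (pre @ (p,s) # post) u) else 0) - (if s = p then top (wact X1 (pre @ (r,q) # post) u) else 0)"
      using sl3_rep_commute[OF rep1 pq, of "wact X1 pre u"]
      by (simp add: wact_add wact_diff top_linear)
  next
    fix pre :: "(nat \<times> nat) list" and p q assume "(p,q) \<in> lows"
    then show "top (wact X1 (pre @ [(p,q)]) u) = 0" using top_X1_low[of p q] by simp
  next
    fix p q and ws :: "(nat \<times> nat) list" assume g: "(p,q) \<in> gens" "p \<le> q" "top (wact X1 ws u) = 0"
    have pq: "p \<in> {1..3}" "q \<in> {1..3}" using g by (auto simp: gens_def)
    obtain c where "X1 p q *v u + X2 p q *v u = c *s u"
    proof (cases "p = q")
      case True
      then show ?thesis using that hwvD(1)[OF u pq(1)] by (simp only: tensor_rep_vector)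
    next
      case False
      then have "X1 p q *v u + X2 p q *v u = 0 *s u" using g(2) hwvD(2)[OF u pq] by (simp add: tensor_rep_vector)
      then show ?thesis using that by blast
    qed
    then have 1: "X1 p q *v u = c *s u - X2 p q *v u" by (simp add: eq_diff_eq)
    show "top (wact X1 ((p,q) # ws) u) = 0"
      unfolding wact.simps fst_conv snd_conv 1 wact_diff wact_smult wact_X1_X2 top_linear top_X2 g(3) by simp
  next
    show "top (wact X1 [] u) = 0" using top by simp
  qed
  have "slice j u = 0" for j
  proof (rule V.sep)
    fix ws :: "(nat \<times> nat) list" assume "set ws \<subseteq> gens"
    then have "top (wact X1 ws u) $ j = 0" using words by simp
    then show "scalar_product \<xi> (wact \<rho> ws (slice j u)) = 0"
      unfolding top_def contr_def wact_X1_slice by simp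
  qed
  then show ?thesis by (auto simp: slice_def vec_eq_iff)
qed

lemma hwv_raise:
  assumes "hwv (tensor_rep \<rho> \<rho>') \<alpha> \<beta> u" "p \<in> {1..3}" "q \<in> {1..3}" "p < q"
  shows "X1 p q *v u = - (X2 p q *v u)"
  using hwvD(2)[OF assms] unfolding tensor_rep_vector by (simp only: eq_neg_iff_add_eq_0)

lemma top_weight:
  assumes u: "hwv (tensor_rep \<rho> \<rho>') \<alpha> \<beta> u" and p: "p \<in> {1..3}"
  shows "\<rho>' p p *v top u = (hwt \<alpha> \<beta> p - hwt (of_nat a) (of_nat b) p) *s top u"
proof -
  have "top (X1 p p *v u + X2 p p *v u) = hwt \<alpha> \<beta> p *s top u"
    using hwvD(1)[OF u p] by (simp only: tensor_rep_vector top_linear)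
  then have "hwt (of_nat a) (of_nat b) p *s top u + \<rho>' p p *v top u = hwt \<alpha> \<beta> p *s top u"
    by (simp only: top_linear top_X1_diag[OF p] top_X2)
  then show ?thesis by (simp add: vec.scale_left_diff_distrib eq_diff_eq add.commute)
qed

text \<open>On a highest-weight vector a raising generator of the second factor equals minus that of
  the first. The two commute, so the same holds for powers up to sign, and the power in the first
  factor is invisible to \<open>\<xi>\<close> by \<open>xi_raise\<close>.\<close>

lemma top_raise:
  assumes u: "hwv (tensor_rep \<rho> \<rho>') \<alpha> \<beta> u"
    and rs: "r = 1 \<and> s = 2 \<and> k = Suc a \<or> r = 2 \<and> s = 3 \<and> k = Suc b"
  shows "((*v) (\<rho>' r s) ^^ k) (top u) = 0"
proof -
  have r: "r \<in> {1..3}" "s \<in> {1..3}" "r < s" using rs by auto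
  have 1: "((*v) (\<rho>' r s) ^^ k) (top u) = top (((*v) (X2 r s) ^^ k) u)" for k
    by (induction k) (simp_all add: top_X2)
  have comm: "((*v) (X1 r s) ^^ k) (X2 r s *v z) = X2 r s *v ((*v) (X1 r s) ^^ k) z" for k z
    by (induction k) (simp_all only: funpow.simps o_apply id_apply tensor_gen_commute)
  have 2: "((*v) (X2 r s) ^^ k) u = (-1)^k *s ((*v) (X1 r s) ^^ k) u" for k
  proof (induction k)
    case (Suc k)
    have "((*v) (X1 r s) ^^ Suc k) u = ((*v) (X1 r s) ^^ k) (X1 r s *v u)" by (simp add: funpow_swap1)
    also have "\<dots> = - (X2 r s *v ((*v) (X1 r s) ^^ k) u)"
      unfolding hwv_raise[OF u r] comm[symmetric] using funpow_mult_smult[of k "X1 r s" "-1"] by simp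
    finally have 4: "((*v) (X1 r s) ^^ Suc k) u = - (X2 r s *v ((*v) (X1 r s) ^^ k) u)" .
    have "X2 r s *v ((*v) (X2 r s) ^^ k) u = (-1)^k *s (X2 r s *v ((*v) (X1 r s) ^^ k) u)"
      by (simp only: Suc matrix_vector_mult_smult)
    then show ?case by (subst 4) simp
  qed simp
  have 3: "slice j (((*v) (X1 r s) ^^ k) z) = ((*v) (\<rho> r s) ^^ k) (slice j z)" for j k z
    by (induction k) (simp_all add: tensor_gen_simps[unfolded One_nat_def] slice_left)
  have "top (((*v) (X1 r s) ^^ k) u) = 0"
    unfolding top_def contr_def 3 V.xi_raise[OF rs] by (simp add: vec_eq_iff)
  then show ?thesis unfolding 1 2 top_linear by simp
qed

end

section \<open>Polarised traces\<close>

text \<open>Splitting off the last index repeatedly turns the sum over index functions in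
  \<open>pol_trace\<close> into nested sums.\<close>

lemma sum_PiE_Suc:
  fixes f :: "(nat \<Rightarrow> nat) \<Rightarrow> 'b::comm_monoid_add"
  assumes "finite T"
  shows "(\<Sum>i \<in> {0..<Suc n} \<rightarrow>\<^sub>E T. f i) = (\<Sum>i \<in> {0..<n} \<rightarrow>\<^sub>E T. \<Sum>x\<in>T. f (i(n := x)))"
proof -
  have ins: "{0..<Suc n} = insert n {0..<n}" by auto
  have "(\<Sum>i \<in> {0..<Suc n} \<rightarrow>\<^sub>E T. f i) = (\<Sum>(x, i) \<in> T \<times> ({0..<n} \<rightarrow>\<^sub>E T). f (i(n := x)))"
    unfolding ins PiE_insert_eq
    by (subst sum.reindex, rule inj_combinator, simp, simp add: case_prod_unfold o_def)
  also have "\<dots> = (\<Sum>x\<in>T. \<Sum>i \<in> {0..<n} \<rightarrow>\<^sub>E T. f (i(n := x)))"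
    by (rule sum.cartesian_product[symmetric])
  also have "\<dots> = (\<Sum>i \<in> {0..<n} \<rightarrow>\<^sub>E T. \<Sum>x\<in>T. f (i(n := x)))" by (rule sum.swap)
  finally show ?thesis .
qed

lemma sum_PiE_0: "(\<Sum>i \<in> {0..<0::nat} \<rightarrow>\<^sub>E T. f i) = f (\<lambda>_. undefined)"
  by simp

lemma pol_trace_2:
  "pol_trace e [a, b] = (\<Sum>i\<in>{1..3}. \<Sum>j\<in>{1..3}. e a j i ** e b i j)"
proof -
  have l: "length [a, b] = Suc (Suc 0)" by simp
  show ?thesis
    unfolding pol_trace_def l sum_PiE_Suc[OF finite_atLeastAtMost] sum_PiE_0
    by (simp add: upt_rec numeral_2_eq_2)
qed

lemma pol_trace_3:
  "pol_trace e [a, b, c] = (\<Sum>i\<in>{1..3}. \<Sum>j\<in>{1..3}. \<Sum>k\<in>{1..3}. e a j i ** (e b k j ** e c i k))"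
proof -
  have l: "length [a, b, c] = Suc (Suc (Suc 0))" by simp
  show ?thesis
    unfolding pol_trace_def l sum_PiE_Suc[OF finite_atLeastAtMost] sum_PiE_0
    by (simp add: upt_rec)
qed

lemma pol_trace_4:
  "pol_trace e [a, b, c, d] = (\<Sum>i\<in>{1..3}. \<Sum>j\<in>{1..3}. \<Sum>k\<in>{1..3}. \<Sum>l\<in>{1..3}.
     e a j i ** (e b k j ** (e c l k ** e d i l)))"
proof -
  have l: "length [a, b, c, d] = Suc (Suc (Suc (Suc 0)))" by simp
  show ?thesis
    unfolding pol_trace_def l sum_PiE_Suc[OF finite_atLeastAtMost] sum_PiE_0
    by (simp add: upt_rec)
qed

lemma pol_trace_bar_4:
  "pol_trace_bar e [a, b, c, d] = (\<Sum>i\<in>{1..3}. \<Sum>j\<in>{1..3}. \<Sum>k\<in>{1..3}. \<Sum>l\<in>{1..3}.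
     e a i j ** (e b j k ** (e c k l ** e d l i)))"
proof -
  have l: "length [a, b, c, d] = Suc (Suc (Suc (Suc 0)))" by simp
  show ?thesis
    unfolding pol_trace_bar_def l sum_PiE_Suc[OF finite_atLeastAtMost] sum_PiE_0
    by (simp add: upt_rec)
qed

subsection \<open>Tensor operators\<close>

text \<open>A \<open>3 \<times> 3\<close> array of additive operators which transforms under the representation \<open>\<tau>\<close> in the same
  way as the generators.  Such arrays are closed under matrix products, and their traces commute with \<open>\<tau>\<close>.\<close>

definition tensor_operator :: "'k::finite rep \<Rightarrow> (nat \<Rightarrow> nat \<Rightarrow> complex^'k \<Rightarrow> complex^'k) \<Rightarrow> bool" where
  "tensor_operator \<tau> A \<longleftrightarrow>
     (\<forall>i j x y. A i j (x + y) = A i j x + A i j y) \<and>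
     (\<forall>p\<in>{1..3}. \<forall>q\<in>{1..3}. \<forall>i\<in>{1..3}. \<forall>j\<in>{1..3}. \<forall>z. \<tau> p q *v A i j z =
        A i j (\<tau> p q *v z) + (if q = i then A p j z else 0) - (if j = p then A i q z else 0))"

lemma additive_facts:
  fixes f :: "complex^'k \<Rightarrow> complex^'k"
  assumes "\<And>x y. f (x + y) = f x + f y"
  shows "f 0 = 0" "f (x - y) = f x - f y" "f (\<Sum>i\<in>I. g i) = (\<Sum>i\<in>I. f (g i))"
proof -
  show 0: "f 0 = 0" using assms[of 0 0] by simp
  show "f (x - y) = f x - f y" using assms[of "x - y" y] by (simp add: eq_diff_eq)
  show "f (\<Sum>i\<in>I. g i) = (\<Sum>i\<in>I. f (g i))"
    by (induction I rule: infinite_finite_induct) (auto simp: 0 assms)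
qed

lemma tensor_operatorD:
  assumes "tensor_operator \<tau> A"
  shows "A i j (x + y) = A i j x + A i j y" "A i j 0 = 0" "A i j (x - y) = A i j x - A i j y"
    "A i j (\<Sum>k\<in>K. g k) = (\<Sum>k\<in>K. A i j (g k))"
    "p \<in> {1..3} \<Longrightarrow> q \<in> {1..3} \<Longrightarrow> i \<in> {1..3} \<Longrightarrow> j \<in> {1..3} \<Longrightarrow> \<tau> p q *v A i j z =
        A i j (\<tau> p q *v z) + (if q = i then A p j z else 0) - (if j = p then A i q z else 0)"
proof -
  have add: "\<And>x y. A i j (x + y) = A i j x + A i j y" using assms unfolding tensor_operator_def by blast
  then show "A i j (x + y) = A i j x + A i j y" .
  show "A i j 0 = 0" "A i j (x - y) = A i j x - A i j y" "A i j (\<Sum>k\<in>K. g k) = (\<Sum>k\<in>K. A i j (g k))"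
    using additive_facts[of "A i j", OF add] by auto
  show "p \<in> {1..3} \<Longrightarrow> q \<in> {1..3} \<Longrightarrow> i \<in> {1..3} \<Longrightarrow> j \<in> {1..3} \<Longrightarrow> \<tau> p q *v A i j z =
        A i j (\<tau> p q *v z) + (if q = i then A p j z else 0) - (if j = p then A i q z else 0)"
    using assms unfolding tensor_operator_def by blast
qed

text \<open>The two index patterns are those of the traces T and of the barred traces. In both, the
  two commutator terms at the contracted index cancel.\<close>

lemma tensor_operator_prod:
  assumes A: "tensor_operator \<tau> A" and B: "tensor_operator \<tau> B"
  shows "tensor_operator \<tau> (\<lambda>c a z. \<Sum>b\<in>{1..3}. A b a (B c b z))"
    and "tensor_operator \<tau> (\<lambda>a c z. \<Sum>b\<in>{1..3}. A a b (B b c z))"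
proof -
  note AD = tensor_operatorD[OF A] and BD = tensor_operatorD[OF B]
  have mem: "(\<Sum>b\<in>{1..3::nat}. if q = b then f b else 0) = f q" if "q \<in> {1..3}" for q and f :: "nat \<Rightarrow> complex^'b"
    using that by (subst sum.delta') auto
  have mem': "(\<Sum>b\<in>{1..3::nat}. if b = q then f b else 0) = f q" if "q \<in> {1..3}" for q and f :: "nat \<Rightarrow> complex^'b"
    using that by (subst sum.delta) auto
  have if_app: "A i j (if P then x else 0) = (if P then A i j x else 0)" for i j P x
    using AD(2) by auto
  show "tensor_operator \<tau> (\<lambda>c a z. \<Sum>b\<in>{1..3}. A b a (B c b z))"
    unfolding tensor_operator_def
  proof (intro conjI allI ballI)
    fix c a x y show "(\<Sum>b\<in>{1..3}. A b a (B c b (x + y))) = (\<Sum>b\<in>{1..3}. A b a (B c b x)) + (\<Sum>b\<in>{1..3}. A b a (B c b y))"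
      by (simp only: AD BD sum.distrib)
  next
    fix p q c a :: nat and z assume h: "p \<in> {1..3}" "q \<in> {1..3}" "c \<in> {1..3}" "a \<in> {1..3}"
    have "\<tau> p q *v (\<Sum>b\<in>{1..3}. A b a (B c b z)) =
      (\<Sum>b\<in>{1..3}. A b a (B c b (\<tau> p q *v z)) + (if q = c then A b a (B p b z) else 0) - (if b = p then A b a (B c q z) else 0)
        + (if q = b then A p a (B c b z) else 0) - (if a = p then A b q (B c b z) else 0))"
      unfolding matrix_vector_mult_sum
    proof (rule sum.cong)
      fix b :: nat assume b: "b \<in> {1..3}"
      show "\<tau> p q *v A b a (B c b z) = A b a (B c b (\<tau> p q *v z)) + (if q = c then A b a (B p b z) else 0) - (if b = p then A b a (B c q z) else 0)
        + (if q = b then A p a (B c b z) else 0) - (if a = p then A b q (B c b z) else 0)"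
        unfolding AD(5)[OF h(1,2) b h(4)] BD(5)[OF h(1,2,3) b] AD(1,3) if_app by simp
    qed simp
    also have "\<dots> = (\<Sum>b\<in>{1..3}. A b a (B c b (\<tau> p q *v z))) + (if q = c then (\<Sum>b\<in>{1..3}. A b a (B p b z)) else 0) - A p a (B c q z)
        + A p a (B c q z) - (if a = p then (\<Sum>b\<in>{1..3}. A b q (B c b z)) else 0)"
      unfolding sum_subtractf sum.distrib mem[OF h(2)] mem'[OF h(1)] by auto
    finally show "\<tau> p q *v (\<Sum>b\<in>{1..3}. A b a (B c b z)) = (\<Sum>b\<in>{1..3}. A b a (B c b (\<tau> p q *v z)))
       + (if q = c then \<Sum>b\<in>{1..3}. A b a (B p b z) else 0) - (if a = p then \<Sum>b\<in>{1..3}. A b q (B c b z) else 0)"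
      by simp
  qed
  show "tensor_operator \<tau> (\<lambda>a c z. \<Sum>b\<in>{1..3}. A a b (B b c z))"
    unfolding tensor_operator_def
  proof (intro conjI allI ballI)
    fix a c x y show "(\<Sum>b\<in>{1..3}. A a b (B b c (x + y))) = (\<Sum>b\<in>{1..3}. A a b (B b c x)) + (\<Sum>b\<in>{1..3}. A a b (B b c y))"
      by (simp only: AD BD sum.distrib)
  next
    fix p q a c :: nat and z assume h: "p \<in> {1..3}" "q \<in> {1..3}" "a \<in> {1..3}" "c \<in> {1..3}"
    have "\<tau> p q *v (\<Sum>b\<in>{1..3}. A a b (B b c z)) =
      (\<Sum>b\<in>{1..3}. A a b (B b c (\<tau> p q *v z)) + (if q = b then A a b (B p c z) else 0) - (if c = p then A a b (B b q z) else 0)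
        + (if q = a then A p b (B b c z) else 0) - (if b = p then A a q (B b c z) else 0))"
      unfolding matrix_vector_mult_sum
    proof (rule sum.cong)
      fix b :: nat assume b: "b \<in> {1..3}"
      show "\<tau> p q *v A a b (B b c z) = A a b (B b c (\<tau> p q *v z)) + (if q = b then A a b (B p c z) else 0) - (if c = p then A a b (B b q z) else 0)
        + (if q = a then A p b (B b c z) else 0) - (if b = p then A a q (B b c z) else 0)"
        unfolding AD(5)[OF h(1,2,3) b] BD(5)[OF h(1,2) b h(4)] AD(1,3) if_app by simp
    qed simp
    also have "\<dots> = (\<Sum>b\<in>{1..3}. A a b (B b c (\<tau> p q *v z))) + A a q (B p c z) - (if c = p then (\<Sum>b\<in>{1..3}. A a b (B b q z)) else 0)
        + (if q = a then (\<Sum>b\<in>{1..3}. A p b (B b c z)) else 0) - A a q (B p c z)"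
      unfolding sum_subtractf sum.distrib mem[OF h(2)] mem'[OF h(1)] by auto
    finally show "\<tau> p q *v (\<Sum>b\<in>{1..3}. A a b (B b c z)) = (\<Sum>b\<in>{1..3}. A a b (B b c (\<tau> p q *v z)))
       + (if q = a then \<Sum>b\<in>{1..3}. A p b (B b c z) else 0) - (if c = p then \<Sum>b\<in>{1..3}. A a b (B b q z) else 0)"
      by simp
  qed
qed

lemma tensor_operator_trace:
  assumes A: "tensor_operator \<tau> A" and h: "p \<in> {1..3}" "q \<in> {1..3}"
  shows "\<tau> p q *v (\<Sum>i\<in>{1..3}. A i i z) = (\<Sum>i\<in>{1..3}. A i i (\<tau> p q *v z))"
proof -
  have e: "{1..3::nat} = {1,2,3}" by auto
  have "\<tau> p q *v A i i z = A i i (\<tau> p q *v z) + (if q = i then A p i z else 0) - (if i = p then A i q z else 0)" if "i \<in> {1..3}" for i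
    using tensor_operatorD(5)[OF A h that that] .
  then have "\<tau> p q *v (\<Sum>i\<in>{1..3}. A i i z) = (\<Sum>i\<in>{1..3}. A i i (\<tau> p q *v z)) + (\<Sum>i\<in>{1..3}. if q = i then A p i z else 0) - (\<Sum>i\<in>{1..3}. if i = p then A i q z else 0)"
    unfolding matrix_vector_mult_sum by (simp add: sum.distrib sum_subtractf)
  also have "(\<Sum>i\<in>{1..3}. if q = i then A p i z else 0) = A p q z"
    using h by (subst sum.delta') auto
  also have "(\<Sum>i\<in>{1..3}. if i = p then A i q z else 0) = A p q z"
    using h by (subst sum.delta) auto
  finally show ?thesis by simp
qed

lemma tensor_operator_rep:
  assumes "sl3_rep \<tau>" shows "tensor_operator \<tau> (\<lambda>i j z. \<tau> i j *v z)"
  unfolding tensor_operator_def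
proof (intro conjI allI ballI)
  fix p q i j :: nat and z assume h: "p \<in> {1..3}" "q \<in> {1..3}" "i \<in> {1..3}" "j \<in> {1..3}"
  show "\<tau> p q *v (\<tau> i j *v z) = \<tau> i j *v (\<tau> p q *v z) + (if q = i then \<tau> p j *v z else 0) - (if j = p then \<tau> i q *v z else 0)"
    by (rule sl3_rep_commute[OF assms h])
qed (simp add: matrix_vector_right_distrib)

lemma tensor_operator_gen:
  assumes "sl3_rep \<rho>" "sl3_rep \<rho>'" "g = 1 \<or> g = 2"
  shows "tensor_operator (tensor_rep \<rho> \<rho>') (\<lambda>i j z. tensor_gen \<rho> \<rho>' g i j *v z)"
proof -
  have "tensor_operator (tensor_rep \<rho> \<rho>') (\<lambda>i j z. tensor_gen \<rho> \<rho>' 1 i j *v z)"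
    unfolding tensor_operator_def
  proof (intro conjI allI ballI)
    fix p q i j :: nat and z assume h: "p \<in> {1..3}" "q \<in> {1..3}" "i \<in> {1..3}" "j \<in> {1..3}"
    show "tensor_rep \<rho> \<rho>' p q *v (tensor_gen \<rho> \<rho>' 1 i j *v z) = tensor_gen \<rho> \<rho>' 1 i j *v (tensor_rep \<rho> \<rho>' p q *v z)
      + (if q = i then tensor_gen \<rho> \<rho>' 1 p j *v z else 0) - (if j = p then tensor_gen \<rho> \<rho>' 1 i q *v z else 0)"
      unfolding tensor_rep_vector matrix_vector_right_distrib tensor_gen_commute
        sl3_rep_commute[OF sl3_rep_tensor_gen(1)[OF assms(1,2)] h] by (simp add: algebra_simps)
  qed (simp add: matrix_vector_right_distrib)
  moreover have "tensor_operator (tensor_rep \<rho> \<rho>') (\<lambda>i j z. tensor_gen \<rho> \<rho>' 2 i j *v z)"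
    unfolding tensor_operator_def
  proof (intro conjI allI ballI)
    fix p q i j :: nat and z assume h: "p \<in> {1..3}" "q \<in> {1..3}" "i \<in> {1..3}" "j \<in> {1..3}"
    show "tensor_rep \<rho> \<rho>' p q *v (tensor_gen \<rho> \<rho>' 2 i j *v z) = tensor_gen \<rho> \<rho>' 2 i j *v (tensor_rep \<rho> \<rho>' p q *v z)
      + (if q = i then tensor_gen \<rho> \<rho>' 2 p j *v z else 0) - (if j = p then tensor_gen \<rho> \<rho>' 2 i q *v z else 0)"
      unfolding tensor_rep_vector matrix_vector_right_distrib tensor_gen_commute
        sl3_rep_commute[OF sl3_rep_tensor_gen(2)[OF assms(1,2)] h] by (simp add: algebra_simps)
  qed (simp add: matrix_vector_right_distrib)
  ultimately show ?thesis using assms(3) by blast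
qed

subsection \<open>The operators \<open>X\<close> and \<open>Y\<close>\<close>

lemmas trace_vector = matrix_sum_vector_mult matrix_vector_mul_assoc[symmetric] matrix_vector_mult_add_rdistrib

text \<open>A polarised trace is the trace of a nested product of tensor operators, one for each
  letter of the list.\<close>

lemma pol_trace_commute:
  assumes \<rho>: "sl3_rep \<rho>" "sl3_rep \<rho>'" and g: "a = 1 \<or> a = 2" "b = 1 \<or> b = 2" "c = 1 \<or> c = 2" "d = 1 \<or> d = 2"
    and h: "p \<in> {1..3}" "q \<in> {1..3}"
  defines "T \<equiv> pol_trace (tensor_gen \<rho> \<rho>')" and "T' \<equiv> pol_trace_bar (tensor_gen \<rho> \<rho>')"
    and "\<tau> \<equiv> tensor_rep \<rho> \<rho>' p q"
  shows "\<tau> *v (T [a,b] *v z) = T [a,b] *v (\<tau> *v z)"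
    "\<tau> *v (T [a,b,c] *v z) = T [a,b,c] *v (\<tau> *v z)"
    "\<tau> *v (T [a,b,c,d] *v z) = T [a,b,c,d] *v (\<tau> *v z)"
    "\<tau> *v (T' [a,b,c,d] *v z) = T' [a,b,c,d] *v (\<tau> *v z)"
proof -
  let ?e = "\<lambda>g i j z. tensor_gen \<rho> \<rho>' g i j *v z"
  note G = tensor_operator_gen[OF \<rho> g(1)] tensor_operator_gen[OF \<rho> g(2)] tensor_operator_gen[OF \<rho> g(3)] tensor_operator_gen[OF \<rho> g(4)]
  have 2: "T [a,b] *v z = (\<Sum>i\<in>{1..3}. \<Sum>j\<in>{1..3}. ?e a j i (?e b i j z))" for z
    unfolding T_def pol_trace_2 trace_vector ..
  show "\<tau> *v (T [a,b] *v z) = T [a,b] *v (\<tau> *v z)"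
    unfolding 2 \<tau>_def by (rule tensor_operator_trace[OF tensor_operator_prod(1)[OF G(1,2)] h])
  have 3: "T [a,b,c] *v z = (\<Sum>i\<in>{1..3}. \<Sum>j\<in>{1..3}. ?e a j i (\<Sum>k\<in>{1..3}. ?e b k j (?e c i k z)))" for z
    unfolding T_def pol_trace_3 trace_vector matrix_vector_mult_sum ..
  show "\<tau> *v (T [a,b,c] *v z) = T [a,b,c] *v (\<tau> *v z)"
    unfolding 3 \<tau>_def by (rule tensor_operator_trace[OF tensor_operator_prod(1)[OF G(1) tensor_operator_prod(1)[OF G(2,3)]] h])
  have 4: "T [a,b,c,d] *v z = (\<Sum>i\<in>{1..3}. \<Sum>j\<in>{1..3}. ?e a j i (\<Sum>k\<in>{1..3}. ?e b k j (\<Sum>l\<in>{1..3}. ?e c l k (?e d i l z))))" for z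
    unfolding T_def pol_trace_4 trace_vector matrix_vector_mult_sum ..
  show "\<tau> *v (T [a,b,c,d] *v z) = T [a,b,c,d] *v (\<tau> *v z)"
    unfolding 4 \<tau>_def by (rule tensor_operator_trace[OF tensor_operator_prod(1)[OF G(1) tensor_operator_prod(1)[OF G(2) tensor_operator_prod(1)[OF G(3,4)]]] h])
  have 5: "T' [a,b,c,d] *v z = (\<Sum>i\<in>{1..3}. \<Sum>j\<in>{1..3}. ?e a i j (\<Sum>k\<in>{1..3}. ?e b j k (\<Sum>l\<in>{1..3}. ?e c k l (?e d l i z))))" for z
    unfolding T'_def pol_trace_bar_4 trace_vector matrix_vector_mult_sum ..
  show "\<tau> *v (T' [a,b,c,d] *v z) = T' [a,b,c,d] *v (\<tau> *v z)"
    unfolding 5 \<tau>_def by (rule tensor_operator_trace[OF tensor_operator_prod(2)[OF G(1) tensor_operator_prod(2)[OF G(2) tensor_operator_prod(2)[OF G(3,4)]]] h])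
qed

lemma casimir_L_vector:
  "casimir_L \<rho> *v z = (1/2) *s
    ((\<Sum>i\<in>{1..3}. \<Sum>j\<in>{1..3}. \<rho> i j *v (\<Sum>k\<in>{1..3}. \<rho> j k *v (\<rho> k i *v z))) +
     (\<Sum>i\<in>{1..3}. \<Sum>j\<in>{1..3}. \<rho> j i *v (\<Sum>k\<in>{1..3}. \<rho> k j *v (\<rho> i k *v z))))"
  unfolding casimir_L_def scaleR_matrix_vector_mult trace_vector matrix_vector_mult_sum sum.distrib by simp

lemma casimir_L_commute:
  assumes \<rho>: "sl3_rep \<rho>" and h: "p \<in> {1..3}" "q \<in> {1..3}"
  shows "\<rho> p q *v (casimir_L \<rho> *v z) = casimir_L \<rho> *v (\<rho> p q *v z)"
proof -
  note G = tensor_operator_rep[OF \<rho>]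
  show ?thesis
    unfolding casimir_L_vector matrix_vector_mult_smult matrix_vector_right_distrib
      tensor_operator_trace[OF tensor_operator_prod(1)[OF G tensor_operator_prod(1)[OF G G]] h]
      tensor_operator_trace[OF tensor_operator_prod(2)[OF G tensor_operator_prod(2)[OF G G]] h] ..
qed

section \<open>The action on a weight space of the second factor\<close>

lemma sum_three: "(\<Sum>d\<in>{1..3::nat}. f d) = f 1 + f 2 + (f 3 :: 'a::comm_monoid_add)"
proof -
  have "{1..3::nat} = {1, 2, 3}" by auto
  then show ?thesis by (simp add: add.assoc)
qed

text \<open>An entry of the square of the array of generators, contracted in the index pattern of T.
  It collects the two letters of the second factor in \<open>T [1,2,2]\<close> and
  \<open>T [1,1,2,2]\<close>.\<close>

definition quad_op :: "'n::finite rep \<Rightarrow> nat \<Rightarrow> nat \<Rightarrow> complex^'n \<Rightarrow> complex^'n" where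
  "quad_op \<rho> a b z = (\<Sum>d\<in>{1..3}. \<rho> d b *v (\<rho> a d *v z))"

lemma quad_op_linear:
  "quad_op \<rho> a b (x + y) = quad_op \<rho> a b x + quad_op \<rho> a b y"
  "quad_op \<rho> a b (x - y) = quad_op \<rho> a b x - quad_op \<rho> a b y"
  "quad_op \<rho> a b (c *s x) = c *s quad_op \<rho> a b x"
  "quad_op \<rho> a b 0 = 0"
  by (simp_all add: quad_op_def matrix_vector_right_distrib matrix_vector_mult_diff_distrib sum.distrib sum_subtractf vec.scale_sum_right)

context hw_triple
begin

abbreviation quad where "quad \<equiv> quad_op \<rho>"
lemmas quad_def = quad_op_def[of \<rho>]

lemma B_m1: "B (-1) i2 i3 j1 j2 j3 = 0" "B i1 (-1) i3 j1 j2 j3 = 0" "B i1 i2 (-1) j1 j2 j3 = 0"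
  "B i1 i2 i3 (-1) j2 j3 = 0" "B i1 i2 i3 j1 (-1) j3 = 0" "B i1 i2 i3 j1 j2 (-1) = 0"
  "B i1 (-2) i3 j1 j2 j3 = 0" "B i1 i2 i3 j1 (-2) j3 = 0"
  by (rule B_neg, simp)+

text \<open>Named so that computations modulo the trace relation become exact identities with
  explicit multiples of \<open>tr\<close>, which are then dropped by \<open>tr_zero\<close>.\<close>

definition tr :: "(complex^'n) family" where
  "tr i1 i2 i3 j1 j2 j3 = of_int ((i1 + 1) * (j1 + 1)) *s B (i1 + 1) i2 i3 (j1 + 1) j2 j3
   + of_int ((i2 + 1) * (j2 + 1)) *s B i1 (i2 + 1) i3 j1 (j2 + 1) j3
   + of_int ((i3 + 1) * (j3 + 1)) *s B i1 i2 (i3 + 1) j1 j2 (j3 + 1)"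

lemma tr_zero: "tr i1 i2 i3 j1 j2 j3 = 0"
  unfolding tr_def by (rule B_trace)

lemma quad_B:
  "quad 1 1 (B i1 i2 i3 j1 j2 j3) = (of_int i1 * (of_int (i1 + i2 + i3) - of_int j1 - 2 * shift) + of_int (i1 + i2 + i3) - of_int i1 + of_int j1 * (of_int (j1 + j2 + j3) + 2 * shift + 2) + shift * shift) *s B i1 i2 i3 j1 j2 j3
     - ((of_int i1 + 1) * (of_int j1 + 1)) *s B (i1 + 1) (i2 - 1) i3 (j1 + 1) (j2 - 1) j3
     - ((of_int i1 + 1) * (of_int j1 + 1)) *s B (i1 + 1) i2 (i3 - 1) (j1 + 1) j2 (j3 - 1)"
    (is "?a11 = ?b11")
  "quad 2 2 (B i1 i2 i3 j1 j2 j3) = (of_int i2 * (of_int (i1 + i2 + i3) - of_int j2 - 2 * shift) + of_int (i1 + i2 + i3) - of_int i2 + of_int j2 * (of_int (j1 + j2 + j3) + 2 * shift + 2) + shift * shift) *s B i1 i2 i3 j1 j2 j3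
     - ((of_int i2 + 1) * (of_int j2 + 1)) *s B (i1 - 1) (i2 + 1) i3 (j1 - 1) (j2 + 1) j3
     - ((of_int i2 + 1) * (of_int j2 + 1)) *s B i1 (i2 + 1) (i3 - 1) j1 (j2 + 1) (j3 - 1)"
    (is "?a22 = ?b22")
  "quad 3 3 (B i1 i2 i3 j1 j2 j3) = (of_int i3 * (of_int (i1 + i2 + i3) - of_int j3 - 2 * shift) + of_int (i1 + i2 + i3) - of_int i3 + of_int j3 * (of_int (j1 + j2 + j3) + 2 * shift + 2) + shift * shift) *s B i1 i2 i3 j1 j2 j3
     - ((of_int i3 + 1) * (of_int j3 + 1)) *s B (i1 - 1) i2 (i3 + 1) (j1 - 1) j2 (j3 + 1)
     - ((of_int i3 + 1) * (of_int j3 + 1)) *s B i1 (i2 - 1) (i3 + 1) j1 (j2 - 1) (j3 + 1)"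
    (is "?a33 = ?b33")
  "quad 2 1 (B i1 i2 i3 j1 j2 j3) = ((of_int i2 + 1) * (of_int (i1 + i2 + i3) - of_int j1 - 1 - 2 * shift)) *s B (i1 - 1) (i2 + 1) i3 j1 j2 j3 + ((of_int j1 + 1) * (of_int (j1 + j2 + j3) + 2 + 2 * shift - of_int i2)) *s B i1 i2 i3 (j1 + 1) (j2 - 1) j3
     - ((of_int i2 + 1) * (of_int j1 + 1)) *s B i1 (i2 + 1) (i3 - 1) (j1 + 1) j2 (j3 - 1)"
    (is "?a21 = ?b21")
  "quad 3 2 (B i1 i2 i3 j1 j2 j3) = ((of_int i3 + 1) * (of_int (i1 + i2 + i3) - of_int j2 - 1 - 2 * shift)) *s B i1 (i2 - 1) (i3 + 1) j1 j2 j3 + ((of_int j2 + 1) * (of_int (j1 + j2 + j3) + 2 + 2 * shift - of_int i3)) *s B i1 i2 i3 j1 (j2 + 1) (j3 - 1)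
     - ((of_int i3 + 1) * (of_int j2 + 1)) *s B (i1 - 1) i2 (i3 + 1) (j1 - 1) (j2 + 1) j3"
    (is "?a32 = ?b32")
  "quad 3 1 (B i1 i2 i3 j1 j2 j3) = ((of_int i3 + 1) * (of_int (i1 + i2 + i3) - of_int j1 - 1 - 2 * shift)) *s B (i1 - 1) i2 (i3 + 1) j1 j2 j3 + ((of_int j1 + 1) * (of_int (j1 + j2 + j3) + 2 + 2 * shift - of_int i3)) *s B i1 i2 i3 (j1 + 1) j2 (j3 - 1)
     - ((of_int i3 + 1) * (of_int j1 + 1)) *s B i1 (i2 - 1) (i3 + 1) (j1 + 1) (j2 - 1) j3"
    (is "?a31 = ?b31")
proof -
  have "?a11 = ?b11 - tr (i1 - 1) i2 i3 (j1 - 1) j2 j3"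
    by (simp only: quad_def tr_def sum_three B_action matrix_vector_mult_smult matrix_vector_mult_diff_distrib) (simp add: vec_eq_iff algebra_simps)
  then show "?a11 = ?b11" by (simp only: tr_zero diff_zero)
  have "?a22 = ?b22 - tr i1 (i2 - 1) i3 j1 (j2 - 1) j3"
    by (simp only: quad_def tr_def sum_three B_action matrix_vector_mult_smult matrix_vector_mult_diff_distrib) (simp add: vec_eq_iff algebra_simps)
  then show "?a22 = ?b22" by (simp only: tr_zero diff_zero)
  have "?a33 = ?b33 - tr i1 i2 (i3 - 1) j1 j2 (j3 - 1)"
    by (simp only: quad_def tr_def sum_three B_action matrix_vector_mult_smult matrix_vector_mult_diff_distrib) (simp add: vec_eq_iff algebra_simps)
  then show "?a33 = ?b33" by (simp only: tr_zero diff_zero)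
  have "?a21 = ?b21 - tr (i1 - 1) i2 i3 j1 (j2 - 1) j3"
    by (simp only: quad_def tr_def sum_three B_action matrix_vector_mult_smult matrix_vector_mult_diff_distrib) (simp add: vec_eq_iff algebra_simps)
  then show "?a21 = ?b21" by (simp only: tr_zero diff_zero)
  have "?a32 = ?b32 - tr i1 (i2 - 1) i3 j1 j2 (j3 - 1)"
    by (simp only: quad_def tr_def sum_three B_action matrix_vector_mult_smult matrix_vector_mult_diff_distrib) (simp add: vec_eq_iff algebra_simps)
  then show "?a32 = ?b32" by (simp only: tr_zero diff_zero)
  have "?a31 = ?b31 - tr (i1 - 1) i2 i3 j1 j2 (j3 - 1)"
    by (simp only: quad_def tr_def sum_three B_action matrix_vector_mult_smult matrix_vector_mult_diff_distrib) (simp add: vec_eq_iff algebra_simps)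
  then show "?a31 = ?b31" by (simp only: tr_zero diff_zero)
qed

lemmas chain_simps = tr_def quad_B quad_op_linear B_action matrix_vector_mult_smult matrix_vector_right_distrib
  matrix_vector_mult_diff_distrib matrix_vector_mult_0_right

text \<open>The monomials of a given weight, reduced modulo \<open>\<Sum>\<^sub>k y\<^sub>k \<beta>\<^sub>k\<close> so that they do not contain
  \<open>y\<^sub>2 \<beta>\<^sub>2\<close>, form a chain, and the elements of weight 0 of the enveloping algebra considered here move
  each of them at most one step.\<close>

lemma chain_action_A:
  fixes k1 p k3 l1 l3 :: int
  defines "x1 \<equiv> of_int k1 :: complex" and "y \<equiv> of_int p :: complex" and "x3 \<equiv> of_int k3 :: complex"
    and "z1 \<equiv> of_int l1 :: complex" and "z3 \<equiv> of_int l3 :: complex"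
    and "u \<equiv> B (k1 + 1) p (k3 - 1) (l1 + 1) 0 (l3 - 1)"
    and "w \<equiv> B k1 p k3 l1 0 l3"
    and "t \<equiv> B (k1 - 1) p (k3 + 1) (l1 - 1) 0 (l3 + 1)"
  shows
    "\<rho> 2 1 *v (\<rho> 1 2 *v w) = 0 *s u + (x1 * y + x1 * z1 + y + z1) *s w + ((x3 + 1) * (z3 + 1))
        *s t" (is "?a0 = ?b0")
    "\<rho> 3 2 *v (\<rho> 2 3 *v w) = ((x1 + 1) * (z1 + 1)) *s u + (y * x3 + x3 * z3 + x3) *s w + 0 *s
        t" (is "?a1 = ?b1")
    "\<rho> 3 1 *v (\<rho> 1 3 *v w) = (- (x1 + 1) * (z1 + 1)) *s u + (x1 * x3 + x3 + z1 * z3 + z1) *s w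
        + (- (x3 + 1) * (z3 + 1)) *s t" (is "?a2 = ?b2")
    "\<rho> 3 1 *v (\<rho> 1 2 *v (\<rho> 2 3 *v w)) = (- (x1 + 1) * (z1 + 1) * (y + z1 + 1)) *s u + (x1
        * y * x3 + x1 * x3 * z1 + x1 * x3 + y * x3 - x3 * z1 * z3 + x3) *s w + ((x3 + 1) * (z3 + 1) * x3)
        *s t" (is "?a3 = ?b3")
    "quad 1 1 w = (- (x1 + 1) * (z1 + 1)) *s u + (x1 * x1 + x1 * y + x1 * x3 - x1 * z1 - 2 * x1 * shift +
        y + x3 + z1 * z1 + z1 * z3 + 2 * z1 * shift + 2 * z1 + shift * shift) *s w + 0 *s t" (is "?a4 = ?b4")
    "quad 2 2 w = ((x1 + 1) * (z1 + 1)) *s u + (x1 * y + x1 * z1 + x1 + y * y + y * x3 - 2 * y * shift +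
        x3 * z3 + x3 + shift * shift) *s w + ((x3 + 1) * (z3 + 1)) *s t" (is "?a5 = ?b5")
    "quad 3 3 w = 0 *s u + (x1 * x3 + x1 + y * x3 + y + x3 * x3 - x3 * z3 - 2 * x3 * shift + z1 * z3 + z3
        * z3 + 2 * z3 * shift + 2 * z3 + shift * shift) *s w + (- (x3 + 1) * (z3 + 1)) *s t" (is "?a6 = ?b6")
    "quad 2 1 (\<rho> 1 2 *v w) = (- (x1 + 1) * (z1 + 1) * (y + z1)) *s u + (x1 * x1 * y + x1 * x1 * z1 +
        x1 * y * y + x1 * y * x3 - 2 * x1 * y * shift + x1 * x3 * z1 - x1 * z1 * z1 - 2 * x1 * z1 * shift
        + y * y + y * x3 - 2 * y * shift - y - x3 * z1 * z3 - z1 * z1 - z1 * z3 - 2 * z1 * shift - 2 *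
        z1) *s w + ((x3 + 1) * (z3 + 1) * (x1 + y + x3 - z1 - 2 * shift)) *s t" (is "?a7 = ?b7")
    "quad 3 2 (\<rho> 2 3 *v w) = ((x1 + 1) * (z1 + 1) * (x3 - z1 - z3 - 2 * shift - 3)) *s u + (x1 * y *
        x3 + x1 * x3 * z1 + x1 * x3 + y * y * x3 + y * x3 * x3 - 2 * y * x3 * shift + x3 * x3 * z3 + x3 *
        x3 - x3 * z1 * z3 - x3 * z3 * z3 - 2 * x3 * z3 * shift - 3 * x3 * z3 - 2 * x3 * shift - x3) *s w
        + ((x3 + 1) * (z3 + 1) * x3) *s t" (is "?a8 = ?b8")
    "quad 3 1 (\<rho> 1 3 *v w) = ((x1 + 1) * (z1 + 1) * (- x3 + z1 + z3 + 2 * shift + 3)) *s u + (x1 *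
        x1 * x3 + x1 * y * x3 + x1 * x3 * x3 - x1 * x3 * z1 - 2 * x1 * x3 * shift + y * x3 + x3 * x3 + x3
        * z1 * z3 - 2 * x3 * shift - x3 - z1 * z1 * z3 - z1 * z1 - z1 * z3 * z3 - 2 * z1 * z3 * shift - 3
        * z1 * z3 - 2 * z1 * shift - 2 * z1) *s w + ((x3 + 1) * (z3 + 1) * (- x1 - y - x3 + z1 + 2 *
        shift)) *s t" (is "?a9 = ?b9")
    "quad 3 1 (\<rho> 1 2 *v (\<rho> 2 3 *v w)) = ((x1 + 1) * (z1 + 1) * (- y * x3 + y * z1 + y * z3 + 2
        * y * shift + 3 * y - x3 * z1 - x3 + z1 * z1 + z1 * z3 + 2 * z1 * shift + 4 * z1 + z3 + 2 * shift
        + 3)) *s u + (x1 * x1 * y * x3 + x1 * x1 * x3 * z1 + x1 * x1 * x3 + x1 * y * y * x3 + x1 * y * x3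
        * x3 - 2 * x1 * y * x3 * shift + x1 * y * x3 + x1 * x3 * x3 * z1 + x1 * x3 * x3 - x1 * x3 * z1 *
        z1 - 2 * x1 * x3 * z1 * shift - x1 * x3 * z1 - 2 * x1 * x3 * shift + y * y * x3 + y * x3 * x3 - 2
        * y * x3 * shift - x3 * x3 * z1 * z3 + x3 * x3 + x3 * z1 * z1 * z3 + x3 * z1 * z3 * z3 + 2 * x3 *
        z1 * z3 * shift + 3 * x3 * z1 * z3 - 2 * x3 * shift - x3) *s w + ((x3 + 1) * (z3 + 1) * (x1 * x3
        + y * x3 + x3 * x3 - x3 * z1 - 2 * x3 * shift)) *s t" (is "?a10 = ?b10")
proof -
  note d = x1_def y_def x3_def z1_def z3_def u_def w_def t_def
  \<comment> \<open>Here and below, the multiples of \<open>tr\<close> remove the monomials that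
    contain y_2 \<beta>_2, and these determine their coefficients.\<close>
  have "?a0 = ?b0 + (- 1) *s tr (k1 - 1) p k3 (l1 - 1) 0 l3"
    by (simp only: d chain_simps) (simp add: vec_eq_iff B_m1 algebra_simps)
  then show "?a0 = ?b0" unfolding tr_zero by simp
  have "?a1 = ?b1 + (- 1) *s tr k1 p (k3 - 1) l1 0 (l3 - 1)"
    by (simp only: d chain_simps) (simp add: vec_eq_iff B_m1 algebra_simps)
  then show "?a1 = ?b1" unfolding tr_zero by simp
  show "?a2 = ?b2"
    by (simp only: d chain_simps) (simp add: vec_eq_iff B_m1 algebra_simps)
  have "?a3 = ?b3 + (- x3) *s tr (k1 - 1) p k3 (l1 - 1) 0 l3 + (z1) *s tr k1 p (k3 - 1) l1 0 (l3 - 1)"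
    by (simp only: d chain_simps) (simp add: vec_eq_iff B_m1 algebra_simps)
  then show "?a3 = ?b3" unfolding tr_zero by simp
  show "?a4 = ?b4"
    by (simp only: d chain_simps) (simp add: vec_eq_iff B_m1 algebra_simps)
  have "?a5 = ?b5 + (- 1) *s tr (k1 - 1) p k3 (l1 - 1) 0 l3 + (- 1) *s tr k1 p (k3 - 1) l1 0 (l3 - 1)"
    by (simp only: d chain_simps) (simp add: vec_eq_iff B_m1 algebra_simps)
  then show "?a5 = ?b5" unfolding tr_zero by simp
  show "?a6 = ?b6"
    by (simp only: d chain_simps) (simp add: vec_eq_iff B_m1 algebra_simps)
  have "?a7 = ?b7 + (- x1 - y - x3 + z1 + 2 * shift) *s tr (k1 - 1) p k3 (l1 - 1) 0 l3 + (z1) *s tr k1 p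
        (k3 - 1) l1 0 (l3 - 1)"
    by (simp only: d chain_simps) (simp add: vec_eq_iff B_m1 algebra_simps)
  then show "?a7 = ?b7" unfolding tr_zero by simp
  have "?a8 = ?b8 + (- x3 + z1 + z3 + 2 * shift + 3) *s tr k1 p (k3 - 1) l1 0 (l3 - 1) + (- x3) *s tr (k1
        - 1) p k3 (l1 - 1) 0 l3"
    by (simp only: d chain_simps) (simp add: vec_eq_iff B_m1 algebra_simps)
  then show "?a8 = ?b8" unfolding tr_zero by simp
  show "?a9 = ?b9"
    by (simp only: d chain_simps) (simp add: vec_eq_iff B_m1 algebra_simps)
  have "?a10 = ?b10 + (- x1 * x3 - y * x3 - x3 * x3 + x3 * z1 + 2 * x3 * shift) *s tr (k1 - 1) p k3 (l1 -
        1) 0 l3 + (x3 * z1 - z1 * z1 - z1 * z3 - 2 * z1 * shift - 3 * z1) *s tr k1 p (k3 - 1) l1 0 (l3 -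
        1)"
    by (simp only: d chain_simps) (simp add: vec_eq_iff B_m1 algebra_simps)
  then show "?a10 = ?b10" unfolding tr_zero by simp
qed

text \<open>The same operators on the chain of weights with a power of \<beta>_2 in place of y_2;
  the polynomial coefficients differ between the two kinds of chain.\<close>

lemma chain_action_B:
  fixes k1 p k3 l1 l3 :: int
  defines "x1 \<equiv> of_int k1 :: complex" and "y \<equiv> of_int p :: complex" and "x3 \<equiv> of_int k3 :: complex"
    and "z1 \<equiv> of_int l1 :: complex" and "z3 \<equiv> of_int l3 :: complex"
    and "u \<equiv> B (k1 + 1) 0 (k3 - 1) (l1 + 1) p (l3 - 1)"
    and "w \<equiv> B k1 0 k3 l1 p l3"
    and "t \<equiv> B (k1 - 1) 0 (k3 + 1) (l1 - 1) p (l3 + 1)"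
  shows
    "\<rho> 2 1 *v (\<rho> 1 2 *v w) = 0 *s u + (x1 * z1 + y * z1 + z1) *s w + ((x3 + 1) * (z3 + 1)) *s
        t" (is "?a0 = ?b0")
    "\<rho> 3 2 *v (\<rho> 2 3 *v w) = ((x1 + 1) * (z1 + 1)) *s u + (y * z3 + y + x3 * z3 + x3) *s w + 0
        *s t" (is "?a1 = ?b1")
    "\<rho> 3 1 *v (\<rho> 1 3 *v w) = (- (x1 + 1) * (z1 + 1)) *s u + (x1 * x3 + x3 + z1 * z3 + z1) *s w
        + (- (x3 + 1) * (z3 + 1)) *s t" (is "?a2 = ?b2")
    "\<rho> 3 1 *v (\<rho> 1 2 *v (\<rho> 2 3 *v w)) = (- (x1 + 1) * (z1 + 1) * (z1 + 1)) *s u + (x1 * x3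
        * z1 + x1 * x3 - y * z1 * z3 - y * z1 - x3 * z1 * z3 + x3) *s w + ((x3 + 1) * (z3 + 1) * (y +
        x3)) *s t" (is "?a3 = ?b3")
    "quad 1 1 w = (- (x1 + 1) * (z1 + 1)) *s u + (x1 * x1 + x1 * x3 - x1 * z1 - 2 * x1 * shift + y * z1 +
        x3 + z1 * z1 + z1 * z3 + 2 * z1 * shift + 2 * z1 + shift * shift) *s w + 0 *s t" (is "?a4 = ?b4")
    "quad 2 2 w = ((x1 + 1) * (z1 + 1)) *s u + (x1 * z1 + x1 + y * y + y * z1 + y * z3 + 2 * y * shift +
        2 * y + x3 * z3 + x3 + shift * shift) *s w + ((x3 + 1) * (z3 + 1)) *s t" (is "?a5 = ?b5")
    "quad 3 3 w = 0 *s u + (x1 * x3 + x1 + y * z3 + x3 * x3 - x3 * z3 - 2 * x3 * shift + z1 * z3 + z3 *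
        z3 + 2 * z3 * shift + 2 * z3 + shift * shift) *s w + (- (x3 + 1) * (z3 + 1)) *s t" (is "?a6 = ?b6")
    "quad 2 1 (\<rho> 1 2 *v w) = (- (x1 + 1) * (z1 + 1) * z1) *s u + (x1 * x1 * z1 + x1 * x3 * z1 - x1 *
        z1 * z1 - 2 * x1 * z1 * shift - y * y * z1 - y * z1 * z1 - y * z1 * z3 - 2 * y * z1 * shift - 3 *
        y * z1 - x3 * z1 * z3 - z1 * z1 - z1 * z3 - 2 * z1 * shift - 2 * z1) *s w + ((x3 + 1) * (z3 + 1)
        * (x1 + x3 - z1 - 2 * shift)) *s t" (is "?a7 = ?b7")
    "quad 3 2 (\<rho> 2 3 *v w) = ((x1 + 1) * (z1 + 1) * (- y + x3 - z1 - z3 - 2 * shift - 3)) *s u + (x1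
        * x3 * z1 + x1 * x3 - y * y * z3 - y * y - y * z1 * z3 - y * z1 - y * z3 * z3 - 2 * y * z3 *
        shift - 3 * y * z3 - 2 * y * shift - 2 * y + x3 * x3 * z3 + x3 * x3 - x3 * z1 * z3 - x3 * z3 * z3
        - 2 * x3 * z3 * shift - 3 * x3 * z3 - 2 * x3 * shift - x3) *s w + ((x3 + 1) * (z3 + 1) * (y +
        x3)) *s t" (is "?a8 = ?b8")
    "quad 3 1 (\<rho> 1 3 *v w) = ((x1 + 1) * (z1 + 1) * (y - x3 + z1 + z3 + 2 * shift + 3)) *s u + (x1 *
        x1 * x3 + x1 * x3 * x3 - x1 * x3 * z1 - 2 * x1 * x3 * shift - y * z1 * z3 - y * z1 + x3 * x3 + x3
        * z1 * z3 - 2 * x3 * shift - x3 - z1 * z1 * z3 - z1 * z1 - z1 * z3 * z3 - 2 * z1 * z3 * shift - 3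
        * z1 * z3 - 2 * z1 * shift - 2 * z1) *s w + ((x3 + 1) * (z3 + 1) * (- x1 - x3 + z1 + 2 * shift))
        *s t" (is "?a9 = ?b9")
    "quad 3 1 (\<rho> 1 2 *v (\<rho> 2 3 *v w)) = ((x1 + 1) * (z1 + 1) * (y * z1 + y - x3 * z1 - x3 + z1
        * z1 + z1 * z3 + 2 * z1 * shift + 4 * z1 + z3 + 2 * shift + 3)) *s u + (x1 * x1 * x3 * z1 + x1 *
        x1 * x3 + x1 * x3 * x3 * z1 + x1 * x3 * x3 - x1 * x3 * z1 * z1 - 2 * x1 * x3 * z1 * shift - x1 *
        x3 * z1 - 2 * x1 * x3 * shift + y * y * z1 * z3 + y * y * z1 + y * z1 * z1 * z3 + y * z1 * z1 + y
        * z1 * z3 * z3 + 2 * y * z1 * z3 * shift + 3 * y * z1 * z3 + 2 * y * z1 * shift + 2 * y * z1 - x3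
        * x3 * z1 * z3 + x3 * x3 + x3 * z1 * z1 * z3 + x3 * z1 * z3 * z3 + 2 * x3 * z1 * z3 * shift + 3 *
        x3 * z1 * z3 - 2 * x3 * shift - x3) *s w + ((x3 + 1) * (z3 + 1) * (x1 * y + x1 * x3 + y * x3 - y
        * z1 - 2 * y * shift + x3 * x3 - x3 * z1 - 2 * x3 * shift)) *s t" (is "?a10 = ?b10")
proof -
  note d = x1_def y_def x3_def z1_def z3_def u_def w_def t_def
  have "?a0 = ?b0 + (- 1) *s tr (k1 - 1) 0 k3 (l1 - 1) p l3"
    by (simp only: d chain_simps) (simp add: vec_eq_iff B_m1 algebra_simps)
  then show "?a0 = ?b0" unfolding tr_zero by simp
  have "?a1 = ?b1 + (- 1) *s tr k1 0 (k3 - 1) l1 p (l3 - 1)"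
    by (simp only: d chain_simps) (simp add: vec_eq_iff B_m1 algebra_simps)
  then show "?a1 = ?b1" unfolding tr_zero by simp
  show "?a2 = ?b2"
    by (simp only: d chain_simps) (simp add: vec_eq_iff B_m1 algebra_simps)
  have "?a3 = ?b3 + (- x3) *s tr (k1 - 1) 0 k3 (l1 - 1) p l3 + (z1) *s tr k1 0 (k3 - 1) l1 p (l3 - 1)"
    by (simp only: d chain_simps) (simp add: vec_eq_iff B_m1 algebra_simps)
  then show "?a3 = ?b3" unfolding tr_zero by simp
  show "?a4 = ?b4"
    by (simp only: d chain_simps) (simp add: vec_eq_iff B_m1 algebra_simps)
  have "?a5 = ?b5 + (- 1) *s tr (k1 - 1) 0 k3 (l1 - 1) p l3 + (- 1) *s tr k1 0 (k3 - 1) l1 p (l3 - 1)"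
    by (simp only: d chain_simps) (simp add: vec_eq_iff B_m1 algebra_simps)
  then show "?a5 = ?b5" unfolding tr_zero by simp
  show "?a6 = ?b6"
    by (simp only: d chain_simps) (simp add: vec_eq_iff B_m1 algebra_simps)
  have "?a7 = ?b7 + (- x1 - x3 + z1 + 2 * shift) *s tr (k1 - 1) 0 k3 (l1 - 1) p l3 + (z1) *s tr k1 0 (k3
        - 1) l1 p (l3 - 1)"
    by (simp only: d chain_simps) (simp add: vec_eq_iff B_m1 algebra_simps)
  then show "?a7 = ?b7" unfolding tr_zero by simp
  have "?a8 = ?b8 + (y - x3 + z1 + z3 + 2 * shift + 3) *s tr k1 0 (k3 - 1) l1 p (l3 - 1) + (- x3) *s tr
        (k1 - 1) 0 k3 (l1 - 1) p l3"
    by (simp only: d chain_simps) (simp add: vec_eq_iff B_m1 algebra_simps)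
  then show "?a8 = ?b8" unfolding tr_zero by simp
  show "?a9 = ?b9"
    by (simp only: d chain_simps) (simp add: vec_eq_iff B_m1 algebra_simps)
  have "?a10 = ?b10 + (- x1 * x3 - x3 * x3 + x3 * z1 + 2 * x3 * shift) *s tr (k1 - 1) 0 k3 (l1 - 1) p l3
        + (- y * z1 + x3 * z1 - z1 * z1 - z1 * z3 - 2 * z1 * shift - 3 * z1) *s tr k1 0 (k3 - 1) l1 p (l3
        - 1)"
    by (simp only: d chain_simps) (simp add: vec_eq_iff B_m1 algebra_simps)
  then show "?a10 = ?b10" unfolding tr_zero by simp
qed
end

lemma matrix_vector_mult_uminus: "A *v (- x) = - (A *v (x :: 'a::comm_ring_1 ^ 'n))"
  by (simp add: matrix_vector_mult_def vec_eq_iff sum_negf)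

text \<open>The eigenvalue of \<open>casimir_L\<close> on [a + 1, b + 1], found by evaluation on the
  top monomial in \<open>casimir_L_scalar\<close>.\<close>

definition cas3 :: "complex \<Rightarrow> complex \<Rightarrow> complex" where
  "cas3 a b = 2 / 9 * a ^ 3 + 1 / 3 * a ^ 2 * b + a ^ 2 - 1 / 3 * a * b ^ 2 + a - 2 / 9 * b ^ 3 - b ^ 2 - b"

context hw_triple
begin

lemma word_span: "vec.span {wact \<rho> ws v | ws. set ws \<subseteq> gens} = UNIV"
proof -
  have "x \<in> vec.span {wact \<rho> ws v | ws. set ws \<subseteq> gens}" for x
  proof (rule ccontr)
    assume "x \<notin> vec.span {wact \<rho> ws v | ws. set ws \<subseteq> gens}"
    then obtain r where r: "\<And>u. u \<in> vec.span {wact \<rho> ws v | ws. set ws \<subseteq> gens} \<Longrightarrow> scalar_product r u = 0" "scalar_product r x = 1"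
      using subspace_separation[OF vec.subspace_span] by blast
    have "r = 0"
    proof (rule cyc)
      fix ws :: "(nat \<times> nat) list" assume "set ws \<subseteq> gens"
      then show "scalar_product r (wact \<rho> ws v) = 0" by (intro r(1) vec.span_base) blast
    qed
    then show False using r(2) by simp
  qed
  then show ?thesis by blast
qed

text \<open>A form of Schur's lemma: the eigenvalue at \<open>v\<close> propagates along words, and
  the word images of \<open>v\<close> span.\<close>

lemma central_scalar:
  assumes comm: "\<And>p q w. p \<in> {1..3} \<Longrightarrow> q \<in> {1..3} \<Longrightarrow> \<rho> p q *v (C *v w) = C *v (\<rho> p q *v w)"
    and top: "C *v v = c *s v"
  shows "C *v w = c *s w"
proof -
  have word: "C *v wact \<rho> ws x = c *s wact \<rho> ws x" if "set ws \<subseteq> gens" "C *v x = c *s x" for ws x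
    using that
  proof (induction ws arbitrary: x)
    case (Cons g ws)
    have "C *v (\<rho> (fst g) (snd g) *v x) = c *s (\<rho> (fst g) (snd g) *v x)"
      using comm[of "fst g" "snd g" x] Cons.prems by (auto simp: gens_def)
    then show ?case using Cons by simp
  qed simp
  have "w \<in> vec.span {wact \<rho> ws v | ws. set ws \<subseteq> gens}" using word_span by simp
  then show ?thesis
  proof (induction rule: vec.span_induct_alt)
    case (step k x y)
    then show ?case using word top by (auto simp: matrix_vector_right_distrib vec.scale_right_distrib vector_smult_assoc mult.commute)
  qed simp
qed

lemma casimir_L_scalar: "casimir_L \<rho> *v w = cas3 (of_nat a) (of_nat b) *s w"
proof (rule central_scalar)
  show "\<rho> p q *v (casimir_L \<rho> *v w) = casimir_L \<rho> *v (\<rho> p q *v w)" if "p \<in> {1..3}" "q \<in> {1..3}" for p q w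
    by (rule casimir_L_commute[OF rep that])
  have "casimir_L \<rho> *v B (int a) 0 0 0 0 (int b) = cas3 (of_nat a) (of_nat b) *s B (int a) 0 0 0 0 (int b)"
    unfolding casimir_L_vector
    by (simp only: sum_three B_action matrix_vector_mult_smult matrix_vector_right_distrib matrix_vector_mult_diff_distrib)
       (simp add: vec_eq_iff B_m1 shift_def cas3_def power2_eq_square power3_eq_cube field_simps)
  then show "casimir_L \<rho> *v v = cas3 (of_nat a) (of_nat b) *s v" unfolding B_top .
qed

end

section \<open>Polarised traces seen through \<open>top\<close>\<close>

context hw_pair
begin

abbreviation L :: "nat \<Rightarrow> complex" where "L \<equiv> hwt (of_nat a) (of_nat b)"

lemma top_X1_X2: "top (X1 p q *v (X2 r s *v z)) = \<rho>' r s *v top (X1 p q *v z)"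
  unfolding tensor_gen_commute top_X2 ..

lemma top_X1:
  assumes u: "hwv (tensor_rep \<rho> \<rho>') \<alpha> \<beta> u" and pq: "p \<in> {1..3}" "q \<in> {1..3}"
  shows "top (X1 p q *v u) = (if p < q then - (\<rho>' p q *v top u) else if p = q then L p *s top u else 0)"
proof -
  consider "p < q" | "p = q" | "q < p" by linarith
  then show ?thesis
  proof cases
    case 1
    then show ?thesis using hwv_raise[OF u pq] by (simp add: top_linear top_X2)
  next
    case 2
    then show ?thesis using top_X1_diag pq by simp
  next
    case 3
    then show ?thesis using top_X1_low[of p q u] pq by (simp add: lows_def gens_def)
  qed
qed

text \<open>Products of two generators of the first factor: a raising generator on the right acts on the second
  factor, one on the left is commuted to the right.\<close>

lemma top_X1_X1:
  assumes u: "hwv (tensor_rep \<rho> \<rho>') \<alpha> \<beta> u" and h: "p \<in> {1..3}" "q \<in> {1..3}" "r \<in> {1..3}" "s \<in> {1..3}"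
  shows "r < s \<Longrightarrow> top (X1 p q *v (X1 r s *v u)) = - (\<rho>' r s *v top (X1 p q *v u))"
    and "q < p \<Longrightarrow> top (X1 p q *v (X1 r s *v u)) = 0"
    and "p = q \<Longrightarrow> top (X1 p q *v (X1 r s *v u)) = L p *s top (X1 r s *v u)"
    and "s < r \<Longrightarrow> top (X1 p q *v (X1 r s *v u)) =
      (if q = r then top (X1 p s *v u) else 0) - (if s = p then top (X1 r q *v u) else 0)"
    and "r = s \<Longrightarrow> top (X1 p q *v (X1 r s *v u)) = L r *s top (X1 p q *v u) +
      (if q = r then top (X1 p s *v u) else 0) - (if s = p then top (X1 r q *v u) else 0)"
proof -
  show "r < s \<Longrightarrow> top (X1 p q *v (X1 r s *v u)) = - (\<rho>' r s *v top (X1 p q *v u))"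
    using hwv_raise[OF u h(3,4)] top_X1_X2[of p q r s u] by (simp add: matrix_vector_mult_uminus top_linear)
  show "q < p \<Longrightarrow> top (X1 p q *v (X1 r s *v u)) = 0"
    using top_X1_low[of p q] h by (simp add: lows_def gens_def)
  show "p = q \<Longrightarrow> top (X1 p q *v (X1 r s *v u)) = L p *s top (X1 r s *v u)"
    using top_X1_diag[OF h(1)] by simp
  have c: "top (X1 p q *v (X1 r s *v u)) = top (X1 r s *v (X1 p q *v u)) +
      (if q = r then top (X1 p s *v u) else 0) - (if s = p then top (X1 r q *v u) else 0)"
    unfolding sl3_rep_commute[OF rep1 h] by (simp add: top_linear)
  show "s < r \<Longrightarrow> top (X1 p q *v (X1 r s *v u)) =
      (if q = r then top (X1 p s *v u) else 0) - (if s = p then top (X1 r q *v u) else 0)"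
    unfolding c using top_X1_low[of r s "X1 p q *v u"] h by (simp add: lows_def gens_def)
  show "r = s \<Longrightarrow> top (X1 p q *v (X1 r s *v u)) = L r *s top (X1 p q *v u) +
      (if q = r then top (X1 p s *v u) else 0) - (if s = p then top (X1 r q *v u) else 0)"
    unfolding c using top_X1_diag[OF h(3), of "X1 p q *v u"] by simp
qed

context
  fixes \<alpha> \<beta> u w
  assumes u: "hwv (tensor_rep \<rho> \<rho>') \<alpha> \<beta> u" and w: "w = top u"
begin

lemmas t1 = top_X1[OF u, folded w]
lemmas t2 = top_X1_X1[OF u, folded w]

text \<open>The square of the array of first-factor generators in the index pattern of T. Under
  \<open>top\<close> it becomes triangular: one half vanishes, and the other half turns into raising
  generators of the second factor.\<close>

lemma left_square:
  "(\<Sum>j\<in>{1..3}. top (X1 j 1 *v (X1 1 j *v u))) = (L 1 * L 1) *s w"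
  "(\<Sum>j\<in>{1..3}. top (X1 j 2 *v (X1 2 j *v u))) = (L 2 * L 2 + L 1 - L 2) *s w"
  "(\<Sum>j\<in>{1..3}. top (X1 j 3 *v (X1 3 j *v u))) = (L 3 * L 3 + L 1 + L 2 - 2 * L 3) *s w"
  "(\<Sum>j\<in>{1..3}. top (X1 j 2 *v (X1 1 j *v u))) = (1 - L 1 - L 2) *s (\<rho>' 1 2 *v w)"
  "(\<Sum>j\<in>{1..3}. top (X1 j 3 *v (X1 2 j *v u))) = (2 - L 2 - L 3) *s (\<rho>' 2 3 *v w)"
  "(\<Sum>j\<in>{1..3}. top (X1 j 3 *v (X1 1 j *v u))) = (1 - L 1 - L 3) *s (\<rho>' 1 3 *v w) + \<rho>' 1 2 *v (\<rho>' 2 3 *v w)"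
  "(\<Sum>j\<in>{1..3}. top (X1 j 1 *v (X1 2 j *v u))) = 0"
  "(\<Sum>j\<in>{1..3}. top (X1 j 1 *v (X1 3 j *v u))) = 0"
  "(\<Sum>j\<in>{1..3}. top (X1 j 2 *v (X1 3 j *v u))) = 0"
  unfolding sum_three
  by (simp_all add: t1 t2 matrix_vector_mult_uminus vec_eq_iff algebra_simps del: One_nat_def)

text \<open>The counterpart for the index pattern of \<open>Tbar\<close>.\<close>

lemma right_square:
  "(\<Sum>j\<in>{1..3}. top (X1 1 j *v (X1 j 1 *v u))) = (L 1 * L 1 + 2 * L 1 - L 2 - L 3) *s w"
  "(\<Sum>j\<in>{1..3}. top (X1 2 j *v (X1 j 2 *v u))) = (L 2 * L 2 + L 2 - L 3) *s w"
  "(\<Sum>j\<in>{1..3}. top (X1 3 j *v (X1 j 3 *v u))) = (L 3 * L 3) *s w"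
  "(\<Sum>j\<in>{1..3}. top (X1 1 j *v (X1 j 2 *v u))) = - (L 1 + L 2 + 2) *s (\<rho>' 1 2 *v w)"
  "(\<Sum>j\<in>{1..3}. top (X1 2 j *v (X1 j 3 *v u))) = - (L 2 + L 3 + 1) *s (\<rho>' 2 3 *v w)"
  "(\<Sum>j\<in>{1..3}. top (X1 1 j *v (X1 j 3 *v u))) = - (L 1 + L 3 + 1) *s (\<rho>' 1 3 *v w) + \<rho>' 2 3 *v (\<rho>' 1 2 *v w)"
  "(\<Sum>j\<in>{1..3}. top (X1 2 j *v (X1 j 1 *v u))) = 0"
  "(\<Sum>j\<in>{1..3}. top (X1 3 j *v (X1 j 1 *v u))) = 0"
  "(\<Sum>j\<in>{1..3}. top (X1 3 j *v (X1 j 2 *v u))) = 0"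
  unfolding sum_three
  by (simp_all add: t1 t2 matrix_vector_mult_uminus vec_eq_iff algebra_simps del: One_nat_def)

abbreviation T where "T \<equiv> pol_trace (tensor_gen \<rho> \<rho>')"
abbreviation Tbar where "Tbar \<equiv> pol_trace_bar (tensor_gen \<rho> \<rho>')"

lemma top_T12:
  "top (T [1,2] *v u) = L 1 *s (\<rho>' 1 1 *v w) + L 2 *s (\<rho>' 2 2 *v w) + L 3 *s (\<rho>' 3 3 *v w)
     - \<rho>' 2 1 *v (\<rho>' 1 2 *v w) - \<rho>' 3 2 *v (\<rho>' 2 3 *v w) - \<rho>' 3 1 *v (\<rho>' 1 3 *v w)"
proof -
  have "top (T [1,2] *v u) = (\<Sum>i\<in>{1..3}. \<Sum>j\<in>{1..3}. \<rho>' i j *v top (X1 j i *v u))"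
    unfolding pol_trace_2 trace_vector top_sum top_X1_X2 ..
  then show ?thesis
    unfolding sum_three by (simp add: t1 matrix_vector_mult_uminus vec_eq_iff algebra_simps del: One_nat_def)
qed

lemma top_T11: "top (T [1,1] *v u) = (L 1 * L 1 + (L 2 * L 2 + L 1 - L 2) + (L 3 * L 3 + L 1 + L 2 - 2 * L 3)) *s w"
proof -
  have "top (T [1,1] *v u) = (\<Sum>i\<in>{1..3}. (\<Sum>j\<in>{1..3}. top (X1 j i *v (X1 i j *v u))))"
    unfolding pol_trace_2 trace_vector top_sum ..
  also have "\<dots> = (L 1 * L 1) *s w + (L 2 * L 2 + L 1 - L 2) *s w + (L 3 * L 3 + L 1 + L 2 - 2 * L 3) *s w"
    unfolding left_square[symmetric] by (rule sum_three)
  finally show ?thesis by (simp only: vec.scale_left_distrib)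
qed

lemma top_T22: "top (T [2,2] *v u) = quad_op \<rho>' 1 1 w + quad_op \<rho>' 2 2 w + quad_op \<rho>' 3 3 w"
proof -
  have "top (T [2,2] *v u) = (\<Sum>i\<in>{1..3}. \<Sum>j\<in>{1..3}. \<rho>' j i *v (\<rho>' i j *v w))"
    unfolding pol_trace_2 trace_vector top_sum top_X2 w ..
  then show ?thesis unfolding quad_op_def by (simp only: sum_three[of "\<lambda>i. \<Sum>j\<in>{1..3}. \<rho>' j i *v (\<rho>' i j *v w)"])
qed

lemma top_T112:
  "top (T [1,1,2] *v u) = (L 1 * L 1) *s (\<rho>' 1 1 *v w) + (L 2 * L 2 + L 1 - L 2) *s (\<rho>' 2 2 *v w)
     + (L 3 * L 3 + L 1 + L 2 - 2 * L 3) *s (\<rho>' 3 3 *v w)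
     + (1 - L 1 - L 2) *s (\<rho>' 2 1 *v (\<rho>' 1 2 *v w)) + (2 - L 2 - L 3) *s (\<rho>' 3 2 *v (\<rho>' 2 3 *v w))
     + (1 - L 1 - L 3) *s (\<rho>' 3 1 *v (\<rho>' 1 3 *v w)) + \<rho>' 3 1 *v (\<rho>' 1 2 *v (\<rho>' 2 3 *v w))"
proof -
  define S where "S k i = (\<Sum>j\<in>{1..3}. top (X1 j i *v (X1 k j *v u)))" for k i
  have "top (T [1,1,2] *v u) = (\<Sum>i\<in>{1..3}. \<Sum>j\<in>{1..3}. \<Sum>k\<in>{1..3}. \<rho>' i k *v top (X1 j i *v (X1 k j *v u)))"
    unfolding pol_trace_3 trace_vector top_sum tensor_gen_commute top_X2 ..
  also have "\<dots> = (\<Sum>i\<in>{1..3}. \<Sum>k\<in>{1..3}. \<rho>' i k *v S k i)"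
    unfolding S_def matrix_vector_mult_sum by (intro sum.cong refl sum.swap)
  finally show ?thesis
    unfolding sum_three left_square[folded S_def] by (simp add: matrix_vector_right_distrib algebra_simps)
qed

lemma top_T122:
  "top (T [1,2,2] *v u) = L 1 *s quad_op \<rho>' 1 1 w + L 2 *s quad_op \<rho>' 2 2 w + L 3 *s quad_op \<rho>' 3 3 w
     - quad_op \<rho>' 2 1 (\<rho>' 1 2 *v w) - quad_op \<rho>' 3 2 (\<rho>' 2 3 *v w) - quad_op \<rho>' 3 1 (\<rho>' 1 3 *v w)"
proof -
  have "top (T [1,2,2] *v u) = (\<Sum>i\<in>{1..3}. \<Sum>j\<in>{1..3}. \<Sum>k\<in>{1..3}. \<rho>' k j *v (\<rho>' i k *v top (X1 j i *v u)))"
    unfolding pol_trace_3 trace_vector top_sum tensor_gen_commute top_X2 ..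
  also have "\<dots> = (\<Sum>i\<in>{1..3}. \<Sum>j\<in>{1..3}. quad_op \<rho>' i j (top (X1 j i *v u)))"
    unfolding quad_op_def ..
  finally show ?thesis
    unfolding sum_three using quad_op_linear(3)[of \<rho>' _ _ "-1"]
    by (simp add: t1 quad_op_linear algebra_simps del: One_nat_def)
qed

lemma top_T1122:
  "top (T [1,1,2,2] *v u) = (L 1 * L 1) *s quad_op \<rho>' 1 1 w + (L 2 * L 2 + L 1 - L 2) *s quad_op \<rho>' 2 2 w
     + (L 3 * L 3 + L 1 + L 2 - 2 * L 3) *s quad_op \<rho>' 3 3 w
     + (1 - L 1 - L 2) *s quad_op \<rho>' 2 1 (\<rho>' 1 2 *v w) + (2 - L 2 - L 3) *s quad_op \<rho>' 3 2 (\<rho>' 2 3 *v w)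
     + (1 - L 1 - L 3) *s quad_op \<rho>' 3 1 (\<rho>' 1 3 *v w) + quad_op \<rho>' 3 1 (\<rho>' 1 2 *v (\<rho>' 2 3 *v w))"
proof -
  define S where "S k i = (\<Sum>j\<in>{1..3}. top (X1 j i *v (X1 k j *v u)))" for k i
  have "top (T [1,1,2,2] *v u) = (\<Sum>i\<in>{1..3}. \<Sum>j\<in>{1..3}. \<Sum>k\<in>{1..3}. quad_op \<rho>' i k (top (X1 j i *v (X1 k j *v u))))"
    unfolding pol_trace_4 trace_vector top_sum tensor_gen_commute top_X2 quad_op_def ..
  also have "\<dots> = (\<Sum>i\<in>{1..3}. \<Sum>k\<in>{1..3}. quad_op \<rho>' i k (S k i))"
    unfolding S_def sum_three by (simp add: quad_op_linear algebra_simps)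
  finally show ?thesis
    unfolding sum_three left_square[folded S_def] by (simp add: quad_op_linear algebra_simps)
qed

text \<open>Reversing the contraction order costs one commutator for each of the three values of
  \<open>l\<close>. On the diagonal, treated next, the additional terms add up to the trace of the
  generators, which is 0.\<close>

lemma quad_op_flip:
  assumes "k \<in> {1..3}" "i \<in> {1..3}" "k \<noteq> i"
  shows "(\<Sum>l\<in>{1..3}. \<rho>' k l *v (\<rho>' l i *v z)) = quad_op \<rho>' k i z + 3 *s (\<rho>' k i *v z)"
proof -
  have "\<rho>' k l *v (\<rho>' l i *v z) = \<rho>' l i *v (\<rho>' k l *v z) + \<rho>' k i *v z" if "l \<in> {1..3}" for l
    using sl3_rep_commute[OF W.rep, of k l l i z] assms that by simp
  then have "(\<Sum>l\<in>{1..3}. \<rho>' k l *v (\<rho>' l i *v z)) = (\<Sum>l\<in>{1..3}. \<rho>' l i *v (\<rho>' k l *v z) + \<rho>' k i *v z)"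
    by (intro sum.cong) auto
  then show ?thesis unfolding quad_op_def sum.distrib by (simp add: sum_three[of "\<lambda>_. \<rho>' k i *v z"] vec_eq_iff)
qed

lemma quad_op_flip_diag:
  assumes "i \<in> {1..3}"
  shows "(\<Sum>l\<in>{1..3}. \<rho>' i l *v (\<rho>' l i *v z)) = quad_op \<rho>' i i z + 3 *s (\<rho>' i i *v z)"
proof -
  have "\<rho>' i l *v (\<rho>' l i *v z) = \<rho>' l i *v (\<rho>' i l *v z) + \<rho>' i i *v z - \<rho>' l l *v z" if "l \<in> {1..3}" for l
    using sl3_rep_commute[OF W.rep, of i l l i z] assms that by simp
  then have "(\<Sum>l\<in>{1..3}. \<rho>' i l *v (\<rho>' l i *v z)) = (\<Sum>l\<in>{1..3}. \<rho>' l i *v (\<rho>' i l *v z) + \<rho>' i i *v z - \<rho>' l l *v z)"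
    by (intro sum.cong) auto
  also have "\<dots> = quad_op \<rho>' i i z + (\<Sum>l\<in>{1..3::nat}. \<rho>' i i *v z) - (\<Sum>l\<in>{1..3}. \<rho>' l l *v z)"
    unfolding quad_op_def sum.distrib sum_subtractf ..
  also have "(\<Sum>l\<in>{1..3}. \<rho>' l l *v z) = 0"
    unfolding sum_three by (rule sl3_rep_trace[OF W.rep])
  finally show ?thesis by (simp add: sum_three[of "\<lambda>_. \<rho>' i i *v z"] vec_eq_iff)
qed

lemma top_Tbar1122:
  "top (Tbar [1,1,2,2] *v u) =
       (L 1 * L 1 + 2 * L 1 - L 2 - L 3) *s (quad_op \<rho>' 1 1 w + 3 *s (\<rho>' 1 1 *v w))
     + (L 2 * L 2 + L 2 - L 3) *s (quad_op \<rho>' 2 2 w + 3 *s (\<rho>' 2 2 *v w))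
     + (L 3 * L 3) *s (quad_op \<rho>' 3 3 w + 3 *s (\<rho>' 3 3 *v w))
     - (L 1 + L 2 + 2) *s (quad_op \<rho>' 2 1 (\<rho>' 1 2 *v w) + 3 *s (\<rho>' 2 1 *v (\<rho>' 1 2 *v w)))
     - (L 2 + L 3 + 1) *s (quad_op \<rho>' 3 2 (\<rho>' 2 3 *v w) + 3 *s (\<rho>' 3 2 *v (\<rho>' 2 3 *v w)))
     - (L 1 + L 3 + 2) *s (quad_op \<rho>' 3 1 (\<rho>' 1 3 *v w) + 3 *s (\<rho>' 3 1 *v (\<rho>' 1 3 *v w)))
     + (quad_op \<rho>' 3 1 (\<rho>' 1 2 *v (\<rho>' 2 3 *v w)) + 3 *s (\<rho>' 3 1 *v (\<rho>' 1 2 *v (\<rho>' 2 3 *v w))))"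
proof -
  define S where "S i k = (\<Sum>j\<in>{1..3}. top (X1 i j *v (X1 j k *v u)))" for i k
  define Q where "Q k i z = quad_op \<rho>' k i z + 3 *s (\<rho>' k i *v z)" for k i z
  have Q: "(\<Sum>l\<in>{1..3}. \<rho>' k l *v (\<rho>' l i *v z)) = Q k i z" if "k \<in> {1..3}" "i \<in> {1..3}" for k i z
    using quad_op_flip[OF that] quad_op_flip_diag[OF that(1)] unfolding Q_def by (cases "k = i") auto
  have Q_linear: "Q k i (x + y) = Q k i x + Q k i y" "Q k i (c *s x) = c *s Q k i x" "Q k i 0 = 0" "Q k i (x - y) = Q k i x - Q k i y" for k i x y c
    unfolding Q_def by (simp_all add: quad_op_linear matrix_vector_right_distrib matrix_vector_mult_diff_distrib vec_eq_iff algebra_simps)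
  have "top (Tbar [1,1,2,2] *v u) = (\<Sum>i\<in>{1..3}. \<Sum>j\<in>{1..3}. \<Sum>k\<in>{1..3}. \<Sum>l\<in>{1..3}. \<rho>' k l *v (\<rho>' l i *v top (X1 i j *v (X1 j k *v u))))"
    unfolding pol_trace_bar_4 trace_vector top_sum tensor_gen_commute top_X2 ..
  also have "\<dots> = (\<Sum>i\<in>{1..3}. \<Sum>j\<in>{1..3}. \<Sum>k\<in>{1..3}. Q k i (top (X1 i j *v (X1 j k *v u))))"
    by (intro sum.cong refl Q)
  also have "\<dots> = (\<Sum>i\<in>{1..3}. \<Sum>k\<in>{1..3}. Q k i (S i k))"
    unfolding S_def sum_three by (simp add: Q_linear algebra_simps)
  finally have 1: "top (Tbar [1,1,2,2] *v u) = (\<Sum>i\<in>{1..3}. \<Sum>k\<in>{1..3}. Q k i (S i k))" .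
  \<comment> \<open>This reordering moves one more multiple of \<open>\<rho>' 1 3\<close> out of the
    product in \<open>right_square\<close>, hence the constant 2 with \<open>L 1 + L 3\<close> in
    place of 1.\<close>
  have 2: "\<rho>' 2 3 *v (\<rho>' 1 2 *v w) = \<rho>' 1 2 *v (\<rho>' 2 3 *v w) - \<rho>' 1 3 *v w"
    using sl3_rep_commute[OF W.rep, of 1 2 2 3 w] by simp
  show ?thesis
    unfolding 1 sum_three right_square[folded S_def] 2 Q_linear
    unfolding Q_def by (simp add: vec_eq_iff algebra_simps)
qed

end

end

section \<open>Operators commuting with the diagonal action\<close>

lemma hwv_add: "hwv \<tau> \<alpha> \<beta> x \<Longrightarrow> hwv \<tau> \<alpha> \<beta> y \<Longrightarrow> hwv \<tau> \<alpha> \<beta> (x + y)"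
  and hwv_diff: "hwv \<tau> \<alpha> \<beta> x \<Longrightarrow> hwv \<tau> \<alpha> \<beta> y \<Longrightarrow> hwv \<tau> \<alpha> \<beta> (x - y)"
  and hwv_smult: "hwv \<tau> \<alpha> \<beta> x \<Longrightarrow> hwv \<tau> \<alpha> \<beta> (c *s x)"
  and hwv_zero: "hwv \<tau> \<alpha> \<beta> 0"
  unfolding hwv_def
  by (simp_all add: matrix_vector_right_distrib matrix_vector_mult_diff_distrib vec.scale_right_distrib vec.scale_right_diff_distrib
    vector_smult_assoc mult.commute)

definition commutes_with :: "complex^'k^'k \<Rightarrow> 'k::finite rep \<Rightarrow> bool" where
  "commutes_with C \<tau> \<longleftrightarrow> (\<forall>p\<in>{1..3}. \<forall>q\<in>{1..3}. \<forall>z. \<tau> p q *v (C *v z) = C *v (\<tau> p q *v z))"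

lemma hwv_commutes_with:
  assumes "commutes_with C \<tau>" "hwv \<tau> \<alpha> \<beta> x"
  shows "hwv \<tau> \<alpha> \<beta> (C *v x)"
  using assms(1) hwvD[OF assms(2)] unfolding hwv_def commutes_with_def by simp

lemma commutes_with_add: "commutes_with C \<tau> \<Longrightarrow> commutes_with D \<tau> \<Longrightarrow> commutes_with (C + D) \<tau>"
  and commutes_with_diff: "commutes_with C \<tau> \<Longrightarrow> commutes_with D \<tau> \<Longrightarrow> commutes_with (C - D) \<tau>"
  and commutes_with_mult: "commutes_with C \<tau> \<Longrightarrow> commutes_with D \<tau> \<Longrightarrow> commutes_with (C ** D) \<tau>"
  and commutes_with_scaleR: "commutes_with C \<tau> \<Longrightarrow> commutes_with (r *\<^sub>R C) \<tau>"
  unfolding commutes_with_def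
  by (simp_all add: matrix_vector_mult_add_rdistrib matrix_vector_mult_diff_rdistrib matrix_vector_right_distrib
    matrix_vector_mult_diff_distrib scaleR_matrix_vector_mult matrix_vector_mul_assoc[symmetric])

context hw_pair
begin

lemma kron_casimir_L:
  "kron (casimir_L \<rho>) (mat 1) *v z = cas3 (of_nat a) (of_nat b) *s z"
  "kron (mat 1) (casimir_L \<rho>') *v z = cas3 (of_nat a') (of_nat b') *s z"
proof -
  have "slice j (kron (casimir_L \<rho>) (mat 1) *v z) = slice j (cas3 (of_nat a) (of_nat b) *s z)" for j
    unfolding slice_left V.casimir_L_scalar slice_linear ..
  then show "kron (casimir_L \<rho>) (mat 1) *v z = cas3 (of_nat a) (of_nat b) *s z"
    by (simp add: slice_def vec_eq_iff)
  show "kron (mat 1) (casimir_L \<rho>') *v z = cas3 (of_nat a') (of_nat b') *s z"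
  proof (rule pair_vec_eqI)
    fix i j
    have "(kron (mat 1) (casimir_L \<rho>') *v z) $ (i, j) = (casimir_L \<rho>' *v (\<chi> l. z $ (i, l))) $ j"
      unfolding kron_right_vector by (simp add: matrix_vector_mult_def)
    also have "\<dots> = cas3 (of_nat a') (of_nat b') * z $ (i, j)"
      unfolding W.casimir_L_scalar by simp
    finally show "(kron (mat 1) (casimir_L \<rho>') *v z) $ (i, j) = (cas3 (of_nat a') (of_nat b') *s z) $ (i, j)" by simp
  qed
qed

lemma op_commutes:
  "commutes_with (op_X \<rho> \<rho>') (tensor_rep \<rho> \<rho>')" "commutes_with (op_Y \<rho> \<rho>') (tensor_rep \<rho> \<rho>')"
  "commutes_with (T [1,2]) (tensor_rep \<rho> \<rho>')" "commutes_with (T [1,1]) (tensor_rep \<rho> \<rho>')"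
  "commutes_with (T [2,2]) (tensor_rep \<rho> \<rho>')"
proof -
  note c = pol_trace_commute[OF V.rep W.rep]
  have T: "commutes_with (T [1,2]) (tensor_rep \<rho> \<rho>')" "commutes_with (T [1,1]) (tensor_rep \<rho> \<rho>')" "commutes_with (T [2,2]) (tensor_rep \<rho> \<rho>')"
    "commutes_with (T [1,1,2]) (tensor_rep \<rho> \<rho>')" "commutes_with (T [1,2,2]) (tensor_rep \<rho> \<rho>')"
    "commutes_with (T [1,1,2,2]) (tensor_rep \<rho> \<rho>')" "commutes_with (Tbar [1,1,2,2]) (tensor_rep \<rho> \<rho>')"
    unfolding commutes_with_def
    by (intro ballI allI, rule c(1)[where c = 1 and d = 1] c(2)[where d = 1] c(3) c(4); simp)+
  have K: "commutes_with (kron (casimir_L \<rho>) (mat 1)) (tensor_rep \<rho> \<rho>')" "commutes_with (kron (mat 1) (casimir_L \<rho>')) (tensor_rep \<rho> \<rho>')"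
    unfolding commutes_with_def kron_casimir_L by simp_all
  show "commutes_with (op_X \<rho> \<rho>') (tensor_rep \<rho> \<rho>')" "commutes_with (op_Y \<rho> \<rho>') (tensor_rep \<rho> \<rho>')"
    unfolding op_X_def op_Y_def Let_def by (intro commutes_with_add commutes_with_diff commutes_with_mult commutes_with_scaleR T K)+
  show "commutes_with (T [1,2]) (tensor_rep \<rho> \<rho>')" "commutes_with (T [1,1]) (tensor_rep \<rho> \<rho>')" "commutes_with (T [2,2]) (tensor_rep \<rho> \<rho>')"
    by (fact T)+
qed

text \<open>\<open>C *v u - c *s u\<close> is a highest-weight vector, and \<open>top\<close> is
  injective on these.\<close>

lemma scalar_on_hwv:
  assumes u: "hwv (tensor_rep \<rho> \<rho>') \<alpha> \<beta> u" and C: "commutes_with C (tensor_rep \<rho> \<rho>')" and t: "top (C *v u) = c *s top u"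
  shows "C *v u = c *s u"
proof -
  have "C *v u - c *s u = 0"
  proof (rule top_injective)
    show "hwv (tensor_rep \<rho> \<rho>') \<alpha> \<beta> (C *v u - c *s u)"
      by (intro hwv_diff hwv_smult hwv_commutes_with C u)
    show "top (C *v u - c *s u) = 0" by (simp add: top_linear t)
  qed
  then show ?thesis by simp
qed

text \<open>The eigenvalue of the quadratic Casimir element of the first factor, read off from
  \<open>top_T11\<close>.\<close>

definition cas2 :: complex where
  "cas2 = L 1 * L 1 + (L 2 * L 2 + L 1 - L 2) + (L 3 * L 3 + L 1 + L 2 - 2 * L 3)"

lemma top_op_X:
  assumes u: "hwv (tensor_rep \<rho> \<rho>') \<alpha> \<beta> u"
  shows "top (op_X \<rho> \<rho>' *v u) = (1/2) *s (top (T [1,1,2] *v u) - top (T [1,2,2] *v u))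
     + ((cas3 (of_nat a) (of_nat b) - cas3 (of_nat a') (of_nat b')) / 3) *s top u"
  unfolding op_X_def Let_def scaleR_matrix_vector_mult matrix_vector_mult_add_rdistrib matrix_vector_mult_diff_rdistrib
    kron_casimir_L top_linear
  by (simp add: vec_eq_iff field_simps)

text \<open>The quadratic traces in \<open>Y\<close> act on \<open>u\<close> itself by scalars, by
  \<open>scalar_on_hwv\<close>, so their products contribute to the diagonal only. Movement along
  the chain comes from the two traces of degree four.\<close>

lemma top_op_Y:
  assumes u: "hwv (tensor_rep \<rho> \<rho>') \<alpha> \<beta> u"
    and t12: "top (T [1,2] *v u) = t *s top u" and t22: "top (T [2,2] *v u) = c *s top u"
  shows "top (op_Y \<rho> \<rho>' *v u) = (1/2) *s (top (T [1,1,2,2] *v u) + top (Tbar [1,1,2,2] *v u))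
     - (t * t / 12 + 5 / 12 * cas2 * c + 2 * t) *s top u"
proof -
  have e12: "T [1,2] *v u = t *s u" by (rule scalar_on_hwv[OF u op_commutes(3) t12])
  have e22: "T [2,2] *v u = c *s u" by (rule scalar_on_hwv[OF u op_commutes(5) t22])
  have e11: "T [1,1] *v u = cas2 *s u"
    by (rule scalar_on_hwv[OF u op_commutes(4)]) (unfold top_T11[OF u refl] cas2_def, rule refl)
  show ?thesis
    unfolding op_Y_def Let_def scaleR_matrix_vector_mult matrix_vector_mult_add_rdistrib matrix_vector_mult_diff_rdistrib
      matrix_vector_mul_assoc[symmetric] e12 e22 e11 matrix_vector_mult_smult top_linear
    by (simp add: vec_eq_iff field_simps)
qed

text \<open>Bookkeeping that separates the operators from the polynomial identities.
  \<open>U\<close> and \<open>Z\<close> stand for the neighbours of \<open>x\<close> in the chain,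
  and the prefixes \<open>u\<close>, \<open>x\<close>, \<open>z\<close> mark the coefficients at
  \<open>U\<close>, \<open>x\<close>, \<open>Z\<close>. The conditions \<open>cas\<close> say that
  \<open>T [1,2]\<close> and \<open>T [2,2]\<close> have no components along the neighbours.\<close>

lemma chain_assemble:
  fixes x U Z :: "complex^'m"
  assumes u: "hwv (tensor_rep \<rho> \<rho>') \<alpha> \<beta> u" and top: "top u = c *s x"
    and d: "\<rho>' 1 1 *v x = d1 *s x" "\<rho>' 2 2 *v x = d2 *s x" "\<rho>' 3 3 *v x = d3 *s x"
    and a: "\<rho>' 2 1 *v (\<rho>' 1 2 *v x) = ua1 *s U + xa1 *s x + za1 *s Z"
      "\<rho>' 3 2 *v (\<rho>' 2 3 *v x) = ua2 *s U + xa2 *s x + za2 *s Z"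
      "\<rho>' 3 1 *v (\<rho>' 1 3 *v x) = ua3 *s U + xa3 *s x + za3 *s Z"
      "\<rho>' 3 1 *v (\<rho>' 1 2 *v (\<rho>' 2 3 *v x)) = ua4 *s U + xa4 *s x + za4 *s Z"
    and r: "quad_op \<rho>' 1 1 x = ur1 *s U + xr1 *s x + zr1 *s Z"
      "quad_op \<rho>' 2 2 x = ur2 *s U + xr2 *s x + zr2 *s Z"
      "quad_op \<rho>' 3 3 x = ur3 *s U + xr3 *s x + zr3 *s Z"
      "quad_op \<rho>' 2 1 (\<rho>' 1 2 *v x) = ur21 *s U + xr21 *s x + zr21 *s Z"
      "quad_op \<rho>' 3 2 (\<rho>' 2 3 *v x) = ur32 *s U + xr32 *s x + zr32 *s Z"
      "quad_op \<rho>' 3 1 (\<rho>' 1 3 *v x) = ur31 *s U + xr31 *s x + zr31 *s Z"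
      "quad_op \<rho>' 3 1 (\<rho>' 1 2 *v (\<rho>' 2 3 *v x)) = ur4 *s U + xr4 *s x + zr4 *s Z"
  defines "s1 \<equiv> L 1 * L 1" and "s2 \<equiv> L 2 * L 2 + L 1 - L 2" and "s3 \<equiv> L 3 * L 3 + L 1 + L 2 - 2 * L 3"
  defines "f112 \<equiv> \<lambda>y1 y2 y3 y4. (1 - L 1 - L 2) * y1 + (2 - L 2 - L 3) * y2 + (1 - L 1 - L 3) * y3 + y4"
    and "f122 \<equiv> \<lambda>y1 y2 y3 y21 y32 y31. L 1 * y1 + L 2 * y2 + L 3 * y3 - y21 - y32 - y31"
    and "f1122 \<equiv> \<lambda>y1 y2 y3 y21 y32 y31 y4. s1 * y1 + s2 * y2 + s3 * y3 + (1 - L 1 - L 2) * y21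
       + (2 - L 2 - L 3) * y32 + (1 - L 1 - L 3) * y31 + y4"
    and "fbar \<equiv> \<lambda>y1 y2 y3 y21 y32 y31 y4. (L 1 * L 1 + 2 * L 1 - L 2 - L 3) * y1 + (L 2 * L 2 + L 2 - L 3) * y2
       + (L 3 * L 3) * y3 - (L 1 + L 2 + 2) * y21 - (L 2 + L 3 + 1) * y32 - (L 1 + L 3 + 2) * y31 + y4"
    and "t \<equiv> L 1 * d1 + L 2 * d2 + L 3 * d3 - xa1 - xa2 - xa3"
  assumes cas: "ua1 + ua2 + ua3 = 0" "za1 + za2 + za3 = 0" "ur1 + ur2 + ur3 = 0" "zr1 + zr2 + zr3 = 0"
  shows "top (op_X \<rho> \<rho>' *v u) = c *s (
      ((f112 ua1 ua2 ua3 ua4 - f122 ur1 ur2 ur3 ur21 ur32 ur31) / 2) *s U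
    + ((s1 * d1 + s2 * d2 + s3 * d3 + f112 xa1 xa2 xa3 xa4 - f122 xr1 xr2 xr3 xr21 xr32 xr31) / 2
        + (cas3 (of_nat a) (of_nat b) - cas3 (of_nat a') (of_nat b')) / 3) *s x
    + ((f112 za1 za2 za3 za4 - f122 zr1 zr2 zr3 zr21 zr32 zr31) / 2) *s Z)" (is ?goal1)
    and "top (op_Y \<rho> \<rho>' *v u) = c *s (
      ((f1122 ur1 ur2 ur3 ur21 ur32 ur31 ur4
        + fbar ur1 ur2 ur3 (ur21 + 3 * ua1) (ur32 + 3 * ua2) (ur31 + 3 * ua3) (ur4 + 3 * ua4)) / 2) *s U
    + ((f1122 xr1 xr2 xr3 xr21 xr32 xr31 xr4
        + fbar (xr1 + 3 * d1) (xr2 + 3 * d2) (xr3 + 3 * d3) (xr21 + 3 * xa1) (xr32 + 3 * xa2) (xr31 + 3 * xa3) (xr4 + 3 * xa4)) / 2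
        - (t * t / 12 + 5 / 12 * cas2 * (xr1 + xr2 + xr3) + 2 * t)) *s x
    + ((f1122 zr1 zr2 zr3 zr21 zr32 zr31 zr4
        + fbar zr1 zr2 zr3 (zr21 + 3 * za1) (zr32 + 3 * za2) (zr31 + 3 * za3) (zr4 + 3 * za4)) / 2) *s Z)" (is ?goal2)
proof -
  note simps = d a r matrix_vector_mult_smult quad_op_linear(3)
  have ua3: "ua3 = - ua1 - ua2" and za3: "za3 = - za1 - za2" and ur3: "ur3 = - ur1 - ur2" and zr3: "zr3 = - zr1 - zr2"
    using cas by (simp_all add: algebra_simps eq_neg_iff_add_eq_0)
  have T12: "top (T [1,2] *v u) = t *s top u"
    unfolding top_T12[OF u refl] top simps t_def ua3 za3 by (simp add: vec_eq_iff algebra_simps)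
  have T22: "top (T [2,2] *v u) = (xr1 + xr2 + xr3) *s top u"
    unfolding top_T22[OF u refl] top simps ur3 zr3 by (simp add: vec_eq_iff algebra_simps)
  have T112: "top (T [1,1,2] *v u) = c *s (f112 ua1 ua2 ua3 ua4 *s U + (s1 * d1 + s2 * d2 + s3 * d3 + f112 xa1 xa2 xa3 xa4) *s x
      + f112 za1 za2 za3 za4 *s Z)"
    unfolding top_T112[OF u refl] top simps f112_def s1_def[symmetric] s2_def[symmetric] s3_def[symmetric]
    by (simp add: vec_eq_iff algebra_simps)
  have T122: "top (T [1,2,2] *v u) = c *s (f122 ur1 ur2 ur3 ur21 ur32 ur31 *s U + f122 xr1 xr2 xr3 xr21 xr32 xr31 *s x
      + f122 zr1 zr2 zr3 zr21 zr32 zr31 *s Z)"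
    unfolding top_T122[OF u refl] top simps f122_def by (simp add: vec_eq_iff algebra_simps)
  have T1122: "top (T [1,1,2,2] *v u) = c *s (f1122 ur1 ur2 ur3 ur21 ur32 ur31 ur4 *s U + f1122 xr1 xr2 xr3 xr21 xr32 xr31 xr4 *s x
      + f1122 zr1 zr2 zr3 zr21 zr32 zr31 zr4 *s Z)"
    unfolding top_T1122[OF u refl] top simps f1122_def s1_def[symmetric] s2_def[symmetric] s3_def[symmetric]
    by (simp add: vec_eq_iff algebra_simps)
  \<comment> \<open>Opaque names keep \<open>algebra_simps\<close> from multiplying these
    coefficients out.\<close>
  define b1 b2 b3 b4 b5 b6 where "b1 = L 1 * L 1 + 2 * L 1 - L 2 - L 3" and "b2 = L 2 * L 2 + L 2 - L 3" and "b3 = L 3 * L 3"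
    and "b4 = L 1 + L 2 + 2" and "b5 = L 2 + L 3 + 1" and "b6 = L 1 + L 3 + 2"
  have Tbar: "top (Tbar [1,1,2,2] *v u) = c *s (
      fbar ur1 ur2 ur3 (ur21 + 3 * ua1) (ur32 + 3 * ua2) (ur31 + 3 * ua3) (ur4 + 3 * ua4) *s U
      + fbar (xr1 + 3 * d1) (xr2 + 3 * d2) (xr3 + 3 * d3) (xr21 + 3 * xa1) (xr32 + 3 * xa2) (xr31 + 3 * xa3) (xr4 + 3 * xa4) *s x
      + fbar zr1 zr2 zr3 (zr21 + 3 * za1) (zr32 + 3 * za2) (zr31 + 3 * za3) (zr4 + 3 * za4) *s Z)"
    unfolding top_Tbar1122[OF u refl] top simps fbar_def b1_def[symmetric] b2_def[symmetric] b3_def[symmetric]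
      b4_def[symmetric] b5_def[symmetric] b6_def[symmetric]
    by (simp add: vec_eq_iff algebra_simps)
  have comb: "(1/2) *s (c *s (y1 *s U + y2 *s x + y3 *s Z) + c *s (v1 *s U + v2 *s x + v3 *s Z)) + k *s (c *s x) =
      c *s (((y1 + v1) / 2) *s U + ((y2 + v2) / 2 + k) *s x + ((y3 + v3) / 2) *s Z)" for y1 y2 y3 v1 v2 v3 k
    by (simp add: vec_eq_iff field_simps)
  have neg: "p - c *s (v1 *s U + v2 *s x + v3 *s Z) = p + c *s ((- v1) *s U + (- v2) *s x + (- v3) *s Z)"
    "p - k *s q = p + (- k) *s q" for p q v1 v2 v3 k
    by (simp_all add: vec_eq_iff algebra_simps)
  show ?goal1
    unfolding top_op_X[OF u] T112 T122 top neg(1) comb by simp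
  show ?goal2
    unfolding top_op_Y[OF u T12 T22] T1122 Tbar top neg(2) comb by simp
qed

end

text \<open>The power sums \<open>E_sum\<close> in terms of exponents, with t = j + \<xi>_b: the
  differences \<xi>_i - t are \<open>z1\<close>, \<open>v3\<close>, \<open>x1\<close> for the first
  three parameters and \<open>- 1 - z3\<close>, \<open>- 1 - u1\<close>, \<open>- 1 - x3\<close> for
  the last three.\<close>

definition chain_E :: "complex \<Rightarrow> complex \<Rightarrow> complex \<Rightarrow> complex \<Rightarrow> complex \<Rightarrow> complex \<Rightarrow> nat \<Rightarrow> complex" where
  "chain_E x1 x3 z1 z3 u1 v3 k = (z1 + 1/2) ^ k + (v3 + 1/2) ^ k + (x1 + 1/2) ^ k
     + (- z3 - 1/2) ^ k + (- u1 - 1/2) ^ k + (- x3 - 1/2) ^ k"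

definition chain_diag_X :: "complex \<Rightarrow> complex \<Rightarrow> complex \<Rightarrow> complex \<Rightarrow> complex \<Rightarrow> complex \<Rightarrow> complex \<Rightarrow> complex" where
  "chain_diag_X x1 x3 z1 z3 u1 v3 \<Lambda> = (let E = chain_E x1 x3 z1 z3 u1 v3 in
     - (1/108) * (7/2 * E 1 ^ 3 - 18 * E 1 * E 2 + 18 * E 3) - 1/24 * E 1 * (\<Lambda>\<^sup>2 + 2))"

definition chain_diag_Y :: "complex \<Rightarrow> complex \<Rightarrow> complex \<Rightarrow> complex \<Rightarrow> complex \<Rightarrow> complex \<Rightarrow> complex \<Rightarrow> complex" where
  "chain_diag_Y x1 x3 z1 z3 u1 v3 \<Lambda> = (let E = chain_E x1 x3 z1 z3 u1 v3 in
     1/288 * (5/2 * E 1 ^ 4 + 32 * E 1 * E 3 + 6 * ((E 2)\<^sup>2 - 3 * (E 1)\<^sup>2 * E 2 - 4 * E 4)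
       + 6 * E 2 * (\<Lambda>\<^sup>2 + 2) - 3 * (E 1)\<^sup>2 * (\<Lambda>\<^sup>2 - 2) - 3/2 * \<Lambda> ^ 4 + 6 * \<Lambda>\<^sup>2 - 36))"

lemma chain_E_scaled:
  "chain_E x1 x3 z1 z3 u1 v3 k = ((2 * z1 + 1) ^ k + (2 * v3 + 1) ^ k + (2 * x1 + 1) ^ k
     + (- 2 * z3 - 1) ^ k + (- 2 * u1 - 1) ^ k + (- 2 * x3 - 1) ^ k) / 2 ^ k"
proof -
  have "(z + 1/2) ^ k = (2 * z + 1) ^ k / 2 ^ k" "(- z - 1/2) ^ k = (- 2 * z - 1) ^ k / 2 ^ k" for z :: complex
  proof -
    have "z + 1/2 = (2 * z + 1) / 2" "- z - 1/2 = (- 2 * z - 1) / 2" by (simp_all add: field_simps)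
    then show "(z + 1/2) ^ k = (2 * z + 1) ^ k / 2 ^ k" "(- z - 1/2) ^ k = (- 2 * z - 1) ^ k / 2 ^ k"
      by (simp_all only: power_divide)
  qed
  then show ?thesis unfolding chain_E_def by (simp add: add_divide_distrib)
qed

text \<open>The factor 1728 = 108 * 2 * 2^3 clears the explicit denominators and those of the
  half-integers.\<close>

lemma chain_diag_X_scaled:
  fixes x1 x3 z1 z3 u1 v3 :: complex
  defines "F \<equiv> \<lambda>k::nat. (2 * z1 + 1) ^ k + (2 * v3 + 1) ^ k + (2 * x1 + 1) ^ k
     + (- 2 * z3 - 1) ^ k + (- 2 * u1 - 1) ^ k + (- 2 * x3 - 1) ^ k"
  shows "1728 * chain_diag_X x1 x3 z1 z3 u1 v3 \<Lambda> = - (7 * F 1 ^ 3 - 36 * F 1 * F 2 + 36 * F 3) - 36 * F 1 * (\<Lambda>\<^sup>2 + 2)"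
proof -
  have E: "chain_E x1 x3 z1 z3 u1 v3 k = F k / 2 ^ k" for k unfolding chain_E_scaled F_def ..
  have "1728 * (- (1/108) * (7/2 * (fa / 2) ^ 3 - 18 * (fa / 2) * (fb / 4) + 18 * (fc / 8)) - 1/24 * (fa / 2) * (\<Lambda>\<^sup>2 + 2))
     = - (7 * fa ^ 3 - 36 * fa * fb + 36 * fc) - 36 * fa * (\<Lambda>\<^sup>2 + 2)" for fa fb fc :: complex
    by (simp add: field_simps power_divide)
  from this[where fa = "F 1" and fb = "F 2" and fc = "F 3"] show ?thesis unfolding chain_diag_X_def Let_def E by (simp only: power_one_right) simp
qed

text \<open>Likewise, 9216 = 288 * 2 * 2^4.\<close>

lemma chain_diag_Y_scaled:
  fixes x1 x3 z1 z3 u1 v3 :: complex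
  defines "F \<equiv> \<lambda>k::nat. (2 * z1 + 1) ^ k + (2 * v3 + 1) ^ k + (2 * x1 + 1) ^ k
     + (- 2 * z3 - 1) ^ k + (- 2 * u1 - 1) ^ k + (- 2 * x3 - 1) ^ k"
  shows "9216 * chain_diag_Y x1 x3 z1 z3 u1 v3 \<Lambda> = 5 * F 1 ^ 4 + 64 * F 1 * F 3
     + 12 * ((F 2)\<^sup>2 - 3 * (F 1)\<^sup>2 * F 2 - 4 * F 4) + 48 * F 2 * (\<Lambda>\<^sup>2 + 2) - 24 * (F 1)\<^sup>2 * (\<Lambda>\<^sup>2 - 2)
     - 48 * \<Lambda> ^ 4 + 192 * \<Lambda>\<^sup>2 - 1152"
proof -
  have E: "chain_E x1 x3 z1 z3 u1 v3 k = F k / 2 ^ k" for k unfolding chain_E_scaled F_def ..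
  have "9216 * (1/288 * (5/2 * (fa / 2) ^ 4 + 32 * (fa / 2) * (fc / 8) + 6 * ((fb / 4)\<^sup>2 - 3 * (fa / 2)\<^sup>2 * (fb / 4) - 4 * (fd / 16))
       + 6 * (fb / 4) * (\<Lambda>\<^sup>2 + 2) - 3 * (fa / 2)\<^sup>2 * (\<Lambda>\<^sup>2 - 2) - 3/2 * \<Lambda> ^ 4 + 6 * \<Lambda>\<^sup>2 - 36))
     = 5 * fa ^ 4 + 64 * fa * fc + 12 * (fb\<^sup>2 - 3 * fa\<^sup>2 * fb - 4 * fd) + 48 * fb * (\<Lambda>\<^sup>2 + 2) - 24 * fa\<^sup>2 * (\<Lambda>\<^sup>2 - 2)
     - 48 * \<Lambda> ^ 4 + 192 * \<Lambda>\<^sup>2 - 1152" for fa fb fc fd :: complex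
    by (simp add: field_simps power_divide)
  from this[where fa = "F 1" and fb = "F 2" and fc = "F 3" and fd = "F 4"] show ?thesis unfolding chain_diag_Y_def Let_def E by (simp only: power_one_right) simp
qed

text \<open>With \<open>s\<close> the shift of the representation, (a - b) / 3, as variable in place
  of \<open>a\<close>, the Casimir value has integer coefficients.\<close>

lemma cas3_shift: "cas3 (3 * s + b) b = 6 * s ^ 3 + 9 * b * s ^ 2 + 9 * s ^ 2 + 3 * b ^ 2 * s + 6 * b * s + 3 * s"
  by (simp add: cas3_def field_simps power2_eq_square power3_eq_cube)

text \<open>These rules multiply the coefficients produced by \<open>chain_assemble\<close> by
  common denominators, 1728 and 9216 on the diagonal, so that \<open>algebra\<close> meets
  polynomial identities with integer coefficients.\<close>

lemma half_eqI: "p = 2 * q \<Longrightarrow> p / 2 = (q :: complex)"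
  and third_eqI: "864 * p + 576 * (c - c') = 1728 * d \<Longrightarrow> p / 2 + (c - c') / 3 = (d :: complex)"
  and twelfth_eqI: "4608 * p - (768 * (t * t) + 3840 * (k * r) + 18432 * t) = 9216 * d
    \<Longrightarrow> p / 2 - (t * t / 12 + 5 / 12 * k * r + 2 * t) = (d :: complex)"
  and sixth_eqI: "3 * p = - (r * (3 * l + m + 6)) \<Longrightarrow> p / 2 = r * (- l / 2 - m / 6 - (1 :: complex))"
    "3 * p = r * (3 * l - m) \<Longrightarrow> p / 2 = r * (l / 2 - m / (6 :: complex))"
proof -
  show "p = 2 * q \<Longrightarrow> p / 2 = q" by simp
  have "p / 2 + (c - c') / 3 = (864 * p + 576 * (c - c')) / 1728" by (simp add: field_simps)
  then show "864 * p + 576 * (c - c') = 1728 * d \<Longrightarrow> p / 2 + (c - c') / 3 = d" by simp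
  have "p / 2 - (t * t / 12 + 5 / 12 * k * r + 2 * t) = (4608 * p - (768 * (t * t) + 3840 * (k * r) + 18432 * t)) / 9216"
    by (simp add: field_simps)
  then show "4608 * p - (768 * (t * t) + 3840 * (k * r) + 18432 * t) = 9216 * d
    \<Longrightarrow> p / 2 - (t * t / 12 + 5 / 12 * k * r + 2 * t) = d" by simp
  have "r * (- l / 2 - m / 6 - 1) = - (r * (3 * l + m + 6)) / 6" "r * (l / 2 - m / 6) = r * (3 * l - m) / 6"
    by (simp_all add: field_simps)
  moreover have "p / 2 = (3 * p) / 6" by simp
  ultimately show "3 * p = - (r * (3 * l + m + 6)) \<Longrightarrow> p / 2 = r * (- l / 2 - m / 6 - 1)"
    "3 * p = r * (3 * l - m) \<Longrightarrow> p / 2 = r * (l / 2 - m / 6)" by (simp_all only:)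
qed

context hw_pair
begin

text \<open>\<open>X\<close> and \<open>A\<close> complete the degrees of the first factor; in
  \<open>C_lift\<close> they are the exponents of x_1 and \<alpha>_3 in the lifted vector. Their
  vanishing later stops the chain at its ends.\<close>

lemma op_on_chain_A:
  fixes k1 p k3 l1 l3 X A :: int
  assumes u: "hwv (tensor_rep \<rho> \<rho>') \<alpha> \<beta> u" and top: "top u = c *s W.B k1 p k3 l1 0 l3"
    and ints: "int a = l1 + p + X" "int b = k3 + A" "int a' = k1 + p + k3" "int b' = l1 + l3"
  defines "x1 \<equiv> of_int k1" and "y \<equiv> of_int p" and "x3 \<equiv> of_int k3" and "z1 \<equiv> of_int l1" and "z3 \<equiv> of_int l3"
    and "u1 \<equiv> of_int X" and "v3 \<equiv> of_int A"
  defines "\<Lambda> \<equiv> z1 + v3 + x1 + 3 + z3 + u1 + x3 + 2 * y"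
  shows "top (op_X \<rho> \<rho>' *v u) = c *s (
      (u1 * (x1 + 1) * (z1 + 1)) *s W.B (k1 + 1) p (k3 - 1) (l1 + 1) 0 (l3 - 1)
    + chain_diag_X x1 x3 z1 z3 u1 v3 \<Lambda> *s W.B k1 p k3 l1 0 l3
    + (- (v3 * (x3 + 1) * (z3 + 1))) *s W.B (k1 - 1) p (k3 + 1) (l1 - 1) 0 (l3 + 1))" (is ?X)
  and "top (op_Y \<rho> \<rho>' *v u) = c *s (
      (u1 * (x1 + 1) * (z1 + 1) * (- \<Lambda> / 2 - (z1 + v3 + x1 - z3 - u1 - x3 - 3) / 6 - 1)) *s W.B (k1 + 1) p (k3 - 1) (l1 + 1) 0 (l3 - 1)
    + chain_diag_Y x1 x3 z1 z3 u1 v3 \<Lambda> *s W.B k1 p k3 l1 0 l3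
    + (- (v3 * (x3 + 1) * (z3 + 1)) * (\<Lambda> / 2 - (z1 + v3 + x1 - z3 - u1 - x3 - 3) / 6)) *s W.B (k1 - 1) p (k3 + 1) (l1 - 1) 0 (l3 + 1))" (is ?Y)
proof -
  define s where "s = W.shift"
  define s0 where "s0 = V.shift"
  have ab: "of_int (int a) = (of_int (l1 + p + X) :: complex)" "of_int (int b) = (of_int (k3 + A) :: complex)"
    "of_int (int a') = (of_int (k1 + p + k3) :: complex)" "of_int (int b') = (of_int (l1 + l3) :: complex)"
    unfolding ints by simp_all
  \<comment> \<open>The exponents and the two shifts satisfy two linear relations. Solving them for
    \<open>x1\<close> and \<open>u1\<close> leaves independent variables, so the remaining claims
    are polynomial identities.\<close>
  have x1: "x1 = 3 * s + (z1 + z3) - (y + x3)" and u1: "u1 = 3 * s0 + (x3 + v3) - (z1 + y)"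
    using ab unfolding s_def s0_def V.shift_def W.shift_def x1_def y_def x3_def z1_def z3_def u1_def v3_def by (simp_all add: field_simps)
  have A: "of_nat a = 3 * s0 + (x3 + v3)" and Bb: "of_nat b = (x3 + v3)" and A': "of_nat a' = 3 * s + (z1 + z3)" and B': "of_nat b' = (z1 + z3)"
    using ab unfolding s_def s0_def V.shift_def W.shift_def x1_def y_def x3_def z1_def z3_def u1_def v3_def by (simp_all add: field_simps)
  have L: "L 1 = 2 * s0 + (x3 + v3)" "L 2 = - s0" "L 3 = - ((x3 + v3)) - s0"
    unfolding hwt_def A Bb by simp_all
  note ch = W.chain_action_A[of k1 p k3 l1 l3, folded x1_def y_def x3_def z1_def z3_def s_def]
  note dg = W.B_action(7-9)[of k1 p k3 l1 0 l3, folded s_def]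
  note asm = chain_assemble[OF u top dg ch]
  note fold = of_int_diff x1_def[symmetric] y_def[symmetric] x3_def[symmetric] z1_def[symmetric] z3_def[symmetric] of_int_0
  have comb: "U = U' \<Longrightarrow> X' = X'' \<Longrightarrow> Z = Z' \<Longrightarrow> c *s (U *s f + X' *s g + Z *s h) = c *s (U' *s f + X'' *s g + Z' *s h)"
    for U U' X' X'' Z Z' and f g h :: "complex^'m" by simp
  show ?X
    apply (rule trans[OF asm(1)])
       apply (algebra, algebra, algebra, algebra)
    apply (rule comb)
    subgoal by (rule half_eqI, unfold L x1 u1, algebra)
    subgoal by (rule third_eqI, unfold chain_diag_X_scaled L, unfold A Bb A' B' cas3_shift, unfold \<Lambda>_def fold, unfold x1 u1, algebra)
    subgoal by (rule half_eqI, unfold L x1 u1, algebra)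
    done
  show ?Y
    apply (rule trans[OF asm(2)])
       apply (algebra, algebra, algebra, algebra)
    apply (rule comb)
    subgoal by (rule sixth_eqI(1), unfold L \<Lambda>_def, unfold x1 u1, algebra)
    subgoal by (rule twelfth_eqI, unfold chain_diag_Y_scaled cas2_def, unfold L \<Lambda>_def fold, unfold x1 u1, algebra)
    subgoal by (rule sixth_eqI(2), unfold L \<Lambda>_def, unfold x1 u1, algebra)
    done
qed

text \<open>The case of a power of \<beta>_2. The degree relations change, but the coefficients come
  out in the same form, which is what allows one formula for both signs of \<ell> - n.\<close>

lemma op_on_chain_B:
  fixes k1 p k3 l1 l3 X A :: int
  assumes u: "hwv (tensor_rep \<rho> \<rho>') \<alpha> \<beta> u" and top: "top u = c *s W.B k1 0 k3 l1 p l3"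
    and ints: "int a = l1 + X" "int b = k3 + p + A" "int a' = k1 + k3" "int b' = l1 + p + l3"
  defines "x1 \<equiv> of_int k1" and "y \<equiv> of_int p" and "x3 \<equiv> of_int k3" and "z1 \<equiv> of_int l1" and "z3 \<equiv> of_int l3"
    and "u1 \<equiv> of_int X" and "v3 \<equiv> of_int A"
  defines "\<Lambda> \<equiv> z1 + v3 + x1 + 3 + z3 + u1 + x3 + 2 * y"
  shows "top (op_X \<rho> \<rho>' *v u) = c *s (
      (u1 * (x1 + 1) * (z1 + 1)) *s W.B (k1 + 1) 0 (k3 - 1) (l1 + 1) p (l3 - 1)
    + chain_diag_X x1 x3 z1 z3 u1 v3 \<Lambda> *s W.B k1 0 k3 l1 p l3
    + (- (v3 * (x3 + 1) * (z3 + 1))) *s W.B (k1 - 1) 0 (k3 + 1) (l1 - 1) p (l3 + 1))" (is ?X)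
  and "top (op_Y \<rho> \<rho>' *v u) = c *s (
      (u1 * (x1 + 1) * (z1 + 1) * (- \<Lambda> / 2 - (z1 + v3 + x1 - z3 - u1 - x3 - 3) / 6 - 1)) *s W.B (k1 + 1) 0 (k3 - 1) (l1 + 1) p (l3 - 1)
    + chain_diag_Y x1 x3 z1 z3 u1 v3 \<Lambda> *s W.B k1 0 k3 l1 p l3
    + (- (v3 * (x3 + 1) * (z3 + 1)) * (\<Lambda> / 2 - (z1 + v3 + x1 - z3 - u1 - x3 - 3) / 6)) *s W.B (k1 - 1) 0 (k3 + 1) (l1 - 1) p (l3 + 1))" (is ?Y)
proof -
  define s where "s = W.shift"
  define s0 where "s0 = V.shift"
  have ab: "of_int (int a) = (of_int (l1 + X) :: complex)" "of_int (int b) = (of_int (k3 + p + A) :: complex)"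
    "of_int (int a') = (of_int (k1 + k3) :: complex)" "of_int (int b') = (of_int (l1 + p + l3) :: complex)"
    unfolding ints by simp_all
  have x1: "x1 = 3 * s + (z1 + y + z3) - x3" and u1: "u1 = 3 * s0 + (x3 + y + v3) - z1"
    using ab unfolding s_def s0_def V.shift_def W.shift_def x1_def y_def x3_def z1_def z3_def u1_def v3_def by (simp_all add: field_simps)
  have A: "of_nat a = 3 * s0 + (x3 + y + v3)" and Bb: "of_nat b = (x3 + y + v3)" and A': "of_nat a' = 3 * s + (z1 + y + z3)" and B': "of_nat b' = (z1 + y + z3)"
    using ab unfolding s_def s0_def V.shift_def W.shift_def x1_def y_def x3_def z1_def z3_def u1_def v3_def by (simp_all add: field_simps)
  have L: "L 1 = 2 * s0 + (x3 + y + v3)" "L 2 = - s0" "L 3 = - ((x3 + y + v3)) - s0"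
    unfolding hwt_def A Bb by simp_all
  note ch = W.chain_action_B[of k1 k3 l1 p l3, folded x1_def y_def x3_def z1_def z3_def s_def]
  note dg = W.B_action(7-9)[of k1 0 k3 l1 p l3, folded s_def]
  note asm = chain_assemble[OF u top dg ch]
  note fold = of_int_diff x1_def[symmetric] y_def[symmetric] x3_def[symmetric] z1_def[symmetric] z3_def[symmetric] of_int_0
  have comb: "U = U' \<Longrightarrow> X' = X'' \<Longrightarrow> Z = Z' \<Longrightarrow> c *s (U *s f + X' *s g + Z *s h) = c *s (U' *s f + X'' *s g + Z' *s h)"
    for U U' X' X'' Z Z' and f g h :: "complex^'m" by simp
  show ?X
    apply (rule trans[OF asm(1)])
       apply (algebra, algebra, algebra, algebra)
    apply (rule comb)
    subgoal by (rule half_eqI, unfold L x1 u1, algebra)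
    subgoal by (rule third_eqI, unfold chain_diag_X_scaled L, unfold A Bb A' B' cas3_shift, unfold \<Lambda>_def fold, unfold x1 u1, algebra)
    subgoal by (rule half_eqI, unfold L x1 u1, algebra)
    done
  show ?Y
    apply (rule trans[OF asm(2)])
       apply (algebra, algebra, algebra, algebra)
    apply (rule comb)
    subgoal by (rule sixth_eqI(1), unfold L \<Lambda>_def, unfold x1 u1, algebra)
    subgoal by (rule twelfth_eqI, unfold chain_diag_Y_scaled cas2_def, unfold L \<Lambda>_def fold, unfold x1 u1, algebra)
    subgoal by (rule sixth_eqI(2), unfold L \<Lambda>_def, unfold x1 u1, algebra)
    done
qed

end

section \<open>Highest-weight vectors from invariants\<close>

text \<open>With \<open>x\<close>, \<open>\<alpha>\<close> the vector and covector of the first factor and \<open>y\<close>, \<open>\<beta>\<close> those of the second one,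
  the monomials in \<open>x\<^sub>1\<close>, \<open>\<alpha>\<^sub>3\<close>, \<open>y\<^sub>1\<close>, \<open>\<beta>\<^sub>3\<close>, \<open>\<alpha>\<cdot>y\<close>, \<open>\<beta>\<cdot>x\<close>, \<open>x\<^sub>1 y\<^sub>2 - x\<^sub>2 y\<^sub>1\<close> and
  \<open>\<alpha>\<^sub>3 \<beta>\<^sub>2 - \<alpha>\<^sub>2 \<beta>\<^sub>3\<close> are killed by the raising operators.  Multiplication by one of the last four is an
  operator on families indexed by the exponents (of divided powers) of \<open>x\<close>, \<open>\<alpha>\<close>, \<open>y\<close>, \<open>\<beta>\<close>.\<close>

type_synonym 'c family2 = "int \<Rightarrow> int \<Rightarrow> int \<Rightarrow> int \<Rightarrow> int \<Rightarrow> int \<Rightarrow> 'c family"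

definition tens :: "complex^'n::finite \<Rightarrow> complex^'m::finite \<Rightarrow> complex^('n \<times> 'm)" where
  "tens x y = (\<chi> i. x $ fst i * y $ snd i)"

lemma tens_linear: "tens (x + x') y = tens x y + tens x' y" "tens (x - x') y = tens x y - tens x' y" "tens (c *s x) y = c *s tens x y"
  "tens x (y + y') = tens x y + tens x y'" "tens x (y - y') = tens x y - tens x y'" "tens x (c *s y) = c *s tens x y"
  "tens 0 y = 0" "tens x 0 = 0"
  by (simp_all add: tens_def vec_eq_iff algebra_simps)

lemma kron_tens: "kron A (mat 1) *v tens x y = tens (A *v x) y" "kron (mat 1) C *v tens x y = tens x (C *v y)"
proof -
  show "kron A (mat 1) *v tens x y = tens (A *v x) y"
    by (rule pair_vec_eqI, unfold kron_left_vector) (simp add: tens_def matrix_vector_mult_def sum_distrib_right mult.assoc)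
  show "kron (mat 1) C *v tens x y = tens x (C *v y)"
    by (rule pair_vec_eqI, unfold kron_right_vector) (simp add: tens_def matrix_vector_mult_def sum_distrib_left mult.left_commute)
qed

lemma of_int_mult_zero: "(k + 1 \<noteq> 0 \<Longrightarrow> k' + 1 \<noteq> 0 \<Longrightarrow> w = 0) \<Longrightarrow> (of_int (k + 1) * of_int (k' + 1)) *s w = (0 :: complex^'n)"
  by (cases "k + 1 = 0"; cases "k' + 1 = 0") (simp_all flip: of_int_add)

context hw_pair
begin

abbreviation \<tau> where "\<tau> \<equiv> tensor_rep \<rho> \<rho>'"

text \<open>Each of the four groups of exponents contributes as in \<open>B_action\<close>.
  Multiplying by a factor that the raising generators kill preserves the formula, and
  \<open>\<tau> 1 3\<close> is recovered as a commutator in \<open>lifted_vector\<close>.\<close>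

definition equivariant :: "(complex^('n \<times> 'm)) family2 \<Rightarrow> bool" where
  "equivariant F \<longleftrightarrow> (\<forall>i1 i2 i3 j1 j2 j3 k1 k2 k3 l1 l2 l3.
     \<tau> 1 2 *v F i1 i2 i3 j1 j2 j3 k1 k2 k3 l1 l2 l3 = of_int (i1 + 1) *s F (i1 + 1) (i2 - 1) i3 j1 j2 j3 k1 k2 k3 l1 l2 l3 - of_int (j2 + 1) *s F i1 i2 i3 (j1 - 1) (j2 + 1) j3 k1 k2 k3 l1 l2 l3 + of_int (k1 + 1) *s F i1 i2 i3 j1 j2 j3 (k1 + 1) (k2 - 1) k3 l1 l2 l3 - of_int (l2 + 1) *s F i1 i2 i3 j1 j2 j3 k1 k2 k3 (l1 - 1) (l2 + 1) l3 \<and>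
     \<tau> 2 3 *v F i1 i2 i3 j1 j2 j3 k1 k2 k3 l1 l2 l3 = of_int (i2 + 1) *s F i1 (i2 + 1) (i3 - 1) j1 j2 j3 k1 k2 k3 l1 l2 l3 - of_int (j3 + 1) *s F i1 i2 i3 j1 (j2 - 1) (j3 + 1) k1 k2 k3 l1 l2 l3 + of_int (k2 + 1) *s F i1 i2 i3 j1 j2 j3 k1 (k2 + 1) (k3 - 1) l1 l2 l3 - of_int (l3 + 1) *s F i1 i2 i3 j1 j2 j3 k1 k2 k3 l1 (l2 - 1) (l3 + 1))"

text \<open>The offsets record the weight of the invariants multiplied in so far: (1, 1, 0) for each
  x_1 y_2 - x_2 y_1 and (0, -1, -1) for each \<alpha>_3 \<beta>_2 - \<alpha>_2 \<beta>_3.\<close>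

definition weighted :: "int \<Rightarrow> int \<Rightarrow> int \<Rightarrow> (complex^('n \<times> 'm)) family2 \<Rightarrow> bool" where
  "weighted w1 w2 w3 F \<longleftrightarrow> (\<forall>i1 i2 i3 j1 j2 j3 k1 k2 k3 l1 l2 l3.
     \<tau> 1 1 *v F i1 i2 i3 j1 j2 j3 k1 k2 k3 l1 l2 l3 = (of_int (i1 - j1 + k1 - l1 + w1) - (V.shift + W.shift)) *s F i1 i2 i3 j1 j2 j3 k1 k2 k3 l1 l2 l3 \<and>
     \<tau> 2 2 *v F i1 i2 i3 j1 j2 j3 k1 k2 k3 l1 l2 l3 = (of_int (i2 - j2 + k2 - l2 + w2) - (V.shift + W.shift)) *s F i1 i2 i3 j1 j2 j3 k1 k2 k3 l1 l2 l3 \<and>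
     \<tau> 3 3 *v F i1 i2 i3 j1 j2 j3 k1 k2 k3 l1 l2 l3 = (of_int (i3 - j3 + k3 - l3 + w3) - (V.shift + W.shift)) *s F i1 i2 i3 j1 j2 j3 k1 k2 k3 l1 l2 l3)"

text \<open>The listed exponents are those which raising generators lower. Where all of them are 0,
  each term of a raised member has a negative exponent, so the member is killed.\<close>

definition nonneg_supported :: "(complex^('n \<times> 'm)) family2 \<Rightarrow> bool" where
  "nonneg_supported F \<longleftrightarrow> (\<forall>i1 i2 i3 j1 j2 j3 k1 k2 k3 l1 l2 l3. i2 < 0 \<or> i3 < 0 \<or> j1 < 0 \<or> j2 < 0 \<or> k2 < 0 \<or> k3 < 0 \<or> l1 < 0 \<or> l2 < 0 \<longrightarrow> F i1 i2 i3 j1 j2 j3 k1 k2 k3 l1 l2 l3 = 0)"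

definition top_supported :: "(complex^('n \<times> 'm)) family2 \<Rightarrow> bool" where
  "top_supported F \<longleftrightarrow> (\<forall>i1 i2 i3 j1 j2 j3 k1 k2 k3 l1 l2 l3. i2 > 0 \<or> i3 > 0 \<or> j1 > 0 \<or> j2 > 0 \<longrightarrow> top (F i1 i2 i3 j1 j2 j3 k1 k2 k3 l1 l2 l3) = 0)"

lemma equivariantD:
  assumes "equivariant F"
  shows "\<tau> 1 2 *v F i1 i2 i3 j1 j2 j3 k1 k2 k3 l1 l2 l3 = of_int (i1 + 1) *s F (i1 + 1) (i2 - 1) i3 j1 j2 j3 k1 k2 k3 l1 l2 l3 - of_int (j2 + 1) *s F i1 i2 i3 (j1 - 1) (j2 + 1) j3 k1 k2 k3 l1 l2 l3 + of_int (k1 + 1) *s F i1 i2 i3 j1 j2 j3 (k1 + 1) (k2 - 1) k3 l1 l2 l3 - of_int (l2 + 1) *s F i1 i2 i3 j1 j2 j3 k1 k2 k3 (l1 - 1) (l2 + 1) l3" "\<tau> 2 3 *v F i1 i2 i3 j1 j2 j3 k1 k2 k3 l1 l2 l3 = of_int (i2 + 1) *s F i1 (i2 + 1) (i3 - 1) j1 j2 j3 k1 k2 k3 l1 l2 l3 - of_int (j3 + 1) *s F i1 i2 i3 j1 (j2 - 1) (j3 + 1) k1 k2 k3 l1 l2 l3 + of_int (k2 + 1) *s F i1 i2 i3 j1 j2 j3 k1 (k2 + 1) (k3 - 1) l1 l2 l3 - of_int (l3 + 1) *s F i1 i2 i3 j1 j2 j3 k1 k2 k3 l1 (l2 - 1)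 (l3 + 1)"
  using assms unfolding equivariant_def by blast+

lemma weightedD:
  assumes "weighted w1 w2 w3 F"
  shows "\<tau> 1 1 *v F i1 i2 i3 j1 j2 j3 k1 k2 k3 l1 l2 l3 = (of_int (i1 - j1 + k1 - l1 + w1) - (V.shift + W.shift)) *s F i1 i2 i3 j1 j2 j3 k1 k2 k3 l1 l2 l3"
    "\<tau> 2 2 *v F i1 i2 i3 j1 j2 j3 k1 k2 k3 l1 l2 l3 = (of_int (i2 - j2 + k2 - l2 + w2) - (V.shift + W.shift)) *s F i1 i2 i3 j1 j2 j3 k1 k2 k3 l1 l2 l3"
    "\<tau> 3 3 *v F i1 i2 i3 j1 j2 j3 k1 k2 k3 l1 l2 l3 = (of_int (i3 - j3 + k3 - l3 + w3) - (V.shift + W.shift)) *s F i1 i2 i3 j1 j2 j3 k1 k2 k3 l1 l2 l3"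
  using assms unfolding weighted_def by blast+

lemma nonneg_supportedD: "nonneg_supported F \<Longrightarrow> i2 < 0 \<or> i3 < 0 \<or> j1 < 0 \<or> j2 < 0 \<or> k2 < 0 \<or> k3 < 0 \<or> l1 < 0 \<or> l2 < 0 \<Longrightarrow> F i1 i2 i3 j1 j2 j3 k1 k2 k3 l1 l2 l3 = 0"
  unfolding nonneg_supported_def by blast

lemma top_supportedD: "top_supported F \<Longrightarrow> i2 > 0 \<or> i3 > 0 \<or> j1 > 0 \<or> j2 > 0 \<Longrightarrow> top (F i1 i2 i3 j1 j2 j3 k1 k2 k3 l1 l2 l3) = 0"
  unfolding top_supported_def by blast

lemmas mult_simps = matrix_vector_mult_smult matrix_vector_right_distrib matrix_vector_mult_diff_distrib

text \<open>Multiplication by \<alpha>.y; the next three definitions are multiplication by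
  \<beta>.x, by x_1 y_2 - x_2 y_1 and by \<alpha>_3 \<beta>_2 - \<alpha>_2 \<beta>_3. The integer
  factors again come from divided powers.\<close>

definition mult_ay :: "(complex^('n \<times> 'm)) family2 \<Rightarrow> (complex^('n \<times> 'm)) family2" where
  "mult_ay F i1 i2 i3 j1 j2 j3 k1 k2 k3 l1 l2 l3 = (of_int (j1 + 1) * of_int (k1 + 1)) *s F i1 i2 i3 (j1 + 1) j2 j3 (k1 + 1) k2 k3 l1 l2 l3 + (of_int (j2 + 1) * of_int (k2 + 1)) *s F i1 i2 i3 j1 (j2 + 1) j3 k1 (k2 + 1) k3 l1 l2 l3 + (of_int (j3 + 1) * of_int (k3 + 1)) *s F i1 i2 i3 j1 j2 (j3 + 1) k1 k2 (k3 + 1) l1 l2 l3"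

definition mult_bx :: "(complex^('n \<times> 'm)) family2 \<Rightarrow> (complex^('n \<times> 'm)) family2" where
  "mult_bx F i1 i2 i3 j1 j2 j3 k1 k2 k3 l1 l2 l3 = (of_int (i1 + 1) * of_int (l1 + 1)) *s F (i1 + 1) i2 i3 j1 j2 j3 k1 k2 k3 (l1 + 1) l2 l3 + (of_int (i2 + 1) * of_int (l2 + 1)) *s F i1 (i2 + 1) i3 j1 j2 j3 k1 k2 k3 l1 (l2 + 1) l3 + (of_int (i3 + 1) * of_int (l3 + 1)) *s F i1 i2 (i3 + 1) j1 j2 j3 k1 k2 k3 l1 l2 (l3 + 1)"

definition mult_xy :: "(complex^('n \<times> 'm)) family2 \<Rightarrow> (complex^('n \<times> 'm)) family2" where
  "mult_xy F i1 i2 i3 j1 j2 j3 k1 k2 k3 l1 l2 l3 = (of_int (i1 + 1) * of_int (k2 + 1)) *s F (i1 + 1) i2 i3 j1 j2 j3 k1 (k2 + 1) k3 l1 l2 l3 - (of_int (i2 + 1) * of_int (k1 + 1)) *s F i1 (i2 + 1) i3 j1 j2 j3 (k1 + 1) k2 k3 l1 l2 l3"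

definition mult_ab :: "(complex^('n \<times> 'm)) family2 \<Rightarrow> (complex^('n \<times> 'm)) family2" where
  "mult_ab F i1 i2 i3 j1 j2 j3 k1 k2 k3 l1 l2 l3 = (of_int (j3 + 1) * of_int (l2 + 1)) *s F i1 i2 i3 j1 j2 (j3 + 1) k1 k2 k3 l1 (l2 + 1) l3 - (of_int (j2 + 1) * of_int (l3 + 1)) *s F i1 i2 i3 j1 (j2 + 1) j3 k1 k2 k3 l1 l2 (l3 + 1)"

definition mono2 :: "(complex^('n \<times> 'm)) family2" where
  "mono2 i1 i2 i3 j1 j2 j3 k1 k2 k3 l1 l2 l3 = tens (V.B i1 i2 i3 j1 j2 j3) (W.B k1 k2 k3 l1 l2 l3)"

lemma top_tens: "top (tens x y) = scalar_product \<xi> x *s y"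
  by (simp add: top_def contr_def slice_def tens_def scalar_product_def vec_eq_iff sum_distrib_right mult.assoc)

lemma mono2_props: "equivariant mono2" "weighted 0 0 0 mono2" "nonneg_supported mono2" "top_supported mono2"
proof -
  show "equivariant mono2"
    unfolding equivariant_def
    by (intro allI conjI; simp only: mono2_def tensor_rep_vector tensor_gen_simps kron_tens V.B_action W.B_action tens_linear)
       (simp_all only: add_diff_eq diff_add_eq)
  show "weighted 0 0 0 mono2"
    unfolding weighted_def
    by (intro allI conjI; simp only: mono2_def tensor_rep_vector tensor_gen_simps kron_tens V.B_action W.B_action tens_linear)
       (simp_all add: vec_eq_iff algebra_simps)
  show "nonneg_supported mono2"
    unfolding nonneg_supported_def mono2_def
  proof (intro allI impI)
    fix i1 i2 i3 j1 j2 j3 k1 k2 k3 l1 l2 l3 :: int assume "i2 < 0 \<or> i3 < 0 \<or> j1 < 0 \<or> j2 < 0 \<or> k2 < 0 \<or> k3 < 0 \<or> l1 < 0 \<or> l2 < 0"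
    then have "V.B i1 i2 i3 j1 j2 j3 = 0 \<or> W.B k1 k2 k3 l1 l2 l3 = 0" using V.B_neg W.B_neg by blast
    then show "tens (V.B i1 i2 i3 j1 j2 j3) (W.B k1 k2 k3 l1 l2 l3) = 0" by (auto simp: tens_linear)
  qed
  show "top_supported mono2"
    unfolding top_supported_def mono2_def top_tens V.xi_B by (auto simp: top_family_def)
qed

text \<open>The derivation rule passes a raising generator on to \<open>F\<close>, since it kills
  \<alpha>.y. A negative exponent survives the shift except at -1, where its factor is 0; positive
  exponents stay positive. The next three lemmas follow the same pattern.\<close>

lemma mult_ay_props:
  assumes "equivariant F" "nonneg_supported F" "top_supported F"
  shows "equivariant (mult_ay F)" "nonneg_supported (mult_ay F)" "top_supported (mult_ay F)"
    "weighted w1 w2 w3 F \<Longrightarrow> weighted w1 w2 w3 (mult_ay F)"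
proof -
  show "equivariant (mult_ay F)"
    unfolding equivariant_def mult_ay_def
    by (intro allI conjI; simp only: equivariantD[OF assms(1)] mult_simps) (simp_all add: vec_eq_iff algebra_simps)
  show "nonneg_supported (mult_ay F)"
    unfolding nonneg_supported_def
  proof (intro allI impI)
    fix i1 i2 i3 j1 j2 j3 k1 k2 k3 l1 l2 l3 :: int assume neg: "i2 < 0 \<or> i3 < 0 \<or> j1 < 0 \<or> j2 < 0 \<or> k2 < 0 \<or> k3 < 0 \<or> l1 < 0 \<or> l2 < 0"
    have z0: "(of_int (j1 + 1) * of_int (k1 + 1)) *s F i1 i2 i3 (j1 + 1) j2 j3 (k1 + 1) k2 k3 l1 l2 l3 = 0"
      by (rule of_int_mult_zero, rule nonneg_supportedD[OF assms(2)], use neg in presburger)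
    have z1: "(of_int (j2 + 1) * of_int (k2 + 1)) *s F i1 i2 i3 j1 (j2 + 1) j3 k1 (k2 + 1) k3 l1 l2 l3 = 0"
      by (rule of_int_mult_zero, rule nonneg_supportedD[OF assms(2)], use neg in presburger)
    have z2: "(of_int (j3 + 1) * of_int (k3 + 1)) *s F i1 i2 i3 j1 j2 (j3 + 1) k1 k2 (k3 + 1) l1 l2 l3 = 0"
      by (rule of_int_mult_zero, rule nonneg_supportedD[OF assms(2)], use neg in presburger)
    show "mult_ay F i1 i2 i3 j1 j2 j3 k1 k2 k3 l1 l2 l3 = 0"
      unfolding mult_ay_def z0 z1 z2 by simp
  qed
  show "top_supported (mult_ay F)"
    unfolding top_supported_def
  proof (intro allI impI)
    fix i1 i2 i3 j1 j2 j3 k1 k2 k3 l1 l2 l3 :: int assume pos: "i2 > 0 \<or> i3 > 0 \<or> j1 > 0 \<or> j2 > 0"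
    have z0: "top (F i1 i2 i3 (j1 + 1) j2 j3 (k1 + 1) k2 k3 l1 l2 l3) = 0" by (rule top_supportedD[OF assms(3)]) (use pos in linarith)
    have z1: "top (F i1 i2 i3 j1 (j2 + 1) j3 k1 (k2 + 1) k3 l1 l2 l3) = 0" by (rule top_supportedD[OF assms(3)]) (use pos in linarith)
    have z2: "top (F i1 i2 i3 j1 j2 (j3 + 1) k1 k2 (k3 + 1) l1 l2 l3) = 0" by (rule top_supportedD[OF assms(3)]) (use pos in linarith)
    show "top (mult_ay F i1 i2 i3 j1 j2 j3 k1 k2 k3 l1 l2 l3) = 0"
      unfolding mult_ay_def top_linear z0 z1 z2 by simp
  qed
  assume "weighted w1 w2 w3 F"
  then show "weighted w1 w2 w3 (mult_ay F)"
    unfolding weighted_def[of _ _ _ "mult_ay F"] mult_ay_def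
    by (intro allI conjI; simp only: weightedD mult_simps) (simp_all add: vec_eq_iff algebra_simps)
qed

lemma mult_bx_props:
  assumes "equivariant F" "nonneg_supported F" "top_supported F"
  shows "equivariant (mult_bx F)" "nonneg_supported (mult_bx F)" "top_supported (mult_bx F)"
    "weighted w1 w2 w3 F \<Longrightarrow> weighted w1 w2 w3 (mult_bx F)"
proof -
  show "equivariant (mult_bx F)"
    unfolding equivariant_def mult_bx_def
    by (intro allI conjI; simp only: equivariantD[OF assms(1)] mult_simps) (simp_all add: vec_eq_iff algebra_simps)
  show "nonneg_supported (mult_bx F)"
    unfolding nonneg_supported_def
  proof (intro allI impI)
    fix i1 i2 i3 j1 j2 j3 k1 k2 k3 l1 l2 l3 :: int assume neg: "i2 < 0 \<or> i3 < 0 \<or> j1 < 0 \<or> j2 < 0 \<or> k2 < 0 \<or> k3 < 0 \<or> l1 < 0 \<or> l2 < 0"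
    have z0: "(of_int (i1 + 1) * of_int (l1 + 1)) *s F (i1 + 1) i2 i3 j1 j2 j3 k1 k2 k3 (l1 + 1) l2 l3 = 0"
      by (rule of_int_mult_zero, rule nonneg_supportedD[OF assms(2)], use neg in presburger)
    have z1: "(of_int (i2 + 1) * of_int (l2 + 1)) *s F i1 (i2 + 1) i3 j1 j2 j3 k1 k2 k3 l1 (l2 + 1) l3 = 0"
      by (rule of_int_mult_zero, rule nonneg_supportedD[OF assms(2)], use neg in presburger)
    have z2: "(of_int (i3 + 1) * of_int (l3 + 1)) *s F i1 i2 (i3 + 1) j1 j2 j3 k1 k2 k3 l1 l2 (l3 + 1) = 0"
      by (rule of_int_mult_zero, rule nonneg_supportedD[OF assms(2)], use neg in presburger)
    show "mult_bx F i1 i2 i3 j1 j2 j3 k1 k2 k3 l1 l2 l3 = 0"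
      unfolding mult_bx_def z0 z1 z2 by simp
  qed
  show "top_supported (mult_bx F)"
    unfolding top_supported_def
  proof (intro allI impI)
    fix i1 i2 i3 j1 j2 j3 k1 k2 k3 l1 l2 l3 :: int assume pos: "i2 > 0 \<or> i3 > 0 \<or> j1 > 0 \<or> j2 > 0"
    have z0: "top (F (i1 + 1) i2 i3 j1 j2 j3 k1 k2 k3 (l1 + 1) l2 l3) = 0" by (rule top_supportedD[OF assms(3)]) (use pos in linarith)
    have z1: "top (F i1 (i2 + 1) i3 j1 j2 j3 k1 k2 k3 l1 (l2 + 1) l3) = 0" by (rule top_supportedD[OF assms(3)]) (use pos in linarith)
    have z2: "top (F i1 i2 (i3 + 1) j1 j2 j3 k1 k2 k3 l1 l2 (l3 + 1)) = 0" by (rule top_supportedD[OF assms(3)]) (use pos in linarith)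
    show "top (mult_bx F i1 i2 i3 j1 j2 j3 k1 k2 k3 l1 l2 l3) = 0"
      unfolding mult_bx_def top_linear z0 z1 z2 by simp
  qed
  assume "weighted w1 w2 w3 F"
  then show "weighted w1 w2 w3 (mult_bx F)"
    unfolding weighted_def[of _ _ _ "mult_bx F"] mult_bx_def
    by (intro allI conjI; simp only: weightedD mult_simps) (simp_all add: vec_eq_iff algebra_simps)
qed

lemma mult_xy_props:
  assumes "equivariant F" "nonneg_supported F" "top_supported F"
  shows "equivariant (mult_xy F)" "nonneg_supported (mult_xy F)" "top_supported (mult_xy F)"
    "weighted w1 w2 w3 F \<Longrightarrow> weighted (w1 + 1) (w2 + 1) w3 (mult_xy F)"
proof -
  show "equivariant (mult_xy F)"
    unfolding equivariant_def mult_xy_def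
    by (intro allI conjI; simp only: equivariantD[OF assms(1)] mult_simps) (simp_all add: vec_eq_iff algebra_simps)
  show "nonneg_supported (mult_xy F)"
    unfolding nonneg_supported_def
  proof (intro allI impI)
    fix i1 i2 i3 j1 j2 j3 k1 k2 k3 l1 l2 l3 :: int assume neg: "i2 < 0 \<or> i3 < 0 \<or> j1 < 0 \<or> j2 < 0 \<or> k2 < 0 \<or> k3 < 0 \<or> l1 < 0 \<or> l2 < 0"
    have z0: "(of_int (i1 + 1) * of_int (k2 + 1)) *s F (i1 + 1) i2 i3 j1 j2 j3 k1 (k2 + 1) k3 l1 l2 l3 = 0"
      by (rule of_int_mult_zero, rule nonneg_supportedD[OF assms(2)], use neg in presburger)
    have z1: "(of_int (i2 + 1) * of_int (k1 + 1)) *s F i1 (i2 + 1) i3 j1 j2 j3 (k1 + 1) k2 k3 l1 l2 l3 = 0"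
      by (rule of_int_mult_zero, rule nonneg_supportedD[OF assms(2)], use neg in presburger)
    show "mult_xy F i1 i2 i3 j1 j2 j3 k1 k2 k3 l1 l2 l3 = 0"
      unfolding mult_xy_def z0 z1 by simp
  qed
  show "top_supported (mult_xy F)"
    unfolding top_supported_def
  proof (intro allI impI)
    fix i1 i2 i3 j1 j2 j3 k1 k2 k3 l1 l2 l3 :: int assume pos: "i2 > 0 \<or> i3 > 0 \<or> j1 > 0 \<or> j2 > 0"
    have z0: "top (F (i1 + 1) i2 i3 j1 j2 j3 k1 (k2 + 1) k3 l1 l2 l3) = 0" by (rule top_supportedD[OF assms(3)]) (use pos in linarith)
    have z1: "top (F i1 (i2 + 1) i3 j1 j2 j3 (k1 + 1) k2 k3 l1 l2 l3) = 0" by (rule top_supportedD[OF assms(3)]) (use pos in linarith)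
    show "top (mult_xy F i1 i2 i3 j1 j2 j3 k1 k2 k3 l1 l2 l3) = 0"
      unfolding mult_xy_def top_linear z0 z1 by simp
  qed
  assume "weighted w1 w2 w3 F"
  then show "weighted (w1 + 1) (w2 + 1) w3 (mult_xy F)"
    unfolding weighted_def[of _ _ _ "mult_xy F"] mult_xy_def
    by (intro allI conjI; simp only: weightedD mult_simps) (simp_all add: vec_eq_iff algebra_simps)
qed

lemma mult_ab_props:
  assumes "equivariant F" "nonneg_supported F" "top_supported F"
  shows "equivariant (mult_ab F)" "nonneg_supported (mult_ab F)" "top_supported (mult_ab F)"
    "weighted w1 w2 w3 F \<Longrightarrow> weighted w1 (w2 - 1) (w3 - 1) (mult_ab F)"
proof -
  show "equivariant (mult_ab F)"
    unfolding equivariant_def mult_ab_def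
    by (intro allI conjI; simp only: equivariantD[OF assms(1)] mult_simps) (simp_all add: vec_eq_iff algebra_simps)
  show "nonneg_supported (mult_ab F)"
    unfolding nonneg_supported_def
  proof (intro allI impI)
    fix i1 i2 i3 j1 j2 j3 k1 k2 k3 l1 l2 l3 :: int assume neg: "i2 < 0 \<or> i3 < 0 \<or> j1 < 0 \<or> j2 < 0 \<or> k2 < 0 \<or> k3 < 0 \<or> l1 < 0 \<or> l2 < 0"
    have z0: "(of_int (j3 + 1) * of_int (l2 + 1)) *s F i1 i2 i3 j1 j2 (j3 + 1) k1 k2 k3 l1 (l2 + 1) l3 = 0"
      by (rule of_int_mult_zero, rule nonneg_supportedD[OF assms(2)], use neg in presburger)
    have z1: "(of_int (j2 + 1) * of_int (l3 + 1)) *s F i1 i2 i3 j1 (j2 + 1) j3 k1 k2 k3 l1 l2 (l3 + 1) = 0"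
      by (rule of_int_mult_zero, rule nonneg_supportedD[OF assms(2)], use neg in presburger)
    show "mult_ab F i1 i2 i3 j1 j2 j3 k1 k2 k3 l1 l2 l3 = 0"
      unfolding mult_ab_def z0 z1 by simp
  qed
  show "top_supported (mult_ab F)"
    unfolding top_supported_def
  proof (intro allI impI)
    fix i1 i2 i3 j1 j2 j3 k1 k2 k3 l1 l2 l3 :: int assume pos: "i2 > 0 \<or> i3 > 0 \<or> j1 > 0 \<or> j2 > 0"
    have z0: "top (F i1 i2 i3 j1 j2 (j3 + 1) k1 k2 k3 l1 (l2 + 1) l3) = 0" by (rule top_supportedD[OF assms(3)]) (use pos in linarith)
    have z1: "top (F i1 i2 i3 j1 (j2 + 1) j3 k1 k2 k3 l1 l2 (l3 + 1)) = 0" by (rule top_supportedD[OF assms(3)]) (use pos in linarith)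
    show "top (mult_ab F i1 i2 i3 j1 j2 j3 k1 k2 k3 l1 l2 l3) = 0"
      unfolding mult_ab_def top_linear z0 z1 by simp
  qed
  assume "weighted w1 w2 w3 F"
  then show "weighted w1 (w2 - 1) (w3 - 1) (mult_ab F)"
    unfolding weighted_def[of _ _ _ "mult_ab F"] mult_ab_def
    by (intro allI conjI; simp only: weightedD mult_simps) (simp_all add: vec_eq_iff algebra_simps)
qed

text \<open>Multiplication acts on the components with \<open>x\<^sub>2 = x\<^sub>3 = \<alpha>\<^sub>1 = \<alpha>\<^sub>2 = 0\<close>, which are those seen by \<open>top\<close>,
  by a single shift.\<close>

definition lifts :: "(complex^('n \<times> 'm)) family2 \<Rightarrow> int \<Rightarrow> int \<Rightarrow> int \<Rightarrow> int \<Rightarrow> int \<Rightarrow> int \<Rightarrow> bool" where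
  "lifts F di dj dk2 dk3 dl1 dl2 \<longleftrightarrow> (\<forall>i1\<ge>0. \<forall>j3\<ge>0. \<forall>k1\<ge>0. \<forall>k2\<ge>0. \<forall>k3\<ge>0. \<forall>l1\<ge>0. \<forall>l2\<ge>0. \<forall>l3\<ge>0.
     \<exists>c::complex. c \<noteq> 0 \<and> top (F i1 0 0 0 0 j3 k1 k2 k3 l1 l2 l3) =
       c *s top (mono2 (i1 + di) 0 0 0 0 (j3 + dj) k1 (k2 + dk2) (k3 + dk3) (l1 + dl1) (l2 + dl2) l3))"

lemma lifts_mono2: "lifts mono2 0 0 0 0 0 0"
  unfolding lifts_def by (auto intro!: exI[of _ 1])

text \<open>Of the terms of \<alpha>.y only \<alpha>_3 y_3 is visible to \<open>top\<close>, because
  the others have a positive exponent of \<alpha>_1 or \<alpha>_2. The next three lemmas single out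
  \<beta>_1 x_1, x_1 y_2 and \<alpha>_3 \<beta>_2 in the same way.\<close>

lemma lifts_mult_ay:
  assumes F: "lifts F di dj dk2 dk3 dl1 dl2" and P: "top_supported F"
  shows "lifts (mult_ay F) di (dj + 1) dk2 (dk3 + 1) dl1 dl2"
  unfolding lifts_def
proof (intro allI impI)
  fix i1 j3 k1 k2 k3 l1 l2 l3 :: int
  assume nn: "i1 \<ge> 0" "j3 \<ge> 0" "k1 \<ge> 0" "k2 \<ge> 0" "k3 \<ge> 0" "l1 \<ge> 0" "l2 \<ge> 0" "l3 \<ge> 0"
  have 1: "top (mult_ay F i1 0 0 0 0 j3 k1 k2 k3 l1 l2 l3) = (of_int (j3 + 1) * of_int (k3 + 1)) *s top (F i1 0 0 0 0 (j3 + 1) k1 k2 (k3 + 1) l1 l2 l3)"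
    by (simp add: mult_ay_def top_linear top_supportedD[OF P])
  obtain c where c: "c \<noteq> 0" "top (F i1 0 0 0 0 (j3 + 1) k1 k2 (k3 + 1) l1 l2 l3) = c *s top (mono2 (i1 + di) 0 0 0 0 ((j3 + 1) + dj) k1 (k2 + dk2) ((k3 + 1) + dk3) (l1 + dl1) (l2 + dl2) l3)"
    using F nn unfolding lifts_def by (metis add_nonneg_nonneg zero_le_one)
  have "of_int (j3 + 1) * of_int (k3 + 1) \<noteq> (0::complex)"
    unfolding of_int_mult[symmetric] of_int_eq_0_iff using nn by simp
  then show "\<exists>c. c \<noteq> 0 \<and> top (mult_ay F i1 0 0 0 0 j3 k1 k2 k3 l1 l2 l3) = c *s top (mono2 (i1 + di) 0 0 0 0 (j3 + (dj + 1)) k1 (k2 + dk2) (k3 + (dk3 + 1)) (l1 + dl1) (l2 + dl2) l3)"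
    using c unfolding 1 by (intro exI[of _ "of_int (j3 + 1) * of_int (k3 + 1) * c"]) (simp add: vector_smult_assoc ac_simps)
qed

lemma lifts_mult_bx:
  assumes F: "lifts F di dj dk2 dk3 dl1 dl2" and P: "top_supported F"
  shows "lifts (mult_bx F) (di + 1) dj dk2 dk3 (dl1 + 1) dl2"
  unfolding lifts_def
proof (intro allI impI)
  fix i1 j3 k1 k2 k3 l1 l2 l3 :: int
  assume nn: "i1 \<ge> 0" "j3 \<ge> 0" "k1 \<ge> 0" "k2 \<ge> 0" "k3 \<ge> 0" "l1 \<ge> 0" "l2 \<ge> 0" "l3 \<ge> 0"
  have 1: "top (mult_bx F i1 0 0 0 0 j3 k1 k2 k3 l1 l2 l3) = (of_int (i1 + 1) * of_int (l1 + 1)) *s top (F (i1 + 1) 0 0 0 0 j3 k1 k2 k3 (l1 + 1) l2 l3)"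
    by (simp add: mult_bx_def top_linear top_supportedD[OF P])
  obtain c where c: "c \<noteq> 0" "top (F (i1 + 1) 0 0 0 0 j3 k1 k2 k3 (l1 + 1) l2 l3) = c *s top (mono2 ((i1 + 1) + di) 0 0 0 0 (j3 + dj) k1 (k2 + dk2) (k3 + dk3) ((l1 + 1) + dl1) (l2 + dl2) l3)"
    using F nn unfolding lifts_def by (metis add_nonneg_nonneg zero_le_one)
  have "of_int (i1 + 1) * of_int (l1 + 1) \<noteq> (0::complex)"
    unfolding of_int_mult[symmetric] of_int_eq_0_iff using nn by simp
  then show "\<exists>c. c \<noteq> 0 \<and> top (mult_bx F i1 0 0 0 0 j3 k1 k2 k3 l1 l2 l3) = c *s top (mono2 (i1 + (di + 1)) 0 0 0 0 (j3 + dj) k1 (k2 + dk2) (k3 + dk3) (l1 + (dl1 + 1)) (l2 + dl2) l3)"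
    using c unfolding 1 by (intro exI[of _ "of_int (i1 + 1) * of_int (l1 + 1) * c"]) (simp add: vector_smult_assoc ac_simps)
qed

lemma lifts_mult_xy:
  assumes F: "lifts F di dj dk2 dk3 dl1 dl2" and P: "top_supported F"
  shows "lifts (mult_xy F) (di + 1) dj (dk2 + 1) dk3 dl1 dl2"
  unfolding lifts_def
proof (intro allI impI)
  fix i1 j3 k1 k2 k3 l1 l2 l3 :: int
  assume nn: "i1 \<ge> 0" "j3 \<ge> 0" "k1 \<ge> 0" "k2 \<ge> 0" "k3 \<ge> 0" "l1 \<ge> 0" "l2 \<ge> 0" "l3 \<ge> 0"
  have 1: "top (mult_xy F i1 0 0 0 0 j3 k1 k2 k3 l1 l2 l3) = (of_int (i1 + 1) * of_int (k2 + 1)) *s top (F (i1 + 1) 0 0 0 0 j3 k1 (k2 + 1) k3 l1 l2 l3)"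
    by (simp add: mult_xy_def top_linear top_supportedD[OF P])
  obtain c where c: "c \<noteq> 0" "top (F (i1 + 1) 0 0 0 0 j3 k1 (k2 + 1) k3 l1 l2 l3) = c *s top (mono2 ((i1 + 1) + di) 0 0 0 0 (j3 + dj) k1 ((k2 + 1) + dk2) (k3 + dk3) (l1 + dl1) (l2 + dl2) l3)"
    using F nn unfolding lifts_def by (metis add_nonneg_nonneg zero_le_one)
  have "of_int (i1 + 1) * of_int (k2 + 1) \<noteq> (0::complex)"
    unfolding of_int_mult[symmetric] of_int_eq_0_iff using nn by simp
  then show "\<exists>c. c \<noteq> 0 \<and> top (mult_xy F i1 0 0 0 0 j3 k1 k2 k3 l1 l2 l3) = c *s top (mono2 (i1 + (di + 1)) 0 0 0 0 (j3 + dj) k1 (k2 + (dk2 + 1)) (k3 + dk3) (l1 + dl1) (l2 + dl2) l3)"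
    using c unfolding 1 by (intro exI[of _ "of_int (i1 + 1) * of_int (k2 + 1) * c"]) (simp add: vector_smult_assoc ac_simps)
qed

lemma lifts_mult_ab:
  assumes F: "lifts F di dj dk2 dk3 dl1 dl2" and P: "top_supported F"
  shows "lifts (mult_ab F) di (dj + 1) dk2 dk3 dl1 (dl2 + 1)"
  unfolding lifts_def
proof (intro allI impI)
  fix i1 j3 k1 k2 k3 l1 l2 l3 :: int
  assume nn: "i1 \<ge> 0" "j3 \<ge> 0" "k1 \<ge> 0" "k2 \<ge> 0" "k3 \<ge> 0" "l1 \<ge> 0" "l2 \<ge> 0" "l3 \<ge> 0"
  have 1: "top (mult_ab F i1 0 0 0 0 j3 k1 k2 k3 l1 l2 l3) = (of_int (j3 + 1) * of_int (l2 + 1)) *s top (F i1 0 0 0 0 (j3 + 1) k1 k2 k3 l1 (l2 + 1) l3)"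
    by (simp add: mult_ab_def top_linear top_supportedD[OF P])
  obtain c where c: "c \<noteq> 0" "top (F i1 0 0 0 0 (j3 + 1) k1 k2 k3 l1 (l2 + 1) l3) = c *s top (mono2 (i1 + di) 0 0 0 0 ((j3 + 1) + dj) k1 (k2 + dk2) (k3 + dk3) (l1 + dl1) ((l2 + 1) + dl2) l3)"
    using F nn unfolding lifts_def by (metis add_nonneg_nonneg zero_le_one)
  have "of_int (j3 + 1) * of_int (l2 + 1) \<noteq> (0::complex)"
    unfolding of_int_mult[symmetric] of_int_eq_0_iff using nn by simp
  then show "\<exists>c. c \<noteq> 0 \<and> top (mult_ab F i1 0 0 0 0 j3 k1 k2 k3 l1 l2 l3) = c *s top (mono2 (i1 + di) 0 0 0 0 (j3 + (dj + 1)) k1 (k2 + dk2) (k3 + dk3) (l1 + dl1) (l2 + (dl2 + 1)) l3)"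
    using c unfolding 1 by (intro exI[of _ "of_int (j3 + 1) * of_int (l2 + 1) * c"]) (simp add: vector_smult_assoc ac_simps)
qed

end

lemma span_image_combination:
  assumes "finite T" "w \<in> vec.span (C ` T)"
  shows "\<exists>c. w = (\<Sum>t\<in>T. c t *s (C t :: complex^'k))"
  using assms(2)
proof (induction rule: vec.span_induct_alt)
  case base
  show ?case by (intro exI[of _ "\<lambda>_. 0"]) simp
next
  case (step k x y)
  then obtain t c where t: "t \<in> T" "x = C t" and c: "y = (\<Sum>t\<in>T. c t *s C t)" by blast
  have "(\<Sum>s\<in>T. (c s + (if s = t then k else 0)) *s C s) = (\<Sum>s\<in>T. c s *s C s) + (\<Sum>s\<in>T. (if s = t then k *s C s else 0))"
    unfolding sum.distrib[symmetric] by (intro sum.cong) (auto simp: vec.scale_left_distrib)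
  also have "\<dots> = k *s x + y" using t c assms(1) by (simp add: sum.delta' add.commute)
  finally show ?case by metis
qed

context hw_pair
begin

text \<open>The member is the product of the accumulated invariants with powers of x_1, \<alpha>_3,
  y_1 and \<beta>_3, variables which raising generators kill.\<close>

lemma lifted_vector:
  assumes F: "equivariant F" "nonneg_supported F" "weighted w1 w2 w3 F"
  shows "\<tau> 1 2 *v F i1 0 0 0 0 j3 k1 0 0 0 0 l3 = 0" "\<tau> 2 3 *v F i1 0 0 0 0 j3 k1 0 0 0 0 l3 = 0"
    "\<tau> 1 3 *v F i1 0 0 0 0 j3 k1 0 0 0 0 l3 = 0"
    "\<tau> 1 1 *v F i1 0 0 0 0 j3 k1 0 0 0 0 l3 = (of_int (i1 + k1 + w1) - (V.shift + W.shift)) *s F i1 0 0 0 0 j3 k1 0 0 0 0 l3"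
    "\<tau> 2 2 *v F i1 0 0 0 0 j3 k1 0 0 0 0 l3 = (of_int w2 - (V.shift + W.shift)) *s F i1 0 0 0 0 j3 k1 0 0 0 0 l3"
    "\<tau> 3 3 *v F i1 0 0 0 0 j3 k1 0 0 0 0 l3 = (of_int (- j3 - l3 + w3) - (V.shift + W.shift)) *s F i1 0 0 0 0 j3 k1 0 0 0 0 l3"
proof -
  have N: "F i1 i2 i3 j1 j2 j3 k1 k2 k3 l1 l2 l3 = 0"
    if "i2 < 0 \<or> i3 < 0 \<or> j1 < 0 \<or> j2 < 0 \<or> k2 < 0 \<or> k3 < 0 \<or> l1 < 0 \<or> l2 < 0" for i1 i2 i3 j1 j2 j3 k1 k2 k3 l1 l2 l3
    using F(2) that unfolding nonneg_supported_def by blast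
  let ?u = "F i1 0 0 0 0 j3 k1 0 0 0 0 l3"
  show 12: "\<tau> 1 2 *v ?u = 0"
    using F(1) unfolding equivariant_def by (simp add: N del: One_nat_def)
  show 23: "\<tau> 2 3 *v ?u = 0"
    using F(1) unfolding equivariant_def by (simp add: N del: One_nat_def)
  have "\<tau> 1 2 *v (\<tau> 2 3 *v ?u) = \<tau> 2 3 *v (\<tau> 1 2 *v ?u) + \<tau> 1 3 *v ?u"
    using sl3_rep_commute[OF rep12, of 1 2 2 3 ?u] by simp
  then show "\<tau> 1 3 *v ?u = 0" unfolding 12 23 by simp
  have W: "\<tau> 1 1 *v ?u = (of_int (i1 - 0 + k1 - 0 + w1) - (V.shift + W.shift)) *s ?u"
    "\<tau> 2 2 *v ?u = (of_int (0 - 0 + 0 - 0 + w2) - (V.shift + W.shift)) *s ?u"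
    "\<tau> 3 3 *v ?u = (of_int (0 - j3 + 0 - l3 + w3) - (V.shift + W.shift)) *s ?u"
    using F(3) unfolding weighted_def by blast+
  then show "\<tau> 1 1 *v ?u = (of_int (i1 + k1 + w1) - (V.shift + W.shift)) *s ?u"
    "\<tau> 2 2 *v ?u = (of_int w2 - (V.shift + W.shift)) *s ?u"
    "\<tau> 3 3 *v ?u = (of_int (- j3 - l3 + w3) - (V.shift + W.shift)) *s ?u"
    by (simp_all del: One_nat_def)
qed

lemma hwv_tauI:
  assumes "\<tau> 1 2 *v u = 0" "\<tau> 2 3 *v u = 0" "\<tau> 1 3 *v u = 0"
    "\<tau> 1 1 *v u = hwt \<alpha> \<beta> 1 *s u" "\<tau> 2 2 *v u = hwt \<alpha> \<beta> 2 *s u" "\<tau> 3 3 *v u = hwt \<alpha> \<beta> 3 *s u"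
  shows "hwv \<tau> \<alpha> \<beta> u"
  unfolding hwv_def
proof (intro conjI ballI impI)
  fix p :: nat assume "p \<in> {1..3}"
  then show "\<tau> p p *v u = hwt \<alpha> \<beta> p *s u"
    unfolding range3 using assms by (elim disjE) (simp_all only:)
  fix q :: nat assume "q \<in> {1..3}" "p < q"
  then have "(p, q) = (1, 2) \<or> (p, q) = (2, 3) \<or> (p, q) = (1, 3)"
    using \<open>p \<in> {1..3}\<close> by auto
  then show "\<tau> p q *v u = 0" using assms by (elim disjE) (simp_all only: prod.inject)
qed

definition admissible :: "int \<Rightarrow> int \<Rightarrow> int \<Rightarrow> (complex^('n \<times> 'm)) family2 \<Rightarrow> bool" where
  "admissible w1 w2 w3 F \<longleftrightarrow> equivariant F \<and> nonneg_supported F \<and> top_supported F \<and> weighted w1 w2 w3 F"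

lemma admissible_mult:
  assumes "admissible w1 w2 w3 F"
  shows "admissible w1 w2 w3 (mult_ay F)" "admissible w1 w2 w3 (mult_bx F)"
    "admissible (w1 + 1) (w2 + 1) w3 (mult_xy F)" "admissible w1 (w2 - 1) (w3 - 1) (mult_ab F)"
proof -
  have F: "equivariant F" "nonneg_supported F" "top_supported F" "weighted w1 w2 w3 F"
    using assms unfolding admissible_def by simp_all
  show "admissible w1 w2 w3 (mult_ay F)" unfolding admissible_def by (intro conjI mult_ay_props F)
  show "admissible w1 w2 w3 (mult_bx F)" unfolding admissible_def by (intro conjI mult_bx_props F)
  show "admissible (w1 + 1) (w2 + 1) w3 (mult_xy F)" unfolding admissible_def by (intro conjI mult_xy_props F)
  show "admissible w1 (w2 - 1) (w3 - 1) (mult_ab F)" unfolding admissible_def by (intro conjI mult_ab_props F)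
qed

lemma admissible_top_supported: "admissible w1 w2 w3 F \<Longrightarrow> top_supported F"
  unfolding admissible_def by simp

lemma admissible_powers:
  assumes "admissible w1 w2 w3 F"
  shows "admissible w1 w2 w3 ((mult_ay ^^ n) F)" "admissible w1 w2 w3 ((mult_bx ^^ n) F)"
    "admissible (w1 + int n) (w2 + int n) w3 ((mult_xy ^^ n) F)" "admissible w1 (w2 - int n) (w3 - int n) ((mult_ab ^^ n) F)"
proof -
  have S: "w + int (Suc n) = w + int n + 1" "w - int (Suc n) = w - int n - 1" for w n by simp_all
  show "admissible w1 w2 w3 ((mult_ay ^^ n) F)"
    by (induction n) (simp_all only: funpow.simps id_apply o_apply assms admissible_mult)
  show "admissible w1 w2 w3 ((mult_bx ^^ n) F)"
    by (induction n) (simp_all only: funpow.simps id_apply o_apply assms admissible_mult)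
  show "admissible (w1 + int n) (w2 + int n) w3 ((mult_xy ^^ n) F)"
    by (induction n) (simp_all only: funpow.simps id_apply o_apply assms admissible_mult S of_nat_0 add_0_right)
  show "admissible w1 (w2 - int n) (w3 - int n) ((mult_ab ^^ n) F)"
    by (induction n) (simp_all only: funpow.simps id_apply o_apply assms admissible_mult S of_nat_0 diff_0_right)
qed

lemma lifts_powers:
  assumes F: "admissible w1 w2 w3 F" "lifts F di dj dk2 dk3 dl1 dl2"
  shows "lifts ((mult_bx ^^ n) F) (di + int n) dj dk2 dk3 (dl1 + int n) dl2"
    "lifts ((mult_ay ^^ n) F) di (dj + int n) dk2 (dk3 + int n) dl1 dl2"
    "lifts ((mult_xy ^^ n) F) (di + int n) dj (dk2 + int n) dk3 dl1 dl2"
    "lifts ((mult_ab ^^ n) F) di (dj + int n) dk2 dk3 dl1 (dl2 + int n)"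
proof -
  have S: "w + int (Suc n) = w + int n + 1" for w n by simp
  note T = admissible_powers[OF F(1), THEN admissible_top_supported]
  show "lifts ((mult_bx ^^ n) F) (di + int n) dj dk2 dk3 (dl1 + int n) dl2"
    by (induction n) (simp_all only: funpow.simps id_apply o_apply F(2) lifts_mult_bx T S of_nat_0 add_0_right)
  show "lifts ((mult_ay ^^ n) F) di (dj + int n) dk2 (dk3 + int n) dl1 dl2"
    by (induction n) (simp_all only: funpow.simps id_apply o_apply F(2) lifts_mult_ay T S of_nat_0 add_0_right)
  show "lifts ((mult_xy ^^ n) F) (di + int n) dj (dk2 + int n) dk3 dl1 dl2"
    by (induction n) (simp_all only: funpow.simps id_apply o_apply F(2) lifts_mult_xy T S of_nat_0 add_0_right)
  show "lifts ((mult_ab ^^ n) F) di (dj + int n) dk2 dk3 dl1 (dl2 + int n)"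
    by (induction n) (simp_all only: funpow.simps id_apply o_apply F(2) lifts_mult_ab T S of_nat_0 add_0_right)
qed

lemma admissible_mono2: "admissible 0 0 0 mono2"
  unfolding admissible_def by (intro conjI mono2_props)

text \<open>Up to a scalar, the vector is x_1^X \<alpha>_3^A y_1^k1 \<beta>_3^l3 (\<alpha>.y)^k3
  (\<beta>.x)^l1 times the invariants already in \<open>F\<close>. Under \<open>top\<close>,
  \<alpha>.y contributes y_3 and \<beta>.x contributes \<beta>_1, which gives the required
  monomial.\<close>

lemma invariant_lift:
  assumes F: "admissible w1 w2 w3 F" "lifts F di dj dk2 0 0 dl2"
    and nn: "X \<ge> 0" "A \<ge> 0" "k1 \<ge> 0" "k3 \<ge> 0" "l1 \<ge> 0" "l3 \<ge> 0"
    and deg: "int a = X + di + l1" "int b = A + dj + k3"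
    and wt: "hwt \<alpha> \<beta> 1 = of_int (X + k1 + w1) - (V.shift + W.shift)" "hwt \<alpha> \<beta> 2 = of_int w2 - (V.shift + W.shift)"
      "hwt \<alpha> \<beta> 3 = of_int (- A - l3 + w3) - (V.shift + W.shift)"
  shows "\<exists>u. hwv \<tau> \<alpha> \<beta> u \<and> top u = W.B k1 dk2 k3 l1 dl2 l3"
proof -
  define G where "G = (mult_ay ^^ nat k3) ((mult_bx ^^ nat l1) F)"
  have F1: "admissible w1 w2 w3 ((mult_bx ^^ nat l1) F)" by (rule admissible_powers(2)[OF F(1)])
  have G: "admissible w1 w2 w3 G" unfolding G_def by (rule admissible_powers(1)[OF F1])
  have "lifts G (di + int (nat l1)) (dj + int (nat k3)) dk2 (0 + int (nat k3)) (0 + int (nat l1)) dl2"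
    unfolding G_def by (rule lifts_powers(2)[OF F1 lifts_powers(1)[OF F]])
  then have L: "lifts G (di + l1) (dj + k3) dk2 k3 l1 dl2" using nn by simp
  let ?u = "G X 0 0 0 0 A k1 0 0 0 0 l3"
  have "\<exists>c::complex. c \<noteq> 0 \<and> top ?u = c *s top (mono2 (X + (di + l1)) 0 0 0 0 (A + (dj + k3)) k1 (0 + dk2) (0 + k3) (0 + l1) (0 + dl2) l3)"
    using L[unfolded lifts_def, rule_format, of X A k1 0 0 0 0 l3] nn by simp
  then obtain c :: complex where c: "c \<noteq> 0" "top ?u = c *s top (mono2 (X + (di + l1)) 0 0 0 0 (A + (dj + k3)) k1 (0 + dk2) (0 + k3) (0 + l1) (0 + dl2) l3)"
    by blast
  have ab: "X + (di + l1) = int a" "A + (dj + k3) = int b" using deg by auto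
  have t: "top ?u = c *s W.B k1 dk2 k3 l1 dl2 l3"
    unfolding c(2) mono2_def top_tens V.xi_B ab by (simp add: top_family_def)
  have G': "equivariant G" "nonneg_supported G" "weighted w1 w2 w3 G" using G unfolding admissible_def by simp_all
  have "hwv \<tau> \<alpha> \<beta> ?u"
    using lifted_vector[OF G', of X A k1 l3] by (intro hwv_tauI) (simp_all only: wt)
  then have "hwv \<tau> \<alpha> \<beta> ((1 / c) *s ?u)" by (rule hwv_smult)
  moreover have "top ((1 / c) *s ?u) = W.B k1 dk2 k3 l1 dl2 l3"
    unfolding top_linear t using c(1) by (simp add: vector_smult_assoc)
  ultimately show ?thesis by blast
qed

section \<open>The chain of highest-weight vectors\<close>

text \<open>The injective map \<open>top\<close> identifies the multiplicity space with the span of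
  the \<open>C t\<close>, so that a basis of the one is lifted to the other.\<close>

lemma chain_basis:
  fixes C :: "int \<Rightarrow> complex^'m" and g :: "int \<Rightarrow> complex"
  assumes span: "\<And>u. hwv \<tau> \<alpha> \<beta> u \<Longrightarrow> \<exists>c. top u = (\<Sum>t\<in>{lo+1..hi}. c t *s C t)"
    and indep: "\<And>c t. (\<Sum>t\<in>{lo+1..hi}. c t *s C t) = 0 \<Longrightarrow> t \<in> {lo+1..hi} \<Longrightarrow> c t = 0"
    and lift: "\<And>t. t \<in> {lo+1..hi} \<Longrightarrow> \<exists>u. hwv \<tau> \<alpha> \<beta> u \<and> top u = C t"
    and g: "\<And>t. t \<in> {lo+1..hi} \<Longrightarrow> g t \<noteq> 0"
  obtains e where "basis_of {u. hwv \<tau> \<alpha> \<beta> u} (nat (hi - lo)) e"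
    "\<And>j. j \<in> {1..nat (hi - lo)} \<Longrightarrow> hwv \<tau> \<alpha> \<beta> (e j) \<and> top (e j) = g (lo + int j) *s C (lo + int j)"
proof -
  let ?d = "nat (hi - lo)"
  have "\<exists>u. hwv \<tau> \<alpha> \<beta> u \<and> top u = g (lo + int j) *s C (lo + int j)" if "j \<in> {1..?d}" for j
  proof -
    have "lo + int j \<in> {lo+1..hi}" using that by auto
    then obtain u where "hwv \<tau> \<alpha> \<beta> u" "top u = C (lo + int j)" using lift by blast
    then show ?thesis by (intro exI[of _ "g (lo + int j) *s u"]) (simp add: hwv_smult top_linear)
  qed
  then obtain e where e: "\<And>j. j \<in> {1..?d} \<Longrightarrow> hwv \<tau> \<alpha> \<beta> (e j) \<and> top (e j) = g (lo + int j) *s C (lo + int j)"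
    by metis
  have reindex: "(\<Sum>j\<in>{1..?d}. f (lo + int j)) = (\<Sum>t\<in>{lo+1..hi}. f t)" for f :: "int \<Rightarrow> complex^'m"
    by (rule sum.reindex_bij_witness[of _ "\<lambda>t. nat (t - lo)" "\<lambda>j. lo + int j"]) auto
  have ind: "c j = 0" if "(\<Sum>j\<in>{1..?d}. c j *s e j) = 0" "j \<in> {1..?d}" for c j
  proof -
    have "0 = (\<Sum>j\<in>{1..?d}. c j *s top (e j))"
      unfolding top_linear(3)[symmetric] top_sum[symmetric] that(1) by (simp add: top_linear)
    also have "\<dots> = (\<Sum>j\<in>{1..?d}. (c (nat (lo + int j - lo)) * g (lo + int j)) *s C (lo + int j))"
      using e by (intro sum.cong) (auto simp: vector_smult_assoc)
    also have "\<dots> = (\<Sum>t\<in>{lo+1..hi}. (c (nat (t - lo)) * g t) *s C t)"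
      by (rule reindex)
    finally have "c (nat (lo + int j - lo)) * g (lo + int j) = 0"
      using that(2) by (intro indep[of "\<lambda>t. c (nat (t - lo)) * g t"]) auto
    moreover have "lo + int j \<in> {lo+1..hi}" using that(2) by auto
    ultimately show ?thesis using g[of "lo + int j"] by simp
  qed
  have "basis_of {u. hwv \<tau> \<alpha> \<beta> u} ?d e"
    unfolding basis_of_def
  proof (intro conjI)
    show inj: "inj_on e {1..?d}"
    proof (rule inj_onI, rule ccontr)
      fix i j assume ij: "i \<in> {1..?d}" "j \<in> {1..?d}" "e i = e j" "i \<noteq> j"
      let ?c = "\<lambda>k. (if k = i then 1 else 0 :: complex) + (if k = j then - 1 else 0)"
      have "(\<Sum>k\<in>{1..?d}. ?c k *s e k) = (\<Sum>k\<in>{1..?d}. if k = i then e k else 0) + (\<Sum>k\<in>{1..?d}. if k = j then - e k else 0)"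
        unfolding sum.distrib[symmetric] using ij(4) by (intro sum.cong) auto
      also have "\<dots> = 0" using ij by (simp add: sum.delta)
      finally have "?c i = 0" using ind[of ?c i] ij(1) by blast
      then show False using ij(4) by simp
    qed
    show "vec.independent (e ` {1..?d})"
    proof (rule vec.independent_if_scalars_zero)
      fix f x assume f: "(\<Sum>x\<in>e ` {1..?d}. f x *s x) = 0" and x: "x \<in> e ` {1..?d}"
      have "(\<Sum>j\<in>{1..?d}. f (e j) *s e j) = 0" using f unfolding sum.reindex[OF inj] o_def .
      then show "f x = 0" using ind[of "\<lambda>j. f (e j)"] x by auto
    qed simp
    show "vec.span (e ` {1..?d}) = {u. hwv \<tau> \<alpha> \<beta> u}"
    proof
      have "vec.subspace {u. hwv \<tau> \<alpha> \<beta> u}"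
        unfolding vec.subspace_def using hwv_add hwv_smult hwv_zero by blast
      then show "vec.span (e ` {1..?d}) \<subseteq> {u. hwv \<tau> \<alpha> \<beta> u}" using e by (intro vec.span_minimal) auto
      show "{u. hwv \<tau> \<alpha> \<beta> u} \<subseteq> vec.span (e ` {1..?d})"
      proof clarify
        fix u assume u: "hwv \<tau> \<alpha> \<beta> u"
        obtain c where c: "top u = (\<Sum>t\<in>{lo+1..hi}. c t *s C t)" using span[OF u] by blast
        define w where "w = (\<Sum>j\<in>{1..?d}. (c (lo + int j) / g (lo + int j)) *s e j)"
        have w: "w \<in> vec.span (e ` {1..?d})"
          unfolding w_def by (intro vec.span_sum vec.span_scale vec.span_base) auto
        have hw: "hwv \<tau> \<alpha> \<beta> w"
          using w \<open>vec.span (e ` {1..?d}) \<subseteq> _\<close> by blast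
        have "top w = (\<Sum>j\<in>{1..?d}. c (lo + int j) *s C (lo + int j))"
          unfolding w_def top_sum top_linear
        proof (intro sum.cong refl)
          fix j assume j: "j \<in> {1..?d}"
          then have "lo + int j \<in> {lo+1..hi}" by auto
          then have "g (lo + int j) \<noteq> 0" by (rule g)
          then show "(c (lo + int j) / g (lo + int j)) *s top (e j) = c (lo + int j) *s C (lo + int j)"
            using e[OF j] by (simp add: vector_smult_assoc)
        qed
        then have "top (u - w) = 0" unfolding top_linear c reindex[of "\<lambda>t. c t *s C t"] by simp
        then have "u - w = 0" using hwv_diff[OF u hw] by (rule top_injective[rotated])
        then show "u \<in> vec.span (e ` {1..?d})" using w by simp
      qed
    qed
  qed
  then show ?thesis using that e by blast
qed

text \<open>Both sides are highest-weight vectors, so they may be compared under \<open>top\<close>.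
  \<open>first\<close> and \<open>last\<close> remove the two terms that would leave the range of
  the chain.\<close>

lemma chain_acts:
  fixes C :: "int \<Rightarrow> complex^'m" and g :: "int \<Rightarrow> complex" and c :: "nat \<Rightarrow> nat \<Rightarrow> real"
  assumes e: "\<And>j. j \<in> {1..d} \<Longrightarrow> hwv \<tau> \<alpha> \<beta> (e j) \<and> top (e j) = g (lo + int j) *s C (lo + int j)"
    and comm: "commutes_with Op \<tau>"
    and act: "\<And>j. j \<in> {1..d} \<Longrightarrow> top (Op *v e j) = g (lo + int j) *s
        (up (lo + int j) *s C (lo + int j - 1) + mid (lo + int j) *s C (lo + int j) + dn (lo + int j) *s C (lo + int j + 1))"
    and first: "up (lo + 1) *s C lo = 0" and last: "dn (lo + int d) *s C (lo + int d + 1) = 0"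
    and diag: "\<And>j. j \<in> {1..d} \<Longrightarrow> mid (lo + int j) = complex_of_real (c j j)"
    and upper: "\<And>j. j \<in> {1..<d} \<Longrightarrow> g (lo + int j + 1) * up (lo + int j + 1) = complex_of_real (c j (j + 1)) * g (lo + int j)"
    and lower: "\<And>j. j \<in> {1..<d} \<Longrightarrow> g (lo + int j) * dn (lo + int j) = complex_of_real (c (j + 1) j) * g (lo + int j + 1)"
    and zero: "\<And>i j. i + 1 < j \<or> j + 1 < i \<Longrightarrow> c i j = 0"
  shows "acts_by Op d e c"
  unfolding acts_by_def
proof
  fix j assume j: "j \<in> {1..d}"
  let ?s = "\<Sum>i\<in>{1..d}. complex_of_real (c i j) *s e i"
  let ?t = "\<lambda>i. lo + int i"
  let ?f = "\<lambda>i. (complex_of_real (c i j) * g (?t i)) *s C (?t i)"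
  have hw: "hwv \<tau> \<alpha> \<beta> (\<Sum>i\<in>I. complex_of_real (c i j) *s e i)" if "I \<subseteq> {1..d}" for I
    using finite_subset[OF that finite_atLeastAtMost] that
  proof (induction I rule: finite_induct)
    case (insert x I)
    then show ?case using e[of x] by (simp add: hwv_add hwv_smult del: atLeastAtMost_iff)
  qed (simp add: hwv_zero)
  have "top ?s = (\<Sum>i\<in>{1..d}. ?f i)"
    unfolding top_sum top_linear using e by (intro sum.cong) (auto simp: vector_smult_assoc)
  also have "\<dots> = (\<Sum>i\<in>{1..d}. (if i = j then ?f j else 0) + (if i + 1 = j then ?f (j - 1) else 0) + (if i = j + 1 then ?f (j + 1) else 0))"
  proof (intro sum.cong refl)
    fix i show "?f i = (if i = j then ?f j else 0) + (if i + 1 = j then ?f (j - 1) else 0) + (if i = j + 1 then ?f (j + 1) else 0)"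
    proof -
      consider "i = j" | "i + 1 = j" | "i = j + 1" | "i + 1 < j \<or> j + 1 < i" by linarith
      then show ?thesis by cases (auto simp: zero)
    qed
  qed
  also have "\<dots> = ?f j + (\<Sum>i\<in>{1..d}. if i + 1 = j then ?f (j - 1) else 0) + (\<Sum>i\<in>{1..d}. if i = j + 1 then ?f (j + 1) else 0)"
    using j by (simp add: sum.distrib)
  also have "(\<Sum>i\<in>{1..d}. if i + 1 = j then ?f (j - 1) else 0) = (g (?t j) * up (?t j)) *s C (?t j - 1)"
  proof (cases "j = 1")
    case True
    then have "(\<Sum>i\<in>{1..d}. if i + 1 = j then ?f (j - 1) else 0) = 0" by (intro sum.neutral) auto
    then show ?thesis using first True by (simp add: vec.scale_eq_0_iff)
  next
    case False
    then obtain i where i: "j = i + 1" "i \<in> {1..d}" "i \<in> {1..<d}" using j by (cases j) auto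
    have "(\<Sum>k\<in>{1..d}. if k + 1 = j then ?f (j - 1) else 0) = ?f i"
      unfolding i(1) using i(2) by simp
    also have "\<dots> = (g (?t j) * up (?t j)) *s C (?t j - 1)"
      unfolding i(1) using upper[OF i(3)] by (simp add: ac_simps)
    finally show ?thesis .
  qed
  also have "(\<Sum>i\<in>{1..d}. if i = j + 1 then ?f (j + 1) else 0) = (g (?t j) * dn (?t j)) *s C (?t j + 1)"
  proof (cases "j = d")
    case True
    then have "(\<Sum>i\<in>{1..d}. if i = j + 1 then ?f (j + 1) else 0) = 0" by (intro sum.neutral) auto
    then show ?thesis using last True by (simp add: vec.scale_eq_0_iff)
  next
    case False
    then have "j + 1 \<in> {1..d}" using j by auto
    then have "(\<Sum>i\<in>{1..d}. if i = j + 1 then ?f (j + 1) else 0) = ?f (j + 1)" by (simp add: sum.delta del: atLeastAtMost_iff)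
    also have "\<dots> = (g (?t j) * dn (?t j)) *s C (?t j + 1)"
      using lower[of j] False j by (auto simp: ac_simps)
    finally show ?thesis .
  qed
  also have "?f j + (g (?t j) * up (?t j)) *s C (?t j - 1) + (g (?t j) * dn (?t j)) *s C (?t j + 1) = top (Op *v e j)"
    unfolding act[OF j] diag[OF j, symmetric] by (simp add: vec_eq_iff algebra_simps)
  finally have "top (Op *v e j - ?s) = 0" unfolding top_linear by simp
  moreover have "hwv \<tau> \<alpha> \<beta> (Op *v e j - ?s)"
    by (intro hwv_diff hwv_commutes_with[OF comm] hw) (use e j in auto)
  ultimately have "Op *v e j - ?s = 0" using top_injective by blast
  then show "Op *v e j = ?s" by simp
qed

end

text \<open>\<open>ln\<close> and \<open>nn\<close> are the numbers \<open>\<ell>\<close> and \<open>n\<close> of the theorem.  All elements \<open>C t\<close> of the chain contain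
  \<open>y\<^sub>2\<close> with exponent \<open>y = max 0 (n - \<ell>)\<close> and \<open>\<beta>\<^sub>2\<close> with exponent \<open>z = max 0 (\<ell> - n)\<close>; the parameters
  \<open>\<xi>\<^sub>i\<close> are the values of \<open>t\<close> at which one of the other exponents, here or in the first factor, changes sign.\<close>

locale hw_chain = hw_pair \<rho> a b v \<xi> \<rho>' a' b' v' \<xi>'
  for \<rho> :: "'n::finite rep" and a b :: nat and v \<xi> and \<rho>' :: "'m::finite rep" and a' b' :: nat and v' \<xi>' +
  fixes \<alpha> \<beta> :: complex and y z ln nn :: int
  assumes yz: "y \<ge> 0" "z \<ge> 0" "y = 0 \<or> z = 0" "nn - ln = y - z"
    and ln: "3 * of_int ln = of_nat a + 2 * of_nat b + of_nat a' + 2 * of_nat b' - \<alpha> - 2 * \<beta> + 3"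
    and nn: "3 * of_int nn = 2 * of_nat a + of_nat b + 2 * of_nat a' + of_nat b' - 2 * \<alpha> - \<beta> + 3"
begin

text \<open>The index \<open>t\<close> exceeds the exponent of y_3 by one, so that \<xi>_6 = 0
  corresponds to the bound t > 0. The other exponents are then forced by the weight and the
  bidegree.\<close>

definition "k3 t = t - (1::int)"
definition "k1 t = int a' - y - k3 t"
definition "l1 t = nn - y - t"
definition "l3 t = int b' - z - l1 t"
definition "X t = int a - y - l1 t"
definition "A t = int b - z - k3 t"
definition "C t = W.B (k1 t) y (k3 t) (l1 t) z (l3 t)"
text \<open>\<open>lo\<close> and \<open>hi\<close> are \<xi>_b and \<xi>_a; the chain consists of
  the integers above \<open>lo\<close> and up to \<open>hi\<close>.\<close>

definition "lo = max 0 (max (ln - 1 - int b') (nn - 1 - int a))"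
definition "hi = min (nn - y) (min (int b + 1 - z) (int a' + 1 - y))"

lemmas exponent_defs = k1_def k3_def l1_def l3_def X_def A_def

lemma range_iff: "t \<in> {lo+1..hi} \<longleftrightarrow> k1 t \<ge> 0 \<and> k3 t \<ge> 0 \<and> l1 t \<ge> 0 \<and> l3 t \<ge> 0 \<and> X t \<ge> 0 \<and> A t \<ge> 0"
  using yz(4) unfolding lo_def hi_def exponent_defs by auto

lemma weights:
  "hwt \<alpha> \<beta> 1 - hwt (of_nat a) (of_nat b) 1 = of_int (int a' + 1 - nn) - W.shift"
  "hwt \<alpha> \<beta> 2 - hwt (of_nat a) (of_nat b) 2 = of_int (y - z) - W.shift"
  "hwt \<alpha> \<beta> 3 - hwt (of_nat a) (of_nat b) 3 = of_int (ln - 1 - int b') - W.shift"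
proof -
  have \<beta>: "\<beta> = of_nat b + of_nat b' + 1 + of_int (nn - ln) - of_int ln"
    using ln nn by (simp add: field_simps, algebra)
  have \<alpha>: "\<alpha> = of_nat a + of_nat a' + 1 - of_int (nn - ln) - of_int nn"
    using ln nn by (simp add: field_simps, algebra)
  show "hwt \<alpha> \<beta> 1 - hwt (of_nat a) (of_nat b) 1 = of_int (int a' + 1 - nn) - W.shift"
    "hwt \<alpha> \<beta> 3 - hwt (of_nat a) (of_nat b) 3 = of_int (ln - 1 - int b') - W.shift"
    unfolding hwt_def W.shift_def \<alpha> \<beta> by (simp_all add: field_simps)
  show "hwt \<alpha> \<beta> 2 - hwt (of_nat a) (of_nat b) 2 = of_int (y - z) - W.shift"
    unfolding hwt_def W.shift_def \<alpha> \<beta> yz(4)[symmetric] by (simp add: field_simps)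
qed

lemma C_zero: "k1 t < 0 \<or> k3 t < 0 \<or> l1 t < 0 \<or> l3 t < 0 \<Longrightarrow> C t = 0"
  unfolding C_def by (rule W.B_neg) auto

text \<open>\<open>\<rho>' 2 3\<close> empties y_3 and \<beta>_2, so its degree on
  \<open>C t\<close> is \<open>k3 t + z\<close>, which equals \<open>b - A t\<close>. It is strictly
  increasing in \<open>t\<close> and exceeds \<open>b\<close> exactly when
  \<open>A t < 0\<close>.\<close>

lemma C_raise23:
  assumes nn: "k1 t \<ge> 0" "k3 t \<ge> 0" "l1 t \<ge> 0" "l3 t \<ge> 0"
  shows "((*v) (\<rho>' 2 3) ^^ nat (k3 t + z)) (C t) \<noteq> 0"
    and "k > nat (k3 t + z) \<Longrightarrow> ((*v) (\<rho>' 2 3) ^^ k) (C t) = 0"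
proof -
  obtain c :: real where c: "c > 0" "((*v) (\<rho>' 2 3) ^^ (nat (k3 t) + nat z)) (W.B (k1 t) y (int (nat (k3 t))) (l1 t) (int (nat z)) (l3 t))
     = complex_of_real ((-1)^nat z * c) *s W.B (k1 t) (y + int (nat (k3 t))) 0 (l1 t) 0 (l3 t + int (nat z))"
    using W.raise23[where x = y and i = "nat (k3 t)" and j = "nat z" and t = "l3 t" and m = "k1 t" and m' = "l1 t"] nn yz by auto
  have "W.B (k1 t) (y + k3 t) 0 (l1 t) 0 (l3 t + z) \<noteq> 0"
    by (rule W.B_nonzero1) (use nn yz in \<open>auto simp: exponent_defs\<close>)
  moreover have "nat (k3 t) + nat z = nat (k3 t + z)" using nn yz by simp
  ultimately show "((*v) (\<rho>' 2 3) ^^ nat (k3 t + z)) (C t) \<noteq> 0"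
    using c nn yz unfolding C_def by (auto simp: vec.scale_eq_0_iff)
  show "((*v) (\<rho>' 2 3) ^^ k) (C t) = 0" if "k > nat (k3 t + z)"
    unfolding C_def by (rule W.raise23_vanish) (use that nn yz in auto)
qed

text \<open>\<open>\<rho>' 1 2\<close> empties y_2 and \<beta>_1, so its degree
  \<open>y + l1 t\<close> equals \<open>a - X t\<close>; it detects \<open>X t < 0\<close>.\<close>

lemma C_raise12:
  assumes nn: "k1 t \<ge> 0" "k3 t \<ge> 0" "l1 t \<ge> 0" "l3 t \<ge> 0"
  shows "((*v) (\<rho>' 1 2) ^^ nat (y + l1 t)) (C t) \<noteq> 0"
    and "k > nat (y + l1 t) \<Longrightarrow> ((*v) (\<rho>' 1 2) ^^ k) (C t) = 0"
proof -
  obtain c :: real where c: "c > 0" "((*v) (\<rho>' 1 2) ^^ (nat y + nat (l1 t))) (W.B (k1 t) (int (nat y)) (k3 t) (int (nat (l1 t))) z (l3 t))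
     = complex_of_real ((-1)^nat (l1 t) * c) *s W.B (k1 t + int (nat y)) 0 (k3 t) 0 (z + int (nat (l1 t))) (l3 t)"
    using W.raise12[where x = "k1 t" and i = "nat y" and j = "nat (l1 t)" and t = z and m = "k3 t" and m' = "l3 t"] nn yz by auto
  have "W.B (k1 t + y) 0 (k3 t) 0 (z + l1 t) (l3 t) \<noteq> 0"
    by (rule W.B_nonzero2) (use nn yz in \<open>auto simp: exponent_defs\<close>)
  moreover have "nat y + nat (l1 t) = nat (y + l1 t)" using nn yz by simp
  ultimately show "((*v) (\<rho>' 1 2) ^^ nat (y + l1 t)) (C t) \<noteq> 0"
    using c nn yz unfolding C_def by (auto simp: vec.scale_eq_0_iff)
  show "((*v) (\<rho>' 1 2) ^^ k) (C t) = 0" if "k > nat (y + l1 t)"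
    unfolding C_def by (rule W.raise12_vanish) (use that nn yz in auto)
qed

lemma C_independent:
  assumes "(\<Sum>t\<in>{lo+1..hi}. c t *s C t) = 0" "t \<in> {lo+1..hi}"
  shows "c t = 0"
proof (rule triangular_coefficients[where m = 0 and E = "\<rho>' 2 3" and deg = "\<lambda>t. nat (k3 t + z)" and T = "{lo+1..hi}" and C = C])
  show "inj_on (\<lambda>t. nat (k3 t + z)) {lo+1..hi}"
    by (rule inj_onI) (use yz in \<open>auto simp: range_iff k3_def simp del: atLeastAtMost_iff\<close>)
qed (use assms C_raise23 in \<open>auto simp: range_iff simp del: atLeastAtMost_iff\<close>)

text \<open>The weight restricts \<open>top u\<close> to the chain, and
  \<open>triangular_coefficients\<close> removes the terms of degree above \<open>b\<close> under
  \<open>\<rho>' 2 3\<close> and above \<open>a\<close> under \<open>\<rho>' 1 2\<close>.\<close>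

lemma top_span:
  assumes u: "hwv \<tau> \<alpha> \<beta> u"
  shows "\<exists>c. top u = (\<Sum>t\<in>{lo+1..hi}. c t *s C t)"
proof -
  \<comment> \<open>\<open>T\<close> imposes only the conditions from the second factor; those on
    \<open>A\<close> and \<open>X\<close> will follow from \<open>top_raise\<close>.\<close>
  define T where "T = {t. k1 t \<ge> 0 \<and> k3 t \<ge> 0 \<and> l1 t \<ge> 0 \<and> l3 t \<ge> 0}"
  have "T \<subseteq> {1..int a' + 1}" using yz unfolding T_def exponent_defs by auto
  then have fin: "finite T" by (rule finite_subset) simp
  have "top u \<in> vec.span {W.B k1 k2 k3 l1 l2 l3 | k1 k2 k3 l1 l2 l3.
     of_int (k1 - l1) - W.shift = hwt \<alpha> \<beta> 1 - hwt (of_nat a) (of_nat b) 1 \<and> of_int (k2 - l2) - W.shift = hwt \<alpha> \<beta> 2 - hwt (of_nat a) (of_nat b) 2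
     \<and> of_int (k3 - l3) - W.shift = hwt \<alpha> \<beta> 3 - hwt (of_nat a) (of_nat b) 3 \<and> (k2 = 0 \<or> l2 = 0)}" (is "_ \<in> vec.span ?S")
    by (rule W.weight_space_span[OF top_weight[OF u]])
  moreover have "?S \<subseteq> vec.span (C ` T)"
  proof clarify
    fix i1 i2 i3 j1 j2 j3 :: int
    assume w: "of_int (i1 - j1) - W.shift = hwt \<alpha> \<beta> 1 - hwt (of_nat a) (of_nat b) 1"
      "of_int (i2 - j2) - W.shift = hwt \<alpha> \<beta> 2 - hwt (of_nat a) (of_nat b) 2" and 0: "i2 = 0 \<or> j2 = 0"
    have w': "i1 - j1 = int a' + 1 - nn" "i2 - j2 = y - z"
    proof -
      have "of_int (i1 - j1) = (of_int (int a' + 1 - nn) :: complex)" "of_int (i2 - j2) = (of_int (y - z) :: complex)"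
        using w unfolding weights by (metis diff_add_cancel)+
      then show "i1 - j1 = int a' + 1 - nn" "i2 - j2 = y - z" unfolding of_int_eq_iff by simp_all
    qed
    show "W.B i1 i2 i3 j1 j2 j3 \<in> vec.span (C ` T)"
    proof (cases "W.B i1 i2 i3 j1 j2 j3 = 0")
      case False
      then have nn: "i1 \<ge> 0" "i2 \<ge> 0" "i3 \<ge> 0" "j1 \<ge> 0" "j2 \<ge> 0" "j3 \<ge> 0" "i1 + i2 + i3 = int a'" "j1 + j2 + j3 = int b'"
        using W.B_neg[of i1 i2 i3 j1 j2 j3] W.B_bidegree[of i1 i2 i3 j1 j2 j3] by (meson not_less)+
      then have "i2 = y" "j2 = z" using w'(2) yz 0 by linarith+
      moreover from this have "i1 = k1 (i3 + 1)" "i3 = k3 (i3 + 1)" "j1 = l1 (i3 + 1)" "j3 = l3 (i3 + 1)"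
        using w' nn unfolding exponent_defs by linarith+
      ultimately have "W.B i1 i2 i3 j1 j2 j3 = C (i3 + 1)" "i3 + 1 \<in> T"
        unfolding C_def T_def using nn by auto
      then show ?thesis by (simp add: vec.span_base)
    qed (simp add: vec.span_zero)
  qed
  ultimately have "top u \<in> vec.span (C ` T)"
    using vec.span_minimal[OF _ vec.subspace_span] by blast
  then obtain c where c: "top u = (\<Sum>t\<in>T. c t *s C t)" using span_image_combination[OF fin] by blast
  have "c t = 0" if "t \<in> T" "A t < 0" for t
  proof (rule triangular_coefficients[where m = "Suc b" and E = "\<rho>' 2 3" and deg = "\<lambda>t. nat (k3 t + z)" and T = T and C = C])
    show "inj_on (\<lambda>t. nat (k3 t + z)) T"
      by (rule inj_onI) (use yz in \<open>auto simp: T_def k3_def\<close>)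
    show "((*v) (\<rho>' 2 3) ^^ Suc b) (\<Sum>t\<in>T. c t *s C t) = 0"
      unfolding c[symmetric] by (rule top_raise[OF u]) simp
    show "Suc b \<le> nat (k3 t + z)" using that unfolding A_def by simp
  qed (use that fin C_raise23 in \<open>auto simp: T_def\<close>)
  moreover have "c t = 0" if "t \<in> T" "X t < 0" for t
  proof (rule triangular_coefficients[where m = "Suc a" and E = "\<rho>' 1 2" and deg = "\<lambda>t. nat (y + l1 t)" and T = T and C = C])
    show "inj_on (\<lambda>t. nat (y + l1 t)) T"
      by (rule inj_onI) (use yz in \<open>auto simp: T_def l1_def\<close>)
    show "((*v) (\<rho>' 1 2) ^^ Suc a) (\<Sum>t\<in>T. c t *s C t) = 0"
      unfolding c[symmetric] by (rule top_raise[OF u]) simp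
    show "Suc a \<le> nat (y + l1 t)" using that unfolding X_def by simp
  qed (use that fin C_raise12 in \<open>auto simp: T_def\<close>)
  ultimately have z: "c t = 0" if "t \<in> T - {lo+1..hi}" for t
    using that unfolding range_iff Diff_iff T_def mem_Collect_eq by (meson not_less)
  have "{lo+1..hi} \<subseteq> T" unfolding T_def subset_iff range_iff by simp
  then have "top u = (\<Sum>t\<in>{lo+1..hi}. c t *s C t)"
    unfolding c using z by (intro sum.mono_neutral_right fin) auto
  then show ?thesis by blast
qed

text \<open>The exponents \<open>y\<close> of y_2 and \<open>z\<close> of \<beta>_2 are supplied by
  powers of x_1 y_2 - x_2 y_1 and \<alpha>_3 \<beta>_2 - \<alpha>_2 \<beta>_3.\<close>

lemma C_lift:
  assumes "t \<in> {lo+1..hi}"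
  shows "\<exists>u. hwv \<tau> \<alpha> \<beta> u \<and> top u = C t"
  unfolding C_def
proof (rule invariant_lift)
  let ?F0 = "(mult_xy ^^ nat y) mono2" and ?F = "(mult_ab ^^ nat z) ((mult_xy ^^ nat y) mono2)"
  note F0 = admissible_powers(3)[OF admissible_mono2, of "nat y"]
  show "admissible (0 + int (nat y)) (0 + int (nat y) - int (nat z)) (0 - int (nat z)) ?F"
    by (rule admissible_powers(4)[OF F0])
  have "lifts ?F (0 + int (nat y)) (0 + int (nat z)) (0 + int (nat y)) 0 0 (0 + int (nat z))"
    by (rule lifts_powers(4)[OF F0 lifts_powers(3)[OF admissible_mono2 lifts_mono2]])
  then show "lifts ?F y z y 0 0 z" using yz by simp
  show "hwt \<alpha> \<beta> 1 = of_int (X t + k1 t + (0 + int (nat y))) - (V.shift + W.shift)"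
    using weights(1) yz unfolding exponent_defs hwt_def V.shift_def W.shift_def by (simp add: field_simps)
  show "hwt \<alpha> \<beta> 2 = of_int (0 + int (nat y) - int (nat z)) - (V.shift + W.shift)"
    using weights(2) yz unfolding exponent_defs hwt_def V.shift_def W.shift_def by (simp add: field_simps)
  have 3: "- A t - l3 t + (0 - int (nat z)) = ln - 1 - int b' - int b" using yz unfolding exponent_defs by simp
  show "hwt \<alpha> \<beta> 3 = of_int (- A t - l3 t + (0 - int (nat z))) - (V.shift + W.shift)"
    using weights(3) unfolding 3 hwt_def V.shift_def W.shift_def by (simp add: field_simps)
qed (use assms in \<open>auto simp: range_iff exponent_defs simp del: atLeastAtMost_iff\<close>)

lemma op_on_chain:
  assumes u: "hwv \<tau> \<alpha> \<beta> u" and top: "top u = c *s C t"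
  defines "z1 \<equiv> of_int (l1 t)" and "v3 \<equiv> of_int (A t)" and "x1 \<equiv> of_int (k1 t)" and "z3 \<equiv> of_int (l3 t)"
    and "u1 \<equiv> of_int (X t)" and "x3 \<equiv> of_int (k3 t)"
  defines "\<Lambda> \<equiv> z1 + v3 + x1 + 3 + z3 + u1 + x3 + 2 * of_int (y + z)"
  shows "top (op_X \<rho> \<rho>' *v u) = c *s ((u1 * (x1 + 1) * (z1 + 1)) *s C (t - 1) + chain_diag_X x1 x3 z1 z3 u1 v3 \<Lambda> *s C t
      + (- (v3 * (x3 + 1) * (z3 + 1))) *s C (t + 1))" (is ?P)
    "top (op_Y \<rho> \<rho>' *v u) = c *s (
      (u1 * (x1 + 1) * (z1 + 1) * (- \<Lambda> / 2 - (z1 + v3 + x1 - z3 - u1 - x3 - 3) / 6 - 1)) *s C (t - 1)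
      + chain_diag_Y x1 x3 z1 z3 u1 v3 \<Lambda> *s C t
      + (- (v3 * (x3 + 1) * (z3 + 1)) * (\<Lambda> / 2 - (z1 + v3 + x1 - z3 - u1 - x3 - 3) / 6)) *s C (t + 1))" (is ?Q)
proof -
  have shift: "k1 (t - 1) = k1 t + 1" "k3 (t - 1) = k3 t - 1" "l1 (t - 1) = l1 t + 1" "l3 (t - 1) = l3 t - 1"
    "k1 (t + 1) = k1 t - 1" "k3 (t + 1) = k3 t + 1" "l1 (t + 1) = l1 t - 1" "l3 (t + 1) = l3 t + 1"
    unfolding exponent_defs by simp_all
  consider "z = 0" | "y = 0" using yz(3) by blast
  then have "?P \<and> ?Q"
  proof cases
    case 1
    have ints: "int a = l1 t + y + X t" "int b = k3 t + A t" "int a' = k1 t + y + k3 t" "int b' = l1 t + l3 t"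
      using 1 unfolding exponent_defs by simp_all
    have C: "C s = W.B (k1 s) y (k3 s) (l1 s) 0 (l3 s)" for s unfolding C_def by (simp only: 1)
    have "y + z = y" using 1 by simp
    then show ?thesis
      using op_on_chain_A[OF u top[unfolded C] ints]
      unfolding C shift z1_def v3_def x1_def z3_def u1_def x3_def \<Lambda>_def by (simp only:)
  next
    case 2
    have ints: "int a = l1 t + X t" "int b = k3 t + z + A t" "int a' = k1 t + k3 t" "int b' = l1 t + z + l3 t"
      using 2 unfolding exponent_defs by simp_all
    have C: "C s = W.B (k1 s) 0 (k3 s) (l1 s) z (l3 s)" for s unfolding C_def by (simp only: 2)
    have "y + z = z" using 2 by simp
    then show ?thesis
      using op_on_chain_B[OF u top[unfolded C] ints]
      unfolding C shift z1_def v3_def x1_def z3_def u1_def x3_def \<Lambda>_def by (simp only:)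
  qed
  then show ?P ?Q by blast+
qed

text \<open>Rescaling by \<open>g\<close> turns the off-diagonal coefficients into the products of the theorem.\<close>

definition "g t = (fact (nat (k1 t)) * fact (nat (k3 t)) * fact (nat (l1 t)) * fact (nat (l3 t)) :: complex)"

lemma g_nonzero: "g t \<noteq> 0"
  unfolding g_def by simp

lemma g_step:
  assumes "t \<in> {lo+1..hi}" "t + 1 \<in> {lo+1..hi}"
  shows "g (t + 1) * (of_int (k1 (t + 1) + 1) * of_int (l1 (t + 1) + 1)) = of_int (k3 t + 1) * of_int (l3 t + 1) * g t" (is ?goal1)
    "g t * (of_int (k3 t + 1) * of_int (l3 t + 1)) = of_int (k1 t) * of_int (l1 t) * g (t + 1)"
proof -
  have nn: "k1 (t + 1) \<ge> 0" "k3 t \<ge> 0" "l1 (t + 1) \<ge> 0" "l3 t \<ge> 0" using assms unfolding range_iff by simp_all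
  have s: "k1 t = k1 (t + 1) + 1" "l1 t = l1 (t + 1) + 1" "k3 (t + 1) = k3 t + 1" "l3 (t + 1) = l3 t + 1"
    unfolding exponent_defs by simp_all
  have f: "fact (nat (k + 1)) = of_int (k + 1) * (fact (nat k) :: complex)" if "k \<ge> 0" for k :: int
    using that by (simp add: nat_add_distrib)
  show ?goal1
    "g t * (of_int (k3 t + 1) * of_int (l3 t + 1)) = of_int (k1 t) * of_int (l1 t) * g (t + 1)"
    unfolding g_def s f[OF nn(1)] f[OF nn(2)] f[OF nn(3)] f[OF nn(4)] by (simp_all only: ac_simps)
qed

text \<open>Depending on which term attains the maximum or minimum, either the neighbour outside the
  range has a negative exponent and is 0, or the coefficient leading to it contains a factor
  \<open>X\<close> or \<open>A\<close> that is 0.\<close>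

lemma chain_boundary:
  "of_int (X (lo + 1)) *s C lo = 0"
  "lo < hi \<Longrightarrow> of_int (A hi) *s C (hi + 1) = 0"
proof -
  have "lo = 0 \<or> lo = ln - 1 - int b' \<or> lo = nn - 1 - int a" unfolding lo_def by linarith
  then have "k3 lo < 0 \<or> l3 lo < 0 \<or> X (lo + 1) = 0" using yz(4) unfolding exponent_defs by linarith
  then show "of_int (X (lo + 1)) *s C lo = 0" using C_zero by auto
  have "hi = nn - y \<or> hi = int b + 1 - z \<or> hi = int a' + 1 - y" unfolding hi_def by linarith
  then have "l1 (hi + 1) < 0 \<or> A hi = 0 \<or> k1 (hi + 1) < 0" unfolding exponent_defs by linarith
  then show "of_int (A hi) *s C (hi + 1) = 0" using C_zero by auto
qed

text \<open>\<open>par\<close> is the list of the \<xi>_i. Its second and third entries are allowed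
  in either order because the two cases of the theorem list them differently. The matrices come out
  transposed.\<close>

lemma chain_operators:
  fixes par :: "nat \<Rightarrow> real" and \<Lambda> lp lm \<mu> :: real
  assumes par123: "par 1 = of_int (nn - y)" "par 2 = of_int (int b + 1 - z) \<and> par 3 = of_int (int a' + 1 - y)
      \<or> par 2 = of_int (int a' + 1 - y) \<and> par 3 = of_int (int b + 1 - z)"
    and par456: "par 4 = of_int (ln - 1 - int b')" "par 5 = of_int (nn - 1 - int a)" "par 6 = 0"
    and \<Lambda>: "\<Lambda> = (\<Sum>i\<in>{1..3}. par i) - (\<Sum>i\<in>{4..6}. par i) + 2 * of_int (y + z)"
    and lp: "lp = 1/2 * \<Lambda> + 1/6 * (\<Sum>i\<in>{1..6}. par i)"
    and lm: "lm = - (1/2) * \<Lambda> + 1/6 * (\<Sum>i\<in>{1..6}. par i)"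
    and \<mu>: "\<mu> = of_int lo"
  obtains e where "basis_of {u. hwv \<tau> \<alpha> \<beta> u} (nat (hi - lo)) e"
    "lo < hi \<Longrightarrow> acts_by (op_X \<rho> \<rho>') (nat (hi - lo)) e (\<lambda>i j. mat_a par \<mu> \<Lambda> j i)"
    "lo < hi \<Longrightarrow> acts_by (op_Y \<rho> \<rho>') (nat (hi - lo)) e (\<lambda>i j. mat_b par \<mu> \<Lambda> lm lp j i)"
proof -
  let ?d = "nat (hi - lo)"
  obtain e where basis: "basis_of {u. hwv \<tau> \<alpha> \<beta> u} ?d e"
    and e: "\<And>j. j \<in> {1..?d} \<Longrightarrow> hwv \<tau> \<alpha> \<beta> (e j) \<and> top (e j) = g (lo + int j) *s C (lo + int j)"
    by (rule chain_basis[where \<alpha> = \<alpha> and \<beta> = \<beta> and lo = lo and hi = hi and C = C and g = g]) (use top_span C_independent C_lift g_nonzero in blast)+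
  \<comment> \<open>\<open>L t\<close> will be \<Lambda>, for every \<open>t\<close>, and
    \<open>M t\<close> the sum of all parameters minus \<open>6 * t\<close>. Hence \<lambda>_+ - t
    and \<lambda>_- - t are \<Lambda>/2 + M/6 and -\<Lambda>/2 + M/6.\<close>
  define L where "L t = l1 t + A t + k1 t + 3 + l3 t + X t + k3 t + 2 * (y + z)" for t
  define M where "M t = l1 t + A t + k1 t - l3 t - X t - k3 t - 3" for t
  have s16: "(\<Sum>i\<in>{1..3}. par i) = par 1 + par 2 + par 3" "(\<Sum>i\<in>{4..6}. par i) = par 4 + par 5 + par 6"
    "(\<Sum>i\<in>{1..6}. f i) = f 1 + f 2 + f 3 + f 4 + f 5 + f 6" for f :: "nat \<Rightarrow> real"
    by (simp_all add: numeral_eq_Suc)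
  \<comment> \<open>For every \<open>t\<close>, a parameter is either \<open>t\<close> plus an
    exponent or \<open>t - 1\<close> minus one; this turns all entries of the theorem into exponents
    at \<open>t\<close>.\<close>
  have ft: "par 1 = of_int (t + l1 t)" "par 4 = of_int (t - 1 - l3 t)" "par 5 = of_int (t - 1 - X t)" "par 6 = of_int (t - 1 - k3 t)"
    "par 2 = of_int (t + A t) \<and> par 3 = of_int (t + k1 t) \<or> par 2 = of_int (t + k1 t) \<and> par 3 = of_int (t + A t)" for t
    using par123 par456 yz(4) unfolding exponent_defs by auto
  have L: "\<Lambda> = of_int (L t)" for t
    using ft(5)[of t] unfolding \<Lambda> s16 ft(1-4)[of t] L_def by auto
  have M: "(\<Sum>i\<in>{1..6}. par i) = of_int (6 * t + M t)" for t
    using ft(5)[of t] unfolding s16 ft(1-4)[of t] M_def by auto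
  have p1: "(of_int t - par 1) * (of_int t - par 2) * (of_int t - par 3) = - of_int (l1 t) * of_int (A t) * of_int (k1 t)" for t
    using ft(5)[of t] unfolding ft(1)[of t] by auto
  have p2: "(of_int t - par 4) * (of_int t - par 5) * (of_int t - par 6) = of_int (l3 t + 1) * of_int (X t + 1) * of_int (k3 t + 1)" for t
    unfolding ft(2-4)[of t] by (simp add: add.commute)
  have E: "complex_of_real (E_sum par \<mu> j k) = chain_E (of_int (k1 (lo + int j))) (of_int (k3 (lo + int j))) (of_int (l1 (lo + int j)))
      (of_int (l3 (lo + int j))) (of_int (X (lo + int j))) (of_int (A (lo + int j))) k" for j k
  proof -
    let ?t = "lo + int j"
    have "E_sum par \<mu> j k = (of_int (l1 ?t) + 1/2) ^ k + (of_int (A ?t) + 1/2) ^ k + (of_int (k1 ?t) + 1/2) ^ k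
        + (- of_int (l3 ?t) - 1/2) ^ k + (- of_int (X ?t) - 1/2) ^ k + (- of_int (k3 ?t) - 1/2) ^ k"
      using ft(5)[of ?t] unfolding E_sum_def s16(3) ft(1-4)[of ?t] \<mu> minus_diff_commute[of _ "1/2"] by auto
    then show ?thesis unfolding chain_E_def by simp
  qed
  have d: "lo + int ?d = hi" if "lo < hi" using that by simp
  have in_range: "lo + int j \<in> {lo+1..hi}" "lo + int j + 1 \<in> {lo+1..hi}" if "j \<in> {1..<?d}" for j
    using that by auto
  have t: "real j + \<mu> = of_int (lo + int j)" for j unfolding \<mu> by simp
  have X1: "X (t + 1) = X t + 1" and M1: "M (t + 1) = M t - 6" for t unfolding M_def exponent_defs by simp_all
  define upX :: "int \<Rightarrow> complex" where "upX t = of_int (X t) * (of_int (k1 t) + 1) * (of_int (l1 t) + 1)" for t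
  define dnX :: "int \<Rightarrow> complex" where "dnX t = - (of_int (A t) * (of_int (k3 t) + 1) * (of_int (l3 t) + 1))" for t
  define midX :: "int \<Rightarrow> complex" where "midX t = chain_diag_X (of_int (k1 t)) (of_int (k3 t)) (of_int (l1 t)) (of_int (l3 t)) (of_int (X t)) (of_int (A t)) (of_real \<Lambda>)" for t
  define midY :: "int \<Rightarrow> complex" where "midY t = chain_diag_Y (of_int (k1 t)) (of_int (k3 t)) (of_int (l1 t)) (of_int (l3 t)) (of_int (X t)) (of_int (A t)) (of_real \<Lambda>)" for t
  have op: "top (op_X \<rho> \<rho>' *v u) = c *s (upX t *s C (t - 1) + midX t *s C t + dnX t *s C (t + 1))"
    "top (op_Y \<rho> \<rho>' *v u) = c *s ((upX t * (- of_real \<Lambda> / 2 - of_int (M t) / 6 - 1)) *s C (t - 1) + midY t *s C t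
      + (dnX t * (of_real \<Lambda> / 2 - of_int (M t) / 6)) *s C (t + 1))"
    if "hwv \<tau> \<alpha> \<beta> u" "top u = c *s C t" for u c t
    using op_on_chain[OF that] unfolding upX_def dnX_def midX_def midY_def L[of t] L_def M_def by simp_all
  have first: "upX (lo + 1) *s C lo = 0" and last: "lo < hi \<Longrightarrow> dnX hi *s C (hi + 1) = 0"
    using chain_boundary unfolding upX_def dnX_def by (auto simp: vec.scale_eq_0_iff)
  have upper: "g (lo + int j + 1) * upX (lo + int j + 1) = complex_of_real (mat_a par \<mu> \<Lambda> (j + 1) j) * g (lo + int j)"
    if "j \<in> {1..<?d}" for j
  proof -
    have "mat_a par \<mu> \<Lambda> (j + 1) j = of_int (l3 (lo + int j) + 1) * of_int (X (lo + int j) + 1) * of_int (k3 (lo + int j) + 1)"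
      unfolding p2[symmetric] mat_a_def t Let_def by simp
    then show ?thesis using g_step(1)[OF in_range[OF that]] unfolding upX_def X1 by (simp add: ac_simps)
  qed
  have lower: "g (lo + int j) * dnX (lo + int j) = complex_of_real (mat_a par \<mu> \<Lambda> j (j + 1)) * g (lo + int j + 1)"
    if "j \<in> {1..<?d}" for j
  proof -
    have "mat_a par \<mu> \<Lambda> j (j + 1) = - of_int (l1 (lo + int j)) * of_int (A (lo + int j)) * of_int (k1 (lo + int j))"
      unfolding p1[symmetric] mat_a_def t Let_def by simp
    then show ?thesis using g_step(2)[OF in_range[OF that]] unfolding dnX_def by (simp add: ac_simps)
  qed
  have actsX: "acts_by (op_X \<rho> \<rho>') ?d e (\<lambda>i j. mat_a par \<mu> \<Lambda> j i)" if "lo < hi"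
  proof (rule chain_acts[where up = upX and mid = midX and dn = dnX and lo = lo and g = g and C = C])
    show "commutes_with (op_X \<rho> \<rho>') \<tau>" by (rule op_commutes)
    show "top (op_X \<rho> \<rho>' *v e j) = g (lo + int j) *s (upX (lo + int j) *s C (lo + int j - 1)
        + midX (lo + int j) *s C (lo + int j) + dnX (lo + int j) *s C (lo + int j + 1))" if "j \<in> {1..?d}" for j
      using e[OF that] by (intro op(1)) simp_all
    show "midX (lo + int j) = complex_of_real (mat_a par \<mu> \<Lambda> j j)" for j
      unfolding midX_def chain_diag_X_def mat_a_def Let_def E[symmetric] by simp
    show "dnX (lo + int ?d) *s C (lo + int ?d + 1) = 0" unfolding d[OF that] by (rule last[OF that])
    show "mat_a par \<mu> \<Lambda> j i = 0" if "i + 1 < j \<or> j + 1 < i" for i j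
      using that unfolding mat_a_def by auto
  qed (use e first upper lower in auto)
  have actsY: "acts_by (op_Y \<rho> \<rho>') ?d e (\<lambda>i j. mat_b par \<mu> \<Lambda> lm lp j i)" if "lo < hi"
  proof (rule chain_acts[where up = "\<lambda>t. upX t * (- of_real \<Lambda> / 2 - of_int (M t) / 6 - 1)" and mid = midY
        and dn = "\<lambda>t. dnX t * (of_real \<Lambda> / 2 - of_int (M t) / 6)" and lo = lo and g = g and C = C])
    show "commutes_with (op_Y \<rho> \<rho>') \<tau>" by (rule op_commutes)
    show "top (op_Y \<rho> \<rho>' *v e j) = g (lo + int j) *s ((upX (lo + int j) * (- of_real \<Lambda> / 2 - of_int (M (lo + int j)) / 6 - 1)) *s C (lo + int j - 1)
        + midY (lo + int j) *s C (lo + int j) + (dnX (lo + int j) * (of_real \<Lambda> / 2 - of_int (M (lo + int j)) / 6)) *s C (lo + int j + 1))"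
      if "j \<in> {1..?d}" for j
      using e[OF that] by (intro op(2)) simp_all
    show "midY (lo + int j) = complex_of_real (mat_b par \<mu> \<Lambda> lm lp j j)" for j
      unfolding midY_def chain_diag_Y_def mat_b_def Let_def E[symmetric] by simp
    show "(dnX (lo + int ?d) * (of_real \<Lambda> / 2 - of_int (M (lo + int ?d)) / 6)) *s C (lo + int ?d + 1) = 0"
      unfolding d[OF that] using last[OF that] by (auto simp: vec.scale_eq_0_iff)
    show "(upX (lo + 1) * (- of_real \<Lambda> / 2 - of_int (M (lo + 1)) / 6 - 1)) *s C lo = 0"
      using first by (auto simp: vec.scale_eq_0_iff)
    show "mat_b par \<mu> \<Lambda> lm lp j i = 0" if "i + 1 < j \<or> j + 1 < i" for i j
      using that unfolding mat_b_def by auto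
    show "g (lo + int j + 1) * (upX (lo + int j + 1) * (- of_real \<Lambda> / 2 - of_int (M (lo + int j + 1)) / 6 - 1))
        = complex_of_real (mat_b par \<mu> \<Lambda> lm lp (j + 1) j) * g (lo + int j)" if j: "j \<in> {1..<?d}" for j
    proof -
      have "mat_b par \<mu> \<Lambda> lm lp (j + 1) j = mat_a par \<mu> \<Lambda> (j + 1) j * (of_int (lo + int j) - lp)"
        unfolding mat_b_def t Let_def by simp
      also have "of_int (lo + int j) - lp = - \<Lambda> / 2 - of_int (M (lo + int j + 1)) / 6 - 1"
        unfolding lp M[of "lo + int j"] M1 by (simp add: field_simps)
      finally show ?thesis using upper[OF j] by (simp add: mult.assoc[symmetric])
    qed
    show "g (lo + int j) * (dnX (lo + int j) * (of_real \<Lambda> / 2 - of_int (M (lo + int j)) / 6))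
        = complex_of_real (mat_b par \<mu> \<Lambda> lm lp j (j + 1)) * g (lo + int j + 1)" if j: "j \<in> {1..<?d}" for j
    proof -
      have "mat_b par \<mu> \<Lambda> lm lp j (j + 1) = mat_a par \<mu> \<Lambda> j (j + 1) * (of_int (lo + int j) - lm)"
        unfolding mat_b_def t Let_def by simp
      also have "of_int (lo + int j) - lm = \<Lambda> / 2 - of_int (M (lo + int j)) / 6"
        unfolding lm M[of "lo + int j"] by (simp add: field_simps)
      finally show ?thesis using lower[OF j] by (simp add: mult.assoc[symmetric])
    qed
  qed (use e in auto)
  show ?thesis by (rule that[OF basis actsX actsY])
qed

end

section \<open>Transposition\<close>

lemma transpose_kron: "transpose (kron A C) = kron (transpose A) (transpose C)"
  by (simp add: kron_def transpose_def vec_eq_iff)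

lemma tensor_gen_transp:
  "tensor_gen (transp \<rho>) (transp \<rho>') c p q = transpose (tensor_gen \<rho> \<rho>' c q p)"
  by (simp add: tensor_gen_def transp_def transpose_kron transpose_mat)

lemma tensor_rep_transp: "tensor_rep (transp \<rho>) (transp \<rho>') = transp (tensor_rep \<rho> \<rho>')"
  by (simp add: fun_eq_iff tensor_rep_def transp_def[of "tensor_rep \<rho> \<rho>'"] tensor_gen_transp transpose_add)

lemma tensor_gen_mult_commute:
  "tensor_gen \<rho> \<rho>' 2 r s ** tensor_gen \<rho> \<rho>' 1 p q = tensor_gen \<rho> \<rho>' 1 p q ** tensor_gen \<rho> \<rho>' 2 r s"
  "tensor_gen \<rho> \<rho>' 2 r s ** (tensor_gen \<rho> \<rho>' 1 p q ** Z) = tensor_gen \<rho> \<rho>' 1 p q ** (tensor_gen \<rho> \<rho>' 2 r s ** Z)" (is ?goal1)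
proof -
  show *: "tensor_gen \<rho> \<rho>' 2 r s ** tensor_gen \<rho> \<rho>' 1 p q = tensor_gen \<rho> \<rho>' 1 p q ** tensor_gen \<rho> \<rho>' 2 r s"
    by (simp add: matrix_eq matrix_vector_mul_assoc[symmetric] tensor_gen_commute del: One_nat_def)
  show ?goal1
    unfolding matrix_mul_assoc * ..
qed

lemma sum_reverse3: "(\<Sum>i\<in>I. \<Sum>j\<in>I. \<Sum>k\<in>I. f i j k) = (\<Sum>i\<in>I. \<Sum>j\<in>I. \<Sum>k\<in>I. f k j i)"
proof -
  have "(\<Sum>i\<in>I. \<Sum>j\<in>I. \<Sum>k\<in>I. f i j k) = (\<Sum>j\<in>I. \<Sum>i\<in>I. \<Sum>k\<in>I. f i j k)" by (rule sum.swap)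
  also have "\<dots> = (\<Sum>j\<in>I. \<Sum>k\<in>I. \<Sum>i\<in>I. f i j k)" by (intro sum.cong refl sum.swap)
  also have "\<dots> = (\<Sum>k\<in>I. \<Sum>j\<in>I. \<Sum>i\<in>I. f i j k)" by (rule sum.swap)
  finally show ?thesis .
qed

text \<open>Transposition reverses the factors and swaps their indices. Generators of different
  factors commute, so the letters 1 can be brought back in front of the letters 2, and what remains
  is a renaming of summation indices. The last claim handles the product of traces in
  \<open>Y\<close>.\<close>

lemma pol_trace_transp:
  fixes \<rho> :: "'n::finite rep" and \<rho>' :: "'m::finite rep"
  defines "T \<equiv> pol_trace (tensor_gen \<rho> \<rho>')" and "S \<equiv> pol_trace (tensor_gen (transp \<rho>) (transp \<rho>'))"
  shows "S [1,2] = transpose (T [1,2])" "S [c,c] = transpose (T [c,c])"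
    "S [1,1,2] = transpose (T [1,1,2])" "S [1,2,2] = transpose (T [1,2,2])"
    "S [1,1,2,2] = transpose (T [1,1,2,2])"
    "pol_trace_bar (tensor_gen (transp \<rho>) (transp \<rho>')) [1,1,2,2] = transpose (pol_trace_bar (tensor_gen \<rho> \<rho>') [1,1,2,2])" (is ?goal1)
    "T [2,2] ** T [1,1] = T [1,1] ** T [2,2]"
proof -
  note rules = tensor_gen_transp matrix_transpose_mul[symmetric] matrix_mul_assoc[symmetric] tensor_gen_mult_commute
  show "S [1,2] = transpose (T [1,2])"
    unfolding S_def T_def pol_trace_2 transpose_sum by (subst sum.swap) (simp only: rules)
  show "S [c,c] = transpose (T [c,c])"
    unfolding S_def T_def pol_trace_2 transpose_sum by (simp only: rules)
  show "S [1,1,2] = transpose (T [1,1,2])"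
    unfolding S_def T_def pol_trace_3 transpose_sum by (subst sum_reverse3) (simp only: rules)
  show "S [1,2,2] = transpose (T [1,2,2])"
    unfolding S_def T_def pol_trace_3 transpose_sum by (subst sum.swap) (simp only: rules)
  show "S [1,1,2,2] = transpose (T [1,1,2,2])"
    unfolding S_def T_def pol_trace_4 transpose_sum by (subst sum_reverse3) (simp only: rules)
  show ?goal1
    unfolding pol_trace_bar_4 transpose_sum by (subst sum_reverse3) (simp only: rules)
  have comm: "tensor_gen \<rho> \<rho>' 2 p q *v (T [1,1] *v w) = T [1,1] *v (tensor_gen \<rho> \<rho>' 2 p q *v w)" for p q w
    unfolding T_def pol_trace_2 trace_vector matrix_vector_mult_sum tensor_gen_commute ..
  have T22: "T [2,2] *v w = (\<Sum>i\<in>{1..3}. \<Sum>j\<in>{1..3}. tensor_gen \<rho> \<rho>' 2 j i *v (tensor_gen \<rho> \<rho>' 2 i j *v w))" for w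
    unfolding T_def pol_trace_2 trace_vector ..
  have "T [2,2] *v (T [1,1] *v w) = T [1,1] *v (T [2,2] *v w)" for w
    unfolding T22 by (simp only: matrix_vector_mult_sum comm)
  then show "T [2,2] ** T [1,1] = T [1,1] ** T [2,2]"
    by (simp add: matrix_eq matrix_vector_mul_assoc[symmetric])
qed

lemma casimir_L_transp: "casimir_L (transp \<rho>) = transpose (casimir_L \<rho>)"
proof -
  have "(\<Sum>j\<in>{1..3}. \<Sum>k\<in>{1..3}. transp \<rho> i j ** transp \<rho> j k ** transp \<rho> k i + transp \<rho> j i ** transp \<rho> k j ** transp \<rho> i k)
      = (\<Sum>j\<in>{1..3}. \<Sum>k\<in>{1..3}. transpose (\<rho> i j ** \<rho> j k ** \<rho> k i + \<rho> j i ** \<rho> k j ** \<rho> i k))" for i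
    by (subst sum.swap) (simp only: transp_def matrix_transpose_mul[symmetric] matrix_mul_assoc[symmetric] transpose_add)
  then show ?thesis unfolding casimir_L_def transpose_smult transpose_sum by simp
qed

lemma op_transp:
  "op_X (transp \<rho>) (transp \<rho>') = transpose (op_X \<rho> \<rho>')"
  "op_Y (transp \<rho>) (transp \<rho>') = transpose (op_Y \<rho> \<rho>')"
  unfolding op_X_def op_Y_def Let_def pol_trace_transp(1-6) casimir_L_transp
  by (simp_all only: transpose_smult transpose_add transpose_diff transpose_kron transpose_mat matrix_transpose_mul[symmetric] pol_trace_transp(7))

section \<open>Multiplicity spaces\<close>

text \<open>The summands are invariant, so each highest-weight equation splits into its components
  by uniqueness of the decomposition.\<close>

lemma irreducible_decomposition_hwv:
  assumes S: "irreducible_decomposition \<tau> S" and w: "hwv \<tau> \<alpha> \<beta> w"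
    and f: "f \<in> (\<Pi>\<^sub>E U\<in>S. U)" "w = (\<Sum>U\<in>S. f U)" and U: "U \<in> S"
  shows "hwv \<tau> \<alpha> \<beta> (f U)"
proof -
  have irr: "irreducible_subrep \<tau> U" if "U \<in> S" for U using S that unfolding irreducible_decomposition_def by blast
  \<comment> \<open>Uniqueness applied to the vector 0. The restrictions give the functions the
    default value outside \<open>S\<close> that membership in the extensional product
    requires.\<close>
  have zero: "h U = 0" if "\<And>V. V \<in> S \<Longrightarrow> h V \<in> V" "(\<Sum>V\<in>S. h V) = 0" for h
  proof -
    have "restrict h S \<in> (\<Pi>\<^sub>E U\<in>S. U)" "restrict (\<lambda>_. 0) S \<in> (\<Pi>\<^sub>E U\<in>S. U)"
      using that(1) irreducible_subrepD(1)[OF irr] by (auto simp: vec.subspace_0)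
    moreover have "(0 :: complex^'a) = (\<Sum>U\<in>S. restrict h S U)" "(0 :: complex^'a) = (\<Sum>U\<in>S. restrict (\<lambda>_. 0) S U)"
      using that(2) by simp_all
    ultimately have "restrict h S = restrict (\<lambda>_. 0) S" using S unfolding irreducible_decomposition_def by metis
    then show ?thesis using U by (metis restrict_apply')
  qed
  have mem: "f V \<in> V" if "V \<in> S" for V using f(1) that by blast
  have "\<tau> p p *v f U - hwt \<alpha> \<beta> p *s f U = 0" if p: "p \<in> {1..3}" for p
  proof (rule zero[where h = "\<lambda>V. \<tau> p p *v f V - hwt \<alpha> \<beta> p *s f V"])
    show "\<tau> p p *v f V - hwt \<alpha> \<beta> p *s f V \<in> V" if "V \<in> S" for V
      using irreducible_subrepD(1,2)[OF irr[OF that]] mem[OF that] p by (simp add: vec.subspace_diff vec.subspace_scale)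
    show "(\<Sum>V\<in>S. \<tau> p p *v f V - hwt \<alpha> \<beta> p *s f V) = 0"
      using hwvD(1)[OF w p] unfolding f(2) by (simp add: sum_subtractf matrix_vector_mult_sum vec.scale_sum_right)
  qed
  moreover have "\<tau> p q *v f U = 0" if p: "p \<in> {1..3}" "q \<in> {1..3}" "p < q" for p q
  proof (rule zero[where h = "\<lambda>V. \<tau> p q *v f V"])
    show "\<tau> p q *v f V \<in> V" if "V \<in> S" for V
      using irreducible_subrepD(1,2)[OF irr[OF that]] mem[OF that] p by simp
    show "(\<Sum>V\<in>S. \<tau> p q *v f V) = 0"
      using hwvD(2)[OF w p] unfolding f(2) by (simp add: matrix_vector_mult_sum)
  qed
  ultimately show ?thesis unfolding hwv_def by simp
qed

text \<open>\<open>D\<close> is the set of copies of the irreducible representation.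
  \<open>x U\<close> is a highest-weight vector of the copy \<open>U\<close>, and
  \<open>\<zeta> U\<close> is the projection onto \<open>U\<close> followed by its highest-weight
  functional. A non-zero component of a highest-weight vector makes its summand a copy, in which
  such vectors are unique up to scalars.\<close>

lemma multiplicity_dual_families:
  fixes \<tau> :: "'k::finite rep"
  assumes rep: "sl3_rep \<tau>" and mult: "has_multiplicity \<tau> m\<^sub>1 m\<^sub>2 d"
  defines "\<alpha> \<equiv> of_nat m\<^sub>1 - 1" and "\<beta> \<equiv> of_nat m\<^sub>2 - 1"
  obtains D :: "(complex^'k) set set" and x \<zeta> where "finite D" "card D = d"
    "\<And>U. U \<in> D \<Longrightarrow> hwv \<tau> \<alpha> \<beta> (x U)" "\<And>U. U \<in> D \<Longrightarrow> hwv (transp \<tau>) \<alpha> \<beta> (\<zeta> U)"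
    "\<And>U V. U \<in> D \<Longrightarrow> V \<in> D \<Longrightarrow> scalar_product (\<zeta> U) (x V) = (if U = V then 1 else 0)"
    "{w. hwv \<tau> \<alpha> \<beta> w} \<subseteq> vec.span (x ` D)"
proof -
  obtain S where S: "irreducible_decomposition \<tau> S" and d: "d = card {U\<in>S. irrep_on \<tau> U m\<^sub>1 m\<^sub>2}"
    using mult unfolding has_multiplicity_def by blast
  define D where "D = {U\<in>S. irrep_on \<tau> U m\<^sub>1 m\<^sub>2}"
  have fin: "finite S" and irr: "\<And>U. U \<in> S \<Longrightarrow> irreducible_subrep \<tau> U"
    and ex1: "\<And>w. \<exists>!f. f \<in> (\<Pi>\<^sub>E U\<in>S. U) \<and> w = (\<Sum>U\<in>S. f U)"
    using S unfolding irreducible_decomposition_def by blast+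
  define comp where "comp w = (THE f. f \<in> (\<Pi>\<^sub>E U\<in>S. U) \<and> w = (\<Sum>U\<in>S. f U))" for w
  have comp: "comp w \<in> (\<Pi>\<^sub>E U\<in>S. U)" "w = (\<Sum>U\<in>S. comp w U)" for w
    using theI'[OF ex1[of w]] unfolding comp_def by blast+
  have compU: "comp w U = h U" if "\<And>V. V \<in> S \<Longrightarrow> h V \<in> V" "w = (\<Sum>V\<in>S. h V)" "U \<in> S" for w h U
  proof -
    have "restrict h S \<in> (\<Pi>\<^sub>E U\<in>S. U)" "w = (\<Sum>V\<in>S. restrict h S V)" using that by auto
    then have "comp w = restrict h S" using ex1[of w] comp[of w] by blast
    then show ?thesis using that(3) by simp
  qed
  have mem: "comp w U \<in> U" if "U \<in> S" for w U using comp(1) that by blast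
  note sub = irreducible_subrepD(1)[OF irr] and act = irreducible_subrepD(2)[OF irr]
  have comp_add: "comp (w + w') U = comp w U + comp w' U" if "U \<in> S" for w w' U
    by (rule compU[where h = "\<lambda>U. comp w U + comp w' U"])
       (use that comp(2)[of w] comp(2)[of w'] mem sub in \<open>auto simp: sum.distrib vec.subspace_add\<close>)
  have comp_smult: "comp (c *s w) U = c *s comp w U" if "U \<in> S" for w c U
    by (rule compU[where h = "\<lambda>U. c *s comp w U"])
       (use that comp(2)[of w] mem sub in \<open>auto simp: vec.scale_sum_right[symmetric] vec.subspace_scale\<close>)
  have comp_act: "comp (\<tau> p q *v w) U = \<tau> p q *v comp w U" if "U \<in> S" "p \<in> {1..3}" "q \<in> {1..3}" for p q w U
    by (rule compU[where h = "\<lambda>U. \<tau> p q *v comp w U"])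
       (use that comp(2)[of w] mem act in \<open>auto simp: matrix_vector_mult_sum[symmetric]\<close>)
  have comp_self: "comp w U = (if U = V then w else 0)" if "w \<in> V" "U \<in> S" "V \<in> S" for w U V
    by (rule compU[where h = "\<lambda>U. if U = V then w else 0"])
       (use that fin sub in \<open>auto simp: vec.subspace_0\<close>)
  have "\<exists>x. x \<in> U \<and> x \<noteq> 0 \<and> hwv \<tau> \<alpha> \<beta> x" if "U \<in> D" for U
    using that highest_weight_space_iff[OF rep] unfolding D_def irrep_on_def \<alpha>_def \<beta>_def by blast
  then obtain x where x: "\<And>U. U \<in> D \<Longrightarrow> x U \<in> U \<and> x U \<noteq> 0 \<and> hwv \<tau> \<alpha> \<beta> (x U)" by metis
  have DS: "D \<subseteq> S" unfolding D_def by blast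
  have "\<exists>\<zeta>. hwv (transp \<tau>) \<alpha> \<beta> \<zeta> \<and> (\<forall>V\<in>D. scalar_product \<zeta> (x V) = (if U = V then 1 else 0))" if U: "U \<in> D" for U
  proof -
    have US: "U \<in> S" using U DS by blast
    interpret hw_vector \<tau> \<alpha> \<beta> "x U" by unfold_locales (use rep x[OF U] in auto)
    obtain r where r: "scalar_product r (x U) = 1"
      "\<And>p q u. (p,q) \<in> lows \<Longrightarrow> u \<in> U \<Longrightarrow> scalar_product r (\<tau> p q *v u) = 0"
      "\<And>p u. p \<in> {1..3} \<Longrightarrow> u \<in> U \<Longrightarrow> scalar_product r (\<tau> p p *v u) = hwt \<alpha> \<beta> p * scalar_product r u"
      using highest_weight_functional[OF irr[OF US]] x[OF U] by blast
    \<comment> \<open>The covector whose coordinates are the values of this functional at the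
      standard basis vectors.\<close>
    define \<zeta> where "\<zeta> = (\<chi> i. scalar_product r (comp (axis i 1) U))"
    have comp_zero: "comp 0 U = 0" using comp_smult[OF US, of 0 0] by simp
    have comp_sum: "comp (\<Sum>i\<in>I. h i) U = (\<Sum>i\<in>I. comp (h i) U)" if "finite I" for I and h :: "'k \<Rightarrow> complex^'k"
      using that by (induction I) (simp_all add: comp_zero comp_add[OF US])
    have \<zeta>: "scalar_product \<zeta> w = scalar_product r (comp w U)" for w
    proof -
      have "w = (\<Sum>i\<in>UNIV. w $ i *s axis i 1)" by (simp add: basis_expansion)
      then have "comp w U = (\<Sum>i\<in>UNIV. w $ i *s comp (axis i 1) U)"
        using comp_sum[of UNIV "\<lambda>i. w $ i *s axis i 1"] by (simp add: comp_smult[OF US])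
      then show ?thesis
        by (simp add: scalar_product_sum_right scalar_product_smult_right) (simp add: scalar_product_def \<zeta>_def mult.commute)
    qed
    have "transp \<tau> p p *v \<zeta> = hwt \<alpha> \<beta> p *s \<zeta>" if p: "p \<in> {1..3}" for p
    proof (rule scalar_product_eqI)
      fix w
      have "scalar_product (transp \<tau> p p *v \<zeta>) w = scalar_product \<zeta> (\<tau> p p *v w)"
        by (metis scalar_product_commute scalar_product_transp)
      then show "scalar_product (transp \<tau> p p *v \<zeta>) w = scalar_product (hwt \<alpha> \<beta> p *s \<zeta>) w"
        unfolding \<zeta> comp_act[OF US p p] scalar_product_smult_left using r(3)[OF p mem[OF US]] by simp
    qed
    moreover have "transp \<tau> p q *v \<zeta> = 0" if p: "p \<in> {1..3}" "q \<in> {1..3}" "p < q" for p q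
    proof (rule scalar_product_eqI)
      fix w
      have low: "(q, p) \<in> lows" using p by (auto simp: lows_def gens_def)
      have "scalar_product (transp \<tau> p q *v \<zeta>) w = scalar_product \<zeta> (\<tau> q p *v w)"
        by (metis scalar_product_commute scalar_product_transp)
      then show "scalar_product (transp \<tau> p q *v \<zeta>) w = scalar_product 0 w"
        unfolding \<zeta> comp_act[OF US p(2,1)] using r(2)[OF low mem[OF US]] by simp
    qed
    ultimately have "hwv (transp \<tau>) \<alpha> \<beta> \<zeta>" unfolding hwv_def by simp
    moreover have "scalar_product \<zeta> (x V) = (if U = V then 1 else 0)" if "V \<in> D" for V
    proof -
      have "comp (x V) U = (if U = V then x V else 0)" using comp_self[of "x V" V U] x[OF that] that DS US by blast
      then show ?thesis unfolding \<zeta> using r(1) by (cases "U = V") (simp_all only: if_True if_False refl scalar_product_zero_right)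
    qed
    ultimately show ?thesis by blast
  qed
  then obtain \<zeta> where \<zeta>: "\<And>U. U \<in> D \<Longrightarrow> hwv (transp \<tau>) \<alpha> \<beta> (\<zeta> U) \<and> (\<forall>V\<in>D. scalar_product (\<zeta> U) (x V) = (if U = V then 1 else 0))"
    by metis
  have "w \<in> vec.span (x ` D)" if w: "hwv \<tau> \<alpha> \<beta> w" for w
  proof -
    have "comp w U \<in> vec.span (x ` D)" if U: "U \<in> S" for U
    proof (cases "comp w U = 0")
      case False
      have comp_hwv: "hwv \<tau> \<alpha> \<beta> (comp w U)" by (rule irreducible_decomposition_hwv[OF S w comp U])
      then have "U \<in> D"
        using U mem[OF U] False irr[OF U] highest_weight_space_iff[OF rep] unfolding D_def irrep_on_def \<alpha>_def \<beta>_def by blast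
      interpret hw_vector \<tau> \<alpha> \<beta> "x U" by unfold_locales (use rep x[OF \<open>U \<in> D\<close>] in auto)
      obtain c where "comp w U = c *s x U"
        using highest_weight_unique[OF irr[OF U] _ _ mem[OF U] comp_hwv] x[OF \<open>U \<in> D\<close>] by blast
      then show ?thesis using \<open>U \<in> D\<close> by (simp add: vec.span_scale vec.span_base)
    qed (simp add: vec.span_zero)
    then have "(\<Sum>U\<in>S. comp w U) \<in> vec.span (x ` D)" by (rule vec.span_sum)
    then show ?thesis using comp(2)[of w] by simp
  qed
  then have span: "{w. hwv \<tau> \<alpha> \<beta> w} \<subseteq> vec.span (x ` D)" by blast
  show ?thesis
    by (rule that[of D x \<zeta>]) (use finite_subset[OF DS fin] d x \<zeta> span in \<open>auto simp: D_def\<close>)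
qed

section \<open>Dual bases\<close>

lemma biorthogonal_independent:
  fixes f x :: "'i \<Rightarrow> complex^'k"
  assumes I: "finite I" and dual: "\<And>i j. i \<in> I \<Longrightarrow> j \<in> I \<Longrightarrow> scalar_product (f i) (x j) = (if i = j then 1 else 0)"
  shows "inj_on x I" "vec.independent (x ` I)"
proof -
  show inj: "inj_on x I"
  proof (rule inj_onI, rule ccontr)
    fix i j assume "i \<in> I" "j \<in> I" "x i = x j" "i \<noteq> j"
    then show False using dual[of i i] dual[of i j] by simp
  qed
  show "vec.independent (x ` I)"
  proof (rule vec.independent_if_scalars_zero)
    fix c v assume 0: "(\<Sum>v\<in>x ` I. c v *s v) = 0" and "v \<in> x ` I"
    then obtain i where i: "i \<in> I" "v = x i" by blast
    have "0 = scalar_product (f i) (\<Sum>j\<in>I. c (x j) *s x j)"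
      using 0 unfolding sum.reindex[OF inj] o_def by simp
    also have "\<dots> = (\<Sum>j\<in>I. if i = j then c (x j) else 0)"
      unfolding scalar_product_sum_right scalar_product_smult_right using i(1) dual by (intro sum.cong) auto
    also have "\<dots> = c v" using i I by simp
    finally show "c v = 0" ..
  qed (use I in simp)
qed

lemma basis_of_coefficients:
  assumes "basis_of M d e" "(\<Sum>k\<in>{1..d}. b k *s e k) = 0" "k \<in> {1..d}"
  shows "b k = 0"
proof -
  have inj: "inj_on e {1..d}" and ind: "vec.independent (e ` {1..d})" using assms(1) unfolding basis_of_def by blast+
  have "(\<Sum>v\<in>e ` {1..d}. b (inv_into {1..d} e v) *s v) = 0"
    unfolding sum.reindex[OF inj] o_def assms(2)[symmetric] by (intro sum.cong) (simp_all only: inv_into_f_f[OF inj])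
  then have "b (inv_into {1..d} e (e k)) = 0"
    using vec.independentD[OF ind, of "e ` {1..d}" "\<lambda>v. b (inv_into {1..d} e v)" "e k"] assms(3) by auto
  then show ?thesis using inj assms(3) by simp
qed

text \<open>The biorthogonal families make the pairing of \<open>M'\<close> and \<open>M\<close>
  perfect once the dimensions agree, so every basis of \<open>M'\<close> has a dual basis in
  \<open>M\<close>.\<close>

lemma dual_basis:
  fixes M M' :: "(complex^'k::finite) set"
  assumes e: "basis_of M' d' e" and M: "vec.subspace M" "M \<subseteq> vec.span (x ` D)" "vec.dim M' = vec.dim M"
    and D: "finite D" "card D = d" and x: "\<And>U. U \<in> D \<Longrightarrow> x U \<in> M" and \<zeta>: "\<And>U. U \<in> D \<Longrightarrow> \<zeta> U \<in> M'"
    and dual: "\<And>U V. U \<in> D \<Longrightarrow> V \<in> D \<Longrightarrow> scalar_product (\<zeta> U) (x V) = (if U = V then 1 else 0)"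
  obtains u where "d' = d" "basis_of M d u"
    "\<And>i j. i \<in> {1..d} \<Longrightarrow> j \<in> {1..d} \<Longrightarrow> scalar_product (e i) (u j) = (if i = j then 1 else 0)"
proof -
  have x_ind: "inj_on x D" "vec.independent (x ` D)" using biorthogonal_independent[OF D(1) dual] by blast+
  have "scalar_product (x U) (\<zeta> V) = (if U = V then 1 else 0)" if "U \<in> D" "V \<in> D" for U V
    using dual[OF that(2,1)] by (simp add: scalar_product_commute eq_commute)
  then have \<zeta>_ind: "inj_on \<zeta> D" "vec.independent (\<zeta> ` D)" using biorthogonal_independent[OF D(1)] by blast+
  have inj: "inj_on e {1..d'}" and ind: "vec.independent (e ` {1..d'})" and span: "vec.span (e ` {1..d'}) = M'"
    using e unfolding basis_of_def by blast+
  have dimM: "vec.dim M = d"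
  proof -
    have "x ` D \<subseteq> M" using x by blast
    then show ?thesis using vec.basis_card_eq_dim[OF _ M(2) x_ind(2)] card_image[OF x_ind(1)] D(2) by simp
  qed
  have dimM': "vec.dim M' = d'"
    using vec.dim_span_eq_card_independent[OF ind] card_image[OF inj] unfolding span by simp
  then have d': "d' = d" using dimM M(3) by simp
  \<comment> \<open>\<open>M'\<close> has dimension \<open>d\<close>, and the
    \<open>\<zeta> U\<close> are \<open>d\<close> independent vectors in it.\<close>
  have \<zeta>_span: "M' \<subseteq> vec.span (\<zeta> ` D)"
    by (rule vec.card_ge_dim_independent) (use \<zeta> \<zeta>_ind D dimM M(3) in \<open>auto simp: card_image\<close>)
  define c where "c i U = scalar_product (e i) (x U)" for i U
  have ec: "e i = (\<Sum>U\<in>D. c i U *s \<zeta> U)" if i: "i \<in> {1..d}" for i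
  proof -
    have "e i \<in> M'" using span vec.span_base i d' by blast
    then have "e i \<in> vec.span (\<zeta> ` D)" using \<zeta>_span by blast
    from span_image_combination[OF D(1) this] obtain b where b: "e i = (\<Sum>U\<in>D. b U *s \<zeta> U)" by blast
    have "c i V = b V" if "V \<in> D" for V
    proof -
      have "c i V = scalar_product (x V) (\<Sum>U\<in>D. b U *s \<zeta> U)" unfolding c_def b by (rule scalar_product_commute)
      also have "\<dots> = (\<Sum>U\<in>D. if U = V then b U else 0)"
        unfolding scalar_product_sum_right scalar_product_smult_right scalar_product_commute[of "x V"]
        using that dual by (intro sum.cong) auto
      finally show ?thesis using that D(1) by simp
    qed
    then show ?thesis unfolding b by (intro sum.cong) auto
  qed
  have "\<exists>b. \<zeta> U = (\<Sum>i\<in>{1..d}. b i *s e i)" if "U \<in> D" for U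
    using \<zeta>[OF that] span d' span_image_combination[of "{1..d}"] by blast
  then obtain z where z: "\<And>U. U \<in> D \<Longrightarrow> \<zeta> U = (\<Sum>i\<in>{1..d}. z U i *s e i)" by metis
  \<comment> \<open>The pairing matrix of \<open>e\<close> with \<open>x\<close> is
    \<open>c\<close>, and \<open>z\<close> is its inverse, being the coordinates of the
    \<open>\<zeta> U\<close> in the basis \<open>e\<close>.\<close>
  define u where "u j = (\<Sum>U\<in>D. z U j *s x U)" for j
  have eu: "scalar_product (e i) (u j) = (if i = j then 1 else 0)" if i: "i \<in> {1..d}" and j: "j \<in> {1..d}" for i j
  proof -
    have "e i = (\<Sum>U\<in>D. \<Sum>k\<in>{1..d}. (c i U * z U k) *s e k)"
      by (subst ec[OF i]) (intro sum.cong refl, simp add: z vec.scale_sum_right vector_smult_assoc)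
    also have "\<dots> = (\<Sum>k\<in>{1..d}. (\<Sum>U\<in>D. c i U * z U k) *s e k)"
      unfolding vec.scale_sum_left by (rule sum.swap)
    finally have 1: "e i = (\<Sum>k\<in>{1..d}. (\<Sum>U\<in>D. c i U * z U k) *s e k)" .
    have 2: "e i = (\<Sum>k\<in>{1..d}. (if i = k then 1 else 0) *s e k)"
      using i by (simp add: if_distrib[of "\<lambda>r. r *s _"] cong: if_cong del: atLeastAtMost_iff)
    have "(\<Sum>k\<in>{1..d}. ((\<Sum>U\<in>D. c i U * z U k) - (if i = k then 1 else 0)) *s e k) = 0"
      unfolding vec.scale_left_diff_distrib sum_subtractf 1[symmetric] 2[symmetric] by simp
    then have "(\<Sum>U\<in>D. c i U * z U j) - (if i = j then 1 else 0) = 0"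
      by (rule basis_of_coefficients[OF e[unfolded d']]) (rule j)
    then show ?thesis
      unfolding u_def scalar_product_sum_right scalar_product_smult_right c_def[symmetric] by (simp add: mult.commute)
  qed
  have "\<And>i j. i \<in> {1..d} \<Longrightarrow> j \<in> {1..d} \<Longrightarrow> scalar_product (e i) (u j) = (if i = j then 1 else 0)" by (rule eu)
  note u_ind = biorthogonal_independent[OF finite_atLeastAtMost this]
  have uM: "u ` {1..d} \<subseteq> M" unfolding u_def using x M(1) by (auto intro!: vec.subspace_sum vec.subspace_scale)
  have "M \<subseteq> vec.span (u ` {1..d})"
    by (rule vec.card_ge_dim_independent) (use uM u_ind dimM in \<open>auto simp: card_image\<close>)
  moreover have "vec.span (u ` {1..d}) \<subseteq> M" by (rule vec.span_minimal[OF uM M(1)])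
  ultimately have "basis_of M d u" unfolding basis_of_def using u_ind by blast
  then show ?thesis using that d' eu by blast
qed

text \<open>The coefficient of \<open>Op *v u j\<close> at \<open>u i\<close> is its pairing with
  \<open>e i\<close>, and there \<open>Op\<close> can be moved to its transpose.\<close>

lemma dual_acts_by:
  assumes u: "basis_of M d u" and op: "\<And>w. w \<in> M \<Longrightarrow> Op *v w \<in> M"
    and dual: "\<And>i j. i \<in> {1..d} \<Longrightarrow> j \<in> {1..d} \<Longrightarrow> scalar_product (e i) (u j) = (if i = j then 1 else 0)"
    and acts: "acts_by (transpose Op) d e (\<lambda>i j. c j i)"
  shows "acts_by Op d u c"
  unfolding acts_by_def
proof
  fix j assume j: "j \<in> {1..d}"
  have inj: "inj_on u {1..d}" and span: "vec.span (u ` {1..d}) = M" using u unfolding basis_of_def by auto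
  have "Op *v u j \<in> M" using op span vec.span_base j by blast
  then have "Op *v u j \<in> vec.span (u ` {1..d})" using span by simp
  then obtain b where b: "Op *v u j = (\<Sum>i\<in>{1..d}. b i *s u i)" using span_image_combination[of "{1..d}"] by blast
  have "b i = of_real (c i j)" if i: "i \<in> {1..d}" for i
  proof -
    have "b i = scalar_product (e i) (Op *v u j)"
      unfolding b scalar_product_sum_right scalar_product_smult_right using i by (simp add: dual sum.delta if_distrib[of "\<lambda>r. _ * r"] cong: if_cong del: atLeastAtMost_iff)
    also have "\<dots> = scalar_product (u j) (transpose Op *v e i)"
      by (metis scalar_product_matrix scalar_product_commute)
    also have "transpose Op *v e i = (\<Sum>k\<in>{1..d}. complex_of_real (c i k) *s e k)" using acts i unfolding acts_by_def by blast
    also have "scalar_product (u j) \<dots> = of_real (c i j)"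
      unfolding scalar_product_sum_right scalar_product_smult_right using j
      by (simp add: dual scalar_product_commute[of "u j"] if_distrib[of "\<lambda>r. _ * r"] cong: if_cong del: atLeastAtMost_iff)
    finally show ?thesis .
  qed
  then show "Op *v u j = (\<Sum>i\<in>{1..d}. complex_of_real (c i j) *s u i)" unfolding b by (intro sum.cong) auto
qed

lemma basis_of_dim:
  assumes "basis_of M d e" shows "vec.dim M = d"
  using assms vec.dim_span_eq_card_independent[of "e ` {1..d}"] card_image[of e "{1..d}"] unfolding basis_of_def by simp

text \<open>The weight of the non-zero vector \<open>top u\<close> is that of some monomial, and
  weights of monomials are integers up to the shift. This is where the integrality of \<ell> and n
  comes from.\<close>

lemma (in hw_pair) integral_weights:
  assumes "hwv \<tau> \<alpha> \<beta> u" "u \<noteq> 0"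
  obtains ln nn :: int where
    "3 * of_int ln = of_nat a + 2 * of_nat b + of_nat a' + 2 * of_nat b' - \<alpha> - 2 * \<beta> + 3"
    "3 * of_int nn = 2 * of_nat a + of_nat b + 2 * of_nat a' + of_nat b' - 2 * \<alpha> - \<beta> + 3"
proof -
  let ?\<kappa> = "\<lambda>p. hwt \<alpha> \<beta> p - hwt (of_nat a) (of_nat b) p"
  define S where "S = {W.B k1 k2 k3 l1 l2 l3 | k1 k2 k3 l1 l2 l3. of_int (k1 - l1) - W.shift = ?\<kappa> 1 \<and> of_int (k2 - l2) - W.shift = ?\<kappa> 2
     \<and> of_int (k3 - l3) - W.shift = ?\<kappa> 3 \<and> (k2 = 0 \<or> l2 = 0)}"
  have "top u \<in> vec.span S" unfolding S_def by (rule W.weight_space_span[OF top_weight[OF assms(1)]])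
  moreover have "top u \<noteq> 0" using top_injective assms by blast
  ultimately have "S \<noteq> {}" by (metis vec.span_empty singletonD)
  then obtain s where "s \<in> S" by auto
  then have "\<exists>k l :: int. of_int k - W.shift = ?\<kappa> 1 \<and> of_int l - W.shift = ?\<kappa> 3"
    unfolding S_def mem_Collect_eq by (elim exE conjE) (intro exI conjI, assumption+)
  then obtain k l :: int where kl: "of_int k - W.shift = ?\<kappa> 1" "of_int l - W.shift = ?\<kappa> 3" by (elim exE conjE)
  show ?thesis
  \<comment> \<open>Obtained by solving k = a' + 1 - n and l = \<ell> - 1 - b', the first and third
    weights of the chain.\<close>
  proof (rule that[of "l + int b' + 1" "int a' + 1 - k"])
    show "3 * of_int (l + int b' + 1) = of_nat a + 2 * of_nat b + of_nat a' + 2 * of_nat b' - \<alpha> - 2 * \<beta> + 3"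
      using kl(2) unfolding hwt_def W.shift_def by (simp add: field_simps, algebra)
    show "3 * of_int (int a' + 1 - k) = 2 * of_nat a + of_nat b + 2 * of_nat a' + of_nat b' - 2 * \<alpha> - \<beta> + 3"
      using kl(1) unfolding hwt_def W.shift_def by (simp add: field_simps, algebra)
  qed
qed

theorem mainTheorem1:
  fixes m\<^sub>1 m\<^sub>2 m\<^sub>1' m\<^sub>2' m\<^sub>1'' m\<^sub>2'' d :: nat
    and \<rho> :: "'n::finite rep" and \<rho>' :: "'m::finite rep"
    and l n \<Lambda> lp lm \<xi>\<^sub>a \<xi>\<^sub>b :: real and \<xi> :: "nat \<Rightarrow> real"
  assumes pos: "m\<^sub>1 > 0" "m\<^sub>2 > 0" "m\<^sub>1' > 0" "m\<^sub>2' > 0" "m\<^sub>1'' > 0" "m\<^sub>2'' > 0"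
    and rep: "irrep \<rho> m\<^sub>1 m\<^sub>2" "irrep \<rho>' m\<^sub>1' m\<^sub>2'"
    and mult: "has_multiplicity (tensor_rep \<rho> \<rho>') m\<^sub>1'' m\<^sub>2'' d" "d \<noteq> 0"
    and l: "l = 1/3 * (real m\<^sub>1 + 2 * real m\<^sub>2 + real m\<^sub>1' + 2 * real m\<^sub>2' - real m\<^sub>1'' - 2 * real m\<^sub>2'')"
    and n: "n = 1/3 * (2 * real m\<^sub>1 + real m\<^sub>2 + 2 * real m\<^sub>1' + real m\<^sub>2' - 2 * real m\<^sub>1'' - real m\<^sub>2'')"
    and \<xi>123: "(l \<le> n \<and> (\<xi> 1, \<xi> 2, \<xi> 3) = (l, real m\<^sub>2, real m\<^sub>1' + l - n)) \<or>
               (n \<le> l \<and> (\<xi> 1, \<xi> 2, \<xi> 3) = (n, real m\<^sub>1', real m\<^sub>2 + n - l))"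
    and \<xi>456: "(\<xi> 4, \<xi> 5, \<xi> 6) = (l - real m\<^sub>2', n - real m\<^sub>1, 0)"
    and \<Lambda>: "\<Lambda> = (\<Sum>i\<in>{1..3}. \<xi> i) - (\<Sum>i\<in>{4..6}. \<xi> i) + 2 * \<bar>l - n\<bar>"
    and lp: "lp = 1/2 * \<Lambda> + 1/6 * (\<Sum>i\<in>{1..6}. \<xi> i)"
    and lm: "lm = - (1/2) * \<Lambda> + 1/6 * (\<Sum>i\<in>{1..6}. \<xi> i)"
    and \<xi>ab: "\<xi>\<^sub>a = Min {\<xi> 1, \<xi> 2, \<xi> 3}" "\<xi>\<^sub>b = Max {\<xi> 4, \<xi> 5, \<xi> 6}"
  shows "real d = \<xi>\<^sub>a - \<xi>\<^sub>b \<and>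
    (\<exists>v. basis_of (highest_weight_space (tensor_rep \<rho> \<rho>') m\<^sub>1'' m\<^sub>2'') d v \<and>
         acts_by (op_X \<rho> \<rho>') d v (mat_a \<xi> \<xi>\<^sub>b \<Lambda>) \<and>
         acts_by (op_Y \<rho> \<rho>') d v (mat_b \<xi> \<xi>\<^sub>b \<Lambda> lm lp))"
proof -
  define a b a' b' where "a = m\<^sub>1 - 1" and "b = m\<^sub>2 - 1" and "a' = m\<^sub>1' - 1" and "b' = m\<^sub>2' - 1"
  have m: "m\<^sub>1 = a + 1" "m\<^sub>2 = b + 1" "m\<^sub>1' = a' + 1" "m\<^sub>2' = b' + 1"
    using pos unfolding a_def b_def a'_def b'_def by simp_all
  define \<alpha> \<beta> :: complex where "\<alpha> = of_nat m\<^sub>1'' - 1" and "\<beta> = of_nat m\<^sub>2'' - 1"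
  obtain v \<zeta> where V: "hw_triple \<rho> a b v \<zeta>" using irrep_hw_triple[OF rep(1) pos(1,2)] unfolding a_def b_def by blast
  obtain v' \<zeta>' where W: "hw_triple \<rho>' a' b' v' \<zeta>'" using irrep_hw_triple[OF rep(2) pos(3,4)] unfolding a'_def b'_def by blast
  have P: "hw_pair \<rho> a b v \<zeta> \<rho>' a' b' v' \<zeta>'" using V W by (simp add: hw_pair_def)
  have Pt: "hw_pair (transp \<rho>) a b \<zeta> v (transp \<rho>') a' b' \<zeta>' v'"
    using hw_triple_transp[OF V] hw_triple_transp[OF W] by (simp add: hw_pair_def)
  interpret P: hw_pair \<rho> a b v \<zeta> \<rho>' a' b' v' \<zeta>' by (rule P)
  let ?\<tau> = "tensor_rep \<rho> \<rho>'"
  have \<tau>: "sl3_rep ?\<tau>" using sl3_rep_tensor[OF P.V.rep P.W.rep] .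
  let ?M = "{w. hwv ?\<tau> \<alpha> \<beta> w}" and ?M' = "{w. hwv (transp ?\<tau>) \<alpha> \<beta> w}"
  have M: "highest_weight_space ?\<tau> m\<^sub>1'' m\<^sub>2'' = ?M"
    using highest_weight_space_iff[OF \<tau>] unfolding \<alpha>_def \<beta>_def by blast
  obtain D :: "(complex^('n \<times> 'm)) set set" and x \<eta> where D: "finite D" "card D = d" and x: "\<And>U. U \<in> D \<Longrightarrow> hwv ?\<tau> \<alpha> \<beta> (x U)"
    and \<eta>: "\<And>U. U \<in> D \<Longrightarrow> hwv (transp ?\<tau>) \<alpha> \<beta> (\<eta> U)"
    and dual: "\<And>U V. U \<in> D \<Longrightarrow> V \<in> D \<Longrightarrow> scalar_product (\<eta> U) (x V) = (if U = V then 1 else 0)"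
    and span: "?M \<subseteq> vec.span (x ` D)"
    proof (rule multiplicity_dual_families[OF \<tau> mult(1), folded \<alpha>_def \<beta>_def], goal_cases)
    case (1 D x \<eta>)
    show ?case by (rule 1(1)[OF 1(2-7)])
  qed
  \<comment> \<open>Since \<open>d\<close> is non-zero there is a highest-weight vector, whose
    weight makes \<ell> and n integers.\<close>
  obtain U where U: "U \<in> D" using mult(2) D by fastforce
  then have "x U \<noteq> 0" using dual[OF U U] by auto
  then obtain ln nn :: int where lncn:
    "3 * of_int ln = of_nat a + 2 * of_nat b + of_nat a' + 2 * of_nat b' - \<alpha> - 2 * \<beta> + 3"
    "3 * of_int nn = 2 * of_nat a + of_nat b + 2 * of_nat a' + of_nat b' - 2 * \<alpha> - \<beta> + 3"
    using P.integral_weights[OF x[OF U]] by blast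
  have "of_int (3 * ln) = (of_int (int m\<^sub>1 + 2 * int m\<^sub>2 + int m\<^sub>1' + 2 * int m\<^sub>2' - int m\<^sub>1'' - 2 * int m\<^sub>2'') :: complex)"
    "of_int (3 * nn) = (of_int (2 * int m\<^sub>1 + int m\<^sub>2 + 2 * int m\<^sub>1' + int m\<^sub>2' - 2 * int m\<^sub>1'' - int m\<^sub>2'') :: complex)"
    using lncn unfolding m \<alpha>_def \<beta>_def by simp_all
  then have ints: "3 * ln = int m\<^sub>1 + 2 * int m\<^sub>2 + int m\<^sub>1' + 2 * int m\<^sub>2' - int m\<^sub>1'' - 2 * int m\<^sub>2''"
    "3 * nn = 2 * int m\<^sub>1 + int m\<^sub>2 + 2 * int m\<^sub>1' + int m\<^sub>2' - 2 * int m\<^sub>1'' - int m\<^sub>2''"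
    unfolding of_int_eq_iff by blast+
  have "real_of_int (3 * ln) = 3 * l" "real_of_int (3 * nn) = 3 * n"
    unfolding ints l n by simp_all
  then have ln: "l = of_int ln" "n = of_int nn" by simp_all
  define y z where "y = max 0 (nn - ln)" and "z = max 0 (ln - nn)"
  have yz: "y \<ge> 0" "z \<ge> 0" "y = 0 \<or> z = 0" "nn - ln = y - z" unfolding y_def z_def by auto
  have abs: "\<bar>l - n\<bar> = of_int (y + z)" unfolding ln y_def z_def by auto
  have \<xi>1: "\<xi> 1 = of_int (nn - y)"
    and \<xi>23: "\<xi> 2 = of_int (int b + 1 - z) \<and> \<xi> 3 = of_int (int a' + 1 - y) \<or> \<xi> 2 = of_int (int a' + 1 - y) \<and> \<xi> 3 = of_int (int b + 1 - z)"
    using \<xi>123 unfolding ln y_def z_def m by auto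
  have \<xi>4: "\<xi> 4 = of_int (ln - 1 - int b')" "\<xi> 5 = of_int (nn - 1 - int a)" "\<xi> 6 = 0"
    using \<xi>456 unfolding ln m by auto
  interpret C: hw_chain \<rho> a b v \<zeta> \<rho>' a' b' v' \<zeta>' \<alpha> \<beta> y z ln nn
    by unfold_locales (use yz lncn in auto)
  \<comment> \<open>The transposed pair has the same highest weights, hence the same parameters and
    the same range.\<close>
  interpret Ct: hw_chain "transp \<rho>" a b \<zeta> v "transp \<rho>'" a' b' \<zeta>' v' \<alpha> \<beta> y z ln nn
    using Pt yz lncn by (simp add: hw_chain_def hw_chain_axioms_def)
  have \<xi>b: "\<xi>\<^sub>b = of_int C.lo"
    unfolding \<xi>ab \<xi>4 C.lo_def by (simp add: max_def)
  have \<xi>a: "\<xi>\<^sub>a = of_int C.hi"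
    using \<xi>23 unfolding \<xi>ab \<xi>1 C.hi_def by (auto simp: min_def)
  note facts = \<xi>1 \<xi>23 \<xi>4 \<Lambda>[unfolded abs] lp lm
  \<comment> \<open>Only the dimension is taken from the chain of the original pair; the matrices
    come from the transposed one.\<close>
  obtain e where "basis_of ?M (nat (C.hi - C.lo)) e"
    by (rule C.chain_operators[OF facts \<xi>b])
  then have dim: "vec.dim ?M = nat (C.hi - C.lo)" by (rule basis_of_dim)
  obtain e' where e': "basis_of ?M' (nat (C.hi - C.lo)) e'"
    and X': "C.lo < C.hi \<Longrightarrow> acts_by (transpose (op_X \<rho> \<rho>')) (nat (C.hi - C.lo)) e' (\<lambda>i j. mat_a \<xi> \<xi>\<^sub>b \<Lambda> j i)"
    and Y': "C.lo < C.hi \<Longrightarrow> acts_by (transpose (op_Y \<rho> \<rho>')) (nat (C.hi - C.lo)) e' (\<lambda>i j. mat_b \<xi> \<xi>\<^sub>b \<Lambda> lm lp j i)"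
  proof (rule Ct.chain_operators[OF facts \<xi>b, unfolded op_transp tensor_rep_transp], goal_cases)
    case (1 e)
    show ?case by (rule 1(1)[OF 1(2-4)])
  qed
  have sub: "vec.subspace ?M" unfolding vec.subspace_def using hwv_add hwv_smult hwv_zero by blast
  \<comment> \<open>The chain count and the multiplicity meet here: the dual basis has
    \<open>d\<close> elements, so \<open>d\<close> is the length of the chain.\<close>
  obtain u where d: "nat (C.hi - C.lo) = d" and u: "basis_of ?M d u"
    and eu: "\<And>i j. i \<in> {1..d} \<Longrightarrow> j \<in> {1..d} \<Longrightarrow> scalar_product (e' i) (u j) = (if i = j then 1 else 0)"
    by (rule dual_basis[OF e' sub span _ D _ _ dual]) (use x \<eta> dim basis_of_dim[OF e'] in auto)
  have lohi: "C.lo < C.hi" using d mult(2) by simp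
  have op: "op_X \<rho> \<rho>' *v w \<in> ?M" "op_Y \<rho> \<rho>' *v w \<in> ?M" if "w \<in> ?M" for w
    using that hwv_commutes_with[OF P.op_commutes(1)] hwv_commutes_with[OF P.op_commutes(2)] by blast+
  have "acts_by (op_X \<rho> \<rho>') d u (mat_a \<xi> \<xi>\<^sub>b \<Lambda>)"
    by (rule dual_acts_by[OF u op(1) eu]) (use X'[OF lohi] d in auto)
  moreover have "acts_by (op_Y \<rho> \<rho>') d u (mat_b \<xi> \<xi>\<^sub>b \<Lambda> lm lp)"
    by (rule dual_acts_by[OF u op(2) eu]) (use Y'[OF lohi] d in auto)
  moreover have "real d = \<xi>\<^sub>a - \<xi>\<^sub>b" unfolding \<xi>a \<xi>b d[symmetric] using lohi by simp
  ultimately show ?thesis unfolding M using u by blast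
qed

end
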